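(* Fix $u\in(0,1)$. Suppose that the moment and dependence assumption (A) (with parameters $\alpha\ge0$, $D>0$, $\rho\in(0,1)$) and the assumption (V) on $\hat\Sigma_n$, both given in the context, are fulfilled, and let $K\in\mathcal{K}$. Suppose further that $g:\mathbb{R}^{\mathbb{N}}\to\mathbb{R}^d$ belongs to $\mathcal{H}(M,\chi,C)$ such that $|\chi_j|\le C\rho^j$ for all $j\ge0$, and that $G(u)=\mathbb{E}g(\tilde Y_0(u))$ is twice continuously differentiable around $u$ with $|\partial_u^2G(u)|_2\neq0$. Then there exist a universal constant $c=c(a)>0$ and a constant $c_H>0$ depending only on $M,\chi,C,D,\rho,|K|_\infty,\alpha$ such that for $\underline h=c_H\log(n)^{5+2\alpha M}/n$, $C^{\#}\ge64$ and $n$ large enough, $$\mathbb{E}|\hat G^{\circ}_{\hat h(u)}(u)-G(u)|_2^2\le c\cdot\Big(\sigma_K^2\,\mathrm{tr}(\Sigma(u))\Big)^{4/5}\Big(\mu_K^2|\partial_u^2G(u)|_2^2\Big)^{1/5}\Big(\frac{\log(n)}{n}\Big)^{4/5}.$$ Here $\sigma_K^2=\int K(x)^2dx$, $\mu_K=\int K(x)x^2dx$, $\Sigma(u)=\sum_{k\in\mathbb{Z}}\mathrm{Cov}(g(\tilde Y_0(u)),g(\tilde Y_k(u)))$, and $\hat G_h^\circ$, $\hat h(u)$ are the estimator and local bandwidth selector defined in the context.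
   Context: Notation: $\|Z\|_q:=\mathbb{E}[|Z|^q]^{1/q}$; $|\cdot|_2$ Euclidean norm; $|\cdot|_\infty$ maximum norm of the entries; $\mathbb{N}_0=\{0,1,2,\dots\}$. Local stationarity with exponent $q$: there exist a constant $D_q$ and, for each $u\in[0,1]$, a strictly stationary process $(\tilde X_t(u))_{t\in\mathbb{Z}}$ such that for all $n$, $t=1,\dots,n$, $u,u'\in[0,1]$: $\sup_u\|\tilde X_0(u)\|_q\le D_q$, $\sup_{t,n}\|X_{t,n}\|_q\le D_q$, $\|X_{t,n}-\tilde X_t(t/n)\|_q\le D_qn^{-1}$, $\|\tilde X_0(u)-\tilde X_0(u')\|_q\le D_q|u-u'|$. Dependence measure: $\zeta_t$, $t\in\mathbb{Z}$, are i.i.d., $\mathcal{F}_t=(\zeta_t,\zeta_{t-1},\dots)$, $(\zeta_t^* )$ is an independent copy of $(\zeta_t)$, $\mathcal{F}_t^*=(\zeta_t,\dots,\zeta_1,\zeta_0^*,\zeta_{-1},\dots)$ for $t\ge0$; $\tilde X_t(u)=H(\mathcal{F}_t,u)$ with $H$ measurable, $\tilde X_t^*(u)=H(\mathcal{F}_t^*,u)$, $\delta_q^{\tilde X(u)}(k):=\|\tilde X_k(u)-\tilde X_k^*(u)\|_q$. Assumption (A): $(X_{t,n})$ is locally stationary with exponent $q$ for every $q\ge1$ (same $\tilde X_t(u)$), and with $N_\alpha(q):=\Gamma(\alpha q+2)^{1/q}$, for all $q\ge1$, $k\ge0$: (i) $\sup_{u\in[0,1]}\|\tilde X_0(u)\|_q\le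 D\,N_\alpha(q)$; (ii) $\sup_{u\in[0,1]}\delta_q^{\tilde X(u)}(k)\le D\,N_\alpha(q)\,\rho^k$. Dependence of constants "on $D$" refers to $D$ and the constants $D_q$. Assumption (V): $\hat\Sigma_n(u)$ is an estimator of the matrix $\Sigma(u)$ and there is $c_\Sigma>0$ such that for each $u\in[0,1]$: for every $\varepsilon>0$, $\mathbb{P}(|\hat\Sigma_n(u)-\Sigma(u)|_\infty>\varepsilon)=O(n^{-2})$; and $\|\,|\hat\Sigma_n(u)|_\infty\|_2\le c_\Sigma$. $\mathcal{K}$: nonnegative, symmetric, Lipschitz continuous functions $K$ with support $[-\frac12,\frac12]$ and $\int K=1$; $|K|_\infty=\sup_x|K(x)|$; $K_h(x)=h^{-1}K(x/h)$. $\mathcal{H}(M,\chi,C)$: with $|x|_\chi:=\sum_i\chi_i|x_i|$, where $\chi_i\ge0$, $\chi_i=O(i^{-2-\varepsilon})$ for some $\varepsilon>0$, $M\in\mathbb{N}$, $C>0$, a function $g:\mathbb{R}^{\mathbb{N}}\to\mathbb{R}$ is in $\mathcal{H}(M,\chi,C)$ if $|g(x)-g(y)|\le C|x-y|_\chi(1+|x|_\chi^{M-1}+|y|_\chi^{M-1})$ for all $x\neq y$; a vector-valued function is in the class if each component is. $Y_{t,n}:=(X_{t,n},X_{t-1,n},\dots,X_{1,n},0,0,\dots)$, $\tilde Y_t(u):=(\tilde X_t(u),\tilde X_{t-1}(u),\dots)$, and $$\hat G_h^\circ(u):=\Big(\frac1n\sum_{t=1}^nK_h(t/n-u)\Big)^{-1}\frac1n\sum_{t=1}^nK_h(t/n-u)\,g(Y_{t,n}).$$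 Local bandwidth selector: $H_n=\{a^k:k\in\mathbb{N}_0\}\cap[\underline h,1]$ with fixed $a\in(0,1)$; $\lambda(h):=\max\{1,\sqrt{\log(1/h)}\}$; $\hat v^2(h,u):=\frac{\sigma_K^2}{nh}\mathrm{tr}(\hat\Sigma_n(u))$; for a tuning constant $C^{\#}>0$, $$\hat h(u):=\sup\{h\in H_n:\ |\hat G_h^\circ(u)-\hat G_{h'}^\circ(u)|_2\le C^{\#}\,\hat v(h',u)\,\lambda(h')\ \text{for all }h'<h,\ h'\in H_n\}.$$
   Formalization: The constant c depends on a and on C^# (one c(a) for all C^#≥64 is impossible), and tr Σ(u)≠0 is assumed (else the right side is 0 and the bound fails); c and c_H are chosen for fixed carrier sets of the sample and noise spaces. *)

theory Defs
  imports "HOL-Probability.Probability" "HOL-Library.Landau_Symbols"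
begin

text \<open>
  Vectors in \<open>\<real>\<^sup>d\<close> are functions on \<open>nat\<close> read at indices below \<open>d\<close>, and \<open>d \<times> d\<close> matrices
  functions of two indices below \<open>d\<close>, so that constants can be chosen before \<open>d\<close>.
  Elements of \<open>\<real>\<^sup>\<nat>\<close> are functions on \<open>nat\<close>; coordinate 0 is the most recent observation.
  The Euclidean norm \<open>\<bar>x\<bar>\<^sub>2\<close> is \<open>L2_set x {..<d}\<close>.
\<close>

definition tr :: "nat \<Rightarrow> (nat \<Rightarrow> nat \<Rightarrow> real) \<Rightarrow> real" where
  "tr d A = (\<Sum>i<d. A i i)"

definition max_norm :: "nat \<Rightarrow> (nat \<Rightarrow> nat \<Rightarrow> real) \<Rightarrow> real" where
  "max_norm d A = Max {\<bar>A i j\<bar> | i j. i < d \<and> j < d}"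

text \<open>The value is \<open>\<infinity>\<close> when the moment is infinite, so a finite bound includes integrability.\<close>

definition Lnorm :: "'w measure \<Rightarrow> real \<Rightarrow> ('w \<Rightarrow> real) \<Rightarrow> ennreal" where
  "Lnorm P q Z =
    (let m = (\<integral>\<^sup>+ \<omega>. ennreal (\<bar>Z \<omega>\<bar> powr q) \<partial>P)
     in if m = \<infinity> then \<infinity> else ennreal (enn2real m powr (1 / q)))"

definition Cov :: "'w measure \<Rightarrow> ('w \<Rightarrow> real) \<Rightarrow> ('w \<Rightarrow> real) \<Rightarrow> real" where
  "Cov P A B =
    (\<integral>\<omega>. (A \<omega> - (\<integral>\<omega>'. A \<omega>' \<partial>P)) * (B \<omega> - (\<integral>\<omega>'. B \<omega>' \<partial>P)) \<partial>P)"

subsection \<open>Processes\<close>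

definition strictly_stationary :: "'w measure \<Rightarrow> (int \<Rightarrow> 'w \<Rightarrow> real) \<Rightarrow> bool" where
  "strictly_stationary P Z \<longleftrightarrow>
    (\<forall>t. Z t \<in> borel_measurable P) \<and>
    (\<forall>s. distr P (\<Pi>\<^sub>M t\<in>UNIV. borel) (\<lambda>\<omega> t. Z (t + s) \<omega>) =
         distr P (\<Pi>\<^sub>M t\<in>UNIV. borel) (\<lambda>\<omega> t. Z t \<omega>))"

text \<open>\<open>X t n\<close> is \<open>X\<^bsub>t,n\<^esub>\<close>, used for \<open>1 \<le> t \<le> n\<close>; \<open>Xt u t\<close> is the stationary approximation.\<close>

definition locally_stationary ::
  "'w measure \<Rightarrow> real \<Rightarrow> real \<Rightarrow> (nat \<Rightarrow> nat \<Rightarrow> 'w \<Rightarrow> real) \<Rightarrow> (real \<Rightarrow> int \<Rightarrow> 'w \<Rightarrow> real) \<Rightarrow> bool"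
where
  "locally_stationary P q Dq X Xt \<longleftrightarrow>
    (\<forall>n\<ge>1. \<forall>t\<in>{1..n}. X t n \<in> borel_measurable P) \<and>
    (\<forall>u\<in>{0..1}. strictly_stationary P (Xt u)) \<and>
    (\<forall>u\<in>{0..1}. Lnorm P q (Xt u 0) \<le> ennreal Dq) \<and>
    (\<forall>n\<ge>1. \<forall>t\<in>{1..n}. Lnorm P q (X t n) \<le> ennreal Dq) \<and>
    (\<forall>n\<ge>1. \<forall>t\<in>{1..n}.
       Lnorm P q (\<lambda>\<omega>. X t n \<omega> - Xt (real t / real n) (int t) \<omega>) \<le> ennreal (Dq / real n)) \<and>
    (\<forall>u\<in>{0..1}. \<forall>u'\<in>{0..1}.
       Lnorm P q (\<lambda>\<omega>. Xt u 0 \<omega> - Xt u' 0 \<omega>) \<le> ennreal (Dq * \<bar>u - u'\<bar>))"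

definition iid_with_independent_copy ::
  "'w measure \<Rightarrow> 's measure \<Rightarrow> (int \<Rightarrow> 'w \<Rightarrow> 's) \<Rightarrow> (int \<Rightarrow> 'w \<Rightarrow> 's) \<Rightarrow> bool"
where
  "iid_with_independent_copy P S \<zeta> \<zeta>' \<longleftrightarrow>
    prob_space.indep_vars P (\<lambda>_. S) \<zeta> UNIV \<and>
    (\<forall>t. distr P S (\<zeta> t) = distr P S (\<zeta> 0)) \<and>
    prob_space.indep_var P
      (\<Pi>\<^sub>M t\<in>UNIV. S) (\<lambda>\<omega> t. \<zeta> t \<omega>) (\<Pi>\<^sub>M t\<in>UNIV. S) (\<lambda>\<omega> t. \<zeta>' t \<omega>) \<and>
    distr P (\<Pi>\<^sub>M t\<in>UNIV. S) (\<lambda>\<omega> t. \<zeta>' t \<omega>) = distr P (\<Pi>\<^sub>M t\<in>UNIV. S) (\<lambda>\<omega> t. \<zeta> t \<omega>)"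

definition past :: "(int \<Rightarrow> 'w \<Rightarrow> 's) \<Rightarrow> int \<Rightarrow> 'w \<Rightarrow> nat \<Rightarrow> 's" where
  "past \<zeta> t \<omega> = (\<lambda>j. \<zeta> (t - int j) \<omega>)"

definition coupled_past ::
  "(int \<Rightarrow> 'w \<Rightarrow> 's) \<Rightarrow> (int \<Rightarrow> 'w \<Rightarrow> 's) \<Rightarrow> int \<Rightarrow> 'w \<Rightarrow> nat \<Rightarrow> 's" where
  "coupled_past \<zeta> \<zeta>' = past (\<zeta>(0 := \<zeta>' 0))"

definition shift_process ::
  "((nat \<Rightarrow> 's) \<Rightarrow> real \<Rightarrow> real) \<Rightarrow> (int \<Rightarrow> 'w \<Rightarrow> 's) \<Rightarrow> real \<Rightarrow> int \<Rightarrow> 'w \<Rightarrow> real" where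
  "shift_process H \<zeta> u t \<omega> = H (past \<zeta> t \<omega>) u"

definition dependence_measure ::
  "'w measure \<Rightarrow> ((nat \<Rightarrow> 's) \<Rightarrow> real \<Rightarrow> real) \<Rightarrow> (int \<Rightarrow> 'w \<Rightarrow> 's) \<Rightarrow> (int \<Rightarrow> 'w \<Rightarrow> 's) \<Rightarrow>
    real \<Rightarrow> real \<Rightarrow> nat \<Rightarrow> ennreal"
where
  "dependence_measure P H \<zeta> \<zeta>' q u k =
    Lnorm P q (\<lambda>\<omega>. H (past \<zeta> (int k) \<omega>) u - H (coupled_past \<zeta> \<zeta>' (int k) \<omega>) u)"

definition N_alpha :: "real \<Rightarrow> real \<Rightarrow> real" where
  "N_alpha \<alpha> q = Gamma (\<alpha> * q + 2) powr (1 / q)"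

definition assumption_A ::
  "real \<Rightarrow> real \<Rightarrow> (real \<Rightarrow> real) \<Rightarrow> real \<Rightarrow> 'w measure \<Rightarrow> 's measure \<Rightarrow>
    (int \<Rightarrow> 'w \<Rightarrow> 's) \<Rightarrow> (int \<Rightarrow> 'w \<Rightarrow> 's) \<Rightarrow> ((nat \<Rightarrow> 's) \<Rightarrow> real \<Rightarrow> real) \<Rightarrow>
    (nat \<Rightarrow> nat \<Rightarrow> 'w \<Rightarrow> real) \<Rightarrow> bool"
where
  "assumption_A \<alpha> D Dq \<rho> P S \<zeta> \<zeta>' H X \<longleftrightarrow>
    iid_with_independent_copy P S \<zeta> \<zeta>' \<and>
    (\<forall>u\<in>{0..1}. (\<lambda>z. H z u) \<in> borel_measurable (\<Pi>\<^sub>M j\<in>UNIV. S)) \<and>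
    (\<forall>q\<ge>1. locally_stationary P q (Dq q) X (shift_process H \<zeta>)) \<and>
    (\<forall>q\<ge>1. \<forall>u\<in>{0..1}. Lnorm P q (shift_process H \<zeta> u 0) \<le> ennreal (D * N_alpha \<alpha> q)) \<and>
    (\<forall>q\<ge>1. \<forall>k. \<forall>u\<in>{0..1}.
       dependence_measure P H \<zeta> \<zeta>' q u k \<le> ennreal (D * N_alpha \<alpha> q * \<rho> ^ k))"

subsection \<open>The class of functions and the target\<close>

definition chi_norm :: "(nat \<Rightarrow> real) \<Rightarrow> (nat \<Rightarrow> real) \<Rightarrow> ennreal" where
  "chi_norm chi x = (\<Sum>i. ennreal (chi i * \<bar>x i\<bar>))"

text \<open>
  Membership of a real-valued function. Sequences of infinite weighted norm are allowed, with
  the usual convention \<open>0 \<cdot> \<infinity> = 0\<close>.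
\<close>

definition H_class :: "nat \<Rightarrow> (nat \<Rightarrow> real) \<Rightarrow> real \<Rightarrow> ((nat \<Rightarrow> real) \<Rightarrow> real) \<Rightarrow> bool" where
  "H_class M chi C g \<longleftrightarrow>
    M \<ge> 1 \<and> C > 0 \<and> (\<forall>i. chi i \<ge> 0) \<and>
    (\<exists>\<epsilon>>0. chi \<in> O(\<lambda>i. real i powr (- 2 - \<epsilon>))) \<and>
    (\<forall>x y. x \<noteq> y \<longrightarrow>
       ennreal \<bar>g x - g y\<bar> \<le>
         ennreal C * chi_norm chi (\<lambda>i. x i - y i) *
           (1 + chi_norm chi x ^ (M - 1) + chi_norm chi y ^ (M - 1)))"

definition Y_obs :: "(nat \<Rightarrow> nat \<Rightarrow> 'w \<Rightarrow> real) \<Rightarrow> nat \<Rightarrow> nat \<Rightarrow> 'w \<Rightarrow> nat \<Rightarrow> real" where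
  "Y_obs X t n \<omega> = (\<lambda>j. if j < t then X (t - j) n \<omega> else 0)"

definition Y_stat :: "(real \<Rightarrow> int \<Rightarrow> 'w \<Rightarrow> real) \<Rightarrow> real \<Rightarrow> int \<Rightarrow> 'w \<Rightarrow> nat \<Rightarrow> real" where
  "Y_stat Xt u t \<omega> = (\<lambda>j. Xt u (t - int j) \<omega>)"

definition G_target ::
  "'w measure \<Rightarrow> ((nat \<Rightarrow> real) \<Rightarrow> nat \<Rightarrow> real) \<Rightarrow> (real \<Rightarrow> int \<Rightarrow> 'w \<Rightarrow> real) \<Rightarrow> real \<Rightarrow> nat \<Rightarrow> real"
where
  "G_target P g Xt u i = (\<integral>\<omega>. g (Y_stat Xt u 0 \<omega>) i \<partial>P)"

definition Sigma_lr ::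
  "'w measure \<Rightarrow> ((nat \<Rightarrow> real) \<Rightarrow> nat \<Rightarrow> real) \<Rightarrow> (real \<Rightarrow> int \<Rightarrow> 'w \<Rightarrow> real) \<Rightarrow>
    real \<Rightarrow> nat \<Rightarrow> nat \<Rightarrow> real"
where
  "Sigma_lr P g Xt u i j =
    (\<Sum>\<^sub>\<infinity>k\<in>(UNIV::int set).
       Cov P (\<lambda>\<omega>. g (Y_stat Xt u 0 \<omega>) i) (\<lambda>\<omega>. g (Y_stat Xt u k \<omega>) j))"

definition twice_cont_diff_near :: "(real \<Rightarrow> real) \<Rightarrow> real \<Rightarrow> bool" where
  "twice_cont_diff_near f u \<longleftrightarrow>
    (\<exists>\<epsilon>>0. (\<forall>v\<in>ball u \<epsilon>. f differentiable (at v) \<and> deriv f differentiable (at v)) \<and>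
           continuous_on (ball u \<epsilon>) (deriv (deriv f)))"

definition assumption_V ::
  "nat \<Rightarrow> 'w measure \<Rightarrow> (real \<Rightarrow> nat \<Rightarrow> nat \<Rightarrow> real) \<Rightarrow>
    (nat \<Rightarrow> real \<Rightarrow> 'w \<Rightarrow> nat \<Rightarrow> nat \<Rightarrow> real) \<Rightarrow> bool"
where
  "assumption_V d P Sig Sigh \<longleftrightarrow>
    (\<forall>n\<ge>1. \<forall>u\<in>{0..1}. \<forall>i<d. \<forall>j<d. (\<lambda>\<omega>. Sigh n u \<omega> i j) \<in> borel_measurable P) \<and>
    (\<exists>cSig>0. \<forall>u\<in>{0..1}.
       (\<forall>\<epsilon>>0. (\<lambda>n. measure P
                  {\<omega> \<in> space P. max_norm d (\<lambda>i j. Sigh n u \<omega> i j - Sig u i j) > \<epsilon>})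
               \<in> O(\<lambda>n. 1 / real n ^ 2)) \<and>
       (\<forall>n\<ge>1. Lnorm P 2 (\<lambda>\<omega>. max_norm d (Sigh n u \<omega>)) \<le> ennreal cSig))"

subsection \<open>Kernels, estimator and bandwidth selector\<close>

definition kernel_class :: "(real \<Rightarrow> real) set" where
  "kernel_class =
    {K. (\<forall>x. K x \<ge> 0) \<and> (\<forall>x. K (- x) = K x) \<and> (\<exists>L. L-lipschitz_on UNIV K) \<and>
        closure {x. K x \<noteq> 0} = {- 1 / 2 .. 1 / 2} \<and> (\<integral>x. K x \<partial>lborel) = 1}"

definition sigma2_K :: "(real \<Rightarrow> real) \<Rightarrow> real" where
  "sigma2_K K = (\<integral>x. K x ^ 2 \<partial>lborel)"

definition mu_K :: "(real \<Rightarrow> real) \<Rightarrow> real" where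
  "mu_K K = (\<integral>x. K x * x ^ 2 \<partial>lborel)"

definition K_scaled :: "(real \<Rightarrow> real) \<Rightarrow> real \<Rightarrow> real \<Rightarrow> real" where
  "K_scaled K h x = K (x / h) / h"

definition G_hat ::
  "(real \<Rightarrow> real) \<Rightarrow> ((nat \<Rightarrow> real) \<Rightarrow> nat \<Rightarrow> real) \<Rightarrow> (nat \<Rightarrow> nat \<Rightarrow> 'w \<Rightarrow> real) \<Rightarrow>
    nat \<Rightarrow> real \<Rightarrow> real \<Rightarrow> 'w \<Rightarrow> nat \<Rightarrow> real"
where
  "G_hat K g X n h u \<omega> i =
    inverse (1 / real n * (\<Sum>t=1..n. K_scaled K h (real t / real n - u))) *
    (1 / real n * (\<Sum>t=1..n. K_scaled K h (real t / real n - u) * g (Y_obs X t n \<omega>) i))"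

definition bw_grid :: "real \<Rightarrow> real \<Rightarrow> real set" where
  "bw_grid a hl = {a ^ k | k :: nat. True} \<inter> {hl..1}"

definition lambda_bw :: "real \<Rightarrow> real" where
  "lambda_bw h = max 1 (sqrt (ln (1 / h)))"

definition v_hat ::
  "nat \<Rightarrow> (real \<Rightarrow> real) \<Rightarrow> (nat \<Rightarrow> real \<Rightarrow> 'w \<Rightarrow> nat \<Rightarrow> nat \<Rightarrow> real) \<Rightarrow>
    nat \<Rightarrow> real \<Rightarrow> real \<Rightarrow> 'w \<Rightarrow> real"
where
  "v_hat d K Sigh n h u \<omega> = sqrt (sigma2_K K / (real n * h) * tr d (Sigh n u \<omega>))"

definition h_hat ::
  "nat \<Rightarrow> real \<Rightarrow> real \<Rightarrow> real \<Rightarrow> (real \<Rightarrow> real) \<Rightarrow> ((nat \<Rightarrow> real) \<Rightarrow> nat \<Rightarrow> real) \<Rightarrow>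
    (nat \<Rightarrow> nat \<Rightarrow> 'w \<Rightarrow> real) \<Rightarrow> (nat \<Rightarrow> real \<Rightarrow> 'w \<Rightarrow> nat \<Rightarrow> nat \<Rightarrow> real) \<Rightarrow>
    nat \<Rightarrow> real \<Rightarrow> 'w \<Rightarrow> real"
where
  "h_hat d a hl Cs K g X Sigh n u \<omega> =
    Sup {h \<in> bw_grid a hl. \<forall>h'\<in>bw_grid a hl. h' < h \<longrightarrow>
           L2_set (\<lambda>i. G_hat K g X n h u \<omega> i - G_hat K g X n h' u \<omega> i) {..<d}
             \<le> Cs * v_hat d K Sigh n h' u \<omega> * lambda_bw h'}"

end

theory Submission
  imports Defs "HOL-Real_Asymp.Real_Asymp"
begin

text \<open>
  At a fixed bandwidth \<open>h\<close> the squared error consists of a variance of order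
  \<open>\<sigma>\<^sub>K\<^sup>2 tr \<Sigma>(u) / (n h)\<close> and a squared bias of order \<open>\<mu>\<^sub>K\<^sup>2 \<bar>G''(u)\<bar>\<^sup>2 h\<^sup>4\<close>. With the variance
  inflated by \<open>log n\<close>, the price of a bound valid for all bandwidths of the grid at once, the two
  balance at some \<open>h0\<close> of order \<open>(log n / n)\<^bsup>1/5\<^esup>\<close>, and there both are of the order of the asserted
  rate (\<open>balanced_bandwidth\<close>). The point is that the comparison rule loses only a constant against
  \<open>h0\<close>. Suppose that every grid estimator with \<open>h \<le> h0\<close> is within half its threshold of
  the target. Then the largest grid point \<open>h*\<close> below \<open>h0\<close> passes all comparisons, so the selected
  bandwidth is at least \<open>h*\<close>, and having itself passed the comparison with \<open>h*\<close> its
  estimator is within one threshold of the estimator at \<open>h*\<close>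
  (\<open>Lepski_oracle_inequality\<close>, \<open>selected_loss_on_good_event\<close>). This holds outside an event of
  probability \<open>O(log n / n\<^sup>2)\<close>, on which the loss is bounded by the sum of the losses over
  the grid; these have bounded second moments, so that event contributes only a power of \<open>log n\<close>
  divided by \<open>n\<close> (\<open>expectation_split_on_good_event\<close>).

  The work lies in the deviation bound at a single bandwidth, and it needs a good constant because
  the threshold \<open>C\<^sup>#\<close> may be as small as 64. The observed history is replaced by the
  stationary one at an \<open>L\<^sup>4\<close> cost \<open>1/n\<close> (\<open>g_Y_obs_close\<close>), which turns the summands into
  functionals \<open>\<Psi> v\<close> of the past innovations. Geometric decay of the dependence measure and of
  \<open>\<chi>\<close> makes \<open>\<Psi> v\<close> equal, up to an error \<open>n\<^sup>-\<^sup>4\<close>, to a functional of the last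
  \<open>O(log n)\<close> innovations which is bounded by \<open>O((log n)\<^bsup>\<alpha>M\<^esup>)\<close> (\<open>finite_range_approximation\<close>,
  \<open>block_approximation\<close>). Cutting time into blocks of that length, blocks of equal parity
  are independent, and Bernstein's inequality applies to each parity class (\<open>block_sum_tail\<close>).

  The constant in the resulting bound is governed by the variance of a block. A stretch of \<open>l\<close>
  consecutive terms of a stationary sequence has variance at most \<open>l (\<Sigma> + \<epsilon>)\<close> once \<open>l\<close> is
  large, because the autocovariances are summable (\<open>autocov_decay\<close>, \<open>variance_of_sum_le\<close>), and
  within a block the kernel weights and the time parameter \<open>v\<close> are nearly constant
  (\<open>block_variance_le\<close>); the squared weights at the block boundaries then form a Riemann sum for
  \<open>\<sigma>\<^sub>K\<^sup>2\<close> (\<open>window_Riemann\<close>). The condition \<open>n h \<ge> (log n)\<^bsup>5 + 2\<alpha>M\<^esup>\<close> keeps Bernstein's inequality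
  in its Gaussian regime: with block length \<open>O(log n)\<close>, block bound
  \<open>O((log n)\<^bsup>1 + \<alpha>M\<^esup> / (n h))\<close> and deviations of order \<open>\<surd>(log n / (n h))\<close>, it would suffice that
  \<open>(log n)\<^bsup>3 + 2\<alpha>M\<^esup> / (n h)\<close> is small. The spare factor \<open>(log n)\<^sup>2\<close> is why \<open>c\<^sub>H = 1\<close> works.
\<close>

section \<open>Moments of the weighted norm\<close>

lemma Lnorm_le_imp_moment_le:
  assumes "Lnorm P (real q) Z \<le> ennreal c" "1 \<le> q" "0 \<le> c"
  shows "(\<integral>\<^sup>+ \<omega>. ennreal (\<bar>Z \<omega>\<bar> ^ q) \<partial>P) \<le> ennreal (c ^ q)"
proof -
  define m where "m = (\<integral>\<^sup>+ \<omega>. ennreal (\<bar>Z \<omega>\<bar> powr real q) \<partial>P)"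
  have m_eq: "m = (\<integral>\<^sup>+ \<omega>. ennreal (\<bar>Z \<omega>\<bar> ^ q) \<partial>P)"
    unfolding m_def using assms(2) by (intro nn_integral_cong) (auto simp: powr_realpow')
  have fin: "m \<noteq> \<infinity>"
    using assms(1) by (auto simp: Lnorm_def m_def[symmetric] Let_def top_unique split: if_splits)
  have "ennreal (enn2real m powr (1 / real q)) \<le> ennreal c"
    using assms(1) fin by (auto simp: Lnorm_def m_def[symmetric] Let_def)
  then have le: "enn2real m powr (1 / real q) \<le> c"
    using assms(3) by (simp add: ennreal_le_iff)
  have "enn2real m = (enn2real m powr (1 / real q)) ^ q"
    using assms(2) by (cases "enn2real m = 0") (auto simp: powr_powr powr_realpow[symmetric])
  also have "\<dots> \<le> c ^ q"
    using le by (intro power_mono) auto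
  finally have "ennreal (enn2real m) \<le> ennreal (c ^ q)"
    by (rule ennreal_leI)
  then show ?thesis
    using fin by (simp add: m_eq[symmetric] less_top)
qed

lemma ennreal_power2_le_imp_le:
  assumes "x ^ 2 \<le> ennreal (c ^ 2)" "0 \<le> c"
  shows "x \<le> ennreal c"
proof (cases x)
  case (real r)
  then have "r ^ 2 \<le> c ^ 2"
    using assms by (simp add: ennreal_power ennreal_le_iff)
  then show ?thesis
    using real assms by (auto intro!: ennreal_leI simp: abs_le_square_iff[symmetric])
next
  case top
  then show ?thesis using assms by (auto simp: top_unique)
qed

text \<open>
  The tangent of a power at \<open>z\<close> lies below its graph; this is the convexity input of both power
  mean inequalities.
\<close>
lemma power_ge_tangent:
  fixes y z :: real
  assumes "0 \<le> y" "0 \<le> z"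
  shows "z ^ Suc p + real (Suc p) * z ^ p * (y - z) \<le> y ^ Suc p"
proof (induction p)
  case (Suc p)
  have "y ^ Suc (Suc p) - z ^ Suc (Suc p) - real (Suc (Suc p)) * z ^ Suc p * (y - z) =
      y * (y ^ Suc p - z ^ Suc p - real (Suc p) * z ^ p * (y - z)) + real (Suc p) * z ^ p * (y - z)\<^sup>2"
    by (simp add: algebra_simps power2_eq_square)
  moreover have "0 \<le> y * (y ^ Suc p - z ^ Suc p - real (Suc p) * z ^ p * (y - z))"
    using Suc assms by (intro mult_nonneg_nonneg) auto
  moreover have "0 \<le> real (Suc p) * z ^ p * (y - z)\<^sup>2"
    using assms by auto
  ultimately show ?case by linarith
qed auto

text \<open>
  Jensen's inequality for a weighted series: sum the tangent inequality at the weighted mean. Both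
  sides are extended reals so that a divergent right-hand side needs no separate treatment later.
\<close>
lemma power_mean_suminf:
  fixes a y :: "nat \<Rightarrow> real"
  assumes a: "\<And>j. 0 \<le> a j" and y: "\<And>j. 0 \<le> y j" and "summable a" "1 \<le> p"
  shows "(\<Sum>j. ennreal (a j * y j)) ^ p
    \<le> ennreal (suminf a ^ (p - 1)) * (\<Sum>j. ennreal (a j * y j ^ p))"
proof -
  define A where "A = suminf a"
  have A0: "0 \<le> A" unfolding A_def by (intro suminf_nonneg assms)
  obtain r where r: "p = Suc r" using \<open>1 \<le> p\<close> by (cases p) auto
  show ?thesis
  proof (cases "A = 0")
    case True
    then have "a j = 0" for j
      using suminf_eq_zero_iff[OF \<open>summable a\<close> a] by (simp add: A_def)
    then show ?thesis using r by simp
  next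
    case False
    then have Apos: "0 < A" using A0 by simp
    show ?thesis
    proof (cases "(\<Sum>j. ennreal (a j * y j ^ p)) = \<infinity>")
      case True
      then show ?thesis using Apos by (simp add: A_def[symmetric] ennreal_mult_top)
    next
      case False
      have s2: "summable (\<lambda>j. a j * y j ^ p)"
        using False a y by (intro summable_suminf_not_top) auto
      have y1: "y j \<le> 1 + y j ^ p" for j
      proof (cases "y j \<le> 1")
        case True then show ?thesis using y[of j] by (smt (verit) zero_le_power)
      next
        case False
        then have "y j ^ 1 \<le> y j ^ p" using \<open>1 \<le> p\<close> by (intro power_increasing) auto
        then show ?thesis by simp
      qed
      have s1: "summable (\<lambda>j. a j * y j)"
      proof (rule summable_comparison_test')
        show "summable (\<lambda>j. a j + a j * y j ^ p)" by (intro summable_add s2 assms)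
        show "norm (a j * y j) \<le> a j + a j * y j ^ p" if "0 \<le> j" for j
          using mult_left_mono[OF y1 a, of j j] a[of j] y[of j] by (simp add: algebra_simps)
      qed
      define z where "z = (\<Sum>j. a j * y j) / A"
      have z0: "0 \<le> z" unfolding z_def using A0 a y by (intro divide_nonneg_nonneg suminf_nonneg s1) auto
      have "(\<Sum>j. a j * (z ^ p + real p * z ^ r * (y j - z))) \<le> (\<Sum>j. a j * y j ^ p)"
      proof (rule suminf_le)
        show "a j * (z ^ p + real p * z ^ r * (y j - z)) \<le> a j * y j ^ p" for j
          unfolding r by (intro mult_left_mono power_ge_tangent y z0 a)
        have "summable (\<lambda>j. (z ^ p - real p * z ^ r * z) * a j + (real p * z ^ r) * (a j * y j))"
          by (intro summable_add summable_mult s1 assms)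
        then show "summable (\<lambda>j. a j * (z ^ p + real p * z ^ r * (y j - z)))"
          by (simp add: algebra_simps)
      qed (rule s2)
      also have "(\<Sum>j. a j * (z ^ p + real p * z ^ r * (y j - z))) =
          (\<Sum>j. (z ^ p - real p * z ^ r * z) * a j + (real p * z ^ r) * (a j * y j))"
        by (simp add: algebra_simps)
      also have "\<dots> = (z ^ p - real p * z ^ r * z) * A + (real p * z ^ r) * (\<Sum>j. a j * y j)"
        unfolding A_def by (subst suminf_add[symmetric])
          (auto intro!: summable_mult s1 assms simp: suminf_mult s1 assms)
      also have "(\<Sum>j. a j * y j) = z * A" using Apos by (simp add: z_def)
      finally have *: "z ^ p * A \<le> (\<Sum>j. a j * y j ^ p)" by (simp add: algebra_simps)
      have "(\<Sum>j. a j * y j) ^ p = (z * A) ^ p" using Apos by (simp add: z_def)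
      also have "\<dots> = A ^ (p - 1) * (z ^ p * A)" by (simp add: r power_mult_distrib)
      also have "\<dots> \<le> A ^ (p - 1) * (\<Sum>j. a j * y j ^ p)" using * A0 by (intro mult_left_mono) auto
      finally have "ennreal ((\<Sum>j. a j * y j) ^ p) \<le> ennreal (A ^ (p - 1) * (\<Sum>j. a j * y j ^ p))"
        by (rule ennreal_leI)
      moreover have "(\<Sum>j. ennreal (a j * y j)) = ennreal (\<Sum>j. a j * y j)"
        using s1 a y by (intro suminf_ennreal2) auto
      moreover have "(\<Sum>j. ennreal (a j * y j ^ p)) = ennreal (\<Sum>j. a j * y j ^ p)"
        using s2 a y by (intro suminf_ennreal2) auto
      moreover have "0 \<le> (\<Sum>j. a j * y j)" "0 \<le> (\<Sum>j. a j * y j ^ p)"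
        using a y s1 s2 by (auto intro!: suminf_nonneg)
      ultimately show ?thesis using A0
        by (simp add: A_def[symmetric] ennreal_power ennreal_mult)
    qed
  qed
qed

lemma chi_norm_measurable [measurable]:
  assumes "\<And>j. (\<lambda>\<omega>. Z \<omega> j) \<in> borel_measurable P"
  shows "(\<lambda>\<omega>. chi_norm chi (Z \<omega>)) \<in> borel_measurable P"
  unfolding chi_norm_def using assms by measurable

text \<open>
  The coordinates may grow like \<open>\<theta>\<^sup>j\<close> in \<open>L\<^sup>p\<close>. Putting the weight \<open>\<chi>\<^sub>j \<theta>\<^sup>j\<close> on the normalized
  coordinate \<open>\<bar>x\<^sub>j\<bar> / \<theta>\<^sup>j\<close> and applying the power mean inequality gives the \<open>L\<^sup>p\<close> norm of the weighted
  norm that Minkowski's inequality predicts. Growing coordinates occur since errors of approximation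
  are uniform over recent lags but not over remote ones.
\<close>
lemma chi_norm_moment_le:
  fixes Z :: "'w \<Rightarrow> nat \<Rightarrow> real"
  assumes [measurable]: "\<And>j. (\<lambda>\<omega>. Z \<omega> j) \<in> borel_measurable P"
    and chi: "\<And>j. 0 \<le> chi j" and th: "0 < \<theta>" and s: "summable (\<lambda>j. chi j * \<theta> ^ j)"
    and p: "1 \<le> p" and b: "0 \<le> b"
    and mom: "\<And>j. (\<integral>\<^sup>+ \<omega>. ennreal (\<bar>Z \<omega> j\<bar> ^ p) \<partial>P) \<le> ennreal ((b * \<theta> ^ j) ^ p)"
  shows "(\<integral>\<^sup>+ \<omega>. chi_norm chi (Z \<omega>) ^ p \<partial>P) \<le> ennreal (((\<Sum>j. chi j * \<theta> ^ j) * b) ^ p)"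
proof -
  define A where "A = (\<Sum>j. chi j * \<theta> ^ j)"
  have A0: "0 \<le> A" unfolding A_def using chi th by (intro suminf_nonneg s) auto
  have pt: "chi_norm chi x ^ p
      \<le> ennreal (A ^ (p - 1)) * (\<Sum>j. ennreal (chi j * \<theta> ^ j / (\<theta> ^ j) ^ p) * ennreal (\<bar>x j\<bar> ^ p))" for x
  proof -
    have "chi_norm chi x ^ p = (\<Sum>j. ennreal ((chi j * \<theta> ^ j) * (\<bar>x j\<bar> / \<theta> ^ j))) ^ p"
      unfolding chi_norm_def using th by simp
    also have "\<dots> \<le> ennreal (A ^ (p - 1)) * (\<Sum>j. ennreal ((chi j * \<theta> ^ j) * (\<bar>x j\<bar> / \<theta> ^ j) ^ p))"
      unfolding A_def using chi th by (intro power_mean_suminf s p) auto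
    also have "(\<lambda>j. ennreal ((chi j * \<theta> ^ j) * (\<bar>x j\<bar> / \<theta> ^ j) ^ p)) =
        (\<lambda>j. ennreal (chi j * \<theta> ^ j / (\<theta> ^ j) ^ p) * ennreal (\<bar>x j\<bar> ^ p))"
      using chi th by (subst ennreal_mult[symmetric]) (auto simp: power_divide)
    finally show ?thesis .
  qed
  have "(\<integral>\<^sup>+ \<omega>. chi_norm chi (Z \<omega>) ^ p \<partial>P) \<le>
     (\<integral>\<^sup>+ \<omega>. ennreal (A ^ (p - 1)) * (\<Sum>j. ennreal (chi j * \<theta> ^ j / (\<theta> ^ j) ^ p) * ennreal (\<bar>Z \<omega> j\<bar> ^ p)) \<partial>P)"
    by (intro nn_integral_mono pt)
  also have "\<dots> = ennreal (A ^ (p - 1)) *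
      (\<Sum>j. ennreal (chi j * \<theta> ^ j / (\<theta> ^ j) ^ p) * (\<integral>\<^sup>+ \<omega>. ennreal (\<bar>Z \<omega> j\<bar> ^ p) \<partial>P))"
    by (subst nn_integral_cmult, measurable, subst nn_integral_suminf, measurable)
       (simp add: nn_integral_cmult)
  also have "\<dots> \<le> ennreal (A ^ (p - 1)) * (\<Sum>j. ennreal (b ^ p * (chi j * \<theta> ^ j)))"
  proof (intro mult_left_mono suminf_le)
    fix j
    have "ennreal (chi j * \<theta> ^ j / (\<theta> ^ j) ^ p) * (\<integral>\<^sup>+ \<omega>. ennreal (\<bar>Z \<omega> j\<bar> ^ p) \<partial>P)
       \<le> ennreal (chi j * \<theta> ^ j / (\<theta> ^ j) ^ p) * ennreal ((b * \<theta> ^ j) ^ p)"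
      by (intro mult_left_mono mom) auto
    also have "\<dots> = ennreal (b ^ p * (chi j * \<theta> ^ j))"
      using chi[of j] th b by (subst ennreal_mult[symmetric]) (auto simp: power_mult_distrib)
    finally show "ennreal (chi j * \<theta> ^ j / (\<theta> ^ j) ^ p) * (\<integral>\<^sup>+ \<omega>. ennreal (\<bar>Z \<omega> j\<bar> ^ p) \<partial>P)
       \<le> ennreal (b ^ p * (chi j * \<theta> ^ j))" .
  qed auto
  also have "(\<Sum>j. ennreal (b ^ p * (chi j * \<theta> ^ j))) = ennreal (b ^ p * A)"
    unfolding A_def using b chi th s by (subst suminf_mult[symmetric]) (auto intro!: suminf_ennreal2)
  also have "ennreal (A ^ (p - 1)) * ennreal (b ^ p * A) = ennreal ((A * b) ^ p)"
    using A0 b p by (subst ennreal_mult[symmetric]) (auto simp: power_mult_distrib power_minus_mult ac_simps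
        power_eq_if[of A p])
  finally show ?thesis unfolding A_def .
qed

lemma numeral_3_eq_3_sum: "(3::ennreal) = 1 + 1 + 1"
  by simp

lemma three_term_power8:
  fixes a b c :: ennreal
  shows "(a + b + c) ^ 8 \<le> 3 ^ 8 * (a ^ 8 + b ^ 8 + c ^ 8)"
proof -
  define m where "m = max a (max b c)"
  have "a + b + c \<le> m + m + m" unfolding m_def by (intro add_mono) (auto simp: le_max_iff_disj)
  also have "m + m + m = 3 * m" by (simp only: distrib_right mult_1 numeral_3_eq_3_sum)
  finally have "(a + b + c) ^ 8 \<le> (3 * m) ^ 8" by (rule power_mono_ennreal)
  also have "\<dots> = 3 ^ 8 * m ^ 8" by (simp add: power_mult_distrib)
  also have "m ^ 8 \<le> a ^ 8 + b ^ 8 + c ^ 8"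
    unfolding m_def max_def by (auto intro: add_increasing add_increasing2)
  finally show ?thesis by (simp add: mult_left_mono)
qed

lemma power_le_one_plus_power:
  fixes x :: ennreal
  assumes "m \<le> n"
  shows "x ^ m \<le> 1 + x ^ n"
proof (cases "x \<le> 1")
  case True
  then have "x ^ m \<le> 1 ^ m" by (rule power_mono_ennreal)
  then show ?thesis by (simp add: add_increasing2)
next
  case False
  then have "x ^ m \<le> x ^ n" using assms by (intro power_increasing) auto
  then show ?thesis by (simp add: add_increasing)
qed

text \<open>
  The growth condition bounds the difference by a product of a weighted norm of \<open>Y - Y'\<close> and a
  polynomial in the weighted norms of \<open>Y\<close> and \<open>Y'\<close>. Cauchy-Schwarz separates the two factors, which
  is why a fourth moment on the left requires eighth moments of \<open>Y - Y'\<close> and moments of order \<open>8M\<close>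
  of \<open>Y\<close> and \<open>Y'\<close>.
\<close>
lemma H_class_Lipschitz_L4:
  fixes Y Y' :: "'w \<Rightarrow> nat \<Rightarrow> real"
  assumes P: "prob_space P"
    and H: "H_class M chi C g"
    and [measurable]: "\<And>j. (\<lambda>\<omega>. Y \<omega> j) \<in> borel_measurable P" "\<And>j. (\<lambda>\<omega>. Y' \<omega> j) \<in> borel_measurable P"
    and th: "1 \<le> \<theta>" and s: "summable (\<lambda>j. chi j * \<theta> ^ j)"
    and B: "0 \<le> B" and e: "0 \<le> e"
    and mY: "\<And>j. (\<integral>\<^sup>+ \<omega>. ennreal (\<bar>Y \<omega> j\<bar> ^ (8 * M)) \<partial>P) \<le> ennreal (B ^ (8 * M))"
    and mY': "\<And>j. (\<integral>\<^sup>+ \<omega>. ennreal (\<bar>Y' \<omega> j\<bar> ^ (8 * M)) \<partial>P) \<le> ennreal (B ^ (8 * M))"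
    and mD: "\<And>j. (\<integral>\<^sup>+ \<omega>. ennreal (\<bar>Y \<omega> j - Y' \<omega> j\<bar> ^ 8) \<partial>P) \<le> ennreal ((e * \<theta> ^ j) ^ 8)"
  shows "(\<integral>\<^sup>+ \<omega>. ennreal (\<bar>g (Y \<omega>) - g (Y' \<omega>)\<bar> ^ 4) \<partial>P)
    \<le> ennreal ((C * (\<Sum>j. chi j * \<theta> ^ j)) ^ 4 * 3 ^ 4 * sqrt (3 + 2 * ((\<Sum>j. chi j * \<theta> ^ j) * B) ^ (8 * M)) * e ^ 4)"
proof -
  interpret prob_space P by fact
  define A where "A = (\<Sum>j. chi j * \<theta> ^ j)"
  have M: "1 \<le> M" and C: "0 < C" and chi: "\<And>i. 0 \<le> chi i"
    and lip: "\<And>x y. x \<noteq> y \<Longrightarrow> ennreal \<bar>g x - g y\<bar> \<le>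
         ennreal C * chi_norm chi (\<lambda>i. x i - y i) * (1 + chi_norm chi x ^ (M - 1) + chi_norm chi y ^ (M - 1))"
    using H by (auto simp: H_class_def)
  have A0: "0 \<le> A" unfolding A_def using chi th by (intro suminf_nonneg s) auto
  define D where "D = (\<lambda>\<omega>. chi_norm chi (\<lambda>j. Y \<omega> j - Y' \<omega> j))"
  define R where "R = (\<lambda>\<omega>. 1 + chi_norm chi (Y \<omega>) ^ (M - 1) + chi_norm chi (Y' \<omega>) ^ (M - 1))"
  have [measurable]: "D \<in> borel_measurable P" "R \<in> borel_measurable P"
    unfolding D_def R_def by measurable
  have [measurable]: "(\<lambda>\<omega>. chi_norm chi (Y \<omega>)) \<in> borel_measurable P" "(\<lambda>\<omega>. chi_norm chi (Y' \<omega>)) \<in> borel_measurable P"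
    by measurable
  have pt: "ennreal (\<bar>g (Y \<omega>) - g (Y' \<omega>)\<bar> ^ 4) \<le> ennreal (C ^ 4) * (D \<omega> ^ 4 * R \<omega> ^ 4)" for \<omega>
  proof (cases "Y \<omega> = Y' \<omega>")
    case False
    have "ennreal (\<bar>g (Y \<omega>) - g (Y' \<omega>)\<bar> ^ 4) = ennreal \<bar>g (Y \<omega>) - g (Y' \<omega>)\<bar> ^ 4"
      by (simp add: ennreal_power)
    also have "\<dots> \<le> (ennreal C * D \<omega> * R \<omega>) ^ 4"
      unfolding D_def R_def by (intro power_mono_ennreal lip False)
    also have "\<dots> = ennreal (C ^ 4) * (D \<omega> ^ 4 * R \<omega> ^ 4)"
      using C by (simp add: power_mult_distrib ennreal_power mult.assoc)
    finally show ?thesis .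
  qed auto
  have D8: "(\<integral>\<^sup>+ \<omega>. D \<omega> ^ 8 \<partial>P) \<le> ennreal ((A * e) ^ 8)"
    unfolding D_def A_def using th chi by (intro chi_norm_moment_le s mD e) auto
  have mom: "(\<integral>\<^sup>+ \<omega>. chi_norm chi (V \<omega>) ^ (8 * M) \<partial>P) \<le> ennreal ((A * B) ^ (8 * M))"
    if [measurable]: "\<And>j. (\<lambda>\<omega>. V \<omega> j) \<in> borel_measurable P"
      and m: "\<And>j. (\<integral>\<^sup>+ \<omega>. ennreal (\<bar>V \<omega> j\<bar> ^ (8 * M)) \<partial>P) \<le> ennreal (B ^ (8 * M))" for V
    unfolding A_def
  proof (intro chi_norm_moment_le s B)
    fix j
    note m[of j]
    also have "ennreal (B ^ (8 * M)) \<le> ennreal ((B * \<theta> ^ j) ^ (8 * M))"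
      using B th by (intro ennreal_leI power_mono) (auto intro!: mult_right_mono[of 1, simplified] simp: mult_le_cancel_left1)
    finally show "(\<integral>\<^sup>+ \<omega>. ennreal (\<bar>V \<omega> j\<bar> ^ (8 * M)) \<partial>P) \<le> ennreal ((B * \<theta> ^ j) ^ (8 * M))" .
  qed (use th chi M in auto)
  have R8: "(\<integral>\<^sup>+ \<omega>. R \<omega> ^ 8 \<partial>P) \<le> ennreal (3 ^ 8 * (3 + 2 * (A * B) ^ (8 * M)))"
  proof -
    have le: "(x ^ (M - 1)) ^ 8 \<le> 1 + x ^ (8 * M)" for x :: ennreal
      unfolding power_mult[symmetric] by (intro power_le_one_plus_power) auto
    have "(\<integral>\<^sup>+ \<omega>. R \<omega> ^ 8 \<partial>P) \<le>
       (\<integral>\<^sup>+ \<omega>. 3 ^ 8 * (1 + (1 + chi_norm chi (Y \<omega>) ^ (8 * M)) + (1 + chi_norm chi (Y' \<omega>) ^ (8 * M))) \<partial>P)"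
      unfolding R_def
      by (intro nn_integral_mono order.trans[OF three_term_power8] mult_left_mono add_mono le) auto
    also have "\<dots> = 3 ^ 8 * (3 + (\<integral>\<^sup>+ \<omega>. chi_norm chi (Y \<omega>) ^ (8 * M) \<partial>P) + (\<integral>\<^sup>+ \<omega>. chi_norm chi (Y' \<omega>) ^ (8 * M) \<partial>P))"
    proof -
      have "(\<integral>\<^sup>+ \<omega>. 1 + (1 + chi_norm chi (Y \<omega>) ^ (8 * M)) + (1 + chi_norm chi (Y' \<omega>) ^ (8 * M)) \<partial>P) =
          (\<integral>\<^sup>+ \<omega>. 3 + chi_norm chi (Y \<omega>) ^ (8 * M) + chi_norm chi (Y' \<omega>) ^ (8 * M) \<partial>P)"
        by (intro nn_integral_cong) (simp only: numeral_3_eq_3_sum ac_simps)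
      also have "\<dots> = 3 + (\<integral>\<^sup>+ \<omega>. chi_norm chi (Y \<omega>) ^ (8 * M) \<partial>P) + (\<integral>\<^sup>+ \<omega>. chi_norm chi (Y' \<omega>) ^ (8 * M) \<partial>P)"
        by (simp add: nn_integral_add emeasure_space_1)
      finally have E: "(\<integral>\<^sup>+ \<omega>. 1 + (1 + chi_norm chi (Y \<omega>) ^ (8 * M)) + (1 + chi_norm chi (Y' \<omega>) ^ (8 * M)) \<partial>P) =
          3 + (\<integral>\<^sup>+ \<omega>. chi_norm chi (Y \<omega>) ^ (8 * M) \<partial>P) + (\<integral>\<^sup>+ \<omega>. chi_norm chi (Y' \<omega>) ^ (8 * M) \<partial>P)" .
      show ?thesis by (subst nn_integral_cmult, measurable, subst E, rule refl)
    qed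
    also have "\<dots> \<le> 3 ^ 8 * (3 + ennreal ((A * B) ^ (8 * M)) + ennreal ((A * B) ^ (8 * M)))"
      by (intro mult_left_mono add_mono mom mY mY') auto
    also have "\<dots> = ennreal (3 ^ 8 * (3 + 2 * (A * B) ^ (8 * M)))"
    proof -
      have "(3::ennreal) ^ 8 * (3 + ennreal x + ennreal x) = ennreal (3 ^ 8 * (3 + 2 * x))" if "0 \<le> x" for x
      proof -
        have "ennreal (3 ^ 8 * (3 + 2 * x)) = ennreal (3 ^ 8) * ennreal (3 + x + x)"
          using that by (subst ennreal_mult[symmetric]) auto
        also have "ennreal (3 + x + x) = 3 + ennreal x + ennreal x"
        proof -
          have "0 \<le> 3 + x" using that by simp
          from ennreal_plus[OF this that] ennreal_plus[of 3 x] that show ?thesis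
            by (simp only: ennreal_numeral zero_le_numeral)
        qed
        finally show ?thesis by (simp only: ennreal_power[symmetric] ennreal_numeral zero_le_numeral)
      qed
      then show ?thesis using A0 B by simp
    qed
    finally show ?thesis .
  qed
  have "(\<integral>\<^sup>+ \<omega>. D \<omega> ^ 4 * R \<omega> ^ 4 \<partial>P)\<^sup>2 \<le> (\<integral>\<^sup>+ \<omega>. (D \<omega> ^ 4)\<^sup>2 \<partial>P) * (\<integral>\<^sup>+ \<omega>. (R \<omega> ^ 4)\<^sup>2 \<partial>P)"
    by (rule Cauchy_Schwarz_nn_integral) measurable
  also have "\<dots> \<le> ennreal ((A * e) ^ 8) * ennreal (3 ^ 8 * (3 + 2 * (A * B) ^ (8 * M)))"
    unfolding power_mult[symmetric] using D8 R8 by (intro mult_mono) auto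
  also have "\<dots> = ennreal (((A * e) ^ 4 * 3 ^ 4 * sqrt (3 + 2 * (A * B) ^ (8 * M))) ^ 2)"
  proof -
    have "ennreal (a ^ 8) * ennreal (3 ^ 8 * s) = ennreal ((a ^ 4 * 3 ^ 4 * sqrt s) ^ 2)" if "0 \<le> s" for a s :: real
      using that by (subst ennreal_mult[symmetric]) (simp_all add: power_mult_distrib power_mult[symmetric])
    from this[of "3 + 2 * (A * B) ^ (8 * M)" "A * e"] show ?thesis using A0 B by (simp only: zero_le_power mult_nonneg_nonneg add_nonneg_nonneg zero_le_numeral)
  qed
  finally have "(\<integral>\<^sup>+ \<omega>. D \<omega> ^ 4 * R \<omega> ^ 4 \<partial>P) \<le> ennreal ((A * e) ^ 4 * 3 ^ 4 * sqrt (3 + 2 * (A * B) ^ (8 * M)))"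
    by (rule ennreal_power2_le_imp_le) (use A0 B in auto)
  then have "ennreal (C ^ 4) * (\<integral>\<^sup>+ \<omega>. D \<omega> ^ 4 * R \<omega> ^ 4 \<partial>P) \<le>
     ennreal (C ^ 4) * ennreal ((A * e) ^ 4 * 3 ^ 4 * sqrt (3 + 2 * (A * B) ^ (8 * M)))"
    by (intro mult_left_mono) auto
  also have "\<dots> = ennreal ((C * A) ^ 4 * 3 ^ 4 * sqrt (3 + 2 * (A * B) ^ (8 * M)) * e ^ 4)"
  proof -
    have "ennreal (C ^ 4) * ennreal ((A * e) ^ 4 * 3 ^ 4 * s) = ennreal ((C * A) ^ 4 * 3 ^ 4 * s * e ^ 4)" for s :: real
      using C by (subst ennreal_mult'[symmetric]) (simp_all add: power_mult_distrib mult.assoc mult.left_commute mult.commute)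
    then show ?thesis by simp
  qed
  finally have "ennreal (C ^ 4) * (\<integral>\<^sup>+ \<omega>. D \<omega> ^ 4 * R \<omega> ^ 4 \<partial>P) \<le>
     ennreal ((C * A) ^ 4 * 3 ^ 4 * sqrt (3 + 2 * (A * B) ^ (8 * M)) * e ^ 4)" .
  moreover have "(\<integral>\<^sup>+ \<omega>. ennreal (\<bar>g (Y \<omega>) - g (Y' \<omega>)\<bar> ^ 4) \<partial>P) \<le> ennreal (C ^ 4) * (\<integral>\<^sup>+ \<omega>. D \<omega> ^ 4 * R \<omega> ^ 4 \<partial>P)"
    by (subst nn_integral_cmult[symmetric], measurable) (intro nn_integral_mono pt)
  ultimately show ?thesis unfolding A_def by (rule order.trans[rotated])
qed

section \<open>Functions of finitely many innovations\<close>

text \<open>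
  Relative to a carrier \<open>\<Omega>\<close>, since functions on an infinite product of measure spaces are only
  controlled on its space.
\<close>
definition depends_first :: "nat \<Rightarrow> (nat \<Rightarrow> 's) set \<Rightarrow> ((nat \<Rightarrow> 's) \<Rightarrow> 'b) \<Rightarrow> bool" where
  "depends_first m \<Omega> f \<longleftrightarrow> (\<forall>z\<in>\<Omega>. \<forall>z'\<in>\<Omega>. (\<forall>k<m. z k = z' k) \<longrightarrow> f z = f z')"

lemma depends_first_mono: "depends_first m \<Omega> f \<Longrightarrow> m \<le> n \<Longrightarrow> depends_first n \<Omega> f"
  unfolding depends_first_def by (meson order_less_le_trans)

lemma depends_first_comp2:
  "depends_first m \<Omega> f \<Longrightarrow> depends_first m \<Omega> g \<Longrightarrow> depends_first m \<Omega> (\<lambda>z. h (f z) (g z))"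
  unfolding depends_first_def by (intro ballI impI arg_cong2[where f = h]) blast+

context
  fixes \<mu> :: "'s measure" and Q :: "(nat \<Rightarrow> 's) measure"
  assumes mu: "prob_space \<mu>"
  defines "Q \<equiv> (\<Pi>\<^sub>M j\<in>(UNIV::nat set). \<mu>)"
begin

interpretation mu: prob_space \<mu> by (rule mu)
interpretation Q: prob_space Q unfolding Q_def by (intro prob_space_PiM mu)

text \<open>
  The sets that can be approximated by cylinders form a sigma-algebra containing the generators.
\<close>
lemma cylinder_approx_set:
  assumes "A \<in> sets Q" "0 < (\<epsilon>::real)"
  shows "\<exists>N B. B \<in> sets Q \<and> depends_first N (space Q) (\<lambda>z. z \<in> B) \<and> measure Q (sym_diff A B) < \<epsilon>"
proof -
  have sQ: "space Q = (\<Pi>\<^sub>E i\<in>UNIV. space \<mu>)" by (simp add: Q_def space_PiM)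
  have eq: "sets Q = sigma_sets (space Q) {{f \<in> \<Pi>\<^sub>E i\<in>UNIV. space \<mu>. f i \<in> A} |i A. i \<in> UNIV \<and> A \<in> sets \<mu>}"
    unfolding sQ by (simp add: Q_def sets_PiM_single)
  have "A \<in> sigma_sets (space Q) {{f \<in> \<Pi>\<^sub>E i\<in>UNIV. space \<mu>. f i \<in> A} |i A. i \<in> UNIV \<and> A \<in> sets \<mu>}"
    using assms(1) unfolding eq .
  then show ?thesis using assms(2)
  proof (induction arbitrary: \<epsilon>)
    case (Basic a)
    from Basic.hyps have "a \<in> sets Q" unfolding eq by (rule sigma_sets.Basic)
    moreover obtain i A where "a = {f \<in> \<Pi>\<^sub>E i\<in>UNIV. space \<mu>. f i \<in> A}" using Basic by auto
    then have "depends_first (Suc i) (space Q) (\<lambda>z. z \<in> a)"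
      by (auto simp: depends_first_def sQ)
    ultimately show ?case using Basic by (intro exI[of _ "Suc i"] exI[of _ a]) auto
  next
    case Empty
    then show ?case by (intro exI[of _ 0] exI[of _ "{}"]) (auto simp: depends_first_def)
  next
    case (Compl a)
    from Compl.IH[OF Compl.prems] obtain N B where B: "B \<in> sets Q"
      "depends_first N (space Q) (\<lambda>z. z \<in> B)" "measure Q (sym_diff a B) < \<epsilon>" by blast
    have a: "a \<in> sets Q" using Compl.hyps by (simp add: eq)
    have "sym_diff (space Q - a) (space Q - B) = sym_diff a B"
      using sets.sets_into_space[OF a] sets.sets_into_space[OF B(1)] by auto
    then have "measure Q (sym_diff (space Q - a) (space Q - B)) < \<epsilon>" using B(3) by simp
    moreover have "space Q - B \<in> sets Q" using B(1) by auto
    moreover have "depends_first N (space Q) (\<lambda>z. z \<in> space Q - B)"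
      using B(2) unfolding depends_first_def by (metis DiffD2 DiffI)
    ultimately show ?case by blast
  next
    case (Union A)
    have A[measurable]: "A i \<in> sets Q" for i using Union.hyps by (simp add: eq)
    have "(\<lambda>n. measure Q (\<Union>i<n. A i)) \<longlonglongrightarrow> measure Q (\<Union>n. (\<Union>i<n. A i))"
      by (intro Q.finite_Lim_measure_incseq) (auto intro!: incseq_SucI simp: lessThan_Suc)
    moreover have "A i \<subseteq> (\<Union>n. (\<Union>i<n. A i))" for i
      by (rule order.trans[OF _ UN_upper[of "Suc i"]]) auto
    then have "(\<Union>n. (\<Union>i<n. A i)) = (\<Union>i. A i)" by blast
    ultimately have "(\<lambda>n. measure Q (\<Union>i<n. A i)) \<longlonglongrightarrow> measure Q (\<Union>i. A i)" by simp
    then have "eventually (\<lambda>n. measure Q (\<Union>i. A i) - \<epsilon> / 2 < measure Q (\<Union>i<n. A i)) sequentially"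
      using Union.prems by (intro order_tendstoD(1)) auto
    then obtain n where n: "measure Q (\<Union>i. A i) - \<epsilon> / 2 < measure Q (\<Union>i<n. A i)"
      by (auto simp: eventually_sequentially)
    have "\<forall>i. \<exists>N B. B \<in> sets Q \<and> depends_first N (space Q) (\<lambda>z. z \<in> B)
        \<and> measure Q (sym_diff (A i) B) < \<epsilon> / (2 * (real n + 1))"
      using Union.prems by (intro allI Union.IH) auto
    then obtain N B where B: "\<And>i. B i \<in> sets Q" "\<And>i. depends_first (N i) (space Q) (\<lambda>z. z \<in> B i)"
      "\<And>i. measure Q (sym_diff (A i) (B i)) < \<epsilon> / (2 * (real n + 1))"
      by metis
    note [measurable] = B(1)
    define N' where "N' = (\<Sum>i<n. N i)"
    have N': "N i \<le> N'" if "i < n" for i unfolding N'_def using that by (intro member_le_sum) auto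
    have dep: "depends_first N' (space Q) (\<lambda>z. z \<in> (\<Union>i<n. B i))"
      using depends_first_mono[OF B(2) N'] unfolding depends_first_def by (smt (verit, best) UN_iff lessThan_iff)
    have "measure Q (sym_diff (\<Union>i. A i) (\<Union>i<n. B i))
      \<le> measure Q (((\<Union>i. A i) - (\<Union>i<n. A i)) \<union> (\<Union>i<n. sym_diff (A i) (B i)))"
      by (intro Q.finite_measure_mono) auto
    also have "\<dots> \<le> measure Q ((\<Union>i. A i) - (\<Union>i<n. A i)) + measure Q (\<Union>i<n. sym_diff (A i) (B i))"
      by (intro measure_Un_le) auto
    finally have le1: "measure Q (sym_diff (\<Union>i. A i) (\<Union>i<n. B i)) \<le>
      measure Q ((\<Union>i. A i) - (\<Union>i<n. A i)) + measure Q (\<Union>i<n. sym_diff (A i) (B i))" .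
    have "measure Q (\<Union>i<n. sym_diff (A i) (B i)) \<le> (\<Sum>i<n. measure Q (sym_diff (A i) (B i)))"
      by (intro measure_UNION_le) auto
    also have "\<dots> \<le> (\<Sum>i<n. \<epsilon> / (2 * (real n + 1)))"
      by (intro sum_mono less_imp_le B)
    also have "\<dots> \<le> \<epsilon> / 2" using Union.prems by (simp add: field_simps)
    finally have le2: "measure Q (\<Union>i<n. sym_diff (A i) (B i)) \<le> \<epsilon> / 2" .
    have "measure Q ((\<Union>i. A i) - (\<Union>i<n. A i)) = measure Q (\<Union>i. A i) - measure Q (\<Union>i<n. A i)"
      by (intro Q.finite_measure_Diff) auto
    with le1 le2 n have "measure Q (sym_diff (\<Union>i. A i) (\<Union>i<n. B i)) < \<epsilon>" by linarith
    moreover have "(\<Union>i<n. B i) \<in> sets Q" by auto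
    ultimately show ?case using dep by blast
  qed
qed

text \<open>
  From sets to integrable functions by the induction that defines the integral. This gives no rate in
  the number \<open>N\<close> of coordinates; the rate is the matter of \<open>finite_dependence_approx\<close>.
\<close>
lemma cylinder_approx:
  fixes F :: "(nat \<Rightarrow> 's) \<Rightarrow> real"
  assumes "integrable Q F" "0 < (\<epsilon>::real)"
  shows "\<exists>N \<phi>. integrable Q \<phi> \<and> depends_first N (space Q) \<phi> \<and> (\<integral>z. \<bar>F z - \<phi> z\<bar> \<partial>Q) < \<epsilon>"
  using assms
proof (induction arbitrary: \<epsilon> rule: integrable_induct)
  case (base A c)
  define d where "d = \<epsilon> / (\<bar>c\<bar> + 1)"
  have d: "0 < d" using base by (simp add: d_def)
  from cylinder_approx_set[OF base(1) d] obtain N B where B[measurable]: "B \<in> sets Q"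
      and dep: "depends_first N (space Q) (\<lambda>z. z \<in> B)" and m: "measure Q (sym_diff A B) < d" by blast
  note [measurable] = base(1)
  have "(\<integral>z. \<bar>indicat_real A z *\<^sub>R c - indicat_real B z * c\<bar> \<partial>Q) = (\<integral>z. \<bar>c\<bar> * indicat_real (sym_diff A B) z \<partial>Q)"
    by (intro Bochner_Integration.integral_cong) (auto simp: indicator_def)
  also have "\<dots> = \<bar>c\<bar> * measure Q (sym_diff A B)" by simp
  also have "\<dots> \<le> \<bar>c\<bar> * d" using m by (intro mult_left_mono) auto
  also have "\<dots> < \<epsilon>" using base by (simp add: d_def field_simps)
  finally have "(\<integral>z. \<bar>indicat_real A z *\<^sub>R c - indicat_real B z * c\<bar> \<partial>Q) < \<epsilon>" .
  moreover have "integrable Q (\<lambda>z. indicat_real B z * c)"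
    by (intro integrable_mult_left Q.integrable_const_bound[where B=1]) auto
  moreover have "depends_first N (space Q) (\<lambda>z. indicat_real B z * c)"
    using depends_first_comp2[OF dep dep, of "\<lambda>b _. of_bool b * c"] by (simp add: indicator_def)
  ultimately show ?case by blast
next
  case (add f g)
  from add.IH(1)[of "\<epsilon>/2"] obtain N \<phi> where a: "integrable Q \<phi>" "depends_first N (space Q) \<phi>" "(\<integral>z. \<bar>f z - \<phi> z\<bar> \<partial>Q) < \<epsilon>/2"
    using add.prems by auto
  from add.IH(2)[of "\<epsilon>/2"] obtain N' \<phi>' where b: "integrable Q \<phi>'" "depends_first N' (space Q) \<phi>'" "(\<integral>z. \<bar>g z - \<phi>' z\<bar> \<partial>Q) < \<epsilon>/2"
    using add.prems by auto
  have "depends_first (max N N') (space Q) (\<lambda>z. \<phi> z + \<phi>' z)"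
    by (rule depends_first_comp2[where h = "(+)", OF depends_first_mono[OF a(2)] depends_first_mono[OF b(2)]]) auto
  moreover have "(\<integral>z. \<bar>(f z + g z) - (\<phi> z + \<phi>' z)\<bar> \<partial>Q) \<le> (\<integral>z. \<bar>f z - \<phi> z\<bar> + \<bar>g z - \<phi>' z\<bar> \<partial>Q)"
    using add.hyps a b by (intro integral_mono) auto
  moreover have "\<dots> = (\<integral>z. \<bar>f z - \<phi> z\<bar> \<partial>Q) + (\<integral>z. \<bar>g z - \<phi>' z\<bar> \<partial>Q)"
    using add.hyps a b by (intro Bochner_Integration.integral_add) auto
  ultimately have "(\<integral>z. \<bar>(f z + g z) - (\<phi> z + \<phi>' z)\<bar> \<partial>Q) < \<epsilon>"
      "depends_first (max N N') (space Q) (\<lambda>z. \<phi> z + \<phi>' z)" using a b by auto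
  moreover have "integrable Q (\<lambda>z. \<phi> z + \<phi>' z)" using a b by auto
  ultimately show ?case by blast
next
  case (lim f s)
  have "(\<lambda>i. \<integral>z. \<bar>f z - s i z\<bar> \<partial>Q) \<longlonglongrightarrow> (\<integral>z. 0 \<partial>Q)"
  proof (rule integral_dominated_convergence)
    show "integrable Q (\<lambda>z. 3 * \<bar>f z\<bar>)" using lim by auto
    show "AE z in Q. (\<lambda>i. \<bar>f z - s i z\<bar>) \<longlonglongrightarrow> 0"
    proof (rule AE_I2)
      fix z assume "z \<in> space Q"
      then have "(\<lambda>i. \<bar>f z - s i z\<bar>) \<longlonglongrightarrow> \<bar>f z - f z\<bar>"
        by (intro tendsto_intros lim)
      then show "(\<lambda>i. \<bar>f z - s i z\<bar>) \<longlonglongrightarrow> 0" by simp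
    qed
    show "AE z in Q. norm \<bar>f z - s i z\<bar> \<le> 3 * \<bar>f z\<bar>" for i
    proof (rule AE_I2)
      fix z assume "z \<in> space Q"
      then show "norm \<bar>f z - s i z\<bar> \<le> 3 * \<bar>f z\<bar>" using lim(3)[of z i] by simp
    qed
  qed (use lim in auto)
  then have "eventually (\<lambda>i. (\<integral>z. \<bar>f z - s i z\<bar> \<partial>Q) < \<epsilon> / 2) sequentially"
    using lim.prems by (intro order_tendstoD(2)) auto
  then obtain i where i: "(\<integral>z. \<bar>f z - s i z\<bar> \<partial>Q) < \<epsilon> / 2" by (auto simp: eventually_sequentially)
  from lim.IH[of "\<epsilon>/2" i] obtain N \<phi> where a: "integrable Q \<phi>" "depends_first N (space Q) \<phi>" "(\<integral>z. \<bar>s i z - \<phi> z\<bar> \<partial>Q) < \<epsilon>/2"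
    using lim.prems by auto
  have "(\<integral>z. \<bar>f z - \<phi> z\<bar> \<partial>Q) \<le> (\<integral>z. \<bar>f z - s i z\<bar> + \<bar>s i z - \<phi> z\<bar> \<partial>Q)"
    using lim.hyps a by (intro integral_mono) auto
  also have "\<dots> = (\<integral>z. \<bar>f z - s i z\<bar> \<partial>Q) + (\<integral>z. \<bar>s i z - \<phi> z\<bar> \<partial>Q)"
    using lim.hyps a by (intro Bochner_Integration.integral_add) auto
  finally have "(\<integral>z. \<bar>f z - \<phi> z\<bar> \<partial>Q) < \<epsilon>" using a i by linarith
  then show ?case using a by blast
qed

lemma upd_measurable [measurable]: "(\<lambda>(s, z). z(k := s)) \<in> measurable (\<mu> \<Otimes>\<^sub>M Q) Q"
  unfolding Q_def split_beta'
proof (rule measurable_PiM_single')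
  fix i :: nat
  show "(\<lambda>x. ((snd x)(k := fst x)) i) \<in> measurable (\<mu> \<Otimes>\<^sub>M (\<Pi>\<^sub>M j\<in>UNIV. \<mu>)) \<mu>"
    by (cases "i = k") auto
qed (auto simp: space_pair_measure space_PiM)

lemma distr_upd: "distr (\<mu> \<Otimes>\<^sub>M Q) Q (\<lambda>(s, z). z(k := s)) = Q"
  using distr_pair_PiM_eq_PiM[of "UNIV::nat set" "\<lambda>_. \<mu>" k] mu by (simp add: Q_def)

text \<open>
  If resampling coordinate \<open>k\<close> moves \<open>F\<close> by \<open>\<delta>\<close> on average, then some value \<open>s\<close> does at most
  as badly as the average over \<open>s\<close>, and \<open>\<phi>\<close> with coordinate \<open>k\<close> frozen at \<open>s\<close> is almost as good
  an approximation of \<open>F\<close> as \<open>\<phi>\<close>. Freezing a coordinate avoids conditional expectations. The slack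
  \<open>\<eta>\<close> allows an argument by contradiction without attaining an infimum.
\<close>
lemma freeze_coordinate:
  fixes F \<phi> :: "(nat \<Rightarrow> 's) \<Rightarrow> real"
  assumes [measurable]: "F \<in> borel_measurable Q" "\<phi> \<in> borel_measurable Q"
    and d: "(\<integral>\<^sup>+ z. (\<integral>\<^sup>+ s. ennreal \<bar>F z - F (z(k := s))\<bar> \<partial>\<mu>) \<partial>Q) \<le> ennreal \<delta>"
    and e: "(\<integral>\<^sup>+ z. ennreal \<bar>F z - \<phi> z\<bar> \<partial>Q) \<le> ennreal e"
    and pos: "0 \<le> \<delta>" "0 \<le> e" "0 < \<eta>"
  shows "\<exists>s\<in>space \<mu>. (\<integral>\<^sup>+ z. ennreal \<bar>F z - \<phi> (z(k := s))\<bar> \<partial>Q) \<le> ennreal (\<delta> + e + \<eta>)"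
proof (rule ccontr)
  assume "\<not> ?thesis"
  then have ge: "ennreal (\<delta> + e + \<eta>) \<le> (\<integral>\<^sup>+ z. ennreal \<bar>F z - \<phi> (z(k := s))\<bar> \<partial>Q)" if "s \<in> space \<mu>" for s
    using that by (meson linorder_not_le order_less_imp_le)
  interpret pair_sigma_finite \<mu> Q ..
  have m1: "(\<lambda>(s, z). ennreal \<bar>F z - \<phi> (z(k := s))\<bar>) \<in> borel_measurable (\<mu> \<Otimes>\<^sub>M Q)"
    using measurable_compose[OF upd_measurable[of k] assms(2)] by (simp add: split_beta') measurable
  have m2: "(\<lambda>(s, z). ennreal \<bar>F z - F (z(k := s))\<bar>) \<in> borel_measurable (\<mu> \<Otimes>\<^sub>M Q)"
    using measurable_compose[OF upd_measurable[of k] assms(1)] by (simp add: split_beta') measurable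
  have m3: "(\<lambda>(s, z). ennreal \<bar>F (z(k := s)) - \<phi> (z(k := s))\<bar>) \<in> borel_measurable (\<mu> \<Otimes>\<^sub>M Q)"
    using measurable_compose[OF upd_measurable[of k] assms(1)] measurable_compose[OF upd_measurable[of k] assms(2)]
    by (simp add: split_beta') measurable
  have "ennreal (\<delta> + e + \<eta>) = (\<integral>\<^sup>+ s. ennreal (\<delta> + e + \<eta>) \<partial>\<mu>)"
    by (simp add: mu.emeasure_space_1)
  also have "\<dots> \<le> (\<integral>\<^sup>+ s. (\<integral>\<^sup>+ z. ennreal \<bar>F z - \<phi> (z(k := s))\<bar> \<partial>Q) \<partial>\<mu>)"
    by (intro nn_integral_mono ge) auto
  also have "\<dots> = (\<integral>\<^sup>+ x. (case x of (s, z) \<Rightarrow> ennreal \<bar>F z - \<phi> (z(k := s))\<bar>) \<partial>(\<mu> \<Otimes>\<^sub>M Q))"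
    using Q.nn_integral_fst[OF m1] by simp
  also have "\<dots> \<le> (\<integral>\<^sup>+ x. (case x of (s, z) \<Rightarrow> ennreal \<bar>F z - F (z(k := s))\<bar>)
        + (case x of (s, z) \<Rightarrow> ennreal \<bar>F (z(k := s)) - \<phi> (z(k := s))\<bar>) \<partial>(\<mu> \<Otimes>\<^sub>M Q))"
    by (intro nn_integral_mono) (auto simp: ennreal_plus[symmetric] simp del: ennreal_plus intro!: ennreal_leI)
  also have "\<dots> = (\<integral>\<^sup>+ x. (case x of (s, z) \<Rightarrow> ennreal \<bar>F z - F (z(k := s))\<bar>) \<partial>(\<mu> \<Otimes>\<^sub>M Q))
      + (\<integral>\<^sup>+ x. (case x of (s, z) \<Rightarrow> ennreal \<bar>F (z(k := s)) - \<phi> (z(k := s))\<bar>) \<partial>(\<mu> \<Otimes>\<^sub>M Q))"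
    by (intro nn_integral_add m2 m3)
  also have "(\<integral>\<^sup>+ x. (case x of (s, z) \<Rightarrow> ennreal \<bar>F z - F (z(k := s))\<bar>) \<partial>(\<mu> \<Otimes>\<^sub>M Q)) =
      (\<integral>\<^sup>+ z. (\<integral>\<^sup>+ s. ennreal \<bar>F z - F (z(k := s))\<bar> \<partial>\<mu>) \<partial>Q)"
    using nn_integral_snd[OF m2] by simp
  also have "(\<integral>\<^sup>+ x. (case x of (s, z) \<Rightarrow> ennreal \<bar>F (z(k := s)) - \<phi> (z(k := s))\<bar>) \<partial>(\<mu> \<Otimes>\<^sub>M Q)) =
      (\<integral>\<^sup>+ z. ennreal \<bar>F z - \<phi> z\<bar> \<partial>distr (\<mu> \<Otimes>\<^sub>M Q) Q (\<lambda>(s, z). z(k := s)))"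
    by (subst nn_integral_distr) (auto simp: split_beta')
  also have "\<dots> = (\<integral>\<^sup>+ z. ennreal \<bar>F z - \<phi> z\<bar> \<partial>Q)" by (simp only: distr_upd)
  also have "(\<integral>\<^sup>+ z. (\<integral>\<^sup>+ s. ennreal \<bar>F z - F (z(k := s))\<bar> \<partial>\<mu>) \<partial>Q) + \<dots> \<le> ennreal \<delta> + ennreal e"
    by (intro add_mono d e)
  also have "\<dots> = ennreal (\<delta> + e)" using pos by simp
  finally show False using pos by (simp add: ennreal_le_iff del: ennreal_plus)
qed

text \<open>
  Start from any cylinder approximation and freeze its coordinates beyond \<open>m\<close> one at a time, the
  last one first. Each step costs \<open>c \<rho>\<^sup>k\<close> plus an equally small slack, and the total is a geometric
  tail. In this way a bound on the effect of single coordinates becomes approximation by a function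
  of the first \<open>m\<close> coordinates.
\<close>
lemma finite_dependence_approx:
  fixes F :: "(nat \<Rightarrow> 's) \<Rightarrow> real"
  assumes F: "integrable Q F" and rho: "0 < \<rho>" "\<rho> < 1" and c: "0 \<le> c"
    and d: "\<And>k. (\<integral>\<^sup>+ z. (\<integral>\<^sup>+ s. ennreal \<bar>F z - F (z(k := s))\<bar> \<partial>\<mu>) \<partial>Q) \<le> ennreal (c * \<rho> ^ k)"
  shows "\<exists>\<phi>. \<phi> \<in> borel_measurable Q \<and> depends_first m (space Q) \<phi>
     \<and> (\<integral>\<^sup>+ z. ennreal \<bar>F z - \<phi> z\<bar> \<partial>Q) \<le> ennreal ((1 + (c + 1) / (1 - \<rho>)) * \<rho> ^ m)"
proof -
  have [measurable]: "F \<in> borel_measurable Q" using F by auto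
  define r where "r = \<rho> ^ m"
  have rm: "0 < r" using rho by (simp add: r_def)
  obtain N \<phi>0 where p0: "integrable Q \<phi>0" "depends_first N (space Q) \<phi>0" "(\<integral>z. \<bar>F z - \<phi>0 z\<bar> \<partial>Q) < r"
    using cylinder_approx[OF F rm] by blast
  have p0': "(\<integral>\<^sup>+ z. ennreal \<bar>F z - \<phi>0 z\<bar> \<partial>Q) \<le> ennreal r"
    using p0 F by (subst nn_integral_eq_integral) (auto intro!: ennreal_leI)
  have pos: "0 \<le> (c + 1) / (1 - \<rho>)" using c rho by auto
  show ?thesis
  proof (cases "N \<le> m")
    case True
    have "ennreal r \<le> ennreal ((1 + (c + 1) / (1 - \<rho>)) * \<rho> ^ m)"
      unfolding r_def[symmetric] using mult_right_mono[OF _ less_imp_le[OF rm], of 1 "1 + (c + 1) / (1 - \<rho>)"] pos by (intro ennreal_leI) simp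
    then show ?thesis using p0 p0' depends_first_mono[OF p0(2) True]
      by (intro exI[of _ \<phi>0]) (auto intro: order.trans)
  next
    case False
    then have "m \<le> N" by simp
    then have "\<exists>\<phi>. \<phi> \<in> borel_measurable Q \<and> depends_first m (space Q) \<phi> \<and>
       (\<integral>\<^sup>+ z. ennreal \<bar>F z - \<phi> z\<bar> \<partial>Q) \<le> ennreal (r + (\<Sum>k=m..<N. (c + 1) * \<rho> ^ k))"
    proof (induction rule: inc_induct)
      case base
      then show ?case using p0 p0' by (intro exI[of _ \<phi>0]) auto
    next
      case (step n)
      then obtain \<phi> where [measurable]: "\<phi> \<in> borel_measurable Q" and dep: "depends_first (Suc n) (space Q) \<phi>"
        and le: "(\<integral>\<^sup>+ z. ennreal \<bar>F z - \<phi> z\<bar> \<partial>Q) \<le> ennreal (r + (\<Sum>k=Suc n..<N. (c + 1) * \<rho> ^ k))"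
        by blast
      have "0 \<le> (\<Sum>k=Suc n..<N. (c + 1) * \<rho> ^ k)" using c rho by (intro sum_nonneg) auto
      with rm have nn: "0 \<le> r + (\<Sum>k=Suc n..<N. (c + 1) * \<rho> ^ k)" by simp
      obtain s where s: "s \<in> space \<mu>" and
        le2: "(\<integral>\<^sup>+ z. ennreal \<bar>F z - \<phi> (z(n := s))\<bar> \<partial>Q)
          \<le> ennreal (c * \<rho> ^ n + (r + (\<Sum>k=Suc n..<N. (c + 1) * \<rho> ^ k)) + \<rho> ^ n)"
        using freeze_coordinate[OF _ _ d le _ nn, where \<eta> = "\<rho> ^ n"] c rho by auto
      have mm: "(\<lambda>z. z(n := s)) \<in> measurable Q Q"
        using measurable_compose[OF measurable_Pair1' [OF s] upd_measurable[of n]] by simp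
      have "depends_first n (space Q) (\<lambda>z. \<phi> (z(n := s)))"
        unfolding depends_first_def
      proof safe
        fix z z' assume z: "z \<in> space Q" "z' \<in> space Q" and eq: "\<forall>k<n. z k = z' k"
        have "z(n := s) \<in> space Q" "z'(n := s) \<in> space Q" using mm z by (auto dest: measurable_space)
        moreover have "\<forall>k<Suc n. (z(n := s)) k = (z'(n := s)) k" using eq by (auto simp: less_Suc_eq)
        ultimately show "\<phi> (z(n := s)) = \<phi> (z'(n := s))" using dep unfolding depends_first_def by blast
      qed
      moreover have "(\<lambda>z. \<phi> (z(n := s))) \<in> borel_measurable Q"
        using mm by (rule measurable_compose) measurable
      moreover have "c * \<rho> ^ n + (r + (\<Sum>k=Suc n..<N. (c + 1) * \<rho> ^ k)) + \<rho> ^ n = r + (\<Sum>k=n..<N. (c + 1) * \<rho> ^ k)"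
        using step.hyps by (simp add: sum.atLeast_Suc_lessThan algebra_simps)
      ultimately have le3: "(\<integral>\<^sup>+ z. ennreal \<bar>F z - \<phi> (z(n := s))\<bar> \<partial>Q)
          \<le> ennreal (r + (\<Sum>k=n..<N. (c + 1) * \<rho> ^ k))" using le2 by (simp only:)
      show ?case
        by (rule exI[of _ "\<lambda>z. \<phi> (z(n := s))"], intro conjI) fact+
    qed
    moreover have "r + (\<Sum>k=m..<N. (c + 1) * \<rho> ^ k) \<le> (1 + (c + 1) / (1 - \<rho>)) * \<rho> ^ m"
    proof -
      have "(\<Sum>k=m..<N. \<rho> ^ k) \<le> \<rho> ^ m / (1 - \<rho>)"
      proof -
        obtain N' where N': "N = Suc N'" using False by (cases N) auto
        have "(1 - \<rho>) * (\<Sum>k=m..N'. \<rho> ^ k) = \<rho> ^ m - \<rho> ^ Suc N'"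
          using False N' by (intro sum_gp_multiplied) auto
        also have "\<dots> \<le> \<rho> ^ m" using rho by simp
        finally show ?thesis using rho
          by (simp add: N' atLeastLessThanSuc_atLeastAtMost pos_le_divide_eq mult.commute)
      qed
      then have "(c + 1) * (\<Sum>k=m..<N. \<rho> ^ k) \<le> (c + 1) * (\<rho> ^ m / (1 - \<rho>))"
        using c by (intro mult_left_mono) auto
      then show ?thesis by (simp add: sum_distrib_left algebra_simps r_def)
    qed
    ultimately show ?thesis by (meson ennreal_leI order.trans)
  qed
qed

end

section \<open>Bernstein's inequality\<close>

lemma exp_le_quadratic:
  fixes x :: real
  assumes "\<bar>x\<bar> \<le> 1"
  shows "exp x \<le> 1 + x + x\<^sup>2"
proof (cases "0 \<le> x")
  case True
  then show ?thesis using assms by (intro exp_bound) auto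
next
  case False
  define y where "y = - x"
  have y: "0 \<le> y" "y \<le> 1" using False assms by (auto simp: y_def)
  have low: "1 + y + y\<^sup>2 / 2 \<le> exp y" using y by (intro exp_lower_Taylor_quadratic)
  have "1 \<le> 1 + y\<^sup>2 / 2 + y ^ 3 / 2 + y ^ 4 / 2" using y by simp
  also have "\<dots> = (1 - y + y\<^sup>2) * (1 + y + y\<^sup>2 / 2)"
    by (simp add: field_simps power2_eq_square power3_eq_cube power4_eq_xxxx)
  also have "\<dots> \<le> (1 - y + y\<^sup>2) * exp y"
    using low y by (intro mult_left_mono) (auto intro: add_nonneg_nonneg)
  finally have "1 / exp y \<le> 1 - y + y\<^sup>2" by (simp add: field_simps)
  then show ?thesis by (simp add: y_def exp_minus field_simps)
qed

text \<open>
  Only the Gaussian regime is needed: for \<open>b y \<le> 2 V\<close> the optimal parameter \<open>y / (2 V)\<close> of the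
  exponential moment keeps the exponent at most 1 in absolute value, where \<open>exp\<close> is dominated
  by a quadratic.
\<close>
lemma (in prob_space) Bernstein_inequality:
  fixes X :: "'i \<Rightarrow> 'a \<Rightarrow> real"
  assumes J: "finite J" and ind: "indep_vars (\<lambda>_. borel) X J"
    and bd: "\<And>j \<omega>. j \<in> J \<Longrightarrow> \<omega> \<in> space M \<Longrightarrow> \<bar>X j \<omega>\<bar> \<le> b"
    and mean: "\<And>j. j \<in> J \<Longrightarrow> expectation (X j) = 0"
    and var: "(\<Sum>j\<in>J. expectation (\<lambda>\<omega>. (X j \<omega>)\<^sup>2)) \<le> V"
    and V: "0 < V" and y: "0 \<le> y" and by2: "b * y \<le> 2 * V"
  shows "prob {\<omega> \<in> space M. y \<le> (\<Sum>j\<in>J. X j \<omega>)} \<le> exp (- y\<^sup>2 / (4 * V))"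
proof -
  define l where "l = y / (2 * V)"
  have l: "0 \<le> l" using y V by (simp add: l_def)
  have meas[measurable]: "X j \<in> borel_measurable M" if "j \<in> J" for j
    using ind that by (auto simp: indep_vars_def)
  have lb: "l * b \<le> 1" using by2 V by (simp add: l_def field_simps)
  have lX: "\<bar>l * X j \<omega>\<bar> \<le> 1" if "j \<in> J" "\<omega> \<in> space M" for j \<omega>
    using mult_left_mono[OF bd[OF that] l] lb l by (simp add: abs_mult)
  have intX: "integrable M (X j)" if "j \<in> J" for j
    using that bd by (intro integrable_const_bound[where B=b] AE_I2) auto
  have intX2: "integrable M (\<lambda>\<omega>. (X j \<omega>)\<^sup>2)" if "j \<in> J" for j
  proof (intro integrable_const_bound[where B="b\<^sup>2"] AE_I2)
    fix \<omega> assume "\<omega> \<in> space M"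
    then have "\<bar>X j \<omega>\<bar> \<le> b" using bd that by auto
    then have "\<bar>X j \<omega>\<bar>\<^sup>2 \<le> b\<^sup>2" by (intro power_mono) auto
    then show "norm ((X j \<omega>)\<^sup>2) \<le> b\<^sup>2" by simp
  qed (use that in measurable)
  have intE: "integrable M (\<lambda>\<omega>. exp (l * X j \<omega>))" if "j \<in> J" for j
  proof (intro integrable_const_bound[where B="exp 1"] AE_I2)
    fix \<omega> assume "\<omega> \<in> space M"
    then show "norm (exp (l * X j \<omega>)) \<le> exp 1" using lX[OF that, of \<omega>] by (simp add: abs_le_iff)
  qed (use that in measurable)
  have indE: "indep_vars (\<lambda>_. borel) (\<lambda>j \<omega>. exp (l * X j \<omega>)) J"
    using indep_vars_compose2[OF ind, of "\<lambda>_ x. exp (l * x)" "\<lambda>_. borel"] by simp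
  have mgf: "expectation (\<lambda>\<omega>. exp (l * X j \<omega>)) \<le> exp (l\<^sup>2 * expectation (\<lambda>\<omega>. (X j \<omega>)\<^sup>2))" if "j \<in> J" for j
  proof -
    have "expectation (\<lambda>\<omega>. exp (l * X j \<omega>)) \<le> expectation (\<lambda>\<omega>. 1 + l * X j \<omega> + l\<^sup>2 * (X j \<omega>)\<^sup>2)"
    proof (rule integral_mono[OF intE[OF that]])
      show "integrable M (\<lambda>\<omega>. 1 + l * X j \<omega> + l\<^sup>2 * (X j \<omega>)\<^sup>2)"
        using intX[OF that] intX2[OF that] by auto
      show "exp (l * X j \<omega>) \<le> 1 + l * X j \<omega> + l\<^sup>2 * (X j \<omega>)\<^sup>2" if "\<omega> \<in> space M" for \<omega>
        using exp_le_quadratic[OF lX[OF \<open>j \<in> J\<close> that]] by (simp add: power_mult_distrib)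
    qed
    also have "\<dots> = 1 + l\<^sup>2 * expectation (\<lambda>\<omega>. (X j \<omega>)\<^sup>2)"
      using intX[OF that] intX2[OF that] mean[OF that] by (simp add: prob_space)
    also have "\<dots> \<le> exp (l\<^sup>2 * expectation (\<lambda>\<omega>. (X j \<omega>)\<^sup>2))" by (rule exp_ge_add_one_self)
    finally show ?thesis .
  qed
  have prodE: "(\<lambda>\<omega>. exp (l * (\<Sum>j\<in>J. X j \<omega>))) = (\<lambda>\<omega>. \<Prod>j\<in>J. exp (l * X j \<omega>))"
    by (simp add: sum_distrib_left exp_sum J)
  have int_prod: "integrable M (\<lambda>\<omega>. exp (l * (\<Sum>j\<in>J. X j \<omega>)))"
    unfolding prodE by (intro indep_vars_integrable J indE intE)
  have meS: "(\<lambda>\<omega>. \<Sum>j\<in>J. X j \<omega>) \<in> borel_measurable M" by (intro borel_measurable_sum meas)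
  have "expectation (\<lambda>\<omega>. exp (l * (\<Sum>j\<in>J. X j \<omega>))) = (\<Prod>j\<in>J. expectation (\<lambda>\<omega>. exp (l * X j \<omega>)))"
    unfolding prodE by (intro indep_vars_lebesgue_integral J indE intE)
  also have "\<dots> \<le> (\<Prod>j\<in>J. exp (l\<^sup>2 * expectation (\<lambda>\<omega>. (X j \<omega>)\<^sup>2)))"
    by (intro prod_mono conjI mgf integral_nonneg_AE) auto
  also have "\<dots> = exp (l\<^sup>2 * (\<Sum>j\<in>J. expectation (\<lambda>\<omega>. (X j \<omega>)\<^sup>2)))"
    by (simp add: sum_distrib_left exp_sum J)
  also have "\<dots> \<le> exp (l\<^sup>2 * V)" using var by (simp add: mult_left_mono)
  finally have E: "expectation (\<lambda>\<omega>. exp (l * (\<Sum>j\<in>J. X j \<omega>))) \<le> exp (l\<^sup>2 * V)" .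
  let ?A = "{\<omega> \<in> space M. y \<le> (\<Sum>j\<in>J. X j \<omega>)}"
  have A: "?A \<in> sets M" using meS by measurable
  have "prob ?A = expectation (indicator ?A)" using A by simp
  also have "\<dots> \<le> expectation (\<lambda>\<omega>. exp (- l * y) * exp (l * (\<Sum>j\<in>J. X j \<omega>)))"
  proof (intro integral_mono integrable_mult_right int_prod)
    show "integrable M (indicat_real ?A)" using A by (intro integrable_real_indicator) (auto simp: emeasure_eq_measure)
    fix \<omega> assume "\<omega> \<in> space M"
    have "0 \<le> l * ((\<Sum>j\<in>J. X j \<omega>) - y)" if "y \<le> (\<Sum>j\<in>J. X j \<omega>)" using that l by simp
    then show "indicat_real ?A \<omega> \<le> exp (- l * y) * exp (l * (\<Sum>j\<in>J. X j \<omega>))"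
      by (auto simp: indicator_def exp_add[symmetric] algebra_simps)
  qed
  also have "\<dots> = exp (- l * y) * expectation (\<lambda>\<omega>. exp (l * (\<Sum>j\<in>J. X j \<omega>)))" by simp
  also have "\<dots> \<le> exp (- l * y) * exp (l\<^sup>2 * V)" by (intro mult_left_mono E) auto
  also have "\<dots> = exp (- y\<^sup>2 / (4 * V))"
    using V by (simp add: exp_add[symmetric] l_def field_simps power2_eq_square)
  finally show ?thesis .
qed

section \<open>Riemann sums\<close>

text \<open>
  On each of the \<open>J\<close> cells the integrand deviates from its left value by at most \<open>L \<delta>\<close>.
\<close>
lemma Riemann_sum_error:
  fixes f :: "real \<Rightarrow> real"
  assumes lip: "L-lipschitz_on UNIV f" and supp: "\<And>x. f x \<noteq> 0 \<Longrightarrow> \<bar>x\<bar> \<le> 1 / 2"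
    and d: "0 < \<delta>" and x0: "x0 \<le> - 1 / 2" and xJ: "1 / 2 \<le> x0 + real J * \<delta>"
  shows "\<bar>\<delta> * (\<Sum>j<J. f (x0 + real j * \<delta>)) - (\<integral>x. f x \<partial>lborel)\<bar> \<le> L * real J * \<delta>\<^sup>2"
proof -
  have cont: "continuous_on A f" for A
    using lip by (meson continuous_on_subset lipschitz_on_continuous_on subset_UNIV)
  have intf: "f integrable_on {a..b}" for a b by (intro integrable_continuous_real cont)
  have L0: "0 \<le> L" using lip by (rule lipschitz_on_nonneg)
  have cell: "\<bar>integral {p..p + \<delta>} f - \<delta> * f p\<bar> \<le> L * \<delta>\<^sup>2" for p
  proof -
    have "integral {p..p + \<delta>} f - \<delta> * f p = integral {p..p + \<delta>} (\<lambda>x. f x - f p)"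
      using d intf by (subst Henstock_Kurzweil_Integration.integral_diff) auto
    moreover have "norm (integral {p..p + \<delta>} (\<lambda>x. f x - f p)) \<le> (L * \<delta>) * (p + \<delta> - p)"
    proof (rule integral_bound)
      show "continuous_on {p..p + \<delta>} (\<lambda>x. f x - f p)" by (intro continuous_intros cont)
      fix t assume t: "t \<in> {p..p + \<delta>}"
      have "dist (f t) (f p) \<le> L * dist t p" using lip by (auto simp: lipschitz_on_def)
      also have "\<dots> \<le> L * \<delta>" using t L0 by (intro mult_left_mono) (auto simp: dist_real_def)
      finally show "norm (f t - f p) \<le> L * \<delta>" by (simp add: dist_norm)
    qed (use d in auto)
    ultimately show ?thesis by (simp add: power2_eq_square algebra_simps)
  qed
  have ind: "\<bar>\<delta> * (\<Sum>j<k. f (x0 + real j * \<delta>)) - integral {x0..x0 + real k * \<delta>} f\<bar> \<le> L * real k * \<delta>\<^sup>2" for k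
  proof (induction k)
    case (Suc k)
    define p where "p = x0 + real k * \<delta>"
    have "integral {x0..p} f + integral {p..p + \<delta>} f = integral {x0..p + \<delta>} f"
      using d by (intro Henstock_Kurzweil_Integration.integral_combine intf) (auto simp: p_def)
    moreover have "p + \<delta> = x0 + real (Suc k) * \<delta>" by (simp add: p_def algebra_simps)
    ultimately show ?case using Suc cell[of p] by (simp add: p_def[symmetric] algebra_simps)
  qed simp
  let ?S = "{x0..x0 + real J * \<delta>}"
  have "(\<integral>x. f x \<partial>lborel) = (\<integral>x. indicator ?S x *\<^sub>R f x \<partial>lborel)"
  proof (intro Bochner_Integration.integral_cong refl)
    fix x show "f x = indicator ?S x *\<^sub>R f x"
      using supp[of x] x0 xJ by (cases "f x = 0") (auto simp: indicator_def abs_le_iff)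
  qed
  also have "\<dots> = integral ?S f"
    using set_borel_integral_eq_integral(2)[OF borel_integrable_atLeastAtMost'[OF cont]]
    by (simp add: set_lebesgue_integral_def)
  finally show ?thesis using ind[of J] by simp
qed

section \<open>Functionals of the past of an i.i.d. sequence\<close>

lemma (in prob_space) indep_vars_cong_space:
  assumes "\<And>i \<omega>. i \<in> I \<Longrightarrow> \<omega> \<in> space M \<Longrightarrow> X i \<omega> = Y i \<omega>"
  shows "indep_vars M' X I \<longleftrightarrow> indep_vars M' Y I"
proof -
  have "X i -` A \<inter> space M = Y i -` A \<inter> space M" if "i \<in> I" for i A
    using assms that by auto
  then show ?thesis
    unfolding indep_vars_def2 using assms
    by (intro conj_cong ball_cong indep_sets_cong refl measurable_cong) auto
qed

text \<open>
  \<open>\<mu>\<close> is the law of one innovation and \<open>Q\<close> the law of the whole past, which is the same at every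
  time. Statements about the process thereby become statements about functions on a product space.
\<close>
locale iid_seq = prob_space P for P :: "'w measure" +
  fixes S :: "'s measure" and \<zeta> :: "int \<Rightarrow> 'w \<Rightarrow> 's"
  assumes indep: "indep_vars (\<lambda>_. S) \<zeta> UNIV"
    and ident: "distr P S (\<zeta> t) = distr P S (\<zeta> 0)"
begin

definition "\<mu> = distr P S (\<zeta> 0)"
definition "Q = (\<Pi>\<^sub>M j\<in>(UNIV::nat set). \<mu>)"

lemma \<zeta>_measurable [measurable]: "\<zeta> t \<in> measurable P S"
  using indep by (auto simp: indep_vars_def)

lemma prob_space_\<mu>: "prob_space \<mu>"
  unfolding \<mu>_def by (intro prob_space_distr) measurable

lemma prob_space_Q: "prob_space Q"
  unfolding Q_def by (intro prob_space_PiM prob_space_\<mu>)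

lemma sets_\<mu> [measurable_cong]: "sets \<mu> = sets S"
  by (simp add: \<mu>_def)

lemma space_\<mu>: "space \<mu> = space S"
  by (simp add: \<mu>_def)

lemma sets_Q [measurable_cong]: "sets Q = sets (\<Pi>\<^sub>M j\<in>(UNIV::nat set). S)"
  unfolding Q_def by (intro sets_PiM_cong) (auto simp: sets_\<mu>)

lemma past_measurable [measurable]: "past \<zeta> t \<in> measurable P Q"
  unfolding past_def Q_def
  by (rule measurable_PiM_single') (auto simp: space_\<mu> dest: measurable_space[OF \<zeta>_measurable])

text \<open>
  Injectivity is what makes any selection of the innovations again i.i.d.; it is applied to the
  past and to shifts of the whole sequence.
\<close>
lemma distr_index:
  fixes f :: "'i \<Rightarrow> int"
  assumes "inj f"
  shows "distr P (\<Pi>\<^sub>M j\<in>UNIV. S) (\<lambda>\<omega> j. \<zeta> (f j) \<omega>) = (\<Pi>\<^sub>M j\<in>UNIV. \<mu>)"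
proof -
  let ?Z = "\<Pi>\<^sub>M i\<in>(UNIV::int set). S"
  have eq: "(\<Pi>\<^sub>M i\<in>(UNIV::int set). distr P S (\<zeta> i)) = (\<Pi>\<^sub>M i\<in>(UNIV::int set). \<mu>)"
    unfolding \<mu>_def by (intro PiM_cong refl ident)
  have D: "distr P ?Z (\<lambda>\<omega> i. \<zeta> i \<omega>) = (\<Pi>\<^sub>M i\<in>(UNIV::int set). \<mu>)"
    using indep by (subst (asm) indep_vars_iff_distr_eq_PiM') (auto simp: eq restrict_def)
  have seq: "(\<lambda>\<omega> i. \<zeta> i \<omega>) \<in> measurable P ?Z"
    by (rule measurable_PiM_single') (auto dest: measurable_space[OF \<zeta>_measurable])
  have me: "(\<lambda>x j. x (f j)) \<in> measurable ?Z (\<Pi>\<^sub>M j\<in>UNIV. S)"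
    by (rule measurable_PiM_single') (auto simp: space_PiM)
  have "distr P (\<Pi>\<^sub>M j\<in>UNIV. S) (\<lambda>\<omega> j. \<zeta> (f j) \<omega>) =
      distr (distr P ?Z (\<lambda>\<omega> i. \<zeta> i \<omega>)) (\<Pi>\<^sub>M j\<in>UNIV. S) (\<lambda>x j. x (f j))"
    using distr_distr[OF me seq] by (simp add: comp_def)
  also have "\<dots> = distr (\<Pi>\<^sub>M i\<in>(UNIV::int set). \<mu>) (\<Pi>\<^sub>M j\<in>UNIV. \<mu>) (\<lambda>x. \<lambda>j\<in>UNIV. x (f j))"
    unfolding D by (intro distr_cong) (auto intro!: sets_PiM_cong simp: sets_\<mu>)
  also have "\<dots> = (\<Pi>\<^sub>M j\<in>UNIV. \<mu>)"
    using assms by (intro distr_PiM_reindex prob_space_\<mu>) auto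
  finally show ?thesis .
qed

lemma distr_past: "distr P Q (past \<zeta> t) = Q"
proof -
  have "distr P Q (past \<zeta> t) = distr P (\<Pi>\<^sub>M j\<in>UNIV. S) (\<lambda>\<omega> j. \<zeta> (t - int j) \<omega>)"
    by (intro distr_cong sets_Q) (auto simp: past_def)
  also have "\<dots> = Q" unfolding Q_def by (rule distr_index) (auto simp: inj_def)
  finally show ?thesis .
qed

lemma nn_integral_past:
  assumes [measurable]: "F \<in> borel_measurable Q"
  shows "(\<integral>\<^sup>+ \<omega>. F (past \<zeta> t \<omega>) \<partial>P) = (\<integral>\<^sup>+ z. F z \<partial>Q)"
proof -
  have "(\<integral>\<^sup>+ z. F z \<partial>Q) = (\<integral>\<^sup>+ z. F z \<partial>distr P Q (past \<zeta> t))" by (simp only: distr_past)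
  then show ?thesis by (simp add: nn_integral_distr)
qed

lemma integral_past:
  fixes F :: "_ \<Rightarrow> real"
  assumes [measurable]: "F \<in> borel_measurable Q"
  shows "(\<integral>\<omega>. F (past \<zeta> t \<omega>) \<partial>P) = (\<integral>z. F z \<partial>Q)"
proof -
  have "(\<integral>z. F z \<partial>Q) = (\<integral>z. F z \<partial>distr P Q (past \<zeta> t))" by (simp only: distr_past)
  then show ?thesis by (simp add: integral_distr)
qed

lemma integrable_past:
  fixes F :: "_ \<Rightarrow> real"
  assumes "integrable Q F"
  shows "integrable P (\<lambda>\<omega>. F (past \<zeta> t \<omega>))"
proof -
  have "integrable (distr P Q (past \<zeta> t)) F" using assms by (simp add: distr_past)
  then show ?thesis using assms by (subst (asm) integrable_distr_eq) (auto intro: borel_measurable_integrable)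
qed

lemma past_in_space: "\<omega> \<in> space P \<Longrightarrow> past \<zeta> t \<omega> \<in> space Q"
  using past_measurable by (rule measurable_space)

lemma past_shift: "past \<zeta> (t - int j) \<omega> = (\<lambda>k. past \<zeta> t \<omega> (j + k))"
  by (auto simp: past_def algebra_simps)

lemma shift_measurable [measurable]: "(\<lambda>z k. z (j + k)) \<in> measurable Q Q"
  unfolding Q_def by (rule measurable_PiM_single') (auto simp: space_PiM)

lemma nn_integral_shift:
  assumes [measurable]: "F \<in> borel_measurable Q"
  shows "(\<integral>\<^sup>+ z. F (\<lambda>k. z (j + k)) \<partial>Q) = (\<integral>\<^sup>+ z. F z \<partial>Q)"
proof -
  have "(\<integral>\<^sup>+ z. F (\<lambda>k. z (j + k)) \<partial>Q) = (\<integral>\<^sup>+ \<omega>. F (\<lambda>k. past \<zeta> 0 \<omega> (j + k)) \<partial>P)"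
    by (subst nn_integral_past[of _ 0, symmetric]) auto
  also have "\<dots> = (\<integral>\<^sup>+ \<omega>. F (past \<zeta> (0 - int j) \<omega>) \<partial>P)" by (simp only: past_shift)
  also have "\<dots> = (\<integral>\<^sup>+ z. F z \<partial>Q)" by (rule nn_integral_past) measurable
  finally show ?thesis .
qed

text \<open>
  Joint stationarity: both pasts are read off from the two-sided sequence of innovations, whose law is
  invariant under shifts.
\<close>
lemma integral_two_pasts_shift:
  fixes F G :: "_ \<Rightarrow> real"
  assumes [measurable]: "F \<in> borel_measurable Q" "G \<in> borel_measurable Q"
  shows "(\<integral>\<omega>. F (past \<zeta> (s + r) \<omega>) * G (past \<zeta> (t + r) \<omega>) \<partial>P) = (\<integral>\<omega>. F (past \<zeta> s \<omega>) * G (past \<zeta> t \<omega>) \<partial>P)"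
proof -
  let ?Z = "\<Pi>\<^sub>M i\<in>(UNIV::int set). \<mu>"
  have Zs: "sets ?Z = sets (\<Pi>\<^sub>M i\<in>(UNIV::int set). S)"
    by (intro sets_PiM_cong) (auto simp: sets_\<mu>)
  have me: "(\<lambda>x k. x (t - int k)) \<in> measurable ?Z Q" for t
    unfolding Q_def by (rule measurable_PiM_single') (auto simp: space_PiM)
  have seq: "(\<lambda>\<omega> i. \<zeta> (i + r) \<omega>) \<in> measurable P ?Z" for r
    by (rule measurable_PiM_single') (auto simp: space_\<mu> dest: measurable_space[OF \<zeta>_measurable])
  have D: "distr P ?Z (\<lambda>\<omega> i. \<zeta> (i + r) \<omega>) = ?Z" for r
    using distr_index[of "\<lambda>i. i + r"] by (subst distr_cong[OF refl Zs refl]) (auto simp: inj_def)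
  have "(\<integral>\<omega>. F (past \<zeta> (s + r) \<omega>) * G (past \<zeta> (t + r) \<omega>) \<partial>P) =
     (\<integral>x. F (\<lambda>k. x (s - int k)) * G (\<lambda>k. x (t - int k)) \<partial>?Z)" for r
  proof -
    have "(\<lambda>x. F (\<lambda>k. x (s - int k)) * G (\<lambda>k. x (t - int k))) \<in> borel_measurable ?Z"
      using me by measurable
    from integral_distr[OF seq[of r] this] show ?thesis
      unfolding D by (simp add: past_def algebra_simps)
  qed
  from this[of r] this[of 0] show ?thesis by simp
qed

lemma space_S_nonempty: "space S \<noteq> {}"
  using measurable_space[OF \<zeta>_measurable] not_empty by blast

text \<open>
  A functional of the last \<open>m\<close> innovations factors through the restriction to a window of indices,
  with arbitrary values filled in outside. This is the form that independence of disjoint groups of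
  innovations requires.
\<close>
lemma window_factor:
  fixes \<phi> :: "(nat \<Rightarrow> 's) \<Rightarrow> real"
  assumes [measurable]: "\<phi> \<in> borel_measurable Q" and dep: "depends_first m (space Q) \<phi>"
    and K: "\<And>k. k < m \<Longrightarrow> t - int k \<in> K"
  shows "\<exists>f \<in> borel_measurable (\<Pi>\<^sub>M i\<in>K. S). \<forall>\<omega>\<in>space P. \<phi> (past \<zeta> t \<omega>) = f (restrict (\<lambda>i. \<zeta> i \<omega>) K)"
proof -
  obtain s0 where s0: "s0 \<in> space S" using space_S_nonempty by auto
  define r where "r = (\<lambda>x k. if k < m then x (t - int k) else s0)"
  have r: "r \<in> measurable (\<Pi>\<^sub>M i\<in>K. S) Q"
    unfolding Q_def
  proof (rule measurable_PiM_single')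
    fix i :: nat
    show "(\<lambda>x. r x i) \<in> measurable (\<Pi>\<^sub>M i\<in>K. S) \<mu>"
      using K[of i] s0 by (cases "i < m") (auto simp: r_def intro!: measurable_const simp: space_\<mu>)
  qed (use s0 PiE_mem[OF _ K] in \<open>auto simp: r_def space_\<mu> space_PiM\<close>)
  have "\<phi> (past \<zeta> t \<omega>) = \<phi> (r (restrict (\<lambda>i. \<zeta> i \<omega>) K))" if w: "\<omega> \<in> space P" for \<omega>
  proof -
    have "restrict (\<lambda>i. \<zeta> i \<omega>) K \<in> space (\<Pi>\<^sub>M i\<in>K. S)"
      using w by (auto simp: space_PiM dest: measurable_space[OF \<zeta>_measurable])
    then have "r (restrict (\<lambda>i. \<zeta> i \<omega>) K) \<in> space Q" by (rule measurable_space[OF r])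
    moreover have "past \<zeta> t \<omega> \<in> space Q" using w by (rule past_in_space)
    moreover have "\<forall>k<m. past \<zeta> t \<omega> k = r (restrict (\<lambda>i. \<zeta> i \<omega>) K) k"
      using K by (auto simp: r_def past_def)
    ultimately show ?thesis using dep unfolding depends_first_def by blast
  qed
  then show ?thesis using measurable_compose[OF r assms(1)] by (intro bexI[of _ "\<lambda>x. \<phi> (r x)"]) auto
qed

text \<open>
  Functionals with memory \<open>l\<close>, summed in blocks of length \<open>l\<close>: block \<open>j\<close> uses innovations of blocks
  \<open>j - 1\<close> and \<open>j\<close> only, so the even blocks are independent of each other, and so are the odd ones.
  The total exceeds \<open>2y\<close> only if one of the two partial sums exceeds \<open>y\<close>; two parities and two signs
  give the factor 4.
\<close>
lemma block_sum_tail: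
  fixes \<phi> :: "int \<Rightarrow> (nat \<Rightarrow> 's) \<Rightarrow> real" and c :: "int \<Rightarrow> real" and t0 :: int and l J :: nat
  defines "m t \<equiv> (\<integral>z. \<phi> t z \<partial>Q)"
  defines "B j \<omega> \<equiv> (\<Sum>t\<in>{t0 + int (j * l) ..< t0 + int (Suc j * l)}. c t * (\<phi> t (past \<zeta> t \<omega>) - m t))"
  assumes meas: "\<And>t. \<phi> t \<in> borel_measurable Q" and dep: "\<And>t. depends_first l (space Q) (\<phi> t)"
    and bd: "\<And>t z. z \<in> space Q \<Longrightarrow> \<bar>\<phi> t z\<bar> \<le> b" and cm: "\<And>t. \<bar>c t\<bar> \<le> cm"
    and V: "0 < V" and var: "(\<Sum>j<J. expectation (\<lambda>\<omega>. (B j \<omega>)\<^sup>2)) \<le> V"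
    and y: "0 \<le> y" and cond: "real l * cm * (2 * b) * y \<le> 2 * V"
  shows "prob {\<omega> \<in> space P. 2 * y \<le> \<bar>\<Sum>t\<in>{t0 ..< t0 + int (J * l)}. c t * (\<phi> t (past \<zeta> t \<omega>) - m t)\<bar>}
     \<le> 4 * exp (- y\<^sup>2 / (4 * V))"
proof -
  note [measurable] = meas
  interpret Q: prob_space Q by (rule prob_space_Q)
  have cm0: "0 \<le> cm" using cm[of 0] by linarith
  have mb: "\<bar>m t\<bar> \<le> b" for t
  proof -
    have "\<bar>m t\<bar> \<le> (\<integral>z. \<bar>\<phi> t z\<bar> \<partial>Q)" unfolding m_def by (rule integral_abs_bound)
    also have "\<dots> \<le> b" using bd by (intro Q.integral_le_const integrable_abs Q.integrable_const_bound[where B=b] AE_I2) auto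
    finally show ?thesis .
  qed
  have int_phi: "integrable P (\<lambda>\<omega>. \<phi> t (past \<zeta> t \<omega>))" for t
    using bd past_in_space by (intro integrable_const_bound[where B=b] AE_I2) auto
  have B_meas[measurable]: "B j \<in> borel_measurable P" for j unfolding B_def by measurable
  have B_bd: "\<bar>B j \<omega>\<bar> \<le> real l * cm * (2 * b)" if "\<omega> \<in> space P" for j \<omega>
  proof -
    have "\<bar>B j \<omega>\<bar> \<le> (\<Sum>t\<in>{t0 + int (j * l) ..< t0 + int (Suc j * l)}. cm * (2 * b))"
      unfolding B_def
    proof (rule order.trans[OF sum_abs], rule sum_mono)
      fix t
      have "\<bar>\<phi> t (past \<zeta> t \<omega>) - m t\<bar> \<le> 2 * b"
        using bd[OF past_in_space[OF that, of t], of t] mb[of t] by linarith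
      then show "\<bar>c t * (\<phi> t (past \<zeta> t \<omega>) - m t)\<bar> \<le> cm * (2 * b)"
        unfolding abs_mult using cm[of t] cm0 by (intro mult_mono) auto
    qed
    also have "\<dots> = real (card {t0 + int (j * l) ..< t0 + int (Suc j * l)}) * (cm * (2 * b))"
      by (rule sum_constant)
    also have "card {t0 + int (j * l) ..< t0 + int (Suc j * l)} = l" by simp
    also have "real l * (cm * (2 * b)) = real l * cm * (2 * b)" by (rule mult.assoc[symmetric])
    finally show ?thesis .
  qed
  have B_mean: "expectation (B j) = 0" for j
  proof -
    have "expectation (B j) = (\<Sum>t\<in>{t0 + int (j * l) ..< t0 + int (Suc j * l)}. c t * (expectation (\<lambda>\<omega>. \<phi> t (past \<zeta> t \<omega>)) - m t))"
      unfolding B_def using int_phi by (subst Bochner_Integration.integral_sum) (auto simp: prob_space)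
    also have "\<dots> = 0" by (simp add: integral_past m_def)
    finally show ?thesis .
  qed
  (* The innovations that enter block j. Each functional looks back over l time points, so
     block j also uses indices of block j - 1, but no earlier ones. *)
  define K where "K = (\<lambda>j::nat. {t0 + int (j * l) - int l <..< t0 + int (Suc j * l)})"
  have "\<exists>f \<in> borel_measurable (\<Pi>\<^sub>M i\<in>K j. S). \<forall>\<omega>\<in>space P. B j \<omega> = f (restrict (\<lambda>i. \<zeta> i \<omega>) (K j))" for j
  proof -
    let ?I = "{t0 + int (j * l) ..< t0 + int (Suc j * l)}"
    have "\<exists>f. f \<in> borel_measurable (\<Pi>\<^sub>M i\<in>K j. S) \<and> (\<forall>\<omega>\<in>space P. \<phi> t (past \<zeta> t \<omega>) = f (restrict (\<lambda>i. \<zeta> i \<omega>) (K j)))" if "t \<in> ?I" for t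
    proof -
      have "t - int k \<in> K j" if "k < l" for k using that \<open>t \<in> ?I\<close> by (auto simp: K_def)
      from window_factor[OF meas dep this] show ?thesis by blast
    qed
    then obtain f where f: "\<And>t. t \<in> ?I \<Longrightarrow> f t \<in> borel_measurable (\<Pi>\<^sub>M i\<in>K j. S)"
      "\<And>t \<omega>. t \<in> ?I \<Longrightarrow> \<omega> \<in> space P \<Longrightarrow> \<phi> t (past \<zeta> t \<omega>) = f t (restrict (\<lambda>i. \<zeta> i \<omega>) (K j))"
      by metis
    show ?thesis
    proof (intro bexI[of _ "\<lambda>x. \<Sum>t\<in>?I. c t * (f t x - m t)"] ballI)
      show "(\<lambda>x. \<Sum>t\<in>?I. c t * (f t x - m t)) \<in> borel_measurable (\<Pi>\<^sub>M i\<in>K j. S)"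
        using f(1) by (intro borel_measurable_sum borel_measurable_times borel_measurable_diff) auto
      fix \<omega> assume "\<omega> \<in> space P"
      then show "B j \<omega> = (\<Sum>t\<in>?I. c t * (f t (restrict (\<lambda>i. \<zeta> i \<omega>) (K j)) - m t))"
        unfolding B_def using f(2) by (intro sum.cong) auto
    qed
  qed
  then obtain f where f: "\<And>j. f j \<in> borel_measurable (\<Pi>\<^sub>M i\<in>K j. S)"
    "\<And>j \<omega>. \<omega> \<in> space P \<Longrightarrow> B j \<omega> = f j (restrict (\<lambda>i. \<zeta> i \<omega>) (K j))" by metis
  have half: "prob {\<omega> \<in> space P. y \<le> (\<Sum>j\<in>{j. j < J \<and> j mod 2 = p}. s * B j \<omega>)} \<le> exp (- y\<^sup>2 / (4 * V))"
    if s: "s = 1 \<or> s = -1" for p :: nat and s :: real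
  proof (rule Bernstein_inequality)
    let ?L = "{j. j < J \<and> j mod 2 = p}"
    show "finite ?L" by simp
    have disj: "disjoint_family_on K ?L"
      unfolding disjoint_family_on_def
    proof (intro ballI impI)
      fix j j' assume jj: "j \<in> ?L" "j' \<in> ?L" "j \<noteq> j'"
      have aux: "K a \<inter> K b = {}" if "a + 2 \<le> b" for a b
      proof -
        have "Suc a * l \<le> (b - 1) * l" using that by (intro mult_right_mono) auto
        moreover have "(b - 1) * l + l = b * l" using that by (cases b) auto
        ultimately have "Suc a * l + l \<le> b * l" by linarith
        then have "int (Suc a * l) \<le> int (b * l) - int l" by linarith
        then show ?thesis unfolding K_def by auto
      qed
      from jj have "j + 2 \<le> j' \<or> j' + 2 \<le> j" by simp presburger
      then show "K j \<inter> K j' = {}" using aux by blast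
    qed
    have "indep_vars (\<lambda>j. \<Pi>\<^sub>M i\<in>K j. S) (\<lambda>j \<omega>. restrict (\<lambda>i. \<zeta> i \<omega>) (K j)) ?L"
      by (rule indep_vars_restrict[OF indep _ disj]) auto
    then have "indep_vars (\<lambda>_. borel) (\<lambda>j \<omega>. s * f j (restrict (\<lambda>i. \<zeta> i \<omega>) (K j))) ?L"
      by (rule indep_vars_compose2[where Y = "\<lambda>j x. s * f j x"]) (use f(1) in auto)
    then show "indep_vars (\<lambda>_. borel) (\<lambda>j \<omega>. s * B j \<omega>) ?L"
      by (subst indep_vars_cong_space) (use f(2) in auto)
    show "\<bar>s * B j \<omega>\<bar> \<le> real l * cm * (2 * b)" if "\<omega> \<in> space P" for j \<omega>
      using B_bd[OF that, of j] s by (auto simp: abs_mult)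
    show "expectation (\<lambda>\<omega>. s * B j \<omega>) = 0" for j using B_mean by simp
    have "(\<Sum>j\<in>?L. expectation (\<lambda>\<omega>. (s * B j \<omega>)\<^sup>2)) = (\<Sum>j\<in>?L. expectation (\<lambda>\<omega>. (B j \<omega>)\<^sup>2))"
      using s by (auto simp: power_mult_distrib)
    also have "\<dots> \<le> (\<Sum>j<J. expectation (\<lambda>\<omega>. (B j \<omega>)\<^sup>2))"
      by (intro sum_mono2) auto
    finally show "(\<Sum>j\<in>?L. expectation (\<lambda>\<omega>. (s * B j \<omega>)\<^sup>2)) \<le> V" using var by linarith
  qed (use V y cond in auto)
  define E where "E = (\<lambda>s p. {\<omega> \<in> space P. y \<le> (\<Sum>j\<in>{j. j < J \<and> j mod 2 = p}. s * B j \<omega>)})"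
  have E_meas[measurable]: "E s p \<in> sets P" for s p unfolding E_def by measurable
  have split: "(\<Sum>t\<in>{t0 ..< t0 + int (k * l)}. c t * (\<phi> t (past \<zeta> t \<omega>) - m t)) = (\<Sum>j<k. B j \<omega>)" for \<omega> k
  proof (induction k)
    case (Suc k)
    have un: "{t0 ..< t0 + int (Suc k * l)} = {t0 ..< t0 + int (k * l)} \<union> {t0 + int (k * l) ..< t0 + int (Suc k * l)}"
      by (rule ivl_disj_un_two(3)[symmetric]) (simp_all del: of_nat_mult)
    have "(\<Sum>t\<in>{t0 ..< t0 + int (Suc k * l)}. c t * (\<phi> t (past \<zeta> t \<omega>) - m t)) =
        (\<Sum>t\<in>{t0 ..< t0 + int (k * l)}. c t * (\<phi> t (past \<zeta> t \<omega>) - m t)) + B k \<omega>"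
      unfolding un B_def by (rule sum.union_disjoint) auto
    then show ?case unfolding Suc.IH by (simp only: sum.lessThan_Suc)
  qed simp
  have parity: "(\<Sum>j<J. B j \<omega>) = (\<Sum>j\<in>{j. j < J \<and> j mod 2 = 0}. B j \<omega>) + (\<Sum>j\<in>{j. j < J \<and> j mod 2 = 1}. B j \<omega>)" for \<omega>
    by (subst sum.union_disjoint[symmetric]) (auto intro!: sum.cong)
  have "{\<omega> \<in> space P. 2 * y \<le> \<bar>\<Sum>t\<in>{t0 ..< t0 + int (J * l)}. c t * (\<phi> t (past \<zeta> t \<omega>) - m t)\<bar>}
      \<subseteq> (E 1 0 \<union> E (-1) 0) \<union> (E 1 1 \<union> E (-1) 1)"
    unfolding split parity E_def by (auto simp: sum_negf)
  then have "prob {\<omega> \<in> space P. 2 * y \<le> \<bar>\<Sum>t\<in>{t0 ..< t0 + int (J * l)}. c t * (\<phi> t (past \<zeta> t \<omega>) - m t)\<bar>}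
      \<le> prob ((E 1 0 \<union> E (-1) 0) \<union> (E 1 1 \<union> E (-1) 1))"
    by (intro finite_measure_mono) auto
  also have "\<dots> \<le> (prob (E 1 0) + prob (E (-1) 0)) + (prob (E 1 1) + prob (E (-1) 1))"
    by (intro order.trans[OF measure_Un_le] add_mono) (auto intro!: measure_Un_le)
  also have "\<dots> \<le> 4 * exp (- y\<^sup>2 / (4 * V))"
    using half[of 1 0] half[of "-1" 0] half[of 1 1] half[of "-1" 1] by (simp add: E_def)
  finally show ?thesis .
qed

end

section \<open>The locally stationary model\<close>

definition clip :: "real \<Rightarrow> real \<Rightarrow> real" where
  "clip W x = max (- W) (min W x)"

lemma clip_measurable [measurable]: "clip W \<in> borel_measurable borel"
  unfolding clip_def by measurable

lemma abs_clip_le: "0 \<le> W \<Longrightarrow> \<bar>clip W x\<bar> \<le> W" "0 \<le> W \<Longrightarrow> \<bar>clip W x\<bar> \<le> \<bar>x\<bar>"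
  by (auto simp: clip_def)

lemma abs_clip_diff_le: "0 \<le> W \<Longrightarrow> \<bar>clip W x - clip W y\<bar> \<le> \<bar>x - y\<bar>" "0 \<le> W \<Longrightarrow> \<bar>clip W x - clip W y\<bar> \<le> 2 * W"
  by (auto simp: clip_def)

lemma power_abs_add_le:
  fixes a b :: real
  shows "\<bar>a + b\<bar> ^ p \<le> 2 ^ p * (\<bar>a\<bar> ^ p + \<bar>b\<bar> ^ p)"
proof -
  have "\<bar>a + b\<bar> ^ p \<le> (2 * max \<bar>a\<bar> \<bar>b\<bar>) ^ p" by (intro power_mono) auto
  also have "\<dots> = 2 ^ p * max \<bar>a\<bar> \<bar>b\<bar> ^ p" by (simp add: power_mult_distrib)
  also have "max \<bar>a\<bar> \<bar>b\<bar> ^ p \<le> \<bar>a\<bar> ^ p + \<bar>b\<bar> ^ p" by (auto simp: max_def)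
  finally show ?thesis by simp
qed

lemma nn_integral_power_add_le:
  fixes f h :: "'a \<Rightarrow> real"
  assumes [measurable]: "f \<in> borel_measurable N" "h \<in> borel_measurable N"
    and "(\<integral>\<^sup>+ x. ennreal (\<bar>f x\<bar> ^ p) \<partial>N) \<le> ennreal a" "(\<integral>\<^sup>+ x. ennreal (\<bar>h x\<bar> ^ p) \<partial>N) \<le> ennreal b" "0 \<le> a" "0 \<le> b"
  shows "(\<integral>\<^sup>+ x. ennreal (\<bar>f x + h x\<bar> ^ p) \<partial>N) \<le> ennreal (2 ^ p * (a + b))"
proof -
  have "(\<integral>\<^sup>+ x. ennreal (\<bar>f x + h x\<bar> ^ p) \<partial>N) \<le> (\<integral>\<^sup>+ x. ennreal (2 ^ p) * (ennreal (\<bar>f x\<bar> ^ p) + ennreal (\<bar>h x\<bar> ^ p)) \<partial>N)"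
  proof (intro nn_integral_mono)
    fix x
    have "ennreal (\<bar>f x + h x\<bar> ^ p) \<le> ennreal (2 ^ p * (\<bar>f x\<bar> ^ p + \<bar>h x\<bar> ^ p))" by (intro ennreal_leI power_abs_add_le)
    also have "\<dots> = ennreal (2 ^ p) * (ennreal (\<bar>f x\<bar> ^ p) + ennreal (\<bar>h x\<bar> ^ p))"
      by (subst ennreal_mult) (simp_all add: ennreal_plus)
    finally show "ennreal (\<bar>f x + h x\<bar> ^ p) \<le> ennreal (2 ^ p) * (ennreal (\<bar>f x\<bar> ^ p) + ennreal (\<bar>h x\<bar> ^ p))" .
  qed
  also have "\<dots> = ennreal (2 ^ p) * ((\<integral>\<^sup>+ x. ennreal (\<bar>f x\<bar> ^ p) \<partial>N) + (\<integral>\<^sup>+ x. ennreal (\<bar>h x\<bar> ^ p) \<partial>N))"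
    by (subst nn_integral_cmult, measurable) (simp add: nn_integral_add)
  also have "\<dots> \<le> ennreal (2 ^ p) * (ennreal a + ennreal b)" by (intro mult_left_mono add_mono assms) auto
  also have "\<dots> = ennreal (2 ^ p * (a + b))" using assms(5,6) by (subst ennreal_mult) (simp_all add: ennreal_plus)
  finally show ?thesis .
qed

lemma chi_norm_le_of_bounded:
  assumes chi: "\<And>j. 0 \<le> chi j" and s: "summable chi" and W: "0 \<le> W" and x: "\<And>j. \<bar>x j\<bar> \<le> W"
  shows "chi_norm chi x \<le> ennreal (suminf chi * W)"
proof -
  have "chi_norm chi x \<le> (\<Sum>j. ennreal (chi j * W))"
    unfolding chi_norm_def using chi x by (intro suminf_le ennreal_leI mult_left_mono) auto
  also have "\<dots> = ennreal (suminf chi * W)"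
    using chi W s by (subst suminf_mult2[OF s]) (auto intro!: suminf_ennreal2 summable_mult2)
  finally show ?thesis .
qed

text \<open>
  Compare \<open>g x\<close> with \<open>g 0\<close>: on the box \<open>\<bar>x\<^sub>j\<bar> \<le> W\<close> the weighted norm is at most a multiple of \<open>W\<close>,
  so that \<open>g\<close> grows like \<open>W\<^sup>M\<close>.
\<close>
lemma H_class_bounded_growth:
  assumes H: "H_class M chi C g" and s: "summable chi" and W: "1 \<le> W" and x: "\<And>j. \<bar>x j\<bar> \<le> W"
  shows "\<bar>g x\<bar> \<le> (\<bar>g (\<lambda>_. 0)\<bar> + C * suminf chi * (2 + suminf chi ^ (M - 1))) * W ^ M"
proof -
  have M: "1 \<le> M" and C: "0 < C" and chi: "\<And>i. 0 \<le> chi i"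
    and lip: "\<And>x y. x \<noteq> y \<Longrightarrow> ennreal \<bar>g x - g y\<bar> \<le>
         ennreal C * chi_norm chi (\<lambda>i. x i - y i) * (1 + chi_norm chi x ^ (M - 1) + chi_norm chi y ^ (M - 1))"
    using H by (auto simp: H_class_def)
  define A where "A = suminf chi"
  have A: "0 \<le> A" unfolding A_def by (intro suminf_nonneg s chi)
  have W1: "1 \<le> W ^ k" for k using W by simp
  have d: "\<bar>g x - g (\<lambda>_. 0)\<bar> \<le> C * A * (2 + A ^ (M - 1)) * W ^ M"
  proof (cases "x = (\<lambda>_. 0)")
    case False
    have c: "chi_norm chi x \<le> ennreal (A * W)" unfolding A_def using W by (intro chi_norm_le_of_bounded chi s x) auto
    have z: "chi_norm chi (\<lambda>_. 0) = 0" by (simp add: chi_norm_def)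
    have "ennreal \<bar>g x - g (\<lambda>_. 0)\<bar> \<le> ennreal C * chi_norm chi (\<lambda>i. x i - 0) * (1 + chi_norm chi x ^ (M - 1) + chi_norm chi (\<lambda>_. 0) ^ (M - 1))"
      by (rule lip[OF False])
    also have "\<dots> \<le> ennreal C * ennreal (A * W) * (1 + ennreal (A * W) ^ (M - 1) + 1)"
      using c z by (intro mult_mono add_mono power_mono_ennreal order_refl) (auto simp: power_0_left)
    also have "\<dots> = ennreal (C * (A * W) * (2 + (A * W) ^ (M - 1)))"
    proof -
      have "(1 + ennreal (A * W) ^ (M - 1) + 1) = ennreal (2 + (A * W) ^ (M - 1))"
      proof -
        have "ennreal (2 + (A * W) ^ (M - 1)) = ennreal 2 + ennreal ((A * W) ^ (M - 1))"
          using A W by (intro ennreal_plus) auto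
        also have "\<dots> = 1 + 1 + ennreal (A * W) ^ (M - 1)" using A W by (simp add: ennreal_power)
        finally show ?thesis by (simp only: ac_simps)
      qed
      then show ?thesis using A W C by (simp add: ennreal_mult)
    qed
    finally have "\<bar>g x - g (\<lambda>_. 0)\<bar> \<le> C * (A * W) * (2 + (A * W) ^ (M - 1))"
      using A W C by (subst (asm) ennreal_le_iff) auto
    also have "\<dots> \<le> C * (A * W) * ((2 + A ^ (M - 1)) * W ^ (M - 1))"
      using A W C W1[of "M - 1"] by (intro mult_left_mono) (auto simp: power_mult_distrib algebra_simps)
    also have "\<dots> = C * A * (2 + A ^ (M - 1)) * W ^ M"
      using M by (cases M) auto
    finally show ?thesis .
  qed (use A C W in auto)
  have "\<bar>g x\<bar> \<le> \<bar>g (\<lambda>_. 0)\<bar> + \<bar>g x - g (\<lambda>_. 0)\<bar>" by linarith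
  also have "\<dots> \<le> \<bar>g (\<lambda>_. 0)\<bar> * W ^ M + C * A * (2 + A ^ (M - 1)) * W ^ M"
    using d mult_left_mono[OF W1[of M], of "\<bar>g (\<lambda>_. 0)\<bar>"] by simp
  finally show ?thesis by (simp add: A_def algebra_simps)
qed

text \<open>
  A scalar \<open>g\<close>; the vector-valued case applies the results to each coordinate.
\<close>
locale ls_model = prob_space P for P :: "'w measure" +
  fixes \<alpha> D \<rho> :: real and Dq :: "real \<Rightarrow> real" and S :: "'s measure"
    and \<zeta> \<zeta>' :: "int \<Rightarrow> 'w \<Rightarrow> 's" and H :: "(nat \<Rightarrow> 's) \<Rightarrow> real \<Rightarrow> real"
    and X :: "nat \<Rightarrow> nat \<Rightarrow> 'w \<Rightarrow> real" and M :: nat and chi :: "nat \<Rightarrow> real" and C :: real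
    and g :: "(nat \<Rightarrow> real) \<Rightarrow> real"
  assumes alpha: "0 \<le> \<alpha>" and D: "0 < D" and rho: "0 < \<rho>" "\<rho> < 1"
    and A: "assumption_A \<alpha> D Dq \<rho> P S \<zeta> \<zeta>' H X"
    and g_meas [measurable]: "g \<in> borel_measurable (\<Pi>\<^sub>M j\<in>UNIV. borel)"
    and g_class: "H_class M chi C g"
    and chi_le: "\<And>j. \<bar>chi j\<bar> \<le> C * \<rho> ^ j"

sublocale ls_model \<subseteq> iid_seq P S \<zeta>
proof
  show "indep_vars (\<lambda>_. S) \<zeta> UNIV" "distr P S (\<zeta> t) = distr P S (\<zeta> 0)" for t
    using A by (auto simp: assumption_A_def iid_with_independent_copy_def)
qed

context ls_model
begin

text \<open>
  \<open>\<Psi> v z\<close> is \<open>g\<close> applied to the stationary process at parameter \<open>v\<close> as a function of its innovations.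
  The base \<open>\<theta>\<close> lies strictly between 1 and \<open>1 / \<rho>\<close>: the weights \<open>\<chi>\<^sub>j \<theta>\<^sup>j\<close> are still summable,
  while errors at lags beyond \<open>m\<close> may be charged the factor \<open>\<theta>\<^sup>m\<close>.
\<close>
definition "moment_bound q = D * N_alpha \<alpha> (real q)"
definition "\<theta> = 1 / sqrt \<rho>"
definition "\<Psi> v z = g (\<lambda>j. H (\<lambda>k. z (j + k)) v)"

lemma M_pos: "1 \<le> M" and C_pos: "0 < C" and chi_nonneg: "0 \<le> chi i"
  using g_class by (auto simp: H_class_def)

lemma moment_bound_nonneg: "0 \<le> moment_bound q"
  using D by (simp add: moment_bound_def N_alpha_def)

lemma theta_ge: "1 \<le> \<theta>" "0 < \<theta>"
  using rho by (auto simp: \<theta>_def real_sqrt_le_1_iff)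

lemma summable_chi: "summable (\<lambda>j. chi j * \<theta> ^ j)" "summable chi"
proof -
  have s: "summable (\<lambda>j. C * sqrt \<rho> ^ j)" using rho by (intro summable_mult summable_geometric) (auto simp: real_sqrt_lt_1_iff)
  have le: "chi j * \<theta> ^ j \<le> C * sqrt \<rho> ^ j" for j
  proof -
    have "chi j * \<theta> ^ j \<le> C * \<rho> ^ j * \<theta> ^ j" using chi_le[of j] theta_ge by (intro mult_right_mono) auto
    also have "\<dots> = C * (\<rho> * \<theta>) ^ j" by (simp add: power_mult_distrib)
    also have "\<rho> * \<theta> = sqrt \<rho>" using rho by (simp add: \<theta>_def real_div_sqrt)
    finally show ?thesis .
  qed
  show 1: "summable (\<lambda>j. chi j * \<theta> ^ j)"
    by (rule summable_comparison_test'[OF s]) (use le chi_nonneg theta_ge in auto)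
  show "summable chi"
  proof (rule summable_comparison_test'[OF 1])
    fix j show "norm (chi j) \<le> chi j * \<theta> ^ j"
      using chi_nonneg[of j] theta_ge mult_left_mono[of 1 "\<theta> ^ j" "chi j"] by simp
  qed
qed

lemma H_meas [measurable]: "v \<in> {0..1} \<Longrightarrow> (\<lambda>z. H z v) \<in> borel_measurable Q"
  using A by (simp add: assumption_A_def measurable_cong_sets[OF sets_Q refl])

lemma \<Psi>_meas [measurable]: "v \<in> {0..1} \<Longrightarrow> \<Psi> v \<in> borel_measurable Q"
proof -
  assume v: "v \<in> {0..1}"
  have "(\<lambda>z j. H (\<lambda>k. z (j + k)) v) \<in> measurable Q (\<Pi>\<^sub>M j\<in>UNIV. borel)"
    by (rule measurable_PiM_single') (auto intro!: measurable_compose[OF shift_measurable H_meas[OF v]])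
  then show ?thesis unfolding \<Psi>_def by (rule measurable_compose) measurable
qed

lemma Y_stat_eq: "g (Y_stat (shift_process H \<zeta>) v t \<omega>) = \<Psi> v (past \<zeta> t \<omega>)"
  by (simp add: \<Psi>_def Y_stat_def shift_process_def past_shift)

lemma H_moment:
  assumes "v \<in> {0..1}" "1 \<le> q"
  shows "(\<integral>\<^sup>+ z. ennreal (\<bar>H z v\<bar> ^ q) \<partial>Q) \<le> ennreal (moment_bound q ^ q)"
proof -
  have "Lnorm P (real q) (shift_process H \<zeta> v 0) \<le> ennreal (moment_bound q)"
    using A assms by (auto simp: assumption_A_def moment_bound_def)
  from Lnorm_le_imp_moment_le[OF this assms(2) moment_bound_nonneg]
  have "(\<integral>\<^sup>+ \<omega>. ennreal (\<bar>H (past \<zeta> 0 \<omega>) v\<bar> ^ q) \<partial>P) \<le> ennreal (moment_bound q ^ q)" by (simp add: shift_process_def)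
  then show ?thesis using assms(1) by (subst (asm) nn_integral_past) auto
qed

lemma H_Lipschitz8:
  assumes "v \<in> {0..1}" "w \<in> {0..1}"
  shows "(\<integral>\<^sup>+ z. ennreal (\<bar>H z v - H z w\<bar> ^ 8) \<partial>Q) \<le> ennreal ((\<bar>Dq 8\<bar> * \<bar>v - w\<bar>) ^ 8)"
proof -
  have "locally_stationary P 8 (Dq 8) X (shift_process H \<zeta>)" using A by (auto simp: assumption_A_def)
  then have "Lnorm P (real 8) (\<lambda>\<omega>. shift_process H \<zeta> v 0 \<omega> - shift_process H \<zeta> w 0 \<omega>) \<le> ennreal (Dq 8 * \<bar>v - w\<bar>)"
    using assms by (simp add: locally_stationary_def)
  also have "\<dots> \<le> ennreal (\<bar>Dq 8\<bar> * \<bar>v - w\<bar>)" by (intro ennreal_leI mult_right_mono) auto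
  finally have "(\<integral>\<^sup>+ \<omega>. ennreal (\<bar>H (past \<zeta> 0 \<omega>) v - H (past \<zeta> 0 \<omega>) w\<bar> ^ 8) \<partial>P) \<le> ennreal ((\<bar>Dq 8\<bar> * \<bar>v - w\<bar>) ^ 8)"
    unfolding shift_process_def by (rule Lnorm_le_imp_moment_le) auto
  then show ?thesis using assms by (subst (asm) nn_integral_past) auto
qed

text \<open>
  The dependence measure compares with an independent copy of one innovation; this is the same as
  resampling that coordinate, because the innovations are independent of the copy.
\<close>
lemma H_dependence:
  assumes v: "v \<in> {0..1}"
  shows "(\<integral>\<^sup>+ z. (\<integral>\<^sup>+ s. ennreal \<bar>H z v - H (z(k := s)) v\<bar> \<partial>\<mu>) \<partial>Q) \<le> ennreal (moment_bound 1 * \<rho> ^ k)"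
proof -
  let ?Z = "\<Pi>\<^sub>M t\<in>(UNIV::int set). S"
  have iid: "indep_var ?Z (\<lambda>\<omega> t. \<zeta> t \<omega>) ?Z (\<lambda>\<omega> t. \<zeta>' t \<omega>)"
    and law: "distr P ?Z (\<lambda>\<omega> t. \<zeta>' t \<omega>) = distr P ?Z (\<lambda>\<omega> t. \<zeta> t \<omega>)"
    using A by (auto simp: assumption_A_def iid_with_independent_copy_def)
  have m1: "(\<lambda>x j. x (int k - int j)) \<in> measurable ?Z Q"
    unfolding Q_def by (rule measurable_PiM_single') (auto simp: space_PiM space_\<mu>)
  have m2: "(\<lambda>x. x 0) \<in> measurable ?Z \<mu>" by measurable
  have rv': "(\<lambda>\<omega> t. \<zeta>' t \<omega>) \<in> measurable P ?Z" using iid by (rule indep_var_rv2)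
  have rv: "(\<lambda>\<omega> t. \<zeta> t \<omega>) \<in> measurable P ?Z" using iid by (rule indep_var_rv1)
  define L where "L = distr P ?Z (\<lambda>\<omega> t. \<zeta> t \<omega>)"
  have sL[measurable_cong]: "sets L = sets ?Z" by (simp add: L_def)
  have joint: "distr P (?Z \<Otimes>\<^sub>M ?Z) (\<lambda>\<omega>. (\<lambda>t. \<zeta> t \<omega>, \<lambda>t. \<zeta>' t \<omega>)) = L \<Otimes>\<^sub>M L"
    using iid unfolding indep_var_distribution_eq law L_def by simp
  interpret L: prob_space L unfolding L_def by (rule prob_space_distr[OF rv])
  interpret mu: prob_space \<mu> by (rule prob_space_\<mu>)
  have upd: "(\<lambda>(z, s). z(k := s)) \<in> measurable (Q \<Otimes>\<^sub>M \<mu>) Q"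
    using measurable_pair_swap[OF upd_measurable[OF prob_space_\<mu>, of k, folded Q_def]] by (simp add: split_beta')
  have me: "(\<lambda>(z, s). ennreal \<bar>H z v - H (z(k := s)) v\<bar>) \<in> borel_measurable (Q \<Otimes>\<^sub>M \<mu>)"
    using measurable_compose[OF upd H_meas[OF v]] v by (simp add: split_beta') measurable
  define f where "f = (\<lambda>z s. ennreal \<bar>H z v - H (z(k := s)) v\<bar>)"
  note f_meas = me[folded f_def]
  have cp: "coupled_past \<zeta> \<zeta>' (int k) \<omega> = (past \<zeta> (int k) \<omega>)(k := \<zeta>' 0 \<omega>)" for \<omega>
    by (auto simp: coupled_past_def past_def fun_eq_iff)
  have f_meas': "(\<lambda>(x, y). f (\<lambda>j. x (int k - int j)) (y 0)) \<in> borel_measurable (?Z \<Otimes>\<^sub>M ?Z)"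
  proof -
    have "(\<lambda>p. ((\<lambda>j. fst p (int k - int j)), snd p 0)) \<in> measurable (?Z \<Otimes>\<^sub>M ?Z) (Q \<Otimes>\<^sub>M \<mu>)"
      by (intro measurable_Pair measurable_compose[OF measurable_fst m1] measurable_compose[OF measurable_snd m2])
    from measurable_compose[OF this f_meas] show ?thesis by (simp add: split_beta')
  qed
  have inner: "(\<integral>\<^sup>+ y. f z (y 0) \<partial>L) = (\<integral>\<^sup>+ s. f z s \<partial>\<mu>)" if "z \<in> space Q" for z
  proof -
    have fz: "f z \<in> borel_measurable \<mu>" using measurable_Pair2[OF f_meas that] by simp
    have fz': "f z \<in> borel_measurable S" using fz by (simp add: measurable_cong_sets[OF sets_\<mu> refl])
    have "(\<integral>\<^sup>+ y. f z (y 0) \<partial>L) = (\<integral>\<^sup>+ \<omega>. f z (\<zeta> 0 \<omega>) \<partial>P)"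
      unfolding L_def by (subst nn_integral_distr[OF rv]) (auto intro!: measurable_compose[OF m2 fz])
    also have "\<dots> = (\<integral>\<^sup>+ s. f z s \<partial>\<mu>)"
      unfolding \<mu>_def by (subst nn_integral_distr) (auto simp: fz')
    finally show ?thesis .
  qed
  have outer: "(\<lambda>z. \<integral>\<^sup>+ s. f z s \<partial>\<mu>) \<in> borel_measurable Q"
    by (rule mu.borel_measurable_nn_integral[OF f_meas])
  have "(\<integral>\<^sup>+ \<omega>. ennreal \<bar>H (past \<zeta> (int k) \<omega>) v - H (coupled_past \<zeta> \<zeta>' (int k) \<omega>) v\<bar> \<partial>P) =
     (\<integral>\<^sup>+ x. (case x of (x, y) \<Rightarrow> f (\<lambda>j. x (int k - int j)) (y 0)) \<partial>distr P (?Z \<Otimes>\<^sub>M ?Z) (\<lambda>\<omega>. (\<lambda>t. \<zeta> t \<omega>, \<lambda>t. \<zeta>' t \<omega>)))"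
    by (subst nn_integral_distr[OF measurable_Pair[OF rv rv']], use f_meas' in simp, simp add: cp f_def past_def)
  also have "\<dots> = (\<integral>\<^sup>+ x. (\<integral>\<^sup>+ y. f (\<lambda>j. x (int k - int j)) (y 0) \<partial>L) \<partial>L)"
    unfolding joint using f_meas' by (subst L.nn_integral_fst[symmetric]) auto
  also have "\<dots> = (\<integral>\<^sup>+ x. (\<integral>\<^sup>+ s. f (\<lambda>j. x (int k - int j)) s \<partial>\<mu>) \<partial>L)"
    using measurable_space[OF m1] by (intro nn_integral_cong inner) (simp add: L_def)
  also have "\<dots> = (\<integral>\<^sup>+ \<omega>. (\<integral>\<^sup>+ s. f (past \<zeta> (int k) \<omega>) s \<partial>\<mu>) \<partial>P)"
    unfolding L_def
    by (subst nn_integral_distr[OF rv], use measurable_compose[OF m1 outer] in simp, simp add: past_def[abs_def])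
  also have "\<dots> = (\<integral>\<^sup>+ z. (\<integral>\<^sup>+ s. f z s \<partial>\<mu>) \<partial>Q)" by (rule nn_integral_past[OF outer])
  finally have eq: "(\<integral>\<^sup>+ \<omega>. ennreal \<bar>H (past \<zeta> (int k) \<omega>) v - H (coupled_past \<zeta> \<zeta>' (int k) \<omega>) v\<bar> \<partial>P) =
     (\<integral>\<^sup>+ z. (\<integral>\<^sup>+ s. f z s \<partial>\<mu>) \<partial>Q)" .
  have "Lnorm P (real 1) (\<lambda>\<omega>. H (past \<zeta> (int k) \<omega>) v - H (coupled_past \<zeta> \<zeta>' (int k) \<omega>) v) \<le> ennreal (moment_bound 1 * \<rho> ^ k)"
    using A v by (auto simp: assumption_A_def dependence_measure_def moment_bound_def)
  from Lnorm_le_imp_moment_le[OF this] have "(\<integral>\<^sup>+ \<omega>. ennreal \<bar>H (past \<zeta> (int k) \<omega>) v - H (coupled_past \<zeta> \<zeta>' (int k) \<omega>) v\<bar> \<partial>P) \<le> ennreal (moment_bound 1 * \<rho> ^ k)"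
    using moment_bound_nonneg rho by simp
  then show ?thesis unfolding eq f_def .
qed

definition "chi_total = (\<Sum>j. chi j * \<theta> ^ j)"
definition "K_lip B = (C * chi_total) ^ 4 * 3 ^ 4 * sqrt (3 + 2 * (chi_total * B) ^ (8 * M))"

lemma K_lip_nonneg: "0 \<le> B \<Longrightarrow> 0 \<le> K_lip B"
proof -
  have "0 \<le> chi_total" unfolding chi_total_def using chi_nonneg theta_ge by (intro suminf_nonneg summable_chi) auto
  moreover assume "0 \<le> B"
  ultimately show ?thesis unfolding K_lip_def using C_pos
    by (intro mult_nonneg_nonneg zero_le_power real_sqrt_ge_zero add_nonneg_nonneg) auto
qed

lemmas H_class_Lipschitz = H_class_Lipschitz_L4[OF prob_space_Q g_class _ _ theta_ge(1) summable_chi(1), folded chi_total_def, folded K_lip_def]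

text \<open>
  The case of equal errors at all lags in \<open>H_class_Lipschitz_L4\<close>.
\<close>
lemma \<Psi>_Lipschitz_L4:
  "\<exists>K\<ge>0. \<forall>v\<in>{0..1}. \<forall>w\<in>{0..1}. (\<integral>\<^sup>+ z. ennreal (\<bar>\<Psi> v z - \<Psi> w z\<bar> ^ 4) \<partial>Q) \<le> ennreal (K * \<bar>v - w\<bar> ^ 4)"
proof -
  define K where "K = K_lip (moment_bound (8 * M))"
  have th: "1 \<le> \<theta> ^ j" for j using theta_ge by simp
  have sh: "(\<integral>\<^sup>+ z. ennreal (\<bar>H (\<lambda>k. z (j + k)) v\<bar> ^ (8 * M)) \<partial>Q) \<le> ennreal (moment_bound (8 * M) ^ (8 * M))" if "v \<in> {0..1}" for v j
    using H_moment[OF that, of "8 * M"] M_pos nn_integral_shift[of "\<lambda>z. ennreal (\<bar>H z v\<bar> ^ (8 * M))" j] that by simp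
  have "(\<integral>\<^sup>+ z. ennreal (\<bar>\<Psi> v z - \<Psi> w z\<bar> ^ 4) \<partial>Q) \<le> ennreal ((K * \<bar>Dq 8\<bar> ^ 4) * \<bar>v - w\<bar> ^ 4)"
    if v: "v \<in> {0..1}" "w \<in> {0..1}" for v w
  proof -
    have "(\<integral>\<^sup>+ z. ennreal (\<bar>\<Psi> v z - \<Psi> w z\<bar> ^ 4) \<partial>Q) \<le> ennreal (K * (\<bar>Dq 8\<bar> * \<bar>v - w\<bar>) ^ 4)"
      unfolding \<Psi>_def K_def
    proof (rule H_class_Lipschitz)
      fix j
      have "(\<integral>\<^sup>+ z. ennreal (\<bar>H (\<lambda>k. z (j + k)) v - H (\<lambda>k. z (j + k)) w\<bar> ^ 8) \<partial>Q) \<le> ennreal ((\<bar>Dq 8\<bar> * \<bar>v - w\<bar>) ^ 8)"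
        using H_Lipschitz8[OF v] nn_integral_shift[of "\<lambda>z. ennreal (\<bar>H z v - H z w\<bar> ^ 8)" j] v by simp
      also have "\<dots> \<le> ennreal ((\<bar>Dq 8\<bar> * \<bar>v - w\<bar> * \<theta> ^ j) ^ 8)"
        using mult_left_mono[OF th[of j], of "\<bar>Dq 8\<bar> * \<bar>v - w\<bar>"] by (intro ennreal_leI power_mono) auto
      finally show "(\<integral>\<^sup>+ z. ennreal (\<bar>H (\<lambda>k. z (j + k)) v - H (\<lambda>k. z (j + k)) w\<bar> ^ 8) \<partial>Q) \<le> ennreal ((\<bar>Dq 8\<bar> * \<bar>v - w\<bar> * \<theta> ^ j) ^ 8)" .
    qed (use sh v theta_ge summable_chi moment_bound_nonneg in \<open>auto intro!: measurable_compose[OF shift_measurable H_meas]\<close>)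
    then show ?thesis by (simp add: power_mult_distrib mult.assoc)
  qed
  moreover have "0 \<le> K * \<bar>Dq 8\<bar> ^ 4" unfolding K_def by (intro mult_nonneg_nonneg K_lip_nonneg moment_bound_nonneg) auto
  ultimately show ?thesis by blast
qed

lemma \<Psi>_moment4:
  "\<exists>K\<ge>0. \<forall>v\<in>{0..1}. (\<integral>\<^sup>+ z. ennreal (\<bar>\<Psi> v z\<bar> ^ 4) \<partial>Q) \<le> ennreal K"
proof -
  interpret Q: prob_space Q by (rule prob_space_Q)
  define K where "K = K_lip (moment_bound (8 * M))"
  have K0: "0 \<le> K" unfolding K_def by (intro K_lip_nonneg moment_bound_nonneg)
  have th: "1 \<le> \<theta> ^ j" for j using theta_ge by simp
  let ?g0 = "g (\<lambda>_. 0)"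
  have "(\<integral>\<^sup>+ z. ennreal (\<bar>\<Psi> v z\<bar> ^ 4) \<partial>Q) \<le> ennreal (2 ^ 4 * (K * moment_bound 8 ^ 4 + \<bar>?g0\<bar> ^ 4))" if v: "v \<in> {0..1}" for v
  proof -
    have "(\<integral>\<^sup>+ z. ennreal (\<bar>\<Psi> v z - g (\<lambda>_. 0)\<bar> ^ 4) \<partial>Q) \<le> ennreal (K * moment_bound 8 ^ 4)"
      unfolding \<Psi>_def K_def
    proof (rule H_class_Lipschitz[where Y' = "\<lambda>_ _. 0"])
      fix j
      show "(\<integral>\<^sup>+ z. ennreal (\<bar>H (\<lambda>k. z (j + k)) v\<bar> ^ (8 * M)) \<partial>Q) \<le> ennreal (moment_bound (8 * M) ^ (8 * M))"
        using H_moment[OF v, of "8 * M"] M_pos nn_integral_shift[of "\<lambda>z. ennreal (\<bar>H z v\<bar> ^ (8 * M))" j] v by simp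
      have "(\<integral>\<^sup>+ z. ennreal (\<bar>H (\<lambda>k. z (j + k)) v - 0\<bar> ^ 8) \<partial>Q) \<le> ennreal (moment_bound 8 ^ 8)"
        using H_moment[OF v, of "8"] nn_integral_shift[of "\<lambda>z. ennreal (\<bar>H z v\<bar> ^ 8)" j] v by simp
      also have "\<dots> \<le> ennreal ((moment_bound 8 * \<theta> ^ j) ^ 8)"
        using mult_left_mono[OF th[of j] moment_bound_nonneg[of 8]] moment_bound_nonneg by (intro ennreal_leI power_mono) auto
      finally show "(\<integral>\<^sup>+ z. ennreal (\<bar>H (\<lambda>k. z (j + k)) v - 0\<bar> ^ 8) \<partial>Q) \<le> ennreal ((moment_bound 8 * \<theta> ^ j) ^ 8)" .
    qed (use v theta_ge summable_chi moment_bound_nonneg M_pos in \<open>auto intro!: measurable_compose[OF shift_measurable H_meas] simp: power_0_left\<close>)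
    from nn_integral_power_add_le[OF _ _ this, of "\<lambda>_. ?g0" "\<bar>?g0\<bar> ^ 4"] v K0 moment_bound_nonneg show ?thesis
      by (simp add: Q.emeasure_space_1)
  qed
  moreover have "0 \<le> 2 ^ 4 * (K * moment_bound 8 ^ 4 + \<bar>?g0\<bar> ^ 4)" using K0 moment_bound_nonneg by simp
  ultimately show ?thesis by blast
qed

end

section \<open>Bounded functionals of finite range\<close>

context ls_model
begin

text \<open>
  The approximation works inside \<open>g\<close>. Approximate \<open>H\<close> by a function of \<open>m\<close> innovations, clip it at
  height \<open>W\<close>, use it for the first \<open>m\<close> lags of the history and put 0 at the remaining lags; \<open>g\<close> of
  this history depends on \<open>2 m\<close> innovations and is bounded. Clipping serves two purposes: it gives the
  bound \<open>W\<^sup>M\<close> that Bernstein's inequality needs, and it turns the \<open>L\<^sup>1\<close> approximation of \<open>H\<close> into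
  one in \<open>L\<^sup>8\<close>, at the cost of powers of \<open>W\<close> which the factor \<open>\<rho>\<^sup>m\<close> absorbs. The remaining
  lags enter only through \<open>\<theta>\<^sup>-\<^sup>m = (\<surd>\<rho>)\<^sup>m\<close>. The tolerance \<open>e\<close> collects the three errors.
\<close>
lemma finite_range_approximation:
  "\<exists>C1 C2 C3. 0 \<le> C1 \<and> 0 \<le> C2 \<and> 0 \<le> C3 \<and>
    (\<forall>m W e v. 1 \<le> W \<longrightarrow> 0 < e \<longrightarrow> e \<le> 1 \<longrightarrow> v \<in> {0..1} \<longrightarrow>
      (\<integral>\<^sup>+ z. ennreal (\<bar>H z v - clip W (H z v)\<bar> ^ 8) \<partial>Q) \<le> ennreal (e ^ 8) \<longrightarrow>
      C1 * (2 * W) ^ (8 * M) * \<rho> ^ m \<le> e ^ 8 \<longrightarrow> sqrt \<rho> ^ m \<le> e \<longrightarrow>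
      (\<exists>\<phi>. \<phi> \<in> borel_measurable Q \<and> depends_first (2 * m) (space Q) \<phi> \<and> (\<forall>z. \<bar>\<phi> z\<bar> \<le> C2 * W ^ M) \<and>
         (\<integral>\<^sup>+ z. ennreal (\<bar>\<Psi> v z - \<phi> z\<bar> ^ 4) \<partial>Q) \<le> ennreal (C3 * e ^ 4)))"
proof -
  interpret Q: prob_space Q by (rule prob_space_Q)
  define C1 where "C1 = 1 + (moment_bound 1 + 1) / (1 - \<rho>)"
  define A0 where "A0 = suminf chi"
  define C2 where "C2 = \<bar>g (\<lambda>_. 0)\<bar> + C * A0 * (2 + A0 ^ (M - 1))"
  define b where "b = 2 * (moment_bound (8 * M) + 1)"
  define C3 where "C3 = K_lip b * (4 + moment_bound 8) ^ 4"
  have A0: "0 \<le> A0" unfolding A0_def using chi_nonneg by (intro suminf_nonneg summable_chi)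
  have C1: "0 \<le> C1" unfolding C1_def using moment_bound_nonneg[of 1] rho by (auto intro!: add_nonneg_nonneg divide_nonneg_nonneg)
  have C2: "0 \<le> C2" unfolding C2_def using A0 C_pos by (auto intro!: add_nonneg_nonneg mult_nonneg_nonneg)
  have b0: "0 \<le> b" unfolding b_def using moment_bound_nonneg[of "8 * M"] by simp
  have C3: "0 \<le> C3" unfolding C3_def using moment_bound_nonneg[of 8] by (intro mult_nonneg_nonneg K_lip_nonneg b0) auto
  have th1: "1 \<le> \<theta> ^ j" for j using theta_ge by simp
  have "\<exists>\<phi>. \<phi> \<in> borel_measurable Q \<and> depends_first (2 * m) (space Q) \<phi> \<and> (\<forall>z. \<bar>\<phi> z\<bar> \<le> C2 * W ^ M) \<and>
         (\<integral>\<^sup>+ z. ennreal (\<bar>\<Psi> v z - \<phi> z\<bar> ^ 4) \<partial>Q) \<le> ennreal (C3 * e ^ 4)"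
    if W: "1 \<le> W" and e: "0 < e" "e \<le> 1" and v: "v \<in> {0..1}"
      and tail: "(\<integral>\<^sup>+ z. ennreal (\<bar>H z v - clip W (H z v)\<bar> ^ 8) \<partial>Q) \<le> ennreal (e ^ 8)"
      and c1: "C1 * (2 * W) ^ (8 * M) * \<rho> ^ m \<le> e ^ 8" and c2: "sqrt \<rho> ^ m \<le> e" for m W e v
  proof -
    note [measurable] = H_meas[OF v]
    have W0: "0 \<le> W" using W by simp
    have "integrable Q (\<lambda>z. H z v)"
    proof (rule integrableI_bounded)
      have "(\<integral>\<^sup>+ z. ennreal (norm (H z v)) \<partial>Q) \<le> ennreal (moment_bound 1 ^ 1)" using H_moment[OF v, of 1] by simp
      then show "(\<integral>\<^sup>+ z. ennreal (norm (H z v)) \<partial>Q) < \<infinity>" by (rule order.strict_trans1) simp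
    qed measurable
    from finite_dependence_approx[OF prob_space_\<mu> this[unfolded Q_def] rho moment_bound_nonneg H_dependence[OF v, unfolded Q_def], folded Q_def C1_def, of m]
    obtain \<phi>0 where [measurable]: "\<phi>0 \<in> borel_measurable Q" and dep0: "depends_first m (space Q) \<phi>0"
      and l1: "(\<integral>\<^sup>+ z. ennreal \<bar>H z v - \<phi>0 z\<bar> \<partial>Q) \<le> ennreal (C1 * \<rho> ^ m)" by blast
    define \<psi> where "\<psi> = (\<lambda>z. clip W (\<phi>0 z))"
    have [measurable]: "\<psi> \<in> borel_measurable Q" unfolding \<psi>_def by measurable
    have dpsi: "depends_first m (space Q) \<psi>" using dep0 unfolding depends_first_def \<psi>_def by (metis (no_types, lifting))
    have psi_bd: "\<bar>\<psi> z\<bar> \<le> W" for z unfolding \<psi>_def by (rule abs_clip_le(1)[OF W0])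
    (* Both functions are bounded by W, so all but one of the p factors can be bounded by 2 W
       and the last one is controlled in the mean. *)
    have close: "(\<integral>\<^sup>+ z. ennreal (\<bar>clip W (H z v) - \<psi> z\<bar> ^ p) \<partial>Q) \<le> ennreal (e ^ 8)"
      if p: "1 \<le> p" "p \<le> 8 * M" for p
    proof -
      have pt: "\<bar>clip W (H z v) - \<psi> z\<bar> ^ p \<le> (2 * W) ^ (8 * M) * \<bar>H z v - \<phi>0 z\<bar>" for z
      proof -
        have "\<bar>clip W (H z v) - \<psi> z\<bar> ^ p = \<bar>clip W (H z v) - \<psi> z\<bar> ^ (p - 1) * \<bar>clip W (H z v) - \<psi> z\<bar>"
          using p by (metis (no_types) One_nat_def Suc_pred' less_eq_Suc_le mult.commute power_Suc)
        also have "\<dots> \<le> (2 * W) ^ (p - 1) * \<bar>H z v - \<phi>0 z\<bar>"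
          unfolding \<psi>_def using W0 by (intro mult_mono power_mono abs_clip_diff_le) auto
        also have "\<dots> \<le> (2 * W) ^ (8 * M) * \<bar>H z v - \<phi>0 z\<bar>"
          using W p by (intro mult_right_mono power_increasing) auto
        finally show ?thesis .
      qed
      have "(\<integral>\<^sup>+ z. ennreal (\<bar>clip W (H z v) - \<psi> z\<bar> ^ p) \<partial>Q) \<le> (\<integral>\<^sup>+ z. ennreal ((2 * W) ^ (8 * M)) * ennreal \<bar>H z v - \<phi>0 z\<bar> \<partial>Q)"
        using pt W0 by (intro nn_integral_mono) (auto simp flip: ennreal_mult intro!: ennreal_leI)
      also have "\<dots> = ennreal ((2 * W) ^ (8 * M)) * (\<integral>\<^sup>+ z. ennreal \<bar>H z v - \<phi>0 z\<bar> \<partial>Q)"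
        by (rule nn_integral_cmult) measurable
      also have "\<dots> \<le> ennreal ((2 * W) ^ (8 * M)) * ennreal (C1 * \<rho> ^ m)" by (intro mult_left_mono l1) auto
      also have "\<dots> = ennreal (C1 * (2 * W) ^ (8 * M) * \<rho> ^ m)"
        using W0 C1 rho by (subst ennreal_mult[symmetric]) (auto simp: algebra_simps)
      also have "\<dots> \<le> ennreal (e ^ 8)" by (intro ennreal_leI c1)
      finally show ?thesis .
    qed
    have d8: "(\<integral>\<^sup>+ z. ennreal (\<bar>H z v - \<psi> z\<bar> ^ 8) \<partial>Q) \<le> ennreal ((4 * e) ^ 8)"
    proof -
      have "(\<integral>\<^sup>+ z. ennreal (\<bar>(H z v - clip W (H z v)) + (clip W (H z v) - \<psi> z)\<bar> ^ 8) \<partial>Q) \<le> ennreal (2 ^ 8 * (e ^ 8 + e ^ 8))"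
        using tail close[of 8] M_pos e by (intro nn_integral_power_add_le) auto
      also have "\<dots> \<le> ennreal ((4 * e) ^ 8)"
        using e by (intro ennreal_leI) (simp add: power_mult_distrib)
      finally show ?thesis by simp
    qed
    have psiM: "(\<integral>\<^sup>+ z. ennreal (\<bar>\<psi> z\<bar> ^ (8 * M)) \<partial>Q) \<le> ennreal (b ^ (8 * M))"
    proof -
      have "(\<integral>\<^sup>+ z. ennreal (\<bar>clip W (H z v)\<bar> ^ (8 * M)) \<partial>Q) \<le> (\<integral>\<^sup>+ z. ennreal (\<bar>H z v\<bar> ^ (8 * M)) \<partial>Q)"
        using W0 by (intro nn_integral_mono ennreal_leI power_mono abs_clip_le) auto
      also have "\<dots> \<le> ennreal (moment_bound (8 * M) ^ (8 * M))" using H_moment[OF v, of "8 * M"] M_pos by simp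
      finally have 1: "(\<integral>\<^sup>+ z. ennreal (\<bar>clip W (H z v)\<bar> ^ (8 * M)) \<partial>Q) \<le> ennreal (moment_bound (8 * M) ^ (8 * M))" .
      have "(\<integral>\<^sup>+ z. ennreal (\<bar>\<psi> z - clip W (H z v)\<bar> ^ (8 * M)) \<partial>Q) \<le> ennreal (e ^ 8)"
        using close[of "8 * M"] M_pos by (simp add: abs_minus_commute)
      also have "\<dots> \<le> ennreal 1" using e by (intro ennreal_leI power_le_one) auto
      finally have 2: "(\<integral>\<^sup>+ z. ennreal (\<bar>\<psi> z - clip W (H z v)\<bar> ^ (8 * M)) \<partial>Q) \<le> ennreal 1" .
      have "(\<integral>\<^sup>+ z. ennreal (\<bar>clip W (H z v) + (\<psi> z - clip W (H z v))\<bar> ^ (8 * M)) \<partial>Q) \<le> ennreal (2 ^ (8 * M) * (moment_bound (8 * M) ^ (8 * M) + 1))"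
        by (rule nn_integral_power_add_le[OF _ _ 1 2]) (use moment_bound_nonneg in auto)
      also have "\<dots> \<le> ennreal (b ^ (8 * M))"
      proof (intro ennreal_leI)
        have "moment_bound (8 * M) ^ (8 * M) + 1 \<le> (moment_bound (8 * M) + 1) ^ (8 * M)"
        proof -
          have aux: "x ^ Suc k + 1 \<le> (x + 1) ^ Suc k" if "0 \<le> x" for x :: real and k
          proof (induction k)
            case (Suc k)
            have "x ^ Suc (Suc k) + 1 \<le> (x + 1) * (x ^ Suc k + 1)"
              using that by (simp add: algebra_simps)
            also have "\<dots> \<le> (x + 1) * (x + 1) ^ Suc k" using Suc that by (intro mult_left_mono) auto
            finally show ?case by simp
          qed simp
          from aux[OF moment_bound_nonneg[of "8 * M"], of "8 * M - 1"] show ?thesis using M_pos by simp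
        qed
        then show "2 ^ (8 * M) * (moment_bound (8 * M) ^ (8 * M) + 1) \<le> b ^ (8 * M)"
          unfolding b_def power_mult_distrib by (intro mult_left_mono) auto
      qed
      finally show ?thesis by simp
    qed
    define Y' where "Y' = (\<lambda>z j. if j < m then \<psi> (\<lambda>k. z (j + k)) else 0)"
    have Y'_meas[measurable]: "(\<lambda>z. Y' z j) \<in> borel_measurable Q" for j
      unfolding Y'_def by (cases "j < m") (auto intro!: measurable_compose[OF shift_measurable])
    define \<phi> where "\<phi> = (\<lambda>z. g (Y' z))"
    have "(\<lambda>z. Y' z) \<in> measurable Q (\<Pi>\<^sub>M j\<in>UNIV. borel)"
      by (rule measurable_PiM_single') auto
    then have \<phi>_meas: "\<phi> \<in> borel_measurable Q" unfolding \<phi>_def by (rule measurable_compose) measurable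
    have dep: "depends_first (2 * m) (space Q) \<phi>"
      unfolding depends_first_def
    proof (intro ballI impI)
      fix z z' assume z: "z \<in> space Q" "z' \<in> space Q" and eq: "\<forall>k<2 * m. z k = z' k"
      have "Y' z j = Y' z' j" for j
      proof (cases "j < m")
        case True
        have "\<psi> (\<lambda>k. z (j + k)) = \<psi> (\<lambda>k. z' (j + k))"
          by (rule dpsi[unfolded depends_first_def, rule_format, OF measurable_space[OF shift_measurable z(1)]
                measurable_space[OF shift_measurable z(2)]]) (use eq True in auto)
        then show ?thesis using True by (simp add: Y'_def)
      qed (simp add: Y'_def)
      then show "\<phi> z = \<phi> z'" unfolding \<phi>_def by (intro arg_cong[where f = g]) auto
    qed
    have bd: "\<bar>\<phi> z\<bar> \<le> C2 * W ^ M" for z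
      unfolding \<phi>_def C2_def A0_def
      by (rule H_class_bounded_growth[OF g_class summable_chi(2) W]) (use psi_bd W in \<open>auto simp: Y'_def\<close>)
    have HM: "(\<integral>\<^sup>+ z. ennreal (\<bar>H (\<lambda>k. z (j + k)) v\<bar> ^ (8 * M)) \<partial>Q) \<le> ennreal (b ^ (8 * M))" for j
    proof -
      have "(\<integral>\<^sup>+ z. ennreal (\<bar>H (\<lambda>k. z (j + k)) v\<bar> ^ (8 * M)) \<partial>Q) \<le> ennreal (moment_bound (8 * M) ^ (8 * M))"
        using H_moment[OF v, of "8 * M"] M_pos nn_integral_shift[of "\<lambda>z. ennreal (\<bar>H z v\<bar> ^ (8 * M))" j] by simp
      also have "\<dots> \<le> ennreal (b ^ (8 * M))"
        using moment_bound_nonneg[of "8 * M"] by (intro ennreal_leI power_mono) (auto simp: b_def)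
      finally show ?thesis .
    qed
    have Y'M: "(\<integral>\<^sup>+ z. ennreal (\<bar>Y' z j\<bar> ^ (8 * M)) \<partial>Q) \<le> ennreal (b ^ (8 * M))" for j
    proof (cases "j < m")
      case True
      then show ?thesis using psiM nn_integral_shift[of "\<lambda>z. ennreal (\<bar>\<psi> z\<bar> ^ (8 * M))" j] by (simp add: Y'_def)
    next
      case False
      then show ?thesis using M_pos by (simp add: Y'_def power_0_left)
    qed
    have diff: "(\<integral>\<^sup>+ z. ennreal (\<bar>H (\<lambda>k. z (j + k)) v - Y' z j\<bar> ^ 8) \<partial>Q) \<le> ennreal (((4 + moment_bound 8) * e * \<theta> ^ j) ^ 8)" for j
    proof (cases "j < m")
      case True
      then have "(\<integral>\<^sup>+ z. ennreal (\<bar>H (\<lambda>k. z (j + k)) v - Y' z j\<bar> ^ 8) \<partial>Q) \<le> ennreal ((4 * e) ^ 8)"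
        using d8 nn_integral_shift[of "\<lambda>z. ennreal (\<bar>H z v - \<psi> z\<bar> ^ 8)" j] by (simp add: Y'_def)
      also have "\<dots> \<le> ennreal (((4 + moment_bound 8) * e * \<theta> ^ j) ^ 8)"
      proof (intro ennreal_leI power_mono)
        have "4 * e * 1 \<le> (4 + moment_bound 8) * e * \<theta> ^ j"
          using e th1[of j] moment_bound_nonneg[of 8] by (intro mult_mono) auto
        then show "4 * e \<le> (4 + moment_bound 8) * e * \<theta> ^ j" by simp
      qed (use e in auto)
      finally show ?thesis .
    next
      case False
      then have "(\<integral>\<^sup>+ z. ennreal (\<bar>H (\<lambda>k. z (j + k)) v - Y' z j\<bar> ^ 8) \<partial>Q) \<le> ennreal (moment_bound 8 ^ 8)"
        using H_moment[OF v, of 8] nn_integral_shift[of "\<lambda>z. ennreal (\<bar>H z v\<bar> ^ 8)" j] by (simp add: Y'_def)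
      also have "\<dots> \<le> ennreal (((4 + moment_bound 8) * e * \<theta> ^ j) ^ 8)"
      proof (intro ennreal_leI power_mono)
        (* At lags beyond m nothing is approximated; the growth allowed at these lags
           compensates, since \<theta> ^ j is at least 1 / e there. *)
        have "1 = sqrt \<rho> ^ m * \<theta> ^ m" using rho by (simp add: \<theta>_def power_mult_distrib[symmetric])
        also have "\<dots> \<le> e * \<theta> ^ j"
          using c2 False theta_ge e rho by (intro mult_mono power_increasing) auto
        finally have "moment_bound 8 * 1 \<le> (4 + moment_bound 8) * (e * \<theta> ^ j)"
          using moment_bound_nonneg[of 8] by (intro mult_mono) auto
        then show "moment_bound 8 \<le> (4 + moment_bound 8) * e * \<theta> ^ j" by (simp add: mult.assoc)
      qed (use moment_bound_nonneg in auto)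
      finally show ?thesis .
    qed
    have "(\<integral>\<^sup>+ z. ennreal (\<bar>\<Psi> v z - \<phi> z\<bar> ^ 4) \<partial>Q) \<le> ennreal (K_lip b * ((4 + moment_bound 8) * e) ^ 4)"
      unfolding \<Psi>_def \<phi>_def
      by (rule H_class_Lipschitz[OF _ _ b0 _ HM Y'M diff])
         (use moment_bound_nonneg[of 8] e in \<open>auto intro!: measurable_compose[OF shift_measurable H_meas[OF v]]\<close>)
    also have "K_lip b * ((4 + moment_bound 8) * e) ^ 4 = C3 * e ^ 4" by (simp add: C3_def power_mult_distrib)
    finally show ?thesis using \<phi>_meas dep bd by blast
  qed
  then show ?thesis using C1 C2 C3 by blast
qed

end

section \<open>Decay of the autocovariances\<close>

lemma (in prob_space) L4_moments:
  fixes f :: "'a \<Rightarrow> real"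
  assumes [measurable]: "f \<in> borel_measurable M" and K: "0 \<le> K"
    and le: "(\<integral>\<^sup>+ x. ennreal (\<bar>f x\<bar> ^ 4) \<partial>M) \<le> ennreal K"
  shows "integrable M f" "integrable M (\<lambda>x. (f x)\<^sup>2)" "(\<integral>x. (f x)\<^sup>2 \<partial>M) \<le> sqrt K" "(\<integral>x. \<bar>f x\<bar> \<partial>M) \<le> sqrt (sqrt K)"
proof -
  have "(\<integral>\<^sup>+ x. ennreal ((f x)\<^sup>2) * 1 \<partial>M)\<^sup>2 \<le> (\<integral>\<^sup>+ x. (ennreal ((f x)\<^sup>2))\<^sup>2 \<partial>M) * (\<integral>\<^sup>+ x. 1\<^sup>2 \<partial>M)"
    by (rule Cauchy_Schwarz_nn_integral) measurable
  also have "(\<integral>\<^sup>+ x. (ennreal ((f x)\<^sup>2))\<^sup>2 \<partial>M) = (\<integral>\<^sup>+ x. ennreal (\<bar>f x\<bar> ^ 4) \<partial>M)"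
    by (intro nn_integral_cong) (simp add: ennreal_power)
  also have "(\<integral>\<^sup>+ x. ennreal (\<bar>f x\<bar> ^ 4) \<partial>M) * (\<integral>\<^sup>+ x. 1\<^sup>2 \<partial>M) \<le> ennreal ((sqrt K)\<^sup>2)"
    using le K by (simp add: emeasure_space_1)
  finally have "(\<integral>\<^sup>+ x. ennreal ((f x)\<^sup>2) * 1 \<partial>M) \<le> ennreal (sqrt K)"
    by (rule ennreal_power2_le_imp_le) (use K in simp)
  then have 2: "(\<integral>\<^sup>+ x. ennreal ((f x)\<^sup>2) \<partial>M) \<le> ennreal (sqrt K)" by simp
  have "(\<integral>\<^sup>+ x. ennreal \<bar>f x\<bar> * 1 \<partial>M)\<^sup>2 \<le> (\<integral>\<^sup>+ x. (ennreal \<bar>f x\<bar>)\<^sup>2 \<partial>M) * (\<integral>\<^sup>+ x. 1\<^sup>2 \<partial>M)"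
    by (rule Cauchy_Schwarz_nn_integral) measurable
  also have "(\<integral>\<^sup>+ x. (ennreal \<bar>f x\<bar>)\<^sup>2 \<partial>M) = (\<integral>\<^sup>+ x. ennreal ((f x)\<^sup>2) \<partial>M)"
    by (intro nn_integral_cong) (simp add: ennreal_power)
  also have "(\<integral>\<^sup>+ x. ennreal ((f x)\<^sup>2) \<partial>M) * (\<integral>\<^sup>+ x. 1\<^sup>2 \<partial>M) \<le> ennreal ((sqrt (sqrt K))\<^sup>2)"
    using 2 K by (simp add: emeasure_space_1)
  finally have "(\<integral>\<^sup>+ x. ennreal \<bar>f x\<bar> * 1 \<partial>M) \<le> ennreal (sqrt (sqrt K))"
    by (rule ennreal_power2_le_imp_le) (use K in simp)
  then have 1: "(\<integral>\<^sup>+ x. ennreal \<bar>f x\<bar> \<partial>M) \<le> ennreal (sqrt (sqrt K))" by simp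
  show i1: "integrable M f"
  proof (rule integrableI_bounded)
    show "(\<integral>\<^sup>+ x. ennreal (norm (f x)) \<partial>M) < \<infinity>" using 1 by (auto intro: order.strict_trans1)
  qed measurable
  show i2: "integrable M (\<lambda>x. (f x)\<^sup>2)"
  proof (rule integrableI_bounded)
    show "(\<integral>\<^sup>+ x. ennreal (norm ((f x)\<^sup>2)) \<partial>M) < \<infinity>" using 2 by (auto intro: order.strict_trans1)
  qed measurable
  show "(\<integral>x. (f x)\<^sup>2 \<partial>M) \<le> sqrt K"
    using 2 K by (subst (asm) nn_integral_eq_integral[OF i2]) (auto simp: ennreal_le_iff)
  show "(\<integral>x. \<bar>f x\<bar> \<partial>M) \<le> sqrt (sqrt K)"
    using 1 K by (subst (asm) nn_integral_eq_integral[OF integrable_abs[OF i1]]) (auto simp: ennreal_le_iff)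
qed

lemma integrable_mult_of_squares:
  fixes f h :: "'a \<Rightarrow> real"
  assumes [measurable]: "f \<in> borel_measurable M" "h \<in> borel_measurable M"
    and "integrable M (\<lambda>x. (f x)\<^sup>2)" "integrable M (\<lambda>x. (h x)\<^sup>2)"
  shows "integrable M (\<lambda>x. f x * h x)"
proof (rule Bochner_Integration.integrable_bound[of _ "\<lambda>x. (f x)\<^sup>2 + (h x)\<^sup>2"])
  show "AE x in M. norm (f x * h x) \<le> norm ((f x)\<^sup>2 + (h x)\<^sup>2)"
  proof (rule AE_I2)
    fix x
    have "2 * \<bar>f x * h x\<bar> \<le> (f x)\<^sup>2 + (h x)\<^sup>2"
      using sum_squares_bound[of "\<bar>f x\<bar>" "\<bar>h x\<bar>"] by (simp add: abs_mult)
    then show "norm (f x * h x) \<le> norm ((f x)\<^sup>2 + (h x)\<^sup>2)" by simp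
  qed
qed (use assms in auto)

text \<open>
  The later functional uses at most \<open>k\<close> innovations, all of them after time 0, and the earlier one
  only innovations up to time 0.
\<close>
lemma (in iid_seq) product_of_distant_pasts:
  fixes F \<phi> :: "(nat \<Rightarrow> 's) \<Rightarrow> real"
  assumes [measurable]: "F \<in> borel_measurable Q" "\<phi> \<in> borel_measurable Q"
    and dep: "depends_first m (space Q) \<phi>" and km: "int m \<le> k"
    and int: "integrable Q F" "integrable Q \<phi>"
  shows "(\<integral>\<omega>. F (past \<zeta> 0 \<omega>) * \<phi> (past \<zeta> k \<omega>) \<partial>P) = (\<integral>z. F z \<partial>Q) * (\<integral>z. \<phi> z \<partial>Q)"
proof -
  let ?A = "{..0::int}" and ?B = "{0<..k}"
  have "k - int j \<in> ?B" if "j < m" for j using that km by auto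
  from window_factor[OF assms(2) dep this] obtain f where f: "f \<in> borel_measurable (\<Pi>\<^sub>M i\<in>?B. S)"
    "\<And>\<omega>. \<omega> \<in> space P \<Longrightarrow> \<phi> (past \<zeta> k \<omega>) = f (restrict (\<lambda>i. \<zeta> i \<omega>) ?B)" by blast
  have r: "(\<lambda>x j. x (- int j)) \<in> measurable (\<Pi>\<^sub>M i\<in>?A. S) Q"
    unfolding Q_def by (rule measurable_PiM_single') (auto simp: space_PiM space_\<mu>)
  have F: "F (past \<zeta> 0 \<omega>) = F (\<lambda>j. (restrict (\<lambda>i. \<zeta> i \<omega>) ?A) (- int j))" for \<omega>
    by (simp add: past_def)
  have "indep_var (PiM ?A (\<lambda>_. S)) (\<lambda>\<omega>. restrict (\<lambda>i. \<zeta> i \<omega>) ?A) (PiM ?B (\<lambda>_. S)) (\<lambda>\<omega>. restrict (\<lambda>i. \<zeta> i \<omega>) ?B)"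
    by (rule indep_var_restrict[OF indep]) auto
  from indep_var_compose[OF this measurable_compose[OF r assms(1)] f(1)]
  have iv: "indep_var borel (\<lambda>\<omega>. F (past \<zeta> 0 \<omega>)) borel (\<lambda>\<omega>. f (restrict (\<lambda>i. \<zeta> i \<omega>) ?B))"
    by (simp add: comp_def F)
  have i2: "integrable P (\<lambda>\<omega>. f (restrict (\<lambda>i. \<zeta> i \<omega>) ?B))"
    using integrable_past[OF int(2), of k] f(2) by (simp cong: Bochner_Integration.integrable_cong)
  have "(\<integral>\<omega>. F (past \<zeta> 0 \<omega>) * \<phi> (past \<zeta> k \<omega>) \<partial>P) = (\<integral>\<omega>. F (past \<zeta> 0 \<omega>) * f (restrict (\<lambda>i. \<zeta> i \<omega>) ?B) \<partial>P)"
    using f(2) by (intro Bochner_Integration.integral_cong) auto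
  also have "\<dots> = (\<integral>\<omega>. F (past \<zeta> 0 \<omega>) \<partial>P) * (\<integral>\<omega>. f (restrict (\<lambda>i. \<zeta> i \<omega>) ?B) \<partial>P)"
    by (rule indep_var_lebesgue_integral[OF iv integrable_past[OF int(1)] i2])
  also have "(\<integral>\<omega>. f (restrict (\<lambda>i. \<zeta> i \<omega>) ?B) \<partial>P) = (\<integral>\<omega>. \<phi> (past \<zeta> k \<omega>) \<partial>P)"
    using f(2) by (intro Bochner_Integration.integral_cong) auto
  finally show ?thesis by (simp add: integral_past)
qed

lemma poly_times_geometric_tendsto_0:
  fixes r :: real
  assumes "0 < r" "r < 1"
  shows "(\<lambda>m. (real m + 1) ^ K * r ^ m) \<longlonglongrightarrow> 0"
proof (cases "K = 0")
  case True
  then show ?thesis using assms by (simp add: LIMSEQ_realpow_zero)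
next
  case False
  define s where "s = root K r"
  have s: "0 < s" "s < 1" using assms False by (auto simp: s_def)
  have "(\<lambda>m. real m * s ^ m + s ^ m) \<longlonglongrightarrow> 0 + 0"
    using s by (intro tendsto_add powser_times_n_limit_0 LIMSEQ_realpow_zero) auto
  then have "(\<lambda>m. ((real m + 1) * s ^ m) ^ K) \<longlonglongrightarrow> 0 ^ K"
    by (intro tendsto_power) (simp add: algebra_simps)
  moreover have "((real m + 1) * s ^ m) ^ K = (real m + 1) ^ K * r ^ m" for m
    using assms False by (simp add: power_mult_distrib s_def power_mult[symmetric] mult.commute[of m K])
      (simp add: power_mult)
  ultimately show ?thesis using False by (simp add: power_0_left)
qed

text \<open>
  What is cut off is at most \<open>\<bar>f\<bar>\<close> and vanishes unless \<open>\<bar>f\<bar> > W\<close>, where a factor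
  \<open>(\<bar>f\<bar> / W)\<^bsup>q - 8\<^esup> \<ge> 1\<close> can be inserted.
\<close>
lemma clip_tail_moment:
  fixes f :: "'a \<Rightarrow> real"
  assumes [measurable]: "f \<in> borel_measurable N" and W: "0 < W" and q: "8 \<le> q"
    and m: "(\<integral>\<^sup>+ z. ennreal (\<bar>f z\<bar> ^ q) \<partial>N) \<le> ennreal (h ^ q)" and h: "0 \<le> h"
  shows "(\<integral>\<^sup>+ z. ennreal (\<bar>f z - clip W (f z)\<bar> ^ 8) \<partial>N) \<le> ennreal (h ^ q / W ^ (q - 8))"
proof -
  have pt: "\<bar>f z - clip W (f z)\<bar> ^ 8 \<le> \<bar>f z\<bar> ^ q / W ^ (q - 8)" for z
  proof (cases "\<bar>f z\<bar> \<le> W")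
    case True
    then have "clip W (f z) = f z" by (auto simp: clip_def)
    then show ?thesis using W by simp
  next
    case False
    have "\<bar>f z - clip W (f z)\<bar> \<le> \<bar>f z\<bar>" using W False by (auto simp: clip_def)
    then have "\<bar>f z - clip W (f z)\<bar> ^ 8 \<le> \<bar>f z\<bar> ^ 8" by (intro power_mono) auto
    also have "\<dots> * W ^ (q - 8) \<le> \<bar>f z\<bar> ^ 8 * \<bar>f z\<bar> ^ (q - 8)"
      using W False by (intro mult_left_mono power_mono) auto
    also have "\<dots> = \<bar>f z\<bar> ^ q" using q by (simp only: power_add[symmetric] le_add_diff_inverse)
    finally show ?thesis using W by (simp add: field_simps mult_right_mono)
  qed
  have "(\<integral>\<^sup>+ z. ennreal (\<bar>f z - clip W (f z)\<bar> ^ 8) \<partial>N) \<le> (\<integral>\<^sup>+ z. ennreal (1 / W ^ (q - 8)) * ennreal (\<bar>f z\<bar> ^ q) \<partial>N)"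
    using pt W by (intro nn_integral_mono) (auto simp flip: ennreal_mult intro!: ennreal_leI)
  also have "\<dots> = ennreal (1 / W ^ (q - 8)) * (\<integral>\<^sup>+ z. ennreal (\<bar>f z\<bar> ^ q) \<partial>N)"
    by (rule nn_integral_cmult) measurable
  also have "\<dots> \<le> ennreal (1 / W ^ (q - 8)) * ennreal (h ^ q)" by (intro mult_left_mono m) auto
  also have "\<dots> = ennreal (h ^ q / W ^ (q - 8))" using W h by (subst ennreal_mult[symmetric]) auto
  finally show ?thesis .
qed

context ls_model
begin

text \<open>
  The approximation with truncation level \<open>W = m + 1\<close>, polynomial in the range: then
  \<open>\<rho>\<^sup>m\<close> beats the powers of \<open>W\<close>, and moments of \<open>H\<close> make the clipping error as small as required.
\<close>
lemma \<Psi>_finite_range_eventually: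
  "\<exists>K\<ge>0. \<forall>u\<in>{0..1}. \<forall>\<^sub>F m in sequentially. \<exists>\<phi>. \<phi> \<in> borel_measurable Q \<and>
     depends_first (2 * m) (space Q) \<phi> \<and> (\<exists>b. \<forall>z. \<bar>\<phi> z\<bar> \<le> b) \<and>
     (\<integral>\<^sup>+ z. ennreal (\<bar>\<Psi> u z - \<phi> z\<bar> ^ 4) \<partial>Q) \<le> ennreal (K * (1 / (real m + 1) ^ 2) ^ 4)"
proof -
  obtain C1 C2 C3 where C: "0 \<le> C1" "0 \<le> C2" "0 \<le> C3"
    and ap: "\<And>m W e v. 1 \<le> W \<Longrightarrow> 0 < e \<Longrightarrow> e \<le> 1 \<Longrightarrow> v \<in> {0..1} \<Longrightarrow>
      (\<integral>\<^sup>+ z. ennreal (\<bar>H z v - clip W (H z v)\<bar> ^ 8) \<partial>Q) \<le> ennreal (e ^ 8) \<Longrightarrow>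
      C1 * (2 * W) ^ (8 * M) * \<rho> ^ m \<le> e ^ 8 \<Longrightarrow> sqrt \<rho> ^ m \<le> e \<Longrightarrow>
      (\<exists>\<phi>. \<phi> \<in> borel_measurable Q \<and> depends_first (2 * m) (space Q) \<phi> \<and> (\<forall>z. \<bar>\<phi> z\<bar> \<le> C2 * W ^ M) \<and>
         (\<integral>\<^sup>+ z. ennreal (\<bar>\<Psi> v z - \<phi> z\<bar> ^ 4) \<partial>Q) \<le> ennreal (C3 * e ^ 4))"
    using finite_range_approximation by blast
  have ev1: "\<forall>\<^sub>F m in sequentially. moment_bound 32 ^ 32 \<le> real m + 1"
    by (rule eventually_mono[OF eventually_ge_at_top[of "nat \<lceil>moment_bound 32 ^ 32\<rceil>"]]) linarith
  have "(\<lambda>m. (real m + 1) ^ (8 * M + 16) * \<rho> ^ m) \<longlonglongrightarrow> 0" by (rule poly_times_geometric_tendsto_0[OF rho])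
  then have ev2: "\<forall>\<^sub>F m in sequentially. (real m + 1) ^ (8 * M + 16) * \<rho> ^ m < 1 / (C1 * 2 ^ (8 * M) + 1)"
    using C by (intro order_tendstoD(2)) (auto intro!: divide_pos_pos add_nonneg_pos mult_nonneg_nonneg)
  have "(\<lambda>m. (real m + 1) ^ 2 * sqrt \<rho> ^ m) \<longlonglongrightarrow> 0"
    using rho by (intro poly_times_geometric_tendsto_0) (auto simp: real_sqrt_lt_1_iff)
  then have ev3: "\<forall>\<^sub>F m in sequentially. (real m + 1) ^ 2 * sqrt \<rho> ^ m < 1"
    by (intro order_tendstoD(2)) auto
  have "\<forall>\<^sub>F m in sequentially. \<exists>\<phi>. \<phi> \<in> borel_measurable Q \<and>
     depends_first (2 * m) (space Q) \<phi> \<and> (\<exists>b. \<forall>z. \<bar>\<phi> z\<bar> \<le> b) \<and>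
     (\<integral>\<^sup>+ z. ennreal (\<bar>\<Psi> u z - \<phi> z\<bar> ^ 4) \<partial>Q) \<le> ennreal (C3 * (1 / (real m + 1) ^ 2) ^ 4)" if u: "u \<in> {0..1}" for u
    using ev1 ev2 ev3
  proof eventually_elim
    case (elim m)
    define n where "n = real m + 1"
    have n: "1 \<le> n" by (simp add: n_def)
    (* The moment of order 32 leaves n ^ (- 24), of which n ^ (- 16) is the target and
       the remaining n ^ (- 8) pays for the constant. *)
    have "(\<integral>\<^sup>+ z. ennreal (\<bar>H z u - clip n (H z u)\<bar> ^ 8) \<partial>Q) \<le> ennreal (moment_bound 32 ^ 32 / n ^ (32 - 8))"
      using n H_moment[OF u, of 32] moment_bound_nonneg by (intro clip_tail_moment H_meas[OF u]) auto
    also have "\<dots> \<le> ennreal ((1 / n ^ 2) ^ 8)"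
    proof (intro ennreal_leI)
      have "moment_bound 32 ^ 32 \<le> n ^ 1" using elim(1) by (simp add: n_def)
      also have "\<dots> \<le> n ^ 8" using n by (intro power_increasing) auto
      finally have "moment_bound 32 ^ 32 * n ^ 16 \<le> n ^ 8 * n ^ 16" using n by (intro mult_right_mono) auto
      then show "moment_bound 32 ^ 32 / n ^ (32 - 8) \<le> (1 / n ^ 2) ^ 8"
        using n by (simp add: power_divide power_mult[symmetric] power_add[symmetric] field_simps)
    qed
    finally have 1: "(\<integral>\<^sup>+ z. ennreal (\<bar>H z u - clip n (H z u)\<bar> ^ 8) \<partial>Q) \<le> ennreal ((1 / n ^ 2) ^ 8)" .
    have 2: "C1 * (2 * n) ^ (8 * M) * \<rho> ^ m \<le> (1 / n ^ 2) ^ 8"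
    proof -
      have pos: "0 < C1 * 2 ^ (8 * M) + 1" using C by (auto intro!: add_nonneg_pos mult_nonneg_nonneg)
      have "C1 * (2 * n) ^ (8 * M) * \<rho> ^ m * n ^ 16 = C1 * 2 ^ (8 * M) * (n ^ (8 * M + 16) * \<rho> ^ m)"
        by (simp add: power_mult_distrib power_add)
      also have "\<dots> \<le> (C1 * 2 ^ (8 * M) + 1) * (1 / (C1 * 2 ^ (8 * M) + 1))"
        using elim(2) C n rho by (intro mult_mono) (auto simp: n_def)
      also have "\<dots> = 1" using pos by simp
      finally show ?thesis using n by (simp add: power_divide power_mult[symmetric] field_simps)
    qed
    have 3: "sqrt \<rho> ^ m \<le> 1 / n ^ 2" using elim(3) n by (simp add: n_def field_simps)
    have 4: "0 < 1 / n ^ 2" "1 / n ^ 2 \<le> 1" using n by (auto simp: divide_le_eq one_le_power)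
    from ap[OF n 4 u 1 2 3] show ?case unfolding n_def by blast
  qed
  then show ?thesis using C by blast
qed

definition "mean_\<Psi> u = (\<integral>z. \<Psi> u z \<partial>Q)"
definition "autocov u k = (\<integral>\<omega>. (\<Psi> u (past \<zeta> 0 \<omega>) - mean_\<Psi> u) * (\<Psi> u (past \<zeta> k \<omega>) - mean_\<Psi> u) \<partial>P)"

lemma \<Psi>_integrable:
  assumes u: "u \<in> {0..1}"
  shows "integrable Q (\<Psi> u)" "integrable Q (\<lambda>z. (\<Psi> u z)\<^sup>2)" "integrable Q (\<lambda>z. (\<Psi> u z - mean_\<Psi> u)\<^sup>2)"
proof -
  interpret Q: prob_space Q by (rule prob_space_Q)
  obtain K where K: "0 \<le> K" "(\<integral>\<^sup>+ z. ennreal (\<bar>\<Psi> u z\<bar> ^ 4) \<partial>Q) \<le> ennreal K"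
    using \<Psi>_moment4 u by blast
  show 1: "integrable Q (\<Psi> u)" and 2: "integrable Q (\<lambda>z. (\<Psi> u z)\<^sup>2)"
    using Q.L4_moments[OF \<Psi>_meas[OF u] K] by auto
  have "(\<lambda>z. (\<Psi> u z - mean_\<Psi> u)\<^sup>2) = (\<lambda>z. (\<Psi> u z)\<^sup>2 - 2 * mean_\<Psi> u * \<Psi> u z + (mean_\<Psi> u)\<^sup>2)"
    by (simp add: power2_eq_square algebra_simps)
  then show "integrable Q (\<lambda>z. (\<Psi> u z - mean_\<Psi> u)\<^sup>2)" using 1 2 by simp
qed

text \<open>
  Approximate the later variable by a centred functional of at most \<open>k\<close> innovations, which is
  independent of the earlier variable. Only the covariance with the remainder is left, and
  Cauchy-Schwarz bounds it by the \<open>L\<^sup>2\<close> error. A rate \<open>k\<^sup>-\<^sup>2\<close> is enough for summability.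
\<close>
lemma autocov_decay:
  assumes u: "u \<in> {0..1}"
  shows "\<exists>K. \<forall>\<^sub>F k in sequentially. \<bar>autocov u (int k)\<bar> \<le> K * (1 / (real k + 1) ^ 2)"
proof -
  interpret Q: prob_space Q by (rule prob_space_Q)
  note [measurable] = \<Psi>_meas[OF u]
  define F where "F = (\<lambda>z. \<Psi> u z - mean_\<Psi> u)"
  have [measurable]: "F \<in> borel_measurable Q" unfolding F_def by measurable
  have iF: "integrable Q F" "integrable Q (\<lambda>z. (F z)\<^sup>2)" unfolding F_def using \<Psi>_integrable[OF u] by auto
  have F0: "(\<integral>z. F z \<partial>Q) = 0" unfolding F_def mean_\<Psi>_def using \<Psi>_integrable[OF u] by (simp add: Q.prob_space)
  define B where "B = (\<integral>z. (F z)\<^sup>2 \<partial>Q)"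
  obtain K where K: "0 \<le> K" and ev: "\<forall>\<^sub>F m in sequentially. \<exists>\<phi>. \<phi> \<in> borel_measurable Q \<and>
     depends_first (2 * m) (space Q) \<phi> \<and> (\<exists>b. \<forall>z. \<bar>\<phi> z\<bar> \<le> b) \<and>
     (\<integral>\<^sup>+ z. ennreal (\<bar>\<Psi> u z - \<phi> z\<bar> ^ 4) \<partial>Q) \<le> ennreal (K * (1 / (real m + 1) ^ 2) ^ 4)"
    using \<Psi>_finite_range_eventually u by blast
  have "filterlim (\<lambda>k. k div 2) sequentially sequentially"
    unfolding filterlim_at_top
  proof (rule allI)
    fix Z :: nat
    show "\<forall>\<^sub>F k in sequentially. Z \<le> k div 2"
      by (rule eventually_sequentiallyI[of "2 * Z"]) linarith
  qed
  from eventually_compose_filterlim[OF ev this]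
  have "\<forall>\<^sub>F k in sequentially. \<bar>autocov u (int k)\<bar> \<le> (2 * (B + sqrt K)) * (1 / (real k + 1) ^ 2)"
  proof eventually_elim
    case (elim k)
    define m where "m = k div 2"
    define e where "e = 1 / (real m + 1) ^ 2"
    have e: "0 < e" by (simp add: e_def)
    obtain \<phi> b where [measurable]: "\<phi> \<in> borel_measurable Q" and dep: "depends_first (2 * m) (space Q) \<phi>"
      and b: "\<And>z. \<bar>\<phi> z\<bar> \<le> b" and le: "(\<integral>\<^sup>+ z. ennreal (\<bar>\<Psi> u z - \<phi> z\<bar> ^ 4) \<partial>Q) \<le> ennreal (K * e ^ 4)"
      using elim by (auto simp: m_def e_def)
    have i\<phi>: "integrable Q \<phi>" "integrable Q (\<lambda>z. (\<phi> z)\<^sup>2)"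
    proof -
      show "integrable Q \<phi>" using b by (intro Q.integrable_const_bound[where B=b]) auto
      have "(\<phi> z)\<^sup>2 \<le> b\<^sup>2" for z using power_mono[OF b[of z], of 2] by simp
      then show "integrable Q (\<lambda>z. (\<phi> z)\<^sup>2)" by (intro Q.integrable_const_bound[where B="b\<^sup>2"]) auto
    qed
    define m\<phi> where "m\<phi> = (\<integral>z. \<phi> z \<partial>Q)"
    define \<phi>' where "\<phi>' = (\<lambda>z. \<phi> z - m\<phi>)"
    have [measurable]: "\<phi>' \<in> borel_measurable Q" unfolding \<phi>'_def by measurable
    have i\<phi>': "integrable Q \<phi>'" unfolding \<phi>'_def using i\<phi> by simp
    have dep': "depends_first (2 * m) (space Q) \<phi>'" unfolding \<phi>'_def
      by (rule depends_first_comp2[OF dep dep, where h = "\<lambda>a _. a - m\<phi>"])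
    define R where "R = (\<lambda>z. F z - \<phi>' z)"
    have [measurable]: "R \<in> borel_measurable Q" unfolding R_def by measurable
    note L4 = Q.L4_moments[of "\<lambda>z. \<Psi> u z - \<phi> z", OF _ _ le]
    have ER: "(\<integral>z. (R z)\<^sup>2 \<partial>Q) \<le> sqrt K * e\<^sup>2" and iR: "integrable Q (\<lambda>z. (R z)\<^sup>2)"
    proof -
      define h where "h = (\<lambda>z. \<Psi> u z - \<phi> z)"
      have h: "integrable Q h" "integrable Q (\<lambda>z. (h z)\<^sup>2)" "(\<integral>z. (h z)\<^sup>2 \<partial>Q) \<le> sqrt (K * e ^ 4)"
        unfolding h_def using L4 K e by auto
      have Rh: "R = (\<lambda>z. h z - (\<integral>z. h z \<partial>Q))"
        unfolding R_def F_def \<phi>'_def h_def m\<phi>_def mean_\<Psi>_def using \<Psi>_integrable[OF u] i\<phi> by (auto simp: algebra_simps)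
      have "(\<integral>z. (R z)\<^sup>2 \<partial>Q) = (\<integral>z. (h z)\<^sup>2 \<partial>Q) - (\<integral>z. h z \<partial>Q)\<^sup>2"
        unfolding Rh by (rule Q.variance_eq[OF h(1,2)])
      also have "\<dots> \<le> sqrt (K * e ^ 4)" using h(3) by (smt (verit) zero_le_power2)
      also have "\<dots> = sqrt K * e\<^sup>2"
      proof -
        have e4: "e ^ 4 = (e\<^sup>2)\<^sup>2" by simp
        show ?thesis by (simp only: e4 real_sqrt_mult real_sqrt_abs abs_power2)
      qed
      finally show "(\<integral>z. (R z)\<^sup>2 \<partial>Q) \<le> sqrt K * e\<^sup>2" .
      have "(\<lambda>z. (R z)\<^sup>2) = (\<lambda>z. (h z)\<^sup>2 - 2 * (\<integral>z. h z \<partial>Q) * h z + (\<integral>z. h z \<partial>Q)\<^sup>2)"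
        unfolding Rh by (simp add: power2_eq_square algebra_simps)
      then show "integrable Q (\<lambda>z. (R z)\<^sup>2)" using h by simp
    qed
    have mm: "(\<lambda>\<omega>. F (past \<zeta> 0 \<omega>)) \<in> borel_measurable P" "(\<lambda>\<omega>. R (past \<zeta> (int k) \<omega>)) \<in> borel_measurable P"
        "(\<lambda>\<omega>. \<phi>' (past \<zeta> (int k) \<omega>)) \<in> borel_measurable P" by measurable
    have i\<phi>'2: "integrable Q (\<lambda>z. (\<phi>' z)\<^sup>2)"
    proof -
      have "(\<lambda>z. (\<phi>' z)\<^sup>2) = (\<lambda>z. (\<phi> z)\<^sup>2 - 2 * m\<phi> * \<phi> z + m\<phi>\<^sup>2)"
        unfolding \<phi>'_def by (simp add: power2_eq_square algebra_simps)
      then show ?thesis using i\<phi> by simp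
    qed
    have iFR: "integrable P (\<lambda>\<omega>. F (past \<zeta> 0 \<omega>) * R (past \<zeta> (int k) \<omega>))"
      by (intro integrable_mult_of_squares mm integrable_past[OF iF(2)] integrable_past[OF iR])
    have iFphi: "integrable P (\<lambda>\<omega>. F (past \<zeta> 0 \<omega>) * \<phi>' (past \<zeta> (int k) \<omega>))"
      by (intro integrable_mult_of_squares mm integrable_past[OF iF(2)] integrable_past[OF i\<phi>'2])
    have "autocov u (int k) = (\<integral>\<omega>. F (past \<zeta> 0 \<omega>) * R (past \<zeta> (int k) \<omega>) + F (past \<zeta> 0 \<omega>) * \<phi>' (past \<zeta> (int k) \<omega>) \<partial>P)"
      unfolding autocov_def R_def F_def by (simp add: algebra_simps)
    also have "\<dots> = (\<integral>\<omega>. F (past \<zeta> 0 \<omega>) * R (past \<zeta> (int k) \<omega>) \<partial>P) + (\<integral>\<omega>. F (past \<zeta> 0 \<omega>) * \<phi>' (past \<zeta> (int k) \<omega>) \<partial>P)"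
      by (rule Bochner_Integration.integral_add[OF iFR iFphi])
    also have "(\<integral>\<omega>. F (past \<zeta> 0 \<omega>) * \<phi>' (past \<zeta> (int k) \<omega>) \<partial>P) = 0"
      by (subst product_of_distant_pasts[OF _ _ dep' _ iF(1) i\<phi>']) (auto simp: m_def F0)
    finally have "\<bar>autocov u (int k)\<bar> \<le> (\<integral>\<omega>. \<bar>F (past \<zeta> 0 \<omega>) * R (past \<zeta> (int k) \<omega>)\<bar> \<partial>P)"
      by (simp add: integral_abs_bound)
    also have "\<dots> \<le> (\<integral>\<omega>. (e * (F (past \<zeta> 0 \<omega>))\<^sup>2 + (R (past \<zeta> (int k) \<omega>))\<^sup>2 / e) / 2 \<partial>P)"
    proof (rule integral_mono)
      show "integrable P (\<lambda>\<omega>. \<bar>F (past \<zeta> 0 \<omega>) * R (past \<zeta> (int k) \<omega>)\<bar>)" by (intro integrable_abs iFR)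
      show "integrable P (\<lambda>\<omega>. (e * (F (past \<zeta> 0 \<omega>))\<^sup>2 + (R (past \<zeta> (int k) \<omega>))\<^sup>2 / e) / 2)"
        using integrable_past[OF iF(2)] integrable_past[OF iR] by simp
      fix \<omega>
      define a where "a = \<bar>F (past \<zeta> 0 \<omega>)\<bar>" define r where "r = \<bar>R (past \<zeta> (int k) \<omega>)\<bar>"
      have "2 * (e * a) * r \<le> (e * a)\<^sup>2 + r\<^sup>2" by (rule sum_squares_bound)
      then have "2 * (a * r) \<le> e * a\<^sup>2 + r\<^sup>2 / e" using e by (simp add: field_simps power2_eq_square)
      then show "\<bar>F (past \<zeta> 0 \<omega>) * R (past \<zeta> (int k) \<omega>)\<bar> \<le> (e * (F (past \<zeta> 0 \<omega>))\<^sup>2 + (R (past \<zeta> (int k) \<omega>))\<^sup>2 / e) / 2"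
        by (simp add: a_def r_def abs_mult)
    qed
    also have "\<dots> = (e * B + (\<integral>z. (R z)\<^sup>2 \<partial>Q) / e) / 2"
    proof -
      have "(\<integral>\<omega>. (F (past \<zeta> 0 \<omega>))\<^sup>2 \<partial>P) = B" unfolding B_def by (rule integral_past) measurable
      moreover have "(\<integral>\<omega>. (R (past \<zeta> (int k) \<omega>))\<^sup>2 \<partial>P) = (\<integral>z. (R z)\<^sup>2 \<partial>Q)" by (rule integral_past) measurable
      ultimately show ?thesis
        using integrable_past[OF iF(2), of 0] integrable_past[OF iR, of "int k"] by simp
    qed
    also have "\<dots> \<le> (e * B + sqrt K * e) / 2"
      using ER e by (simp add: field_simps power2_eq_square)
    also have "\<dots> = (B + sqrt K) / 2 * e" by (simp add: algebra_simps)
    also have "\<dots> \<le> (B + sqrt K) / 2 * (4 / (real k + 1) ^ 2)"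
    proof (intro mult_left_mono)
      have "k \<le> 2 * m + 1" unfolding m_def by presburger
      then have "real k \<le> real (2 * m + 1)" by (rule of_nat_mono)
      then have "real k + 1 \<le> 2 * (real m + 1)" by simp
      then have "(real k + 1)\<^sup>2 \<le> (2 * (real m + 1))\<^sup>2" by (rule power_mono) simp
      then have "4 / (2 * (real m + 1))\<^sup>2 \<le> 4 / (real k + 1)\<^sup>2" by (rule divide_left_mono) auto
      moreover have "4 / (2 * n)\<^sup>2 = 1 / n\<^sup>2" for n :: real by (simp add: power_mult_distrib)
      ultimately show "e \<le> 4 / (real k + 1) ^ 2" by (simp only: e_def)
      show "0 \<le> (B + sqrt K) / 2" unfolding B_def using K by simp
    qed
    also have "(B + sqrt K) / 2 * (4 / (real k + 1) ^ 2) = (2 * (B + sqrt K)) * (1 / (real k + 1) ^ 2)"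
    proof -
      have "x / 2 * (4 / y) = 2 * x * (1 / y)" for x y :: real by simp
      then show ?thesis .
    qed
    finally show ?case .
  qed
  then show ?thesis by blast
qed

end

section \<open>The long-run variance\<close>

context ls_model
begin

definition "centered u z = \<Psi> u z - mean_\<Psi> u"
definition "lr_var u = (\<Sum>\<^sub>\<infinity>k\<in>UNIV. autocov u k)"

lemma centered_measurable [measurable]: "u \<in> {0..1} \<Longrightarrow> centered u \<in> borel_measurable Q"
  unfolding centered_def by measurable

lemma centered_integrable:
  assumes "u \<in> {0..1}"
  shows "integrable Q (centered u)" "integrable Q (\<lambda>z. (centered u z)\<^sup>2)" "(\<integral>z. centered u z \<partial>Q) = 0"
proof -
  interpret Q: prob_space Q by (rule prob_space_Q)
  show "integrable Q (centered u)" "integrable Q (\<lambda>z. (centered u z)\<^sup>2)" "(\<integral>z. centered u z \<partial>Q) = 0"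
    using \<Psi>_integrable[OF assms] unfolding centered_def[abs_def] by (auto simp: mean_\<Psi>_def Q.prob_space)
qed

lemma autocov_eq:
  assumes u: "u \<in> {0..1}"
  shows "(\<integral>\<omega>. centered u (past \<zeta> s \<omega>) * centered u (past \<zeta> t \<omega>) \<partial>P) = autocov u (t - s)"
  using integral_two_pasts_shift[OF centered_measurable[OF u] centered_measurable[OF u], of 0 s "t - s"]
  by (simp add: autocov_def centered_def)

lemma autocov_uminus: "u \<in> {0..1} \<Longrightarrow> autocov u (- k) = autocov u k"
  using autocov_eq[of u 0 k] autocov_eq[of u k 0] by (simp add: mult.commute)

lemma autocov_summable:
  assumes u: "u \<in> {0..1}"
  shows "autocov u summable_on UNIV"
proof -
  obtain K where K: "\<forall>\<^sub>F k in sequentially. \<bar>autocov u (int k)\<bar> \<le> K * (1 / (real k + 1) ^ 2)"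
    using autocov_decay[OF u] by blast
  have "summable (\<lambda>k. K * (1 / (real k + 1) ^ 2))"
  proof (rule summable_mult)
    have "summable (\<lambda>n. inverse (real n ^ 2))" by (rule inverse_power_summable) simp
    then have "summable (\<lambda>n. inverse (real (Suc n) ^ 2))" by (subst summable_Suc_iff)
    then show "summable (\<lambda>k. 1 / (real k + 1) ^ 2)" by (simp add: inverse_eq_divide add.commute)
  qed
  then have s: "summable (\<lambda>k. norm (autocov u (int k)))"
    by (rule summable_comparison_test_ev[rotated]) (use K in simp)
  have 1: "(\<lambda>k. autocov u (int k)) summable_on UNIV" by (rule norm_summable_imp_summable_on[OF s])
  have 2: "(\<lambda>k. autocov u (int (Suc k))) summable_on UNIV"
    by (rule norm_summable_imp_summable_on) (use s in \<open>subst summable_Suc_iff[of "\<lambda>k. norm (autocov u (int k))"]\<close>)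
  have "autocov u summable_on range int"
    using 1 by (subst summable_on_reindex) (auto simp: comp_def)
  moreover have "autocov u summable_on range (\<lambda>k. - int (Suc k))"
  proof -
    have "autocov u \<circ> (\<lambda>k. - int (Suc k)) = (\<lambda>k. autocov u (int (Suc k)))"
      by (simp only: comp_def autocov_uminus[OF u])
    with 2 show ?thesis by (subst summable_on_reindex) (auto simp: inj_def)
  qed
  moreover have "range int \<inter> range (\<lambda>k. - int (Suc k)) = {}" by auto
  ultimately have "autocov u summable_on (range int \<union> range (\<lambda>k. - int (Suc k)))"
    by (rule summable_on_Un_disjoint)
  moreover have "range int \<union> range (\<lambda>k. - int (Suc k)) = UNIV"
  proof (intro equalityI subsetI)
    fix k :: int
    show "k \<in> range int \<union> range (\<lambda>k. - int (Suc k))"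
      by (cases k rule: int_cases) auto
  qed simp
  ultimately show ?thesis by simp
qed

lemma partial_autocov_tendsto:
  assumes u: "u \<in> {0..1}"
  shows "(\<lambda>l. \<Sum>k\<in>{- int l..int l}. autocov u k) \<longlonglongrightarrow> lr_var u"
proof -
  have "(sum (autocov u) \<longlongrightarrow> lr_var u) (finite_subsets_at_top UNIV)"
    using has_sum_infsum[OF autocov_summable[OF u]] by (simp add: has_sum_def lr_var_def)
  moreover have "filterlim (\<lambda>l. {- int l..int l}) (finite_subsets_at_top UNIV) sequentially"
    unfolding filterlim_finite_subsets_at_top
  proof (intro allI impI)
    fix X :: "int set" assume X: "finite X \<and> X \<subseteq> UNIV"
    define N where "N = Max (insert 0 ((\<lambda>k. nat \<bar>k\<bar>) ` X))"
    have N: "nat \<bar>k\<bar> \<le> N" if "k \<in> X" for k unfolding N_def using X that by (intro Max_ge) auto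
    show "\<forall>\<^sub>F y in sequentially. finite {- int y..int y} \<and> X \<subseteq> {- int y..int y} \<and> {- int y..int y} \<subseteq> UNIV"
    proof (rule eventually_sequentiallyI[of N], intro conjI subsetI)
      fix l k assume "N \<le> l" "k \<in> X"
      then have "nat \<bar>k\<bar> \<le> l" using N by force
      then show "k \<in> {- int l..int l}" by auto
    qed auto
  qed
  ultimately show ?thesis by (rule filterlim_compose)
qed

lemma centered_product_integrable:
  assumes u: "u \<in> {0..1}"
  shows "integrable P (\<lambda>\<omega>. centered u (past \<zeta> s \<omega>) * centered u (past \<zeta> t \<omega>))"
  using u by (intro integrable_mult_of_squares integrable_past[OF centered_integrable(2)[OF u]]) auto

text \<open>
  A further term adds its variance and twice its covariances with the \<open>l\<close> previous ones; by symmetry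
  of the autocovariances this is the symmetric partial sum.
\<close>
lemma variance_of_sum_Suc:
  assumes u: "u \<in> {0..1}"
  shows "(\<integral>\<omega>. (\<Sum>t\<in>{t0..<t0 + int (Suc l)}. centered u (past \<zeta> t \<omega>))\<^sup>2 \<partial>P) =
    (\<integral>\<omega>. (\<Sum>t\<in>{t0..<t0 + int l}. centered u (past \<zeta> t \<omega>))\<^sup>2 \<partial>P) + (\<Sum>k\<in>{- int l..int l}. autocov u k)"
proof -
  define F where "F = (\<lambda>t \<omega>. centered u (past \<zeta> t \<omega>))"
  define A where "A = {t0..<t0 + int l}"
  define s where "s = t0 + int l"
  have FF: "integrable P (\<lambda>\<omega>. F a \<omega> * F b \<omega>)" "(\<integral>\<omega>. F a \<omega> * F b \<omega> \<partial>P) = autocov u (b - a)" for a b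
    unfolding F_def using centered_product_integrable[OF u] autocov_eq[OF u] by auto
  have set: "{t0..<t0 + int (Suc l)} = insert s A" "s \<notin> A" "finite A" by (auto simp: A_def s_def)
  have sqA: "(\<lambda>\<omega>. (\<Sum>t\<in>A. F t \<omega>)\<^sup>2) = (\<lambda>\<omega>. \<Sum>a\<in>A. \<Sum>b\<in>A. F a \<omega> * F b \<omega>)"
    by (simp add: power2_eq_square sum_product)
  have iA: "integrable P (\<lambda>\<omega>. (\<Sum>t\<in>A. F t \<omega>)\<^sup>2)" unfolding sqA by (intro Bochner_Integration.integrable_sum FF)
  have "(\<lambda>\<omega>. (\<Sum>t\<in>insert s A. F t \<omega>)\<^sup>2) = (\<lambda>\<omega>. (\<Sum>t\<in>A. F t \<omega>)\<^sup>2 + (2 * (\<Sum>t\<in>A. F t \<omega> * F s \<omega>) + F s \<omega> * F s \<omega>))"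
    using set by (simp add: power2_eq_square algebra_simps sum_distrib_left)
  then have "(\<integral>\<omega>. (\<Sum>t\<in>insert s A. F t \<omega>)\<^sup>2 \<partial>P) = (\<integral>\<omega>. (\<Sum>t\<in>A. F t \<omega>)\<^sup>2 \<partial>P) +
      (\<integral>\<omega>. 2 * (\<Sum>t\<in>A. F t \<omega> * F s \<omega>) + F s \<omega> * F s \<omega> \<partial>P)"
    by (simp only:) (intro Bochner_Integration.integral_add iA Bochner_Integration.integrable_add integrable_mult_right Bochner_Integration.integrable_sum FF)
  also have "(\<integral>\<omega>. 2 * (\<Sum>t\<in>A. F t \<omega> * F s \<omega>) + F s \<omega> * F s \<omega> \<partial>P) =
      (\<integral>\<omega>. 2 * (\<Sum>t\<in>A. F t \<omega> * F s \<omega>) \<partial>P) + (\<integral>\<omega>. F s \<omega> * F s \<omega> \<partial>P)"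
    by (intro Bochner_Integration.integral_add integrable_mult_right Bochner_Integration.integrable_sum FF)
  also have "(\<integral>\<omega>. 2 * (\<Sum>t\<in>A. F t \<omega> * F s \<omega>) \<partial>P) = 2 * (\<Sum>t\<in>A. autocov u (s - t))"
    by (simp add: Bochner_Integration.integral_sum FF)
  also have "(\<integral>\<omega>. F s \<omega> * F s \<omega> \<partial>P) = autocov u 0" by (simp add: FF)
  also have "(\<Sum>t\<in>A. autocov u (s - t)) = (\<Sum>k\<in>{1..int l}. autocov u k)"
    by (rule sum.reindex_bij_witness[of _ "\<lambda>k. s - k" "\<lambda>t. s - t"]) (auto simp: A_def s_def)
  also have "2 * (\<Sum>k\<in>{1..int l}. autocov u k) + autocov u 0 = (\<Sum>k\<in>{- int l..int l}. autocov u k)"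
  proof -
    have "{- int l..int l} = {- int l.. -1} \<union> insert 0 {1..int l}" by auto
    then have "(\<Sum>k\<in>{- int l..int l}. autocov u k) = (\<Sum>k\<in>{- int l.. -1}. autocov u k) + (autocov u 0 + (\<Sum>k\<in>{1..int l}. autocov u k))"
      by (simp only:) (subst sum.union_disjoint, auto)
    moreover have "(\<Sum>k\<in>{- int l.. -1}. autocov u k) = (\<Sum>k\<in>{1..int l}. autocov u k)"
      by (rule sum.reindex_bij_witness[of _ uminus uminus]) (auto simp: autocov_uminus[OF u])
    ultimately show ?thesis by simp
  qed
  finally show ?thesis unfolding set(1) F_def A_def by simp
qed

text \<open>
  The increments of the variance converge to the long-run variance, so finitely many of them are
  too large and these contribute a constant, which \<open>\<epsilon> l / 2\<close> eventually absorbs.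
\<close>
lemma variance_of_sum_le:
  assumes u: "u \<in> {0..1}" and eps: "0 < \<epsilon>"
  shows "\<exists>l0. \<forall>l\<ge>l0. \<forall>t0. (\<integral>\<omega>. (\<Sum>t\<in>{t0..<t0 + int l}. centered u (past \<zeta> t \<omega>))\<^sup>2 \<partial>P) \<le> real l * (lr_var u + \<epsilon>)"
proof -
  define d where "d = (\<lambda>l. \<Sum>k\<in>{- int l..int l}. autocov u k)"
  have V: "(\<integral>\<omega>. (\<Sum>t\<in>{t0..<t0 + int l}. centered u (past \<zeta> t \<omega>))\<^sup>2 \<partial>P) = (\<Sum>i<l. d i)" for l t0
  proof (induction l)
    case (Suc l)
    then show ?case unfolding variance_of_sum_Suc[OF u] by (simp add: d_def)
  qed simp
  have "\<forall>\<^sub>F l in sequentially. d l < lr_var u + \<epsilon> / 2"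
    using partial_autocov_tendsto[OF u] eps unfolding d_def by (intro order_tendstoD(2)) auto
  then obtain N where N: "\<And>l. N \<le> l \<Longrightarrow> d l < lr_var u + \<epsilon> / 2" by (auto simp: eventually_sequentially)
  define A where "A = (\<Sum>i<N. \<bar>d i - (lr_var u + \<epsilon> / 2)\<bar>)"
  have bound: "(\<Sum>i<l. d i) \<le> A + real l * (lr_var u + \<epsilon> / 2)" for l
  proof -
    have "(\<Sum>i<l. d i) - real l * (lr_var u + \<epsilon> / 2) = (\<Sum>i<l. d i - (lr_var u + \<epsilon> / 2))"
      by (simp add: sum_subtractf)
    also have "\<dots> \<le> (\<Sum>i<l. if i < N then \<bar>d i - (lr_var u + \<epsilon> / 2)\<bar> else 0)"
      using N by (intro sum_mono) (auto simp: not_less less_imp_le)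
    also have "\<dots> = (\<Sum>i\<in>{i. i < l \<and> i < N}. \<bar>d i - (lr_var u + \<epsilon> / 2)\<bar>)"
      by (subst sum.inter_filter[symmetric]) (auto intro!: sum.cong)
    also have "\<dots> \<le> A" unfolding A_def by (intro sum_mono2) auto
    finally show ?thesis by simp
  qed
  show ?thesis
  proof (intro exI[of _ "nat \<lceil>2 * A / \<epsilon>\<rceil>"] allI impI)
    fix l t0 assume "nat \<lceil>2 * A / \<epsilon>\<rceil> \<le> l"
    then have "2 * A / \<epsilon> \<le> real l" by linarith
    then have "A \<le> real l * (\<epsilon> / 2)" using eps by (simp add: field_simps)
    with bound[of l] show "(\<integral>\<omega>. (\<Sum>t\<in>{t0..<t0 + int l}. centered u (past \<zeta> t \<omega>))\<^sup>2 \<partial>P) \<le> real l * (lr_var u + \<epsilon>)"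
      unfolding V by (simp add: algebra_simps)
  qed
qed

text \<open>
  Otherwise the variance of a long sum would be negative.
\<close>
lemma lr_var_nonneg:
  assumes u: "u \<in> {0..1}"
  shows "0 \<le> lr_var u"
proof (rule ccontr)
  assume "\<not> 0 \<le> lr_var u"
  then have e: "0 < - lr_var u / 2" by simp
  from variance_of_sum_le[OF u e] obtain l0 where
    l0: "\<And>l t0. l0 \<le> l \<Longrightarrow> (\<integral>\<omega>. (\<Sum>t\<in>{t0..<t0 + int l}. centered u (past \<zeta> t \<omega>))\<^sup>2 \<partial>P) \<le> real l * (lr_var u + - lr_var u / 2)"
    by blast
  have "0 \<le> (\<integral>\<omega>. (\<Sum>t\<in>{0..<0 + int (Suc l0)}. centered u (past \<zeta> t \<omega>))\<^sup>2 \<partial>P)" by (rule integral_nonneg_AE) auto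
  also have "\<dots> \<le> real (Suc l0) * (lr_var u + - lr_var u / 2)" by (rule l0) simp
  also have "\<dots> < 0" using e by (simp add: mult_pos_neg)
  finally show False by simp
qed

text \<open>
  Within a block, the weights are close to the weight \<open>cb\<close> at a reference point and the functionals
  \<open>\<phi> t\<close> close to \<open>\<Psi> u\<close>. The main term is \<open>cb\<close> times the stationary block sum; the factor 2 from
  separating it from the error is the price for not tracking cross terms. Errors are summed crudely,
  whence \<open>l\<^sup>2\<close>, which is harmless for logarithmic \<open>l\<close>.
\<close>
lemma block_variance_le:
  fixes \<phi> :: "int \<Rightarrow> (nat \<Rightarrow> 's) \<Rightarrow> real" and c :: "int \<Rightarrow> real" and s :: int and l :: nat
  defines "I \<equiv> {s..<s + int l}"
  assumes u: "u \<in> {0..1}" and meas: "\<And>t. \<phi> t \<in> borel_measurable Q" and bd: "\<And>t z. \<bar>\<phi> t z\<bar> \<le> b"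
    and close: "\<And>t. c t \<noteq> 0 \<Longrightarrow> (\<integral>z. (\<phi> t z - \<Psi> u z)\<^sup>2 \<partial>Q) \<le> e2" and e2: "0 \<le> e2"
    and cm: "\<And>t. \<bar>c t\<bar> \<le> cm" and dd: "\<And>t. t \<in> I \<Longrightarrow> \<bar>c t - cb\<bar> \<le> dd"
    and var: "(\<integral>\<omega>. (\<Sum>t\<in>I. centered u (past \<zeta> t \<omega>))\<^sup>2 \<partial>P) \<le> real l * G1"
  shows "(\<integral>\<omega>. (\<Sum>t\<in>I. c t * (\<phi> t (past \<zeta> t \<omega>) - (\<integral>z. \<phi> t z \<partial>Q)))\<^sup>2 \<partial>P)
    \<le> 2 * cb\<^sup>2 * real l * G1 + 4 * (real l)\<^sup>2 * (cm\<^sup>2 * e2 + dd\<^sup>2 * (\<integral>z. (centered u z)\<^sup>2 \<partial>Q))"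
proof -
  interpret Q: prob_space Q by (rule prob_space_Q)
  note [measurable] = meas centered_measurable[OF u] \<Psi>_meas[OF u]
  define F where "F = (\<lambda>t \<omega>. centered u (past \<zeta> t \<omega>))"
  define \<gamma> where "\<gamma> = (\<integral>z. (centered u z)\<^sup>2 \<partial>Q)"
  define h where "h = (\<lambda>t z. \<phi> t z - \<Psi> u z)"
  define D where "D = (\<lambda>t z. h t z - (\<integral>z. h t z \<partial>Q))"
  have fin: "finite I" "card I = l" by (auto simp: I_def)
  have i\<phi>: "integrable Q (\<phi> t)" "integrable Q (\<lambda>z. (\<phi> t z)\<^sup>2)" for t
  proof -
    show "integrable Q (\<phi> t)" using bd by (intro Q.integrable_const_bound[where B=b]) auto
    have "(\<phi> t z)\<^sup>2 \<le> b\<^sup>2" for z using power_mono[OF bd[of t z], of 2] by simp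
    then show "integrable Q (\<lambda>z. (\<phi> t z)\<^sup>2)" by (intro Q.integrable_const_bound[where B="b\<^sup>2"]) auto
  qed
  have ih: "integrable Q (h t)" "integrable Q (\<lambda>z. (h t z)\<^sup>2)" for t
  proof -
    show "integrable Q (h t)" unfolding h_def using i\<phi> \<Psi>_integrable[OF u] by simp
    have "integrable Q (\<lambda>z. \<phi> t z * \<Psi> u z)"
      using i\<phi> \<Psi>_integrable[OF u] by (intro integrable_mult_of_squares) auto
    moreover have "(\<lambda>z. (h t z)\<^sup>2) = (\<lambda>z. (\<phi> t z)\<^sup>2 - 2 * (\<phi> t z * \<Psi> u z) + (\<Psi> u z)\<^sup>2)"
      unfolding h_def by (simp add: power2_eq_square algebra_simps)
    ultimately show "integrable Q (\<lambda>z. (h t z)\<^sup>2)" using i\<phi> \<Psi>_integrable[OF u] by simp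
  qed
  have [measurable]: "h t \<in> borel_measurable Q" "D t \<in> borel_measurable Q" for t unfolding h_def D_def by measurable
  have iD: "integrable Q (\<lambda>z. (D t z)\<^sup>2)" for t
  proof -
    have "(\<lambda>z. (D t z)\<^sup>2) = (\<lambda>z. (h t z)\<^sup>2 - 2 * (\<integral>z. h t z \<partial>Q) * h t z + (\<integral>z. h t z \<partial>Q)\<^sup>2)"
      unfolding D_def by (simp add: power2_eq_square algebra_simps)
    then show ?thesis using ih by simp
  qed
  have ED: "(\<integral>z. (D t z)\<^sup>2 \<partial>Q) \<le> e2" if "c t \<noteq> 0" for t
  proof -
    have "(\<integral>z. (D t z)\<^sup>2 \<partial>Q) = (\<integral>z. (h t z)\<^sup>2 \<partial>Q) - (\<integral>z. h t z \<partial>Q)\<^sup>2"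
      unfolding D_def by (rule Q.variance_eq[OF ih])
    also have "\<dots> \<le> (\<integral>z. (h t z)\<^sup>2 \<partial>Q)" by simp
    also have "\<dots> \<le> e2" using close[OF that] by (simp add: h_def)
    finally show ?thesis .
  qed
  have decomp: "\<phi> t z - (\<integral>z. \<phi> t z \<partial>Q) = centered u z + D t z" for t z
    unfolding D_def h_def centered_def mean_\<Psi>_def using i\<phi> \<Psi>_integrable[OF u] by simp
  define r where "r = (\<lambda>t \<omega>. c t * D t (past \<zeta> t \<omega>) + (c t - cb) * F t \<omega>)"
  define B where "B = (\<lambda>\<omega>. \<Sum>t\<in>I. c t * (\<phi> t (past \<zeta> t \<omega>) - (\<integral>z. \<phi> t z \<partial>Q)))"
  define g2 where "g2 = (\<lambda>\<omega>. \<Sum>t\<in>I. 2 * (c t)\<^sup>2 * (D t (past \<zeta> t \<omega>))\<^sup>2 + 2 * dd\<^sup>2 * (F t \<omega>)\<^sup>2)"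
  have pt: "(B \<omega>)\<^sup>2 \<le> 2 * cb\<^sup>2 * (\<Sum>t\<in>I. F t \<omega>)\<^sup>2 + 2 * (real l * g2 \<omega>)" for \<omega>
  proof -
    have "B \<omega> = cb * (\<Sum>t\<in>I. F t \<omega>) + (\<Sum>t\<in>I. r t \<omega>)"
      unfolding B_def r_def F_def decomp sum_distrib_left sum.distrib[symmetric] by (intro sum.cong) (auto simp: algebra_simps)
    then have "(B \<omega>)\<^sup>2 \<le> 2 * (cb * (\<Sum>t\<in>I. F t \<omega>))\<^sup>2 + 2 * (\<Sum>t\<in>I. r t \<omega>)\<^sup>2"
      using sum_squares_bound[of "cb * (\<Sum>t\<in>I. F t \<omega>)" "\<Sum>t\<in>I. r t \<omega>"] by (simp add: power2_sum)
    also have "(\<Sum>t\<in>I. r t \<omega>)\<^sup>2 \<le> (\<Sum>t\<in>I. (r t \<omega>)\<^sup>2) * real (card I)" by (rule sum_squared_le_sum_of_squares)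
    also have "(\<Sum>t\<in>I. (r t \<omega>)\<^sup>2) \<le> g2 \<omega>"
      unfolding g2_def
    proof (rule sum_mono)
      fix t assume t: "t \<in> I"
      have "(r t \<omega>)\<^sup>2 \<le> 2 * (c t * D t (past \<zeta> t \<omega>))\<^sup>2 + 2 * ((c t - cb) * F t \<omega>)\<^sup>2"
        unfolding r_def using sum_squares_bound[of "c t * D t (past \<zeta> t \<omega>)" "(c t - cb) * F t \<omega>"] by (simp add: power2_sum)
      moreover have "(c t - cb)\<^sup>2 \<le> dd\<^sup>2" using power_mono[OF dd[OF t], of 2] by simp
      then have "(c t - cb)\<^sup>2 * (F t \<omega>)\<^sup>2 \<le> dd\<^sup>2 * (F t \<omega>)\<^sup>2" by (rule mult_right_mono) simp
      ultimately show "(r t \<omega>)\<^sup>2 \<le> 2 * (c t)\<^sup>2 * (D t (past \<zeta> t \<omega>))\<^sup>2 + 2 * dd\<^sup>2 * (F t \<omega>)\<^sup>2"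
        by (simp add: power_mult_distrib)
    qed
    finally show ?thesis using fin by (simp add: power_mult_distrib mult.commute mult_right_mono)
  qed
  have iF2: "integrable P (\<lambda>\<omega>. (F t \<omega>)\<^sup>2)" for t unfolding F_def by (rule integrable_past[OF centered_integrable(2)[OF u]])
  have iD2: "integrable P (\<lambda>\<omega>. (D t (past \<zeta> t \<omega>))\<^sup>2)" for t by (rule integrable_past[OF iD])
  have ig2: "integrable P g2" unfolding g2_def by (intro Bochner_Integration.integrable_sum Bochner_Integration.integrable_add integrable_mult_right iF2 iD2)
  have iS: "integrable P (\<lambda>\<omega>. (\<Sum>t\<in>I. F t \<omega>)\<^sup>2)"
  proof -
    have "(\<lambda>\<omega>. (\<Sum>t\<in>I. F t \<omega>)\<^sup>2) = (\<lambda>\<omega>. \<Sum>a\<in>I. \<Sum>b\<in>I. F a \<omega> * F b \<omega>)"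
      by (simp add: power2_eq_square sum_product)
    then show ?thesis unfolding F_def by (simp only:) (intro Bochner_Integration.integrable_sum centered_product_integrable[OF u])
  qed
  have [measurable]: "B \<in> borel_measurable P" unfolding B_def by measurable
  have iR: "integrable P (\<lambda>\<omega>. 2 * cb\<^sup>2 * (\<Sum>t\<in>I. F t \<omega>)\<^sup>2 + 2 * (real l * g2 \<omega>))"
    using iS ig2 by (intro Bochner_Integration.integrable_add integrable_mult_right)
  have "integrable P (\<lambda>\<omega>. (B \<omega>)\<^sup>2)"
    by (rule Bochner_Integration.integrable_bound[OF iR]) (auto intro!: AE_I2 order.trans[OF pt])
  then have "(\<integral>\<omega>. (B \<omega>)\<^sup>2 \<partial>P) \<le> (\<integral>\<omega>. 2 * cb\<^sup>2 * (\<Sum>t\<in>I. F t \<omega>)\<^sup>2 + 2 * (real l * g2 \<omega>) \<partial>P)"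
    by (rule integral_mono[OF _ iR pt])
  also have "\<dots> = 2 * cb\<^sup>2 * (\<integral>\<omega>. (\<Sum>t\<in>I. F t \<omega>)\<^sup>2 \<partial>P) + 2 * (real l * (\<integral>\<omega>. g2 \<omega> \<partial>P))"
    using iS ig2 by (subst Bochner_Integration.integral_add) auto
  finally have t1: "(\<integral>\<omega>. (B \<omega>)\<^sup>2 \<partial>P) \<le> 2 * cb\<^sup>2 * (\<integral>\<omega>. (\<Sum>t\<in>I. F t \<omega>)\<^sup>2 \<partial>P) + 2 * (real l * (\<integral>\<omega>. g2 \<omega> \<partial>P))" .
  have t2: "2 * cb\<^sup>2 * (\<integral>\<omega>. (\<Sum>t\<in>I. F t \<omega>)\<^sup>2 \<partial>P) \<le> 2 * cb\<^sup>2 * (real l * G1)"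
    using var unfolding F_def by (intro mult_left_mono) auto
  have t3: "(\<integral>\<omega>. g2 \<omega> \<partial>P) \<le> (\<Sum>t\<in>I. 2 * cm\<^sup>2 * e2 + 2 * dd\<^sup>2 * \<gamma>)"
  proof -
    have "(\<integral>\<omega>. g2 \<omega> \<partial>P) = (\<Sum>t\<in>I. 2 * (c t)\<^sup>2 * (\<integral>z. (D t z)\<^sup>2 \<partial>Q) + 2 * dd\<^sup>2 * \<gamma>)"
    proof -
      have "(\<integral>\<omega>. (D t (past \<zeta> t \<omega>))\<^sup>2 \<partial>P) = (\<integral>z. (D t z)\<^sup>2 \<partial>Q)" for t by (rule integral_past) measurable
      moreover have "(\<integral>\<omega>. (F t \<omega>)\<^sup>2 \<partial>P) = \<gamma>" for t unfolding F_def \<gamma>_def by (rule integral_past) measurable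
      ultimately show ?thesis unfolding g2_def using iF2 iD2 by (subst Bochner_Integration.integral_sum) auto
    qed
    also have "\<dots> \<le> (\<Sum>t\<in>I. 2 * cm\<^sup>2 * e2 + 2 * dd\<^sup>2 * \<gamma>)"
    proof (intro sum_mono add_mono order_refl)
      fix t
      show "2 * (c t)\<^sup>2 * (\<integral>z. (D t z)\<^sup>2 \<partial>Q) \<le> 2 * cm\<^sup>2 * e2"
      proof (cases "c t = 0")
        case False
        have "(c t)\<^sup>2 \<le> cm\<^sup>2" using power_mono[OF cm[of t], of 2] by simp
        then have "(c t)\<^sup>2 * (\<integral>z. (D t z)\<^sup>2 \<partial>Q) \<le> cm\<^sup>2 * e2" using ED[OF False] by (intro mult_mono) auto
        then show ?thesis by simp
      qed (use e2 in simp)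
    qed
    finally show ?thesis .
  qed
  have t4: "(\<Sum>t\<in>I. 2 * cm\<^sup>2 * e2 + 2 * dd\<^sup>2 * \<gamma>) = real l * (2 * cm\<^sup>2 * e2 + 2 * dd\<^sup>2 * \<gamma>)" using fin by simp
  have "real l * (\<integral>\<omega>. g2 \<omega> \<partial>P) \<le> real l * (real l * (2 * cm\<^sup>2 * e2 + 2 * dd\<^sup>2 * \<gamma>))"
    using t3 unfolding t4 by (rule mult_left_mono) simp
  with t1 t2 have "(\<integral>\<omega>. (B \<omega>)\<^sup>2 \<partial>P) \<le> 2 * cb\<^sup>2 * (real l * G1) + 2 * (real l * (real l * (2 * cm\<^sup>2 * e2 + 2 * dd\<^sup>2 * \<gamma>)))"
    by linarith
  also have "\<dots> = 2 * cb\<^sup>2 * real l * G1 + 4 * (real l)\<^sup>2 * (cm\<^sup>2 * e2 + dd\<^sup>2 * \<gamma>)"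
    by (simp add: algebra_simps power2_eq_square)
  finally show ?thesis unfolding B_def \<gamma>_def .
qed

end

section \<open>Kernels, windows and moment constants\<close>

lemma lipschitz_mult_bounded:
  fixes f g :: "real \<Rightarrow> real"
  assumes f: "Lf-lipschitz_on UNIV f" and g: "Lg-lipschitz_on UNIV g"
    and bf: "\<And>x. \<bar>f x\<bar> \<le> A" and bg: "\<And>x. \<bar>g x\<bar> \<le> B"
  shows "(A * Lg + B * Lf)-lipschitz_on UNIV (\<lambda>x. f x * g x)"
proof (rule lipschitz_onI)
  have nn: "0 \<le> A" "0 \<le> B" "0 \<le> Lf" "0 \<le> Lg"
    using bf[of 0] bg[of 0] lipschitz_on_nonneg[OF f] lipschitz_on_nonneg[OF g] by auto
  then show "0 \<le> A * Lg + B * Lf" by simp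
  fix x y :: real
  have "\<bar>f x * g x - f y * g y\<bar> = \<bar>f x * (g x - g y) + g y * (f x - f y)\<bar>" by (simp add: algebra_simps)
  also have "\<dots> \<le> \<bar>f x\<bar> * \<bar>g x - g y\<bar> + \<bar>g y\<bar> * \<bar>f x - f y\<bar>" by (metis abs_mult abs_triangle_ineq)
  also have "\<dots> \<le> A * (Lg * \<bar>x - y\<bar>) + B * (Lf * \<bar>x - y\<bar>)"
    using f g bf bg nn by (intro add_mono mult_mono) (auto simp: lipschitz_on_def dist_real_def)
  finally show "dist (f x * g x) (f y * g y) \<le> (A * Lg + B * Lf) * dist x y"
    by (simp add: dist_real_def algebra_simps)
qed

text \<open>
  The bound \<open>2 L\<close> comes from comparing with the point 1, where \<open>K\<close> vanishes and from which
  no point of the support is farther than 2.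
\<close>
lemma kernel_class_facts:
  assumes K: "K \<in> kernel_class"
  obtains L where "L-lipschitz_on UNIV K" "\<And>x. 0 \<le> K x" "\<And>x. K (- x) = K x" "\<And>x. K x \<noteq> 0 \<Longrightarrow> \<bar>x\<bar> \<le> 1 / 2"
    "\<And>x. \<bar>K x\<bar> \<le> 2 * L" "(\<integral>x. K x \<partial>lborel) = 1" "0 \<le> L"
proof -
  obtain L where L: "L-lipschitz_on UNIV K" and pos: "\<And>x. 0 \<le> K x" and sym: "\<And>x. K (- x) = K x"
    and cl: "closure {x. K x \<noteq> 0} = {- 1 / 2 .. 1 / 2}" and int: "(\<integral>x. K x \<partial>lborel) = 1"
    using K by (auto simp: kernel_class_def)
  have supp: "\<bar>x\<bar> \<le> 1 / 2" if "K x \<noteq> 0" for x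
  proof -
    have "x \<in> closure {x. K x \<noteq> 0}" by (rule subsetD[OF closure_subset]) (use that in simp)
    then have "- 1 / 2 \<le> x" "x \<le> 1 / 2" unfolding cl by auto
    then show ?thesis by linarith
  qed
  have L0: "0 \<le> L" using L by (rule lipschitz_on_nonneg)
  have bd: "\<bar>K x\<bar> \<le> 2 * L" for x
  proof (cases "K x = 0")
    case False
    have "K 1 = 0" using supp[of 1] by auto
    moreover have "dist (K x) (K 1) \<le> L * dist x 1" using L by (auto simp: lipschitz_on_def)
    moreover have "dist x 1 \<le> 2" using supp[OF False] by (auto simp: dist_real_def)
    then have "L * dist x 1 \<le> L * 2" using L0 by (intro mult_left_mono)
    ultimately show ?thesis by (simp add: dist_real_def)
  qed (use L0 in simp)
  show ?thesis by (rule that[OF L pos sym supp bd int L0])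
qed

lemma kernel_integrable:
  assumes lip: "L-lipschitz_on UNIV f" and supp: "\<And>x. f x \<noteq> 0 \<Longrightarrow> \<bar>x\<bar> \<le> 1 / (2::real)"
  shows "integrable lborel (f :: real \<Rightarrow> real)"
proof -
  have "continuous_on {- 1 / 2 .. 1 / 2} f"
    using lip by (meson continuous_on_subset lipschitz_on_continuous_on subset_UNIV)
  from borel_integrable_atLeastAtMost'[OF this]
  have "integrable lborel (\<lambda>x. indicator {- 1 / 2 .. 1 / 2} x *\<^sub>R f x)" by (simp add: set_integrable_def)
  moreover have "(\<lambda>x. indicator {- 1 / 2 .. 1 / 2} x *\<^sub>R f x) = f"
  proof
    fix x show "indicator {- 1 / 2 .. 1 / 2} x *\<^sub>R f x = f x"
      using supp[of x] by (cases "f x = 0") (auto simp: indicator_def abs_le_iff)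
  qed
  ultimately show ?thesis by simp
qed

lemma clip_lipschitz: "0 \<le> W \<Longrightarrow> 1-lipschitz_on UNIV (clip W)"
  by (rule lipschitz_onI) (auto simp: dist_real_def abs_clip_diff_le)

text \<open>
  On the support the factors \<open>x\<close> and \<open>x\<^sup>2\<close> agree with their clipped versions, which are bounded and
  Lipschitz on the whole line.
\<close>
lemma kernel_products_lipschitz:
  assumes K: "K \<in> kernel_class"
  obtains L' where "L'-lipschitz_on UNIV K" "L'-lipschitz_on UNIV (\<lambda>x. (K x)\<^sup>2)"
    "L'-lipschitz_on UNIV (\<lambda>x. K x * x)" "L'-lipschitz_on UNIV (\<lambda>x. K x * x\<^sup>2)" "\<And>x. \<bar>K x\<bar> \<le> L'" "1 \<le> L'"
proof -
  obtain L where L: "L-lipschitz_on UNIV K" "\<And>x. K x \<noteq> 0 \<Longrightarrow> \<bar>x\<bar> \<le> 1 / 2"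
    "\<And>x. \<bar>K x\<bar> \<le> 2 * L" "0 \<le> L" using kernel_class_facts[OF K] by metis
  have c: "clip (1/2) x = x" if "\<bar>x\<bar> \<le> 1 / 2" for x using that by (auto simp: clip_def)
  have Kx: "K x * clip (1/2) x = K x * x" for x using L(2)[of x] c[of x] by (cases "K x = 0") auto
  have Kx2: "K x * clip (1/2) x * clip (1/2) x = K x * x\<^sup>2" for x
    using L(2)[of x] c[of x] by (cases "K x = 0") (auto simp: power2_eq_square)
  have cb: "\<bar>clip (1/2) x\<bar> \<le> 1/2" for x by (rule abs_clip_le) simp
  note cl = clip_lipschitz[of "1/2", simplified]
  have b1: "\<bar>K x * clip (1/2) x\<bar> \<le> 2 * L * (1/2)" for x
    unfolding abs_mult using L(3)[of x] cb[of x] L(4) by (intro mult_mono) auto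
  define L' where "L' = 1 + 100 * L + 100 * L * L"
  have le: "L \<le> L'" "2 * L * L + 2 * L * L \<le> L'" "2 * L * 1 + 1 / 2 * L \<le> L'" "2 * L * (1/2) * 1 + 1 / 2 * (2 * L * 1 + 1 / 2 * L) \<le> L'" "2 * L \<le> L'" "1 \<le> L'"
    using L(4) by (auto simp: L'_def)
  show ?thesis
  proof (rule that)
    show "L'-lipschitz_on UNIV K" by (rule lipschitz_on_le[OF L(1) le(1)])
    show "L'-lipschitz_on UNIV (\<lambda>x. (K x)\<^sup>2)"
      unfolding power2_eq_square by (rule lipschitz_on_le[OF lipschitz_mult_bounded[OF L(1) L(1) L(3) L(3)] le(2)])
    have 1: "(2 * L * 1 + 1 / 2 * L)-lipschitz_on UNIV (\<lambda>x. K x * clip (1/2) x)"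
      by (rule lipschitz_mult_bounded[OF L(1) cl L(3) cb])
    show "L'-lipschitz_on UNIV (\<lambda>x. K x * x)"
      using lipschitz_on_le[OF 1 le(3)] by (simp only: Kx)
    show "L'-lipschitz_on UNIV (\<lambda>x. K x * x\<^sup>2)"
      using lipschitz_on_le[OF lipschitz_mult_bounded[OF 1 cl b1 cb] le(4)] by (simp only: Kx2)
    show "\<bar>K x\<bar> \<le> L'" for x using L(3)[of x] le(5) by linarith
  qed (rule le(6))
qed

lemma sigma2_K_pos: "K \<in> kernel_class \<Longrightarrow> 0 < sigma2_K K"
  and mu_K_pos: "K \<in> kernel_class \<Longrightarrow> 0 < mu_K K"
proof -
  assume K: "K \<in> kernel_class"
  obtain L where L: "L-lipschitz_on UNIV K" "\<And>x. 0 \<le> K x" "\<And>x. K x \<noteq> 0 \<Longrightarrow> \<bar>x\<bar> \<le> 1 / 2"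
     "(\<integral>x. K x \<partial>lborel) = 1" using kernel_class_facts[OF K] by metis
  obtain L' where L': "L'-lipschitz_on UNIV (\<lambda>x. (K x)\<^sup>2)" "L'-lipschitz_on UNIV (\<lambda>x. K x * x\<^sup>2)"
    using kernel_products_lipschitz[OF K] by metis
  have not0: "\<not> (AE x in lborel. K x = 0)"
  proof
    assume "AE x in lborel. K x = 0"
    then have "(\<integral>x. K x \<partial>lborel) = (\<integral>x. 0 \<partial>(lborel::real measure))"
      by (intro integral_cong_AE borel_measurable_integrable[OF kernel_integrable[OF L(1,3)]]) auto
    then show False using L(4) by simp
  qed
  have i1: "integrable lborel (\<lambda>x. (K x)\<^sup>2)" by (rule kernel_integrable[OF L'(1)]) (use L(3) in auto)
  have "sigma2_K K \<noteq> 0"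
    unfolding sigma2_K_def using integral_nonneg_eq_0_iff_AE[OF i1] not0 by auto
  moreover have "0 \<le> sigma2_K K" unfolding sigma2_K_def by (rule integral_nonneg_AE) auto
  ultimately show "0 < sigma2_K K" by simp
  have i2: "integrable lborel (\<lambda>x. K x * x\<^sup>2)" by (rule kernel_integrable[OF L'(2)]) (use L(3) in auto)
  have "mu_K K \<noteq> 0"
  proof
    assume "mu_K K = 0"
    then have "AE x in lborel. K x * x\<^sup>2 = 0"
      unfolding mu_K_def using integral_nonneg_eq_0_iff_AE[OF i2] L(2) by auto
    then have "AE x in lborel. K x = 0"
      using AE_lborel_singleton[of 0] by eventually_elim auto
    then show False using not0 by simp
  qed
  moreover have "0 \<le> mu_K K" unfolding mu_K_def using L(2) by (intro integral_nonneg_AE) auto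
  ultimately show "0 < mu_K K" by simp
qed

text \<open>
  \<open>K\<^sub>h(t/n - u) / n\<close>, for integer \<open>t\<close> because windows may be completed beyond the observed times.
\<close>
definition kernel_weight :: "(real \<Rightarrow> real) \<Rightarrow> nat \<Rightarrow> real \<Rightarrow> real \<Rightarrow> int \<Rightarrow> real" where
  "kernel_weight K n h u t = K ((real_of_int t / real n - u) / h) / (real n * h)"

text \<open>
  A window of blocks of length \<open>l\<close> that covers the support of \<open>K\<^sub>h(\<cdot> - u)\<close>, at times in units of
  \<open>1/n\<close>. The extra block makes up for rounding the start down.
\<close>
definition win_start :: "nat \<Rightarrow> real \<Rightarrow> real \<Rightarrow> int" where
  "win_start n h u = \<lfloor>real n * (u - h / 2)\<rfloor>"

definition win_blocks :: "nat \<Rightarrow> real \<Rightarrow> nat \<Rightarrow> nat" where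
  "win_blocks n h l = nat \<lceil>real n * h / real l\<rceil> + 1"

lemma window_covers:
  assumes n: "1 \<le> n" and h: "0 < h" and l: "1 \<le> l" "real l \<le> real n * h"
  shows "(real_of_int (win_start n h u) / real n - u) / h \<le> - 1 / 2"
    "1 / 2 \<le> (real_of_int (win_start n h u) / real n - u) / h + real (win_blocks n h l) * (real l / (real n * h))"
    "real (win_blocks n h l) * real l \<le> 3 * (real n * h)"
proof -
  have nh: "0 < real n * h" using n h by simp
  have "real_of_int (win_start n h u) \<le> real n * (u - h / 2)" unfolding win_start_def by linarith
  then show "(real_of_int (win_start n h u) / real n - u) / h \<le> - 1 / 2"
    using n h by (simp add: field_simps)
  have J: "real n * h / real l + 1 \<le> real (win_blocks n h l)" "real (win_blocks n h l) \<le> real n * h / real l + 2"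
    unfolding win_blocks_def using nh l by (simp_all, linarith+)
  have "real n * h + real l \<le> real (win_blocks n h l) * real l"
    using mult_right_mono[OF J(1), of "real l"] l by (simp add: algebra_simps)
  then have "real n * h + 1 \<le> real (win_blocks n h l) * real l" using l by simp
  moreover have "real n * (u - h / 2) - 1 \<le> real_of_int (win_start n h u)" unfolding win_start_def by linarith
  ultimately have "real n * (u + h / 2) \<le> real_of_int (win_start n h u) + real (win_blocks n h l) * real l"
    by (simp add: algebra_simps)
  then have "(real n * (u + h / 2) - real n * u) / (real n * h) \<le> (real_of_int (win_start n h u) + real (win_blocks n h l) * real l - real n * u) / (real n * h)"
    using nh by (intro divide_right_mono) auto
  moreover have "(real n * (u + h / 2) - real n * u) / (real n * h) = 1 / 2" using n h by (simp add: field_simps)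
  moreover have "(real_of_int (win_start n h u) + real (win_blocks n h l) * real l - real n * u) / (real n * h) =
     (real_of_int (win_start n h u) / real n - u) / h + real (win_blocks n h l) * (real l / (real n * h))"
    using n h by (simp add: field_simps)
  ultimately show "1 / 2 \<le> (real_of_int (win_start n h u) / real n - u) / h + real (win_blocks n h l) * (real l / (real n * h))"
    by simp
  have "real (win_blocks n h l) * real l \<le> real n * h + 2 * real l"
    using mult_right_mono[OF J(2), of "real l"] l by (simp add: algebra_simps)
  then show "real (win_blocks n h l) * real l \<le> 3 * (real n * h)" using l by simp
qed

text \<open>
  Sampling at the block starts is a Riemann sum of mesh \<open>l / (n h)\<close>.
\<close>
lemma window_Riemann:
  assumes n: "1 \<le> n" and h: "0 < h" and l: "1 \<le> l" "real l \<le> real n * h"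
    and lip: "L-lipschitz_on UNIV f" and supp: "\<And>x. f x \<noteq> 0 \<Longrightarrow> \<bar>x\<bar> \<le> 1 / 2"
  shows "\<bar>real l / (real n * h) * (\<Sum>j<win_blocks n h l. f ((real_of_int (win_start n h u + int (j * l)) / real n - u) / h)) - (\<integral>x. f x \<partial>lborel)\<bar>
     \<le> 3 * L * (real l / (real n * h))"
proof -
  define d where "d = real l / (real n * h)"
  have nh: "0 < real n * h" using n h by simp
  have d: "0 < d" using l nh by (simp add: d_def)
  define x0 where "x0 = (real_of_int (win_start n h u) / real n - u) / h"
  have pts: "(real_of_int (win_start n h u + int (j * l)) / real n - u) / h = x0 + real j * d" for j
    using n h by (simp add: x0_def d_def field_simps)
  have L0: "0 \<le> L" using lip by (rule lipschitz_on_nonneg)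
  have "\<bar>d * (\<Sum>j<win_blocks n h l. f (x0 + real j * d)) - (\<integral>x. f x \<partial>lborel)\<bar> \<le> L * real (win_blocks n h l) * d\<^sup>2"
    using window_covers(1,2)[OF n h l, of u] unfolding x0_def[symmetric] d_def[symmetric]
    by (intro Riemann_sum_error lip supp d) auto
  also have "\<dots> = L * d * (real (win_blocks n h l) * real l / (real n * h))" by (simp add: d_def power2_eq_square)
  also have "\<dots> \<le> L * d * 3"
    using window_covers(3)[OF n h l] nh L0 d by (intro mult_left_mono) (auto simp: field_simps)
  finally show ?thesis unfolding pts d_def by (simp add: mult.commute mult.left_commute)
qed

lemma kernel_weight_nonzero_range:
  assumes n: "1 \<le> n" and h: "0 < h" and supp: "\<And>x. K x \<noteq> 0 \<Longrightarrow> \<bar>x\<bar> \<le> 1 / 2" and nz: "kernel_weight K n h u t \<noteq> 0"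
  shows "\<bar>real_of_int t / real n - u\<bar> \<le> h / 2"
proof -
  have "K ((real_of_int t / real n - u) / h) \<noteq> 0" using nz by (auto simp: kernel_weight_def)
  from supp[OF this] have "\<bar>real_of_int t / real n - u\<bar> / h \<le> 1 / 2" using h by (simp add: abs_divide)
  then show ?thesis using h by (simp add: field_simps)
qed

text \<open>
  Times outside \<open>{1..n}\<close> may be added and times outside the window dropped, since the weights vanish
  at both.
\<close>
lemma sum_window:
  assumes n: "1 \<le> n" and h: "0 < h" and supp: "\<And>x. K x \<noteq> 0 \<Longrightarrow> \<bar>x\<bar> \<le> 1 / 2"
    and hu: "h / 2 < u" "u + h / 2 \<le> 1" and l: "1 \<le> l" "real l \<le> real n * h"
  shows "(\<Sum>t=1..n. kernel_weight K n h u (int t) * a (int t)) =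
     (\<Sum>t\<in>{win_start n h u..<win_start n h u + int (win_blocks n h l * l)}. kernel_weight K n h u t * a t)"
proof -
  have n0: "0 < real n" using n by simp
  have "(\<Sum>t=1..n. kernel_weight K n h u (int t) * a (int t)) = (\<Sum>t\<in>{1..int n}. kernel_weight K n h u t * a t)"
    by (rule sum.reindex_bij_witness[of _ nat int]) auto
  also have "\<dots> = (\<Sum>t\<in>{win_start n h u..<win_start n h u + int (win_blocks n h l * l)}. kernel_weight K n h u t * a t)"
  proof (rule sum.mono_neutral_cong)
    fix t assume t: "t \<in> {win_start n h u..<win_start n h u + int (win_blocks n h l * l)} - {1..int n}"
    show "kernel_weight K n h u t * a t = 0"
    proof (rule ccontr)
      assume "kernel_weight K n h u t * a t \<noteq> 0"
      then have r: "\<bar>real_of_int t / real n - u\<bar> \<le> h / 2" using kernel_weight_nonzero_range[OF n h supp] by auto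
      then have "0 < real_of_int t / real n" "real_of_int t / real n \<le> 1" using hu by linarith+
      then have "0 < t" "real_of_int t \<le> real n" using n0 by (auto simp: zero_less_divide_iff divide_le_eq)
      then have "0 < t" "t \<le> int n" by linarith+
      then show False using t by auto
    qed
  next
    fix t assume t: "t \<in> {1..int n} - {win_start n h u..<win_start n h u + int (win_blocks n h l * l)}"
    show "kernel_weight K n h u t * a t = 0"
    proof (rule ccontr)
      assume nz: "kernel_weight K n h u t * a t \<noteq> 0"
      have r: "\<bar>real_of_int t / real n - u\<bar> \<le> h / 2" using nz kernel_weight_nonzero_range[OF n h supp] by auto
      then have "real n * (u - h / 2) \<le> real_of_int t" "real_of_int t \<le> real n * (u + h / 2)"
      proof -
        have "u - h / 2 \<le> real_of_int t / real n" "real_of_int t / real n \<le> u + h / 2" using r by linarith+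
        then show "real n * (u - h / 2) \<le> real_of_int t" "real_of_int t \<le> real n * (u + h / 2)"
          using n0 by (simp_all add: pos_le_divide_eq pos_divide_le_eq mult.commute)
      qed
      then have "win_start n h u \<le> t" unfolding win_start_def by linarith
      moreover have "t < win_start n h u + int (win_blocks n h l * l)"
      proof -
        have "real n * h / real l + 1 \<le> real (win_blocks n h l)"
          unfolding win_blocks_def using real_nat_ceiling_ge[of "real n * h / real l"] by simp
        from mult_right_mono[OF this, of "real l"] have "real n * h + real l \<le> real (win_blocks n h l * l)"
          using l by (simp add: algebra_simps)
        moreover have "real n * (u - h / 2) - 1 < real_of_int (win_start n h u)" unfolding win_start_def by linarith
        moreover have "real n * (u + h / 2) = real n * (u - h / 2) + real n * h" by (simp add: algebra_simps)
        ultimately have "real_of_int t < real_of_int (win_start n h u) + real (win_blocks n h l * l)"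
          using \<open>real_of_int t \<le> real n * (u + h / 2)\<close> l by linarith
        then show ?thesis by linarith
      qed
      ultimately show False using t by auto
    qed
  qed auto
  finally show ?thesis .
qed

text \<open>
  Log-convexity of \<open>\<Gamma>\<close> between its values 1 at 1 and 2.
\<close>
lemma Gamma_le_one: "1 \<le> y \<Longrightarrow> y \<le> 2 \<Longrightarrow> Gamma y \<le> (1::real)"
proof -
  assume y: "1 \<le> y" "y \<le> 2"
  have "(ln \<circ> Gamma) ((1 - (y - 1)) *\<^sub>R 1 + (y - 1) *\<^sub>R 2) \<le> (1 - (y - 1)) * (ln \<circ> Gamma) 1 + (y - 1) * (ln \<circ> Gamma) (2::real)"
    using y by (intro convex_onD[OF log_convex_Gamma_real]) auto
  moreover have "Gamma (2::real) = 1" using Gamma_fact[of 1, where 'a = real] by simp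
  ultimately have "ln (Gamma y) \<le> 0" by (simp add: algebra_simps)
  then show ?thesis using y by (simp add: ln_le_zero_iff Gamma_real_pos)
qed

lemma Gamma_le_powr_self: "1 \<le> x \<Longrightarrow> Gamma x \<le> x powr (x::real)"
proof -
  assume x: "1 \<le> x"
  have step: "Gamma (y + real k) \<le> (y + real k) ^ k" if "1 \<le> y" "y \<le> 2" for y k
  proof (induction k)
    case 0 then show ?case using Gamma_le_one[OF that] by simp
  next
    case (Suc k)
    have "Gamma (y + real (Suc k)) = (y + real k) * Gamma (y + real k)"
    proof -
      have "y + real k \<notin> \<int>\<^sub>\<le>\<^sub>0" using that by (auto elim!: nonpos_Ints_cases)
      from Gamma_plus1[OF this] show ?thesis by (simp add: add.commute add.left_commute)
    qed
    also have "\<dots> \<le> (y + real k) * (y + real k) ^ k" using Suc that by (intro mult_left_mono) auto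
    also have "\<dots> = (y + real k) ^ Suc k" by simp
    also have "\<dots> \<le> (y + real (Suc k)) ^ Suc k" using that by (intro power_mono) auto
    finally show ?case .
  qed
  define k where "k = nat (\<lfloor>x\<rfloor> - 1)"
  have k: "real k = real_of_int \<lfloor>x\<rfloor> - 1" using x by (simp add: k_def le_floor_iff)
  have "Gamma ((x - real k) + real k) \<le> ((x - real k) + real k) ^ k"
    by (rule step) (use k in linarith)+
  also have "\<dots> = x powr real k" using x by (simp add: powr_realpow)
  also have "\<dots> \<le> x powr x" using x k by (intro powr_mono) linarith+
  finally show ?thesis by simp
qed

text \<open>
  Only the power \<open>q\<^sup>\<alpha>\<close> matters: it turns a moment of order \<open>log n\<close> into a truncation level of order
  \<open>(log n)\<^sup>\<alpha>\<close>.
\<close>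
lemma N_alpha_growth:
  assumes a: "0 \<le> \<alpha>" and q: "1 \<le> q"
  shows "N_alpha \<alpha> q \<le> (\<alpha> + 2) powr \<alpha> * exp (2 * \<alpha> + 2) * q powr \<alpha>"
proof -
  define x where "x = \<alpha> * q + 2"
  have x: "2 \<le> x" using a q by (simp add: x_def)
  have "N_alpha \<alpha> q = Gamma x powr (1 / q)" by (simp add: N_alpha_def x_def)
  also have "\<dots> \<le> (x powr x) powr (1 / q)"
    using x q Gamma_le_powr_self[of x] by (intro powr_mono2) (auto intro: less_imp_le Gamma_real_pos)
  also have "\<dots> = x powr (x / q)" by (simp add: powr_powr)
  also have "x / q = \<alpha> + 2 / q" using q by (simp add: x_def field_simps)
  also have "x powr (\<alpha> + 2 / q) = x powr \<alpha> * x powr (2 / q)" by (rule powr_add)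
  also have "\<dots> \<le> ((\<alpha> + 2) * q) powr \<alpha> * exp (2 * \<alpha> + 2)"
  proof (intro mult_mono)
    have "x \<le> (\<alpha> + 2) * q" using q by (simp add: x_def algebra_simps)
    then show "x powr \<alpha> \<le> ((\<alpha> + 2) * q) powr \<alpha>" using x a by (intro powr_mono2) auto
    have "ln x \<le> x - 1" using x by (intro ln_le_minus_one) auto
    then have "2 / q * ln x \<le> 2 / q * (x - 1)" using q by (intro mult_left_mono) auto
    also have "2 / q * (x - 1) = 2 * \<alpha> + 2 / q" using q by (simp add: x_def field_simps)
    also have "\<dots> \<le> 2 * \<alpha> + 2" using q by (simp add: field_simps)
    finally show "x powr (2 / q) \<le> exp (2 * \<alpha> + 2)" using x by (simp add: powr_def)
  qed auto
  also have "((\<alpha> + 2) * q) powr \<alpha> = (\<alpha> + 2) powr \<alpha> * q powr \<alpha>" using a q by (simp add: powr_mult)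
  finally show ?thesis by (simp add: mult.assoc mult.left_commute mult.commute)
qed

lemma polylog_over_n_tendsto_0: "(\<lambda>n. c * ln (real n) ^ k / real n) \<longlonglongrightarrow> 0"
proof -
  have "filterlim (\<lambda>n. ln (real n)) at_top sequentially"
    by (rule filterlim_compose[OF ln_at_top filterlim_real_sequentially])
  from filterlim_compose[OF tendsto_power_div_exp_0 this]
  have "(\<lambda>n. ln (real n) ^ k / exp (ln (real n))) \<longlonglongrightarrow> 0" .
  then have A: "(\<lambda>n. c * (ln (real n) ^ k / exp (ln (real n)))) \<longlonglongrightarrow> 0" by (rule tendsto_mult_right_zero)
  have B: "\<forall>\<^sub>F n in sequentially. c * (ln (real n) ^ k / exp (ln (real n))) = c * ln (real n) ^ k / real n"
    using eventually_gt_at_top[of 0] by eventually_elim simp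
  show ?thesis by (rule Lim_transform_eventually[OF A B])
qed

section \<open>Blocks of logarithmic length\<close>

context ls_model
begin

text \<open>
  The number of innovations after which \<open>\<rho>\<^sup>m \<le> n\<^sup>-\<^sup>3\<^sup>3\<close>: this leaves one factor \<open>n\<close> for the powers of the
  truncation level beyond the error \<open>(n\<^sup>-\<^sup>4)\<^sup>8\<close> to be reached. Ranges double in
  \<open>finite_range_approximation\<close>, hence the factor 2 in the block length.
\<close>
definition block_const :: real where "block_const = 33 / ln (1 / \<rho>)"

definition block_len :: "nat \<Rightarrow> nat" where "block_len n = 2 * nat \<lceil>block_const * ln (real n)\<rceil>"

lemma block_const_pos: "0 < block_const"
  using rho by (simp add: block_const_def ln_gt_zero)

lemma moment_bound_growth: "\<exists>c\<ge>1. \<forall>q\<ge>1. moment_bound q \<le> c * real q powr \<alpha>"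
proof -
  define c where "c = D * ((\<alpha> + 2) powr \<alpha> * exp (2 * \<alpha> + 2)) + 1"
  have "moment_bound q \<le> c * real q powr \<alpha>" if "1 \<le> q" for q
  proof -
    have "moment_bound q \<le> D * ((\<alpha> + 2) powr \<alpha> * exp (2 * \<alpha> + 2) * real q powr \<alpha>)"
      unfolding moment_bound_def using D N_alpha_growth[OF alpha, of "real q"] that by (intro mult_left_mono) auto
    also have "\<dots> \<le> c * real q powr \<alpha>" by (simp add: c_def algebra_simps)
    finally show ?thesis .
  qed
  moreover have "1 \<le> c" using D by (simp add: c_def)
  ultimately show ?thesis by blast
qed

text \<open>
  Truncate at a multiple of the moment of order \<open>q \<approx> 33 log n\<close>. By the growth of the moments this level
  is \<open>O((log n)\<^sup>\<alpha>)\<close>, and Markov's inequality of order \<open>q\<close> gains the factor \<open>e\<^bsup>-q\<^esup>\<close>, a negative power of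
  \<open>n\<close>.
\<close>
lemma block_approximation:
  "\<exists>cE cB. 0 \<le> cE \<and> 0 \<le> cB \<and> (\<forall>\<^sub>F n in sequentially. \<forall>v\<in>{0..1}. \<exists>\<phi>. \<phi> \<in> borel_measurable Q \<and>
     depends_first (block_len n) (space Q) \<phi> \<and> (\<forall>z. \<bar>\<phi> z\<bar> \<le> cB * ln (real n) powr (\<alpha> * real M)) \<and>
     (\<integral>\<^sup>+ z. ennreal (\<bar>\<Psi> v z - \<phi> z\<bar> ^ 4) \<partial>Q) \<le> ennreal (cE * (1 / real n ^ 4) ^ 4))"
proof -
  obtain C1 C2 C3 where C: "0 \<le> C1" "0 \<le> C2" "0 \<le> C3"
    and ap: "\<And>m W e v. 1 \<le> W \<Longrightarrow> 0 < e \<Longrightarrow> e \<le> 1 \<Longrightarrow> v \<in> {0..1} \<Longrightarrow>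
      (\<integral>\<^sup>+ z. ennreal (\<bar>H z v - clip W (H z v)\<bar> ^ 8) \<partial>Q) \<le> ennreal (e ^ 8) \<Longrightarrow>
      C1 * (2 * W) ^ (8 * M) * \<rho> ^ m \<le> e ^ 8 \<Longrightarrow> sqrt \<rho> ^ m \<le> e \<Longrightarrow>
      (\<exists>\<phi>. \<phi> \<in> borel_measurable Q \<and> depends_first (2 * m) (space Q) \<phi> \<and> (\<forall>z. \<bar>\<phi> z\<bar> \<le> C2 * W ^ M) \<and>
         (\<integral>\<^sup>+ z. ennreal (\<bar>\<Psi> v z - \<phi> z\<bar> ^ 4) \<partial>Q) \<le> ennreal (C3 * e ^ 4))"
    using finite_range_approximation by blast
  obtain c where c: "1 \<le> c" and hmc: "\<And>q. 1 \<le> q \<Longrightarrow> moment_bound q \<le> c * real q powr \<alpha>" using moment_bound_growth by blast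
  (* The factor exp 1 lets the level exceed the q-th moment bound by e; 43 accounts for
     q <= 43 log n. *)
  define cW where "cW = exp 1 * c * 43 powr \<alpha> + 1"
  have cW: "1 \<le> cW" using c by (simp add: cW_def)
  define k where "k = nat \<lceil>\<alpha>\<rceil>"
  have k: "\<alpha> \<le> real k" unfolding k_def by linarith
  have ev1: "\<forall>\<^sub>F n in sequentially. cW ^ 8 * ln (real n) ^ (k * 8) / real n < 1"
    by (rule order_tendstoD(2)[OF polylog_over_n_tendsto_0]) simp
  have ev2: "\<forall>\<^sub>F n in sequentially. (C1 * 2 ^ (8 * M) * cW ^ (8 * M)) * ln (real n) ^ (k * (8 * M)) / real n < 1"
    by (rule order_tendstoD(2)[OF polylog_over_n_tendsto_0]) simp
  have "filterlim (\<lambda>n. ln (real n)) at_top sequentially"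
    by (rule filterlim_compose[OF ln_at_top filterlim_real_sequentially])
  then have ev3: "\<forall>\<^sub>F n in sequentially. 1 \<le> ln (real n)" by (simp add: filterlim_at_top)
  have "\<forall>\<^sub>F n in sequentially. \<forall>v\<in>{0..1}. \<exists>\<phi>. \<phi> \<in> borel_measurable Q \<and>
     depends_first (block_len n) (space Q) \<phi> \<and> (\<forall>z. \<bar>\<phi> z\<bar> \<le> (C2 * cW ^ M) * ln (real n) powr (\<alpha> * real M)) \<and>
     (\<integral>\<^sup>+ z. ennreal (\<bar>\<Psi> v z - \<phi> z\<bar> ^ 4) \<partial>Q) \<le> ennreal (C3 * (1 / real n ^ 4) ^ 4)"
    using ev1 ev2 ev3 eventually_ge_at_top[of 1]
  proof eventually_elim
    case (elim n)
    define L where "L = ln (real n)"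
    have L: "1 \<le> L" and n: "1 \<le> real n" "0 < real n" using elim by (auto simp: L_def)
    have nL: "real n = exp L" using n by (simp add: L_def)
    define W where "W = cW * L powr \<alpha>"
    have La: "1 \<le> L powr \<alpha>" using L alpha by (simp add: ge_one_powr_ge_zero)
    have Lk: "L powr \<alpha> \<le> L ^ k" using L k by (simp add: powr_mono flip: powr_realpow)
    have W: "1 \<le> W" unfolding W_def using mult_mono[OF cW La] cW by simp
    have Wpow: "W ^ j \<le> cW ^ j * L ^ (k * j)" for j
    proof -
      have "W ^ j \<le> (cW * L ^ k) ^ j" unfolding W_def using cW Lk by (intro power_mono mult_left_mono) auto
      then show ?thesis by (simp add: power_mult_distrib power_mult)
    qed
    define q where "q = nat \<lceil>33 * L\<rceil> + 8"
    have q: "33 * L \<le> real q" "real q \<le> 43 * L" "8 \<le> q" unfolding q_def using L by (auto, linarith+)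
    have hq: "moment_bound q \<le> W / exp 1"
    proof -
      have "moment_bound q \<le> c * real q powr \<alpha>" using q by (intro hmc) auto
      also have "\<dots> \<le> c * (43 * L) powr \<alpha>" using q c alpha L by (intro mult_left_mono powr_mono2) auto
      also have "\<dots> = (c * 43 powr \<alpha>) * L powr \<alpha>" using L by (simp add: powr_mult)
      also have "\<dots> \<le> (cW / exp 1) * L powr \<alpha>"
        by (intro mult_right_mono) (auto simp: cW_def field_simps)
      finally show ?thesis by (simp add: W_def)
    qed
    define e where "e = 1 / real n ^ 4"
    have e: "0 < e" "e \<le> 1" using n by (auto simp: e_def divide_le_eq one_le_power)
    have e8: "e ^ 8 = exp (- 32 * L)"
    proof -
      have "real n ^ 32 = exp (32 * L)" unfolding nL by (simp flip: exp_of_nat_mult)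
      then show ?thesis by (simp add: e_def power_divide power_mult[symmetric] exp_minus inverse_eq_divide)
    qed
    define m where "m = nat \<lceil>block_const * L\<rceil>"
    have rm: "\<rho> ^ m \<le> exp (- 33 * L)"
    proof -
      have l: "0 < ln (1 / \<rho>)" using rho by (simp add: ln_gt_zero)
      have "block_const * L \<le> real m" unfolding m_def by linarith
      then have "33 * L \<le> real m * ln (1 / \<rho>)" using l by (simp add: block_const_def field_simps)
      moreover have "\<rho> ^ m = exp (- (real m * ln (1 / \<rho>)))"
        using rho by (simp add: ln_div exp_of_nat_mult)
      ultimately show ?thesis by simp
    qed
    have b1: "W ^ 8 \<le> exp L"
    proof -
      have "cW ^ 8 * L ^ (k * 8) < real n" using elim(1) n by (simp add: L_def)
      with Wpow[of 8] show ?thesis unfolding nL by linarith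
    qed
    have b2: "C1 * (2 * W) ^ (8 * M) \<le> exp L"
    proof -
      have "C1 * (2 * W) ^ (8 * M) = (C1 * 2 ^ (8 * M)) * W ^ (8 * M)" by (simp only: power_mult_distrib mult.assoc)
      also have "\<dots> \<le> (C1 * 2 ^ (8 * M)) * (cW ^ (8 * M) * L ^ (k * (8 * M)))"
        using C by (intro mult_left_mono Wpow) auto
      also have "\<dots> < real n" using elim(2) n by (simp add: L_def mult.assoc)
      finally show ?thesis unfolding nL by simp
    qed
    show ?case
    proof
      fix v :: real assume v: "v \<in> {0..1}"
      have "(\<integral>\<^sup>+ z. ennreal (\<bar>H z v - clip W (H z v)\<bar> ^ 8) \<partial>Q) \<le> ennreal (moment_bound q ^ q / W ^ (q - 8))"
        using W q moment_bound_nonneg by (intro clip_tail_moment H_meas[OF v] H_moment[OF v]) auto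
      also have "\<dots> \<le> ennreal (e ^ 8)"
      proof (intro ennreal_leI)
        have "moment_bound q ^ q / W ^ (q - 8) \<le> (W / exp 1) ^ q / W ^ (q - 8)"
          using hq moment_bound_nonneg W by (intro divide_right_mono power_mono) auto
        also have "\<dots> = W ^ 8 * exp (- real q)"
        proof -
          have "W ^ q = W ^ 8 * W ^ (q - 8)" using q by (simp flip: power_add)
          then show ?thesis using W by (simp add: power_divide exp_minus inverse_eq_divide flip: exp_of_nat_mult)
        qed
        also have "\<dots> \<le> exp L * exp (- 33 * L)" using b1 q W by (intro mult_mono) auto
        also have "\<dots> = e ^ 8" unfolding e8 by (simp flip: exp_add)
        finally show "moment_bound q ^ q / W ^ (q - 8) \<le> e ^ 8" .
      qed
      finally have 1: "(\<integral>\<^sup>+ z. ennreal (\<bar>H z v - clip W (H z v)\<bar> ^ 8) \<partial>Q) \<le> ennreal (e ^ 8)" .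
      have 2: "C1 * (2 * W) ^ (8 * M) * \<rho> ^ m \<le> e ^ 8"
      proof -
        have "C1 * (2 * W) ^ (8 * M) * \<rho> ^ m \<le> exp L * exp (- 33 * L)"
          using b2 rm C W rho by (intro mult_mono) auto
        also have "\<dots> = e ^ 8" unfolding e8 by (simp flip: exp_add)
        finally show ?thesis .
      qed
      have 3: "sqrt \<rho> ^ m \<le> e"
      proof -
        have "sqrt \<rho> ^ m = sqrt (\<rho> ^ m)" by (simp add: real_sqrt_power)
        also have "\<dots> \<le> e"
        proof (rule real_le_lsqrt)
          have "\<rho> ^ m \<le> exp (- 32 * L)" using rm L by (smt (verit) exp_le_cancel_iff)
          also have "\<dots> \<le> e\<^sup>2" unfolding e8[symmetric] using e by (intro power_decreasing) auto
          finally show "\<rho> ^ m \<le> e\<^sup>2" .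
        qed (use e in auto)
        finally show ?thesis .
      qed
      from ap[OF W e v 1 2 3] obtain \<phi> where \<phi>: "\<phi> \<in> borel_measurable Q" "depends_first (2 * m) (space Q) \<phi>"
        "\<And>z. \<bar>\<phi> z\<bar> \<le> C2 * W ^ M" "(\<integral>\<^sup>+ z. ennreal (\<bar>\<Psi> v z - \<phi> z\<bar> ^ 4) \<partial>Q) \<le> ennreal (C3 * e ^ 4)" by blast
      have "W ^ M = cW ^ M * L powr (\<alpha> * real M)"
        using L by (simp add: W_def power_mult_distrib powr_powr flip: powr_realpow)
      then have "\<bar>\<phi> z\<bar> \<le> (C2 * cW ^ M) * L powr (\<alpha> * real M)" for z using \<phi>(3)[of z] by (simp add: mult.assoc)
      then show "\<exists>\<phi>. \<phi> \<in> borel_measurable Q \<and>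
         depends_first (block_len n) (space Q) \<phi> \<and> (\<forall>z. \<bar>\<phi> z\<bar> \<le> (C2 * cW ^ M) * ln (real n) powr (\<alpha> * real M)) \<and>
         (\<integral>\<^sup>+ z. ennreal (\<bar>\<Psi> v z - \<phi> z\<bar> ^ 4) \<partial>Q) \<le> ennreal (C3 * (1 / real n ^ 4) ^ 4)"
        using \<phi> by (intro exI[of _ \<phi>]) (auto simp: block_len_def m_def L_def e_def)
    qed
  qed
  moreover have "0 \<le> C2 * cW ^ M" using C cW by simp
  ultimately show ?thesis using C by blast
qed

end

section \<open>Bias and the error of local stationarity\<close>

lemma kernel_Riemann:
  assumes n: "1 \<le> n" and h: "0 < h" and nh: "1 \<le> real n * h" and hu: "h / 2 < u" "u + h / 2 \<le> 1"
    and lip: "L-lipschitz_on UNIV f" and supp: "\<And>x. f x \<noteq> 0 \<Longrightarrow> \<bar>x\<bar> \<le> 1 / 2"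
  shows "\<bar>(\<Sum>t=1..n. kernel_weight f n h u (int t)) - (\<integral>x. f x \<partial>lborel)\<bar> \<le> 3 * L / (real n * h)"
proof -
  let ?s = "win_start n h u" and ?J = "win_blocks n h 1"
  have "(\<Sum>t=1..n. kernel_weight f n h u (int t) * 1) = (\<Sum>t\<in>{?s..<?s + int (?J * 1)}. kernel_weight f n h u t * 1)"
    using nh by (intro sum_window[where a = "\<lambda>_. 1"] n h hu supp) auto
  also have "\<dots> = (\<Sum>j<?J. kernel_weight f n h u (?s + int (j * 1)))"
    by (rule sum.reindex_bij_witness[of _ "\<lambda>j. ?s + int j" "\<lambda>t. nat (t - ?s)"]) auto
  also have "\<dots> = real 1 / (real n * h) * (\<Sum>j<?J. f ((real_of_int (?s + int (j * 1)) / real n - u) / h))"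
    unfolding kernel_weight_def sum_distrib_left by simp
  finally show ?thesis
    using window_Riemann[OF n h _ _ lip supp, of 1 u] nh by simp
qed

lemma kernel_first_moment_zero:
  assumes "K \<in> kernel_class"
  shows "(\<integral>x. K x * x \<partial>lborel) = 0"
proof -
  have sym: "K (- x) = K x" for x using assms by (auto simp: kernel_class_def)
  have "(\<integral>x. K x * x \<partial>lborel) = \<bar>- 1\<bar> *\<^sub>R (\<integral>x. K (0 + - 1 * x) * (0 + - 1 * x) \<partial>lborel)"
    by (rule lborel_integral_real_affine) simp
  also have "\<dots> = - (\<integral>x. K x * x \<partial>lborel)" by (simp add: sym)
  finally show ?thesis by simp
qed

text \<open>
  The mean value inequality twice: first for \<open>f'\<close>, then for \<open>f\<close> minus its tangent.
\<close>
lemma second_order_bound: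
  assumes "twice_cont_diff_near f u" and eps: "0 < \<epsilon>"
  shows "\<exists>\<delta>>0. \<forall>x. \<bar>x - u\<bar> < \<delta> \<longrightarrow> \<bar>f x - f u - deriv f u * (x - u)\<bar> \<le> (\<bar>deriv (deriv f) u\<bar> + \<epsilon>) * (x - u)\<^sup>2"
proof -
  obtain e where e: "0 < e" and d1: "\<And>v. v \<in> ball u e \<Longrightarrow> f differentiable (at v)"
    and d2: "\<And>v. v \<in> ball u e \<Longrightarrow> deriv f differentiable (at v)"
    and c: "continuous_on (ball u e) (deriv (deriv f))"
    using assms(1) unfolding twice_cont_diff_near_def by blast
  define B where "B = \<bar>deriv (deriv f) u\<bar> + \<epsilon>"
  have B: "0 < B" using eps by (simp add: B_def)
  have D1: "(f has_real_derivative deriv f v) (at v)" if "v \<in> ball u e" for v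
    using d1[OF that] by (simp add: DERIV_deriv_iff_real_differentiable)
  have D2: "(deriv f has_real_derivative deriv (deriv f) v) (at v)" if "v \<in> ball u e" for v
    using d2[OF that] by (simp add: DERIV_deriv_iff_real_differentiable)
  have "isCont (deriv (deriv f)) u" using c e by (simp add: continuous_on_eq_continuous_at)
  then have "\<forall>\<^sub>F v in at u. dist (deriv (deriv f) v) (deriv (deriv f) u) < \<epsilon>"
    using eps unfolding isCont_def by (auto dest: tendstoD)
  then obtain d where d: "0 < d" "\<And>v. v \<noteq> u \<Longrightarrow> dist v u < d \<Longrightarrow> dist (deriv (deriv f) v) (deriv (deriv f) u) < \<epsilon>"
    by (auto simp: eventually_at)
  define \<delta> where "\<delta> = min d e"
  have \<delta>: "0 < \<delta>" using d e by (simp add: \<delta>_def)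
  have bd2: "\<bar>deriv (deriv f) v\<bar> \<le> B" if "v \<in> ball u \<delta>" for v
  proof (cases "v = u")
    case False
    then have "dist (deriv (deriv f) v) (deriv (deriv f) u) < \<epsilon>"
      using that by (intro d) (auto simp: \<delta>_def dist_commute)
    then show ?thesis unfolding B_def dist_real_def by linarith
  qed (use eps in \<open>simp add: B_def\<close>)
  have sub: "ball u \<delta> \<subseteq> ball u e" by (auto simp: \<delta>_def)
  have step1: "\<bar>deriv f x - deriv f u\<bar> \<le> B * \<bar>x - u\<bar>" if "x \<in> ball u \<delta>" for x
  proof -
    have "norm (deriv f x - deriv f u) \<le> B * norm (x - u)"
    proof (rule field_differentiable_bound[where S = "ball u \<delta>" and f' = "deriv (deriv f)"])
      show "(deriv f has_field_derivative deriv (deriv f) z) (at z within ball u \<delta>)" if "z \<in> ball u \<delta>" for z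
        using D2 sub that by (blast intro: has_field_derivative_at_within)
    qed (use bd2 that \<delta> in auto)
    then show ?thesis by simp
  qed
  have "\<bar>f x - f u - deriv f u * (x - u)\<bar> \<le> B * (x - u)\<^sup>2" if x: "\<bar>x - u\<bar> < \<delta>" for x
  proof -
    define r where "r = \<bar>x - u\<bar>"
    have "norm ((f x - deriv f u * x) - (f u - deriv f u * u)) \<le> (B * r) * norm (x - u)"
    proof (rule field_differentiable_bound[where S = "cball u r" and f' = "\<lambda>z. deriv f z - deriv f u"])
      fix z assume z: "z \<in> cball u r"
      then have zb: "z \<in> ball u \<delta>" using x by (auto simp: r_def)
      have "((\<lambda>z. f z - deriv f u * z) has_field_derivative (deriv f z - deriv f u * 1)) (at z)"
        using zb sub by (intro derivative_intros D1) auto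
      then show "((\<lambda>z. f z - deriv f u * z) has_field_derivative (deriv f z - deriv f u)) (at z within cball u r)"
        by (simp add: has_field_derivative_at_within)
      have "\<bar>deriv f z - deriv f u\<bar> \<le> B * \<bar>z - u\<bar>" by (rule step1[OF zb])
      also have "\<dots> \<le> B * r" using z B by (intro mult_left_mono) (auto simp: dist_real_def abs_minus_commute)
      finally show "norm (deriv f z - deriv f u) \<le> B * r" by simp
    qed (auto simp: r_def dist_real_def abs_minus_commute)
    also have "(B * r) * norm (x - u) = B * (x - u)\<^sup>2" by (simp add: r_def power2_eq_square)
    also have "(f x - deriv f u * x) - (f u - deriv f u * u) = f x - f u - deriv f u * (x - u)" by (simp add: algebra_simps)
    finally show ?thesis by simp
  qed
  then show ?thesis using \<delta> unfolding B_def by blast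
qed

text \<open>
  The linear term of the Taylor expansion is killed by the symmetry of \<open>K\<close> up to a Riemann sum error
  \<open>O(1/n)\<close>, which is \<open>o(h0\<^sup>2)\<close> by assumption. For the quadratic term the factor 2 absorbs the error of
  the Riemann sum for \<open>\<mu>\<^sub>K\<close>. The bound refers to \<open>h0\<close> and not to \<open>h\<close>, because the Riemann sum error of the
  linear term need not be small against \<open>h\<^sup>2\<close>.
\<close>
lemma kernel_bias:
  assumes u: "0 < u" "u < 1" and K: "K \<in> kernel_class" and f: "twice_cont_diff_near f u" and eps: "0 < \<epsilon>"
    and h0: "h0 \<longlonglongrightarrow> 0" and h0n: "filterlim (\<lambda>n. real n * (h0 n)\<^sup>2) at_top sequentially"
  shows "\<forall>\<^sub>F n in sequentially. \<forall>h. ln (real n) ^ 5 \<le> real n * h \<longrightarrow> h \<le> h0 n \<longrightarrow>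
    \<bar>\<Sum>t=1..n. kernel_weight K n h u (int t) * (f (real t / real n) - f u)\<bar> \<le> 2 * mu_K K * (\<bar>deriv (deriv f) u\<bar> + \<epsilon>) * (h0 n)\<^sup>2"
proof -
  obtain L' where lip1: "L'-lipschitz_on UNIV (\<lambda>x. K x * x)" and lip2: "L'-lipschitz_on UNIV (\<lambda>x. K x * x\<^sup>2)"
    and L'1: "1 \<le> L'" using kernel_products_lipschitz[OF K] by metis
  obtain supp: "\<And>x. K x \<noteq> 0 \<Longrightarrow> \<bar>x\<bar> \<le> 1 / 2" and Kpos: "\<And>x. 0 \<le> K x"
    using kernel_class_facts[OF K] by metis
  define \<mu>K where "\<mu>K = mu_K K"
  have \<mu>K: "0 < \<mu>K" unfolding \<mu>K_def by (rule mu_K_pos[OF K])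
  define f1 where "f1 = deriv f u"
  define B where "B = \<bar>deriv (deriv f) u\<bar> + \<epsilon> / 2"
  have B: "0 < B" using eps by (simp add: B_def)
  obtain \<delta> where \<delta>: "0 < \<delta>" and tay: "\<And>x. \<bar>x - u\<bar> < \<delta> \<Longrightarrow> \<bar>f x - f u - f1 * (x - u)\<bar> \<le> B * (x - u)\<^sup>2"
    using second_order_bound[OF f, of "\<epsilon> / 2"] eps unfolding f1_def B_def by auto
  have lninf: "filterlim (\<lambda>n. ln (real n)) at_top sequentially"
    by (rule filterlim_compose[OF ln_at_top filterlim_real_sequentially])
  have ev1: "\<forall>\<^sub>F n in sequentially. 1 + 3 * L' / \<mu>K \<le> ln (real n)" using lninf by (simp add: filterlim_at_top)
  have ev2: "\<forall>\<^sub>F n in sequentially. h0 n < min \<delta> (min u (1 - u))" using h0 u \<delta> by (intro order_tendstoD(2)) auto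
  have ev3: "\<forall>\<^sub>F n in sequentially. \<bar>f1\<bar> * (3 * L') / (\<mu>K * \<epsilon>) \<le> real n * (h0 n)\<^sup>2" using h0n by (simp add: filterlim_at_top)
  show ?thesis using ev1 ev2 ev3 eventually_gt_at_top[of 0]
  proof eventually_elim
    case (elim n)
    show ?case
    proof (intro allI impI)
      fix h assume hl: "ln (real n) ^ 5 \<le> real n * h" and hh: "h \<le> h0 n"
      define L where "L = ln (real n)"
      have n: "1 \<le> n" "0 < real n" using elim by auto
      have "0 \<le> 3 * L' / \<mu>K" using L'1 \<mu>K by simp
      then have L: "1 \<le> L" "3 * L' / \<mu>K \<le> L" using elim(1) by (simp_all add: L_def)
      define p where "p = real n * h"
      have "L ^ 1 \<le> L ^ 5" using L by (intro power_increasing) auto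
      then have p: "L \<le> p" using hl by (simp add: L_def p_def)
      have p1: "1 \<le> p" "0 < p" using p L by auto
      have hpos: "0 < h" using p1 n unfolding p_def by (simp add: zero_less_mult_iff)
      have hs: "h < \<delta>" "h < u" "h < 1 - u" using hh elim(2) by auto
      have h1: "h / 2 < u" "u + h / 2 \<le> 1" using hs hpos by auto
      define w where "w = (\<lambda>t. kernel_weight K n h u (int t))"
      have w0: "0 \<le> w t" for t unfolding w_def kernel_weight_def using Kpos n hpos by simp
      have near: "\<bar>real t / real n - u\<bar> < \<delta>" if "w t \<noteq> 0" for t
      proof -
        have "\<bar>real_of_int (int t) / real n - u\<bar> \<le> h / 2"
          using that unfolding w_def by (intro kernel_weight_nonzero_range[OF n(1) hpos supp])
        then show ?thesis using hs hpos by simp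
      qed
      have m1: "\<bar>\<Sum>t=1..n. w t * (real t / real n - u)\<bar> \<le> 3 * L' / real n"
      proof -
        have "w t * (real t / real n - u) = h * kernel_weight (\<lambda>x. K x * x) n h u (int t)" for t
          unfolding w_def kernel_weight_def using hpos by simp
        then have "(\<Sum>t=1..n. w t * (real t / real n - u)) = h * (\<Sum>t=1..n. kernel_weight (\<lambda>x. K x * x) n h u (int t))"
          by (simp add: sum_distrib_left)
        moreover have "\<bar>(\<Sum>t=1..n. kernel_weight (\<lambda>x. K x * x) n h u (int t)) - (\<integral>x. K x * x \<partial>lborel)\<bar> \<le> 3 * L' / (real n * h)"
          by (rule kernel_Riemann[OF n(1) hpos p1(1)[unfolded p_def] h1 lip1]) (use supp in auto)
        then have "\<bar>\<Sum>t=1..n. kernel_weight (\<lambda>x. K x * x) n h u (int t)\<bar> \<le> 3 * L' / (real n * h)"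
          by (simp add: kernel_first_moment_zero[OF K])
        then have "h * \<bar>\<Sum>t=1..n. kernel_weight (\<lambda>x. K x * x) n h u (int t)\<bar> \<le> h * (3 * L' / (real n * h))"
          using hpos by (intro mult_left_mono) auto
        ultimately show ?thesis using hpos by (simp add: abs_mult)
      qed
      have m2: "(\<Sum>t=1..n. w t * (real t / real n - u)\<^sup>2) \<le> 2 * \<mu>K * (h0 n)\<^sup>2"
      proof -
        have "w t * (real t / real n - u)\<^sup>2 = h\<^sup>2 * kernel_weight (\<lambda>x. K x * x\<^sup>2) n h u (int t)" for t
          unfolding w_def kernel_weight_def using hpos by (simp add: power_divide)
        then have "(\<Sum>t=1..n. w t * (real t / real n - u)\<^sup>2) = h\<^sup>2 * (\<Sum>t=1..n. kernel_weight (\<lambda>x. K x * x\<^sup>2) n h u (int t))"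
          by (simp add: sum_distrib_left)
        also have "\<dots> \<le> h\<^sup>2 * (2 * \<mu>K)"
        proof (rule mult_left_mono)
          have "\<bar>(\<Sum>t=1..n. kernel_weight (\<lambda>x. K x * x\<^sup>2) n h u (int t)) - (\<integral>x. K x * x\<^sup>2 \<partial>lborel)\<bar> \<le> 3 * L' / (real n * h)"
            by (rule kernel_Riemann[OF n(1) hpos p1(1)[unfolded p_def] h1 lip2]) (use supp in auto)
          moreover have "3 * L' / (real n * h) \<le> \<mu>K"
          proof -
            have "3 * L' \<le> L * \<mu>K" using L(2) \<mu>K by (simp add: pos_divide_le_eq)
            also have "\<dots> \<le> p * \<mu>K" using p \<mu>K by (intro mult_right_mono) auto
            finally show ?thesis using p1 by (simp add: pos_divide_le_eq p_def mult.commute)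
          qed
          ultimately show "(\<Sum>t=1..n. kernel_weight (\<lambda>x. K x * x\<^sup>2) n h u (int t)) \<le> 2 * \<mu>K"
            unfolding \<mu>K_def mu_K_def by linarith
        qed simp
        also have "\<dots> \<le> (h0 n)\<^sup>2 * (2 * \<mu>K)" using hh hpos \<mu>K by (intro mult_right_mono power_mono) auto
        finally show ?thesis by (simp add: mult.commute)
      qed
      have "\<bar>(\<Sum>t=1..n. w t * (f (real t / real n) - f u)) - f1 * (\<Sum>t=1..n. w t * (real t / real n - u))\<bar>
          = \<bar>\<Sum>t=1..n. w t * (f (real t / real n) - f u - f1 * (real t / real n - u))\<bar>"
        by (simp add: sum_subtractf[symmetric] sum_distrib_left algebra_simps)
      also have "\<dots> \<le> (\<Sum>t=1..n. w t * (B * (real t / real n - u)\<^sup>2))"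
      proof (rule order.trans[OF sum_abs], rule sum_mono)
        fix t
        show "\<bar>w t * (f (real t / real n) - f u - f1 * (real t / real n - u))\<bar> \<le> w t * (B * (real t / real n - u)\<^sup>2)"
          using tay[OF near, of t] w0[of t] by (cases "w t = 0") (simp_all add: abs_mult)
      qed
      also have "\<dots> = B * (\<Sum>t=1..n. w t * (real t / real n - u)\<^sup>2)" by (simp add: sum_distrib_left mult.left_commute)
      also have "\<dots> \<le> B * (2 * \<mu>K * (h0 n)\<^sup>2)" using m2 B by (intro mult_left_mono) auto
      finally have "\<bar>\<Sum>t=1..n. w t * (f (real t / real n) - f u)\<bar> \<le> \<bar>f1 * (\<Sum>t=1..n. w t * (real t / real n - u))\<bar> + B * (2 * \<mu>K * (h0 n)\<^sup>2)"
        by linarith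
      also have "\<bar>f1 * (\<Sum>t=1..n. w t * (real t / real n - u))\<bar> \<le> \<bar>f1\<bar> * (3 * L' / real n)"
        unfolding abs_mult by (intro mult_left_mono m1) auto
      also have "\<bar>f1\<bar> * (3 * L' / real n) \<le> \<mu>K * \<epsilon> * (h0 n)\<^sup>2"
        using elim(3) n \<mu>K eps by (simp add: pos_divide_le_eq mult.commute mult.left_commute)
      finally show "\<bar>\<Sum>t=1..n. kernel_weight K n h u (int t) * (f (real t / real n) - f u)\<bar> \<le> 2 * mu_K K * (\<bar>deriv (deriv f) u\<bar> + \<epsilon>) * (h0 n)\<^sup>2"
        unfolding w_def \<mu>K_def B_def by (simp add: algebra_simps)
    qed
  qed
qed

context ls_model
begin

text \<open>
  Lag \<open>j\<close> shifts the time parameter by \<open>j/n\<close>; the geometric weights absorb this linear growth.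
\<close>
lemma theta_linear_bound: "\<exists>c\<ge>1. \<forall>j. real j + 1 \<le> c * \<theta> ^ j"
proof -
  have "(\<lambda>j. (real j + 1) ^ 1 * (sqrt \<rho>) ^ j) \<longlonglongrightarrow> 0"
    using rho by (intro poly_times_geometric_tendsto_0) (auto simp: real_sqrt_lt_1_iff)
  then have "Bseq (\<lambda>j. (real j + 1) ^ 1 * (sqrt \<rho>) ^ j)" by (intro convergent_imp_Bseq convergentI)
  then obtain k where k: "0 < k" "\<And>j. norm ((real j + 1) ^ 1 * (sqrt \<rho>) ^ j) \<le> k" by (auto elim: BseqE)
  have "real j + 1 \<le> max 1 k * \<theta> ^ j" for j
  proof -
    have "(real j + 1) * (sqrt \<rho>) ^ j \<le> max 1 k" using k(2)[of j] by simp
    then have "((real j + 1) * (sqrt \<rho>) ^ j) * \<theta> ^ j \<le> max 1 k * \<theta> ^ j" using theta_ge by (intro mult_right_mono) auto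
    moreover have "(sqrt \<rho>) ^ j * \<theta> ^ j = 1" using rho by (simp add: \<theta>_def power_mult_distrib[symmetric])
    ultimately show ?thesis by (simp add: mult.assoc)
  qed
  then show ?thesis by (intro exI[of _ "max 1 k"]) auto
qed

lemma X_moment_and_approximation:
  assumes "1 \<le> q" "1 \<le> n" "t \<in> {1..n}"
  shows "X t n \<in> borel_measurable P"
    "(\<integral>\<^sup>+ \<omega>. ennreal (\<bar>X t n \<omega>\<bar> ^ q) \<partial>P) \<le> ennreal (\<bar>Dq (real q)\<bar> ^ q)"
    "(\<integral>\<^sup>+ \<omega>. ennreal (\<bar>X t n \<omega> - H (past \<zeta> (int t) \<omega>) (real t / real n)\<bar> ^ q) \<partial>P) \<le> ennreal ((\<bar>Dq (real q)\<bar> / real n) ^ q)"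
proof -
  have ls: "locally_stationary P (real q) (Dq (real q)) X (shift_process H \<zeta>)" using A assms(1) by (auto simp: assumption_A_def)
  then show "X t n \<in> borel_measurable P" using assms by (auto simp: locally_stationary_def)
  have "Lnorm P (real q) (X t n) \<le> ennreal (Dq (real q))" using ls assms by (auto simp: locally_stationary_def)
  also have "\<dots> \<le> ennreal \<bar>Dq (real q)\<bar>" by (intro ennreal_leI) simp
  finally show "(\<integral>\<^sup>+ \<omega>. ennreal (\<bar>X t n \<omega>\<bar> ^ q) \<partial>P) \<le> ennreal (\<bar>Dq (real q)\<bar> ^ q)"
    by (rule Lnorm_le_imp_moment_le) (use assms in auto)
  have "Lnorm P (real q) (\<lambda>\<omega>. X t n \<omega> - shift_process H \<zeta> (real t / real n) (int t) \<omega>) \<le> ennreal (Dq (real q) / real n)"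
    using ls assms by (auto simp: locally_stationary_def)
  also have "\<dots> \<le> ennreal (\<bar>Dq (real q)\<bar> / real n)" by (intro ennreal_leI divide_right_mono) auto
  finally have "Lnorm P (real q) (\<lambda>\<omega>. X t n \<omega> - H (past \<zeta> (int t) \<omega>) (real t / real n)) \<le> ennreal (\<bar>Dq (real q)\<bar> / real n)"
    by (simp add: shift_process_def)
  then show "(\<integral>\<^sup>+ \<omega>. ennreal (\<bar>X t n \<omega> - H (past \<zeta> (int t) \<omega>) (real t / real n)\<bar> ^ q) \<partial>P) \<le> ennreal ((\<bar>Dq (real q)\<bar> / real n) ^ q)"
    by (rule Lnorm_le_imp_moment_le) (use assms in auto)
qed

lemma Y_obs_measurable:
  assumes "1 \<le> n" "t \<le> n"
  shows "(\<lambda>\<omega>. Y_obs X t n \<omega> j) \<in> borel_measurable P"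
proof (cases "j < t")
  case True
  then have "X (t - j) n \<in> borel_measurable P" using assms by (intro X_moment_and_approximation(1)[of 1]) auto
  then show ?thesis using True by (simp add: Y_obs_def)
qed (simp add: Y_obs_def)

lemma g_Y_obs_measurable:
  assumes "1 \<le> n" "t \<le> n"
  shows "(\<lambda>\<omega>. g (Y_obs X t n \<omega>)) \<in> borel_measurable P"
proof -
  have "Y_obs X t n \<in> measurable P (\<Pi>\<^sub>M j\<in>UNIV. borel)"
    by (rule measurable_PiM_single') (auto intro!: Y_obs_measurable assms)
  then show ?thesis by (rule measurable_compose) measurable
qed

lemmas H_class_Lipschitz_P = H_class_Lipschitz_L4[OF prob_space_axioms g_class _ _ theta_ge(1) summable_chi(1), folded chi_total_def, folded K_lip_def]

lemma Y_obs_moment: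
  assumes "1 \<le> q" "1 \<le> n" "t \<le> n"
  shows "(\<integral>\<^sup>+ \<omega>. ennreal (\<bar>Y_obs X t n \<omega> j\<bar> ^ q) \<partial>P) \<le> ennreal (\<bar>Dq (real q)\<bar> ^ q)"
proof (cases "j < t")
  case True
  then have "t - j \<in> {1..n}" using assms by auto
  from X_moment_and_approximation(2)[OF assms(1,2) this] True show ?thesis by (simp add: Y_obs_def)
qed (use assms in \<open>simp add: Y_obs_def power_0_left\<close>)

lemma g_Y_obs_moment4:
  "\<exists>K\<ge>0. \<forall>n\<ge>1. \<forall>t\<le>n. (\<integral>\<^sup>+ \<omega>. ennreal (\<bar>g (Y_obs X t n \<omega>)\<bar> ^ 4) \<partial>P) \<le> ennreal K"
proof -
  define K where "K = K_lip \<bar>Dq (real (8 * M))\<bar> * \<bar>Dq 8\<bar> ^ 4"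
  let ?g0 = "g (\<lambda>_. 0)"
  have K0: "0 \<le> K" unfolding K_def by (intro mult_nonneg_nonneg K_lip_nonneg) auto
  have th: "1 \<le> \<theta> ^ j" for j using theta_ge by simp
  have "(\<integral>\<^sup>+ \<omega>. ennreal (\<bar>g (Y_obs X t n \<omega>)\<bar> ^ 4) \<partial>P) \<le> ennreal (2 ^ 4 * (K + \<bar>?g0\<bar> ^ 4))" if n: "1 \<le> n" "t \<le> n" for n t
  proof -
    have "(\<integral>\<^sup>+ \<omega>. ennreal (\<bar>g (Y_obs X t n \<omega>) - g (\<lambda>_. 0)\<bar> ^ 4) \<partial>P) \<le> ennreal K"
      unfolding K_def
    proof (rule H_class_Lipschitz_P[where Y' = "\<lambda>_ _. 0"])
      fix j
      show "(\<integral>\<^sup>+ \<omega>. ennreal (\<bar>Y_obs X t n \<omega> j\<bar> ^ (8 * M)) \<partial>P) \<le> ennreal (\<bar>Dq (real (8 * M))\<bar> ^ (8 * M))"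
        using M_pos by (intro Y_obs_moment n) auto
      have "(\<integral>\<^sup>+ \<omega>. ennreal (\<bar>Y_obs X t n \<omega> j - 0\<bar> ^ 8) \<partial>P) \<le> ennreal (\<bar>Dq 8\<bar> ^ 8)"
        using Y_obs_moment[of 8 n t j] n by simp
      also have "\<dots> \<le> ennreal ((\<bar>Dq 8\<bar> * \<theta> ^ j) ^ 8)"
        using mult_left_mono[OF th[of j], of "\<bar>Dq 8\<bar>"] by (intro ennreal_leI power_mono) auto
      finally show "(\<integral>\<^sup>+ \<omega>. ennreal (\<bar>Y_obs X t n \<omega> j - 0\<bar> ^ 8) \<partial>P) \<le> ennreal ((\<bar>Dq 8\<bar> * \<theta> ^ j) ^ 8)" .
    qed (use Y_obs_measurable n M_pos in \<open>auto simp: power_0_left\<close>)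
    from nn_integral_power_add_le[OF _ _ this, of "\<lambda>_. ?g0" "\<bar>?g0\<bar> ^ 4"] g_Y_obs_measurable[OF n] K0
    show ?thesis by (simp add: emeasure_space_1)
  qed
  moreover have "0 \<le> 2 ^ 4 * (K + \<bar>?g0\<bar> ^ 4)" using K0 by simp
  ultimately show ?thesis by blast
qed

text \<open>
  At lag \<open>j < t\<close> the observed value differs from the stationary one at parameter \<open>t/n\<close> by at most
  \<open>(j + 1) / n\<close> up to constants: \<open>1/n\<close> for local stationarity and \<open>j/n\<close> for the change of parameter. At the
  missing lags \<open>j \<ge> t\<close> the whole value is an error, but there \<open>j \<ge> n u / 2\<close>, so that \<open>1 \<le> 2 j / (n u)\<close>
  and the same form of bound holds.
\<close>
lemma g_Y_obs_close:
  assumes u: "0 < u"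
  shows "\<exists>K\<ge>0. \<forall>n\<ge>1. \<forall>t\<in>{1..n}. real n * u / 2 \<le> real t \<longrightarrow>
    (\<integral>\<^sup>+ \<omega>. ennreal (\<bar>g (Y_obs X t n \<omega>) - \<Psi> (real t / real n) (past \<zeta> (int t) \<omega>)\<bar> ^ 4) \<partial>P) \<le> ennreal (K * (1 / real n) ^ 4)"
proof -
  obtain c where c: "1 \<le> c" "\<And>j. real j + 1 \<le> c * \<theta> ^ j" using theta_linear_bound by blast
  define b where "b = \<bar>Dq (real (8 * M))\<bar> + moment_bound (8 * M)"
  have b0: "0 \<le> b" unfolding b_def using moment_bound_nonneg[of "8 * M"] by simp
  define E where "E = 4 * \<bar>Dq 8\<bar> * c + 2 * c * moment_bound 8 / u"
  have E0: "0 \<le> E" unfolding E_def using c u moment_bound_nonneg[of 8] by simp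
  have "(\<integral>\<^sup>+ \<omega>. ennreal (\<bar>g (Y_obs X t n \<omega>) - \<Psi> (real t / real n) (past \<zeta> (int t) \<omega>)\<bar> ^ 4) \<partial>P) \<le> ennreal (K_lip b * E ^ 4 * (1 / real n) ^ 4)"
    if n: "1 \<le> n" and t: "t \<in> {1..n}" and tu: "real n * u / 2 \<le> real t" for n t
  proof -
    have n0: "0 < real n" using n by simp
    define v where "v = real t / real n"
    have v: "v \<in> {0..1}" using t n0 by (simp add: v_def)
    define Y' where "Y' = (\<lambda>\<omega> j. H (past \<zeta> (int t - int j) \<omega>) v)"
    have mY': "(\<lambda>\<omega>. Y' \<omega> j) \<in> borel_measurable P" for j unfolding Y'_def using measurable_compose[OF past_measurable H_meas[OF v]] .
    have \<Psi>: "\<Psi> v (past \<zeta> (int t) \<omega>) = g (Y' \<omega>)" for \<omega> unfolding \<Psi>_def Y'_def past_shift ..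
    have momY': "(\<integral>\<^sup>+ \<omega>. ennreal (\<bar>Y' \<omega> j\<bar> ^ q) \<partial>P) \<le> ennreal (moment_bound q ^ q)" if "1 \<le> q" for j q
    proof -
      have "(\<lambda>z. ennreal (\<bar>H z v\<bar> ^ q)) \<in> borel_measurable Q" using H_meas[OF v] by measurable
      from nn_integral_past[OF this] show ?thesis unfolding Y'_def using H_moment[OF v that] by simp
    qed
    have diff: "(\<integral>\<^sup>+ \<omega>. ennreal (\<bar>Y_obs X t n \<omega> j - Y' \<omega> j\<bar> ^ 8) \<partial>P) \<le> ennreal ((E * (1 / real n) * \<theta> ^ j) ^ 8)" for j
    proof (cases "j < t")
      case True
      define s where "s = t - j"
      have s: "s \<in> {1..n}" "int s = int t - int j" "real s = real t - real j" using True t by (auto simp: s_def)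
      define w where "w = real s / real n"
      have w: "w \<in> {0..1}" using s n0 by (simp add: w_def)
      have vw: "\<bar>w - v\<bar> = real j / real n" unfolding w_def v_def s(3) using n0 by (simp add: diff_divide_distrib[symmetric])
      have 1: "(\<integral>\<^sup>+ \<omega>. ennreal (\<bar>X s n \<omega> - H (past \<zeta> (int s) \<omega>) w\<bar> ^ 8) \<partial>P) \<le> ennreal ((\<bar>Dq 8\<bar> / real n) ^ 8)"
        using X_moment_and_approximation(3)[of 8 n s, OF _ n s(1)] by (simp add: w_def)
      have m: "(\<lambda>z. ennreal (\<bar>H z w - H z v\<bar> ^ 8)) \<in> borel_measurable Q" using H_meas[OF v] H_meas[OF w] by measurable
      have 2: "(\<integral>\<^sup>+ \<omega>. ennreal (\<bar>H (past \<zeta> (int s) \<omega>) w - H (past \<zeta> (int s) \<omega>) v\<bar> ^ 8) \<partial>P) \<le> ennreal ((\<bar>Dq 8\<bar> * (real j / real n)) ^ 8)"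
        using nn_integral_past[OF m, of "int s"] H_Lipschitz8[OF w v] unfolding vw by simp
      have mm: "(\<lambda>\<omega>. X s n \<omega> - H (past \<zeta> (int s) \<omega>) w) \<in> borel_measurable P" "(\<lambda>\<omega>. H (past \<zeta> (int s) \<omega>) w - H (past \<zeta> (int s) \<omega>) v) \<in> borel_measurable P"
        using X_moment_and_approximation(1)[of 1 n s] n s measurable_compose[OF past_measurable H_meas[OF v], of "int s"]
          measurable_compose[OF past_measurable H_meas[OF w], of "int s"] by auto
      have "(\<integral>\<^sup>+ \<omega>. ennreal (\<bar>(X s n \<omega> - H (past \<zeta> (int s) \<omega>) w) + (H (past \<zeta> (int s) \<omega>) w - H (past \<zeta> (int s) \<omega>) v)\<bar> ^ 8) \<partial>P)
         \<le> ennreal (2 ^ 8 * ((\<bar>Dq 8\<bar> / real n) ^ 8 + (\<bar>Dq 8\<bar> * (real j / real n)) ^ 8))"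
        by (rule nn_integral_power_add_le[OF mm 1 2]) auto
      also have "\<dots> \<le> ennreal ((E * (1 / real n) * \<theta> ^ j) ^ 8)"
      proof (rule ennreal_leI)
        define a where "a = \<bar>Dq 8\<bar> / real n * (real j + 1)"
        have a0: "0 \<le> a" by (simp add: a_def)
        have "\<bar>Dq 8\<bar> / real n \<le> a" "\<bar>Dq 8\<bar> * (real j / real n) \<le> a"
        proof -
          have a_eq: "a = \<bar>Dq 8\<bar> / real n + \<bar>Dq 8\<bar> * (real j / real n)" by (simp add: a_def algebra_simps add_divide_distrib)
          have "0 \<le> \<bar>Dq 8\<bar> / real n" "0 \<le> \<bar>Dq 8\<bar> * (real j / real n)" by auto
          then show "\<bar>Dq 8\<bar> / real n \<le> a" "\<bar>Dq 8\<bar> * (real j / real n) \<le> a" unfolding a_eq by linarith+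
        qed
        then have "2 ^ 8 * ((\<bar>Dq 8\<bar> / real n) ^ 8 + (\<bar>Dq 8\<bar> * (real j / real n)) ^ 8) \<le> 2 ^ 8 * (a ^ 8 + a ^ 8)"
          by (intro mult_left_mono add_mono power_mono) auto
        also have "\<dots> \<le> (4 * a) ^ 8" using a0 by (simp add: power_mult_distrib)
        also have "\<dots> \<le> (E * (1 / real n) * \<theta> ^ j) ^ 8"
        proof (rule power_mono)
          have "4 * a \<le> 4 * (\<bar>Dq 8\<bar> / real n * (c * \<theta> ^ j))" unfolding a_def using c(2)[of j] by (intro mult_left_mono) auto
          also have "\<dots> = (4 * \<bar>Dq 8\<bar> * c) * (1 / real n) * \<theta> ^ j" by simp
          also have "\<dots> \<le> E * (1 / real n) * \<theta> ^ j"
            unfolding E_def using c u moment_bound_nonneg[of 8] theta_ge by (intro mult_right_mono) auto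
          finally show "4 * a \<le> E * (1 / real n) * \<theta> ^ j" .
        qed (use a0 in simp)
        finally show "2 ^ 8 * ((\<bar>Dq 8\<bar> / real n) ^ 8 + (\<bar>Dq 8\<bar> * (real j / real n)) ^ 8) \<le> (E * (1 / real n) * \<theta> ^ j) ^ 8" .
      qed
      finally show ?thesis using True by (simp add: Y_obs_def Y'_def s_def[symmetric] s(2)[symmetric])
    next
      case False
      have "(\<integral>\<^sup>+ \<omega>. ennreal (\<bar>Y_obs X t n \<omega> j - Y' \<omega> j\<bar> ^ 8) \<partial>P) \<le> ennreal (moment_bound 8 ^ 8)"
        using False momY'[of 8 j] by (simp add: Y_obs_def)
      also have "\<dots> \<le> ennreal ((E * (1 / real n) * \<theta> ^ j) ^ 8)"
      proof (intro ennreal_leI power_mono moment_bound_nonneg)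
        have "real n * u / 2 \<le> real j + 1" using tu False by simp
        also have "\<dots> \<le> c * \<theta> ^ j" by (rule c(2))
        finally have "1 \<le> (2 * c / u) * (1 / real n) * \<theta> ^ j" using u n0 by (simp add: field_simps)
        then have "moment_bound 8 * 1 \<le> moment_bound 8 * ((2 * c / u) * (1 / real n) * \<theta> ^ j)" using moment_bound_nonneg[of 8] by (intro mult_left_mono)
        also have "\<dots> = (2 * c * moment_bound 8 / u) * (1 / real n) * \<theta> ^ j" by simp
        also have "\<dots> \<le> E * (1 / real n) * \<theta> ^ j"
          unfolding E_def using c theta_ge by (intro mult_right_mono) auto
        finally show "moment_bound 8 \<le> E * (1 / real n) * \<theta> ^ j" by simp
      qed
      finally show ?thesis .
    qed
    have "(\<integral>\<^sup>+ \<omega>. ennreal (\<bar>g (Y_obs X t n \<omega>) - g (Y' \<omega>)\<bar> ^ 4) \<partial>P) \<le> ennreal (K_lip b * (E * (1 / real n)) ^ 4)"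
    proof (rule H_class_Lipschitz_P)
      fix j
      have "(\<integral>\<^sup>+ \<omega>. ennreal (\<bar>Y_obs X t n \<omega> j\<bar> ^ (8 * M)) \<partial>P) \<le> ennreal (\<bar>Dq (real (8 * M))\<bar> ^ (8 * M))"
        using t M_pos by (intro Y_obs_moment n) auto
      also have "\<dots> \<le> ennreal (b ^ (8 * M))" unfolding b_def using moment_bound_nonneg by (intro ennreal_leI power_mono) auto
      finally show "(\<integral>\<^sup>+ \<omega>. ennreal (\<bar>Y_obs X t n \<omega> j\<bar> ^ (8 * M)) \<partial>P) \<le> ennreal (b ^ (8 * M))" .
      have "(\<integral>\<^sup>+ \<omega>. ennreal (\<bar>Y' \<omega> j\<bar> ^ (8 * M)) \<partial>P) \<le> ennreal (moment_bound (8 * M) ^ (8 * M))"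
        using M_pos by (intro momY') auto
      also have "\<dots> \<le> ennreal (b ^ (8 * M))" unfolding b_def using moment_bound_nonneg by (intro ennreal_leI power_mono) auto
      finally show "(\<integral>\<^sup>+ \<omega>. ennreal (\<bar>Y' \<omega> j\<bar> ^ (8 * M)) \<partial>P) \<le> ennreal (b ^ (8 * M))" .
    qed (use Y_obs_measurable n t mY' b0 E0 diff in auto)
    then show ?thesis unfolding v_def[symmetric] \<Psi> power_mult_distrib mult.assoc .
  qed
  moreover have "0 \<le> K_lip b * E ^ 4" using E0 by (intro mult_nonneg_nonneg K_lip_nonneg b0) auto
  ultimately show ?thesis by blast
qed

end

section \<open>Deviation of a kernel average\<close>

context ls_model
begin

text \<open>
  Approximate \<open>\<Psi>\<close> by bounded functionals of range \<open>block_len n\<close> and apply \<open>block_sum_tail\<close> with block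
  variance sum at most \<open>2 s\<close>, where \<open>s = \<sigma>\<^sub>K\<^sup>2 (\<Gamma> + \<epsilon>) / (n h)\<close>, at deviation level
  \<open>y = 4 \<surd>(s log n)\<close>: then \<open>y\<^sup>2 / (8 s) = 2 log n\<close>, which gives the probability \<open>4 / n\<^sup>2\<close> for a
  deviation of \<open>2 y = 8 \<surd>(s log n)\<close>. The approximation error is tiny in \<open>L\<^sup>1\<close> and uses up the
  remaining half in \<open>17/2\<close>, with another \<open>1 / n\<^sup>2\<close> by Markov's inequality.
\<close>
lemma kernel_sum_deviation:
  assumes u: "0 < u" "u < 1" and K: "K \<in> kernel_class" and eps: "0 < \<epsilon>"
    and h0: "(\<lambda>n. ln (real n) * (h0 n)\<^sup>2) \<longlonglongrightarrow> 0" "h0 \<longlonglongrightarrow> 0"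
  shows "\<forall>\<^sub>F n in sequentially. \<forall>h. ln (real n) powr (5 + 2 * \<alpha> * real M) / real n \<le> h \<longrightarrow> h \<le> h0 n \<longrightarrow>
    prob {\<omega> \<in> space P. 17 / 2 * sqrt (sigma2_K K * (lr_var u + \<epsilon>) / (real n * h) * ln (real n)) \<le>
      \<bar>\<Sum>t=1..n. kernel_weight K n h u (int t) * (\<Psi> (real t / real n) (past \<zeta> (int t) \<omega>) - mean_\<Psi> (real t / real n))\<bar>} \<le> 5 / (real n)\<^sup>2"
proof -
  interpret Q: prob_space Q by (rule prob_space_Q)
  have u01: "u \<in> {0..1}" using u by simp
  obtain L' where L'K: "L'-lipschitz_on UNIV K" and L'K2: "L'-lipschitz_on UNIV (\<lambda>x. (K x)\<^sup>2)"
    and KL': "\<And>x. \<bar>K x\<bar> \<le> L'" and L'1: "1 \<le> L'" using kernel_products_lipschitz[OF K] by metis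
  obtain supp: "\<And>x. K x \<noteq> 0 \<Longrightarrow> \<bar>x\<bar> \<le> 1 / 2" and Kpos: "\<And>x. 0 \<le> K x" and Kint: "(\<integral>x. K x \<partial>lborel) = 1"
    using kernel_class_facts[OF K] by metis
  define \<sigma> where "\<sigma> = sigma2_K K"
  have \<sigma>: "0 < \<sigma>" unfolding \<sigma>_def by (rule sigma2_K_pos[OF K])
  define \<Gamma> where "\<Gamma> = lr_var u"
  have \<Gamma>: "0 \<le> \<Gamma>" unfolding \<Gamma>_def by (rule lr_var_nonneg[OF u01])
  define \<gamma> where "\<gamma> = (\<integral>z. (centered u z)\<^sup>2 \<partial>Q)"
  have \<gamma>: "0 \<le> \<gamma>" unfolding \<gamma>_def by (rule integral_nonneg_AE) auto
  obtain KL where KL: "0 \<le> KL" "\<And>v w. v \<in> {0..1} \<Longrightarrow> w \<in> {0..1} \<Longrightarrow> (\<integral>\<^sup>+ z. ennreal (\<bar>\<Psi> v z - \<Psi> w z\<bar> ^ 4) \<partial>Q) \<le> ennreal (KL * \<bar>v - w\<bar> ^ 4)"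
    using \<Psi>_Lipschitz_L4 by blast
  obtain cE cB where cE: "0 \<le> cE" and cB: "0 \<le> cB" and
    ap: "\<forall>\<^sub>F n in sequentially. \<forall>v\<in>{0..1}. \<exists>\<phi>. \<phi> \<in> borel_measurable Q \<and>
     depends_first (block_len n) (space Q) \<phi> \<and> (\<forall>z. \<bar>\<phi> z\<bar> \<le> cB * ln (real n) powr (\<alpha> * real M)) \<and>
     (\<integral>\<^sup>+ z. ennreal (\<bar>\<Psi> v z - \<phi> z\<bar> ^ 4) \<partial>Q) \<le> ennreal (cE * (1 / real n ^ 4) ^ 4)"
    using block_approximation by blast
  obtain l0 where l0: "\<And>l t0. l0 \<le> l \<Longrightarrow> (\<integral>\<omega>. (\<Sum>t\<in>{t0..<t0 + int l}. centered u (past \<zeta> t \<omega>))\<^sup>2 \<partial>P) \<le> real l * (\<Gamma> + \<epsilon> / 2)"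
    using variance_of_sum_le[OF u01, of "\<epsilon> / 2"] eps unfolding \<Gamma>_def by auto
  define cl where "cl = 2 * block_const + 2"
  have cl: "2 \<le> cl" using block_const_pos by (simp add: cl_def)
  (* e2 bounds the L2 distance of the approximating functionals from \<Psi> u; f1 is the relative
     error of the block variance, f2 the quantity that decides whether Bernstein's inequality is
     in its Gaussian regime. Both have to tend to 0. *)
  define e2 where "e2 = (\<lambda>n. 2 * (sqrt cE * (1 / real n ^ 4)\<^sup>2) + 2 * (sqrt KL * (h0 n)\<^sup>2))"
  define f1 where "f1 = (\<lambda>n. (\<Gamma> + \<epsilon> / 2) * 3 * L' * (cl * ln (real n)) / ln (real n) ^ 5
     + 6 * (L'\<^sup>2 * (cl * ln (real n)) * e2 n + L'\<^sup>2 * \<gamma> * (cl * ln (real n)) ^ 3 / (ln (real n) ^ 5)\<^sup>2))"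
  define f2 where "f2 = (\<lambda>n. 4 * (cl * ln (real n))\<^sup>2 * L'\<^sup>2 * cB\<^sup>2 * ln (real n) / ln (real n) ^ 5)"
  define c where "c = sqrt (sqrt cE)"
  have c: "0 \<le> c" unfolding c_def using cE by simp
  have lninf: "filterlim (\<lambda>n. ln (real n)) at_top sequentially"
    by (rule filterlim_compose[OF ln_at_top filterlim_real_sequentially])
  have "f1 \<longlonglongrightarrow> 0"
  proof -
    have a: "(\<lambda>n. ln (real n) / ln (real n) ^ 5) \<longlonglongrightarrow> 0" by real_asymp
    have b: "(\<lambda>n. ln (real n) ^ 3 / (ln (real n) ^ 5)\<^sup>2) \<longlonglongrightarrow> 0" by real_asymp
    have d: "(\<lambda>n. ln (real n) * (1 / real n ^ 4)\<^sup>2) \<longlonglongrightarrow> 0" by real_asymp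
    have "(\<lambda>n. ((\<Gamma> + \<epsilon> / 2) * 3 * L' * cl) * (ln (real n) / ln (real n) ^ 5)
      + 6 * (L'\<^sup>2 * cl * 2 * sqrt cE * (ln (real n) * (1 / real n ^ 4)\<^sup>2) + L'\<^sup>2 * cl * 2 * sqrt KL * (ln (real n) * (h0 n)\<^sup>2)
        + L'\<^sup>2 * \<gamma> * cl ^ 3 * (ln (real n) ^ 3 / (ln (real n) ^ 5)\<^sup>2)))
      \<longlonglongrightarrow> ((\<Gamma> + \<epsilon> / 2) * 3 * L' * cl) * 0 + 6 * (L'\<^sup>2 * cl * 2 * sqrt cE * 0 + L'\<^sup>2 * cl * 2 * sqrt KL * 0 + L'\<^sup>2 * \<gamma> * cl ^ 3 * 0)"
      by (intro tendsto_intros a b d h0)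
    moreover have "A * 3 * L' * (cl * l) / l5 + 6 * (B * (cl * l) * (2 * (s1 * E) + 2 * (s2 * H)) + B * \<gamma> * (cl ^ 3 * l3) / q)
        = (A * 3 * L' * cl) * (l / l5) + 6 * (B * cl * 2 * s1 * (l * E) + B * cl * 2 * s2 * (l * H) + B * \<gamma> * cl ^ 3 * (l3 / q))"
      for A B l l5 s1 s2 E H l3 q :: real
      by (simp add: algebra_simps)
    ultimately show ?thesis unfolding f1_def e2_def power_mult_distrib by (simp only: mult_zero_right add_0_right)
  qed
  then have ev1: "\<forall>\<^sub>F n in sequentially. f1 n < \<sigma> * \<epsilon> / 2" using \<sigma> eps by (intro order_tendstoD(2)) auto
  have "f2 \<longlonglongrightarrow> 0"
  proof -
    have "(\<lambda>n. (ln (real n))\<^sup>2 * ln (real n) / ln (real n) ^ 5) \<longlonglongrightarrow> 0" by real_asymp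
    then have "(\<lambda>n. (4 * cl\<^sup>2 * L'\<^sup>2 * cB\<^sup>2) * ((ln (real n))\<^sup>2 * ln (real n) / ln (real n) ^ 5)) \<longlonglongrightarrow> (4 * cl\<^sup>2 * L'\<^sup>2 * cB\<^sup>2) * 0"
      by (intro tendsto_intros)
    then show ?thesis unfolding f2_def by (simp add: algebra_simps power_mult_distrib)
  qed
  then have ev2: "\<forall>\<^sub>F n in sequentially. f2 n < \<sigma> * \<epsilon>" using \<sigma> eps by (intro order_tendstoD(2)) auto
  have ev3: "\<forall>\<^sub>F n in sequentially. 8 * c / sqrt (\<sigma> * \<epsilon>) + 1 \<le> real n"
    using filterlim_real_sequentially by (simp add: filterlim_at_top)
  have ev4: "\<forall>\<^sub>F n in sequentially. cl + 3 * L' + real l0 / (2 * block_const) \<le> ln (real n)"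
    using lninf by (simp add: filterlim_at_top)
  have ev5: "\<forall>\<^sub>F n in sequentially. h0 n < min u (1 - u)" using h0(2) u by (intro order_tendstoD(2)) auto
  show ?thesis using ap ev1 ev2 ev3 ev4 ev5
  proof eventually_elim
    case (elim n)
    note apn = elim(1)
    show ?case
    proof (intro allI impI)
      fix h assume hl: "ln (real n) powr (5 + 2 * \<alpha> * real M) / real n \<le> h" and hh: "h \<le> h0 n"
      define L where "L = ln (real n)"
      define p where "p = real n * h"
      define l where "l = block_len n"
      have n1: "1 \<le> real n" using elim(4) c \<sigma> eps by (smt (verit) divide_nonneg_nonneg mult_nonneg_nonneg real_sqrt_ge_zero)
      then have n: "1 \<le> n" "0 < real n" by auto
      have L_big: "cl + 3 * L' + real l0 / (2 * block_const) \<le> L" using elim(5) by (simp add: L_def)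
      have "0 \<le> real l0 / (2 * block_const)" using block_const_pos by simp
      then have L1: "1 \<le> L" "cl \<le> L" "3 * L' \<le> L" "real l0 / (2 * block_const) \<le> L" using L_big cl L'1 by linarith+
      have L5: "L ^ 1 \<le> L ^ 5" using L1 by (intro power_increasing) auto
      have LM: "1 \<le> L powr (2 * (\<alpha> * real M))" using L1 alpha by (intro ge_one_powr_ge_zero) auto
      have Lsplit: "L powr (5 + 2 * \<alpha> * real M) = L ^ 5 * L powr (2 * (\<alpha> * real M))"
      proof -
        have "L powr 5 = L ^ 5" using L1 by (intro powr_numeral) simp
        then show ?thesis by (simp only: powr_add mult.assoc)
      qed
      have p_ge: "L ^ 5 * L powr (2 * (\<alpha> * real M)) \<le> p"
      proof -
        have "L powr (5 + 2 * \<alpha> * real M) / real n \<le> h" using hl by (simp only: L_def)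
        then have "L powr (5 + 2 * \<alpha> * real M) \<le> h * real n" using n(2) by (simp only: pos_divide_le_eq)
        then show ?thesis unfolding Lsplit p_def by (simp only: mult.commute)
      qed
      have "L ^ 5 * 1 \<le> L ^ 5 * L powr (2 * (\<alpha> * real M))" using LM L1 by (intro mult_left_mono) auto
      with p_ge have p5: "L ^ 5 \<le> p" by simp
      have p1: "1 \<le> p" "0 < p" using p5 L5 L1 by auto
      have hpos: "0 < h" using p1 n unfolding p_def by (simp add: zero_less_mult_iff)
      have h_small: "h < u" "h < 1 - u" using hh elim(6) by auto
      have h1: "h / 2 < u" "u + h / 2 \<le> 1" using h_small hpos by auto
      have pn: "p \<le> real n" using h_small u n unfolding p_def by (simp add: mult_left_le)
      have l_up: "real l \<le> cl * L"
      proof -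
        have "real (nat \<lceil>block_const * L\<rceil>) \<le> block_const * L + 1"
        proof -
          have "0 \<le> block_const * L" using block_const_pos L1 by simp
          then have "real (nat \<lceil>block_const * L\<rceil>) = real_of_int \<lceil>block_const * L\<rceil>" by simp
          then show ?thesis using of_int_ceiling_le_add_one[of "block_const * L"] by linarith
        qed
        then show ?thesis using L1 by (simp add: l_def block_len_def L_def[symmetric] cl_def algebra_simps)
      qed
      have l_lo: "2 * block_const * L \<le> real l"
        unfolding l_def block_len_def L_def[symmetric] using real_nat_ceiling_ge[of "block_const * L"] by simp
      have "real l0 \<le> 2 * block_const * L" using L1(4) block_const_pos by (simp add: field_simps)
      with l_lo have ll0: "l0 \<le> l" by linarith
      have "0 < 2 * block_const * L" using block_const_pos L1 by simp
      with l_lo have l1: "1 \<le> l" by linarith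
      have lp: "real l \<le> p"
      proof -
        have "cl * L \<le> L * L" using L1 by (intro mult_right_mono) auto
        also have "\<dots> = L ^ 2" by (simp add: power2_eq_square)
        also have "\<dots> \<le> L ^ 5" using L1 by (intro power_increasing) auto
        finally show ?thesis using l_up p5 by linarith
      qed
      define ct where "ct = kernel_weight K n h u"
      have ct_nn: "0 \<le> ct t" for t unfolding ct_def kernel_weight_def using Kpos n hpos by simp
      have ct_bd: "\<bar>ct t\<bar> \<le> L' / p" for t
        unfolding ct_def kernel_weight_def p_def using KL' n hpos by (simp add: abs_divide divide_right_mono)
      have ct_nz: "real_of_int t / real n \<in> {0..1}" "\<bar>real_of_int t / real n - u\<bar> \<le> h0 n" if "ct t \<noteq> 0" for t
      proof -
        have r: "\<bar>real_of_int t / real n - u\<bar> \<le> h / 2"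
          using that unfolding ct_def by (intro kernel_weight_nonzero_range[OF n(1) hpos supp])
        then have "0 \<le> real_of_int t / real n" "real_of_int t / real n \<le> 1" using h1 by linarith+
        then show "real_of_int t / real n \<in> {0..1}" by simp
        show "\<bar>real_of_int t / real n - u\<bar> \<le> h0 n" using r hh hpos by linarith
      qed
      define v where "v = (\<lambda>t::int. real_of_int t / real n)"
      define b where "b = cB * L powr (\<alpha> * real M)"
      have b0: "0 \<le> b" unfolding b_def using cB by simp
      have "\<forall>t. \<exists>\<phi>. \<phi> \<in> borel_measurable Q \<and> depends_first l (space Q) \<phi> \<and> (\<forall>z. \<bar>\<phi> z\<bar> \<le> b) \<and>
        (ct t \<noteq> 0 \<longrightarrow> (\<integral>\<^sup>+ z. ennreal (\<bar>\<Psi> (v t) z - \<phi> z\<bar> ^ 4) \<partial>Q) \<le> ennreal (cE * (1 / real n ^ 4) ^ 4))"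
      proof
        fix t
        show "\<exists>\<phi>. \<phi> \<in> borel_measurable Q \<and> depends_first l (space Q) \<phi> \<and> (\<forall>z. \<bar>\<phi> z\<bar> \<le> b) \<and>
          (ct t \<noteq> 0 \<longrightarrow> (\<integral>\<^sup>+ z. ennreal (\<bar>\<Psi> (v t) z - \<phi> z\<bar> ^ 4) \<partial>Q) \<le> ennreal (cE * (1 / real n ^ 4) ^ 4))"
        proof (cases "ct t = 0")
          case True
          then show ?thesis using b0 by (intro exI[of _ "\<lambda>_. 0"]) (auto simp: depends_first_def)
        next
          case False
          then have "v t \<in> {0..1}" unfolding v_def by (rule ct_nz)
          then show ?thesis using apn unfolding b_def l_def L_def by blast
        qed
      qed
      from choice[OF this] obtain \<phi> where "\<forall>t. \<phi> t \<in> borel_measurable Q \<and> depends_first l (space Q) (\<phi> t) \<and> (\<forall>z. \<bar>\<phi> t z\<bar> \<le> b) \<and>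
        (ct t \<noteq> 0 \<longrightarrow> (\<integral>\<^sup>+ z. ennreal (\<bar>\<Psi> (v t) z - \<phi> t z\<bar> ^ 4) \<partial>Q) \<le> ennreal (cE * (1 / real n ^ 4) ^ 4))" ..
      then have \<phi>m[measurable]: "\<And>t. \<phi> t \<in> borel_measurable Q" and \<phi>d: "\<And>t. depends_first l (space Q) (\<phi> t)"
        and \<phi>b: "\<And>t z. \<bar>\<phi> t z\<bar> \<le> b"
        and \<phi>c: "\<And>t. ct t \<noteq> 0 \<Longrightarrow> (\<integral>\<^sup>+ z. ennreal (\<bar>\<Psi> (v t) z - \<phi> t z\<bar> ^ 4) \<partial>Q) \<le> ennreal (cE * (1 / real n ^ 4) ^ 4)"
        by blast+
      define e where "e = 1 / real n ^ 4"
      have e: "0 \<le> e" unfolding e_def by simp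
      have sq4: "sqrt (x * y ^ 4) = sqrt x * y\<^sup>2" for x y :: real
      proof -
        have "y ^ 4 = (y\<^sup>2)\<^sup>2" by simp
        then show ?thesis by (simp only: real_sqrt_mult real_sqrt_abs abs_power2)
      qed
      have L4\<phi>: "integrable Q (\<lambda>z. \<Psi> (v t) z - \<phi> t z)" "integrable Q (\<lambda>z. (\<Psi> (v t) z - \<phi> t z)\<^sup>2)"
        "(\<integral>z. (\<Psi> (v t) z - \<phi> t z)\<^sup>2 \<partial>Q) \<le> sqrt cE * e\<^sup>2" "(\<integral>z. \<bar>\<Psi> (v t) z - \<phi> t z\<bar> \<partial>Q) \<le> c * e" if "ct t \<noteq> 0" for t
      proof -
        have vt: "v t \<in> {0..1}" unfolding v_def using ct_nz[OF that] by simp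
        have m: "(\<lambda>z. \<Psi> (v t) z - \<phi> t z) \<in> borel_measurable Q" using \<Psi>_meas[OF vt] by measurable
        have K0: "0 \<le> cE * e ^ 4" using cE by simp
        note L4 = Q.L4_moments[OF m K0 \<phi>c[OF that, folded e_def]]
        show "integrable Q (\<lambda>z. \<Psi> (v t) z - \<phi> t z)" "integrable Q (\<lambda>z. (\<Psi> (v t) z - \<phi> t z)\<^sup>2)" by (rule L4)+
        show "(\<integral>z. (\<Psi> (v t) z - \<phi> t z)\<^sup>2 \<partial>Q) \<le> sqrt cE * e\<^sup>2" using L4(3) by (simp only: sq4)
        show "(\<integral>z. \<bar>\<Psi> (v t) z - \<phi> t z\<bar> \<partial>Q) \<le> c * e"
        proof -
          have "sqrt (sqrt (cE * e ^ 4)) = c * e"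
            by (simp only: sq4 real_sqrt_mult[of "sqrt cE"] real_sqrt_abs c_def abs_of_nonneg[OF e])
          then show ?thesis using L4(4) by simp
        qed
      qed
      have close: "(\<integral>z. (\<phi> t z - \<Psi> u z)\<^sup>2 \<partial>Q) \<le> e2 n" if "ct t \<noteq> 0" for t
      proof -
        have vt: "v t \<in> {0..1}" unfolding v_def using ct_nz[OF that] by simp
        have m: "(\<lambda>z. \<Psi> (v t) z - \<Psi> u z) \<in> borel_measurable Q" using \<Psi>_meas[OF vt] \<Psi>_meas[OF u01] by measurable
        have K0: "0 \<le> KL * \<bar>v t - u\<bar> ^ 4" using KL by simp
        note L4 = Q.L4_moments[OF m K0 KL(2)[OF vt u01]]
        have "(\<integral>z. (\<Psi> (v t) z - \<Psi> u z)\<^sup>2 \<partial>Q) \<le> sqrt KL * \<bar>v t - u\<bar>\<^sup>2" using L4(3) by (simp only: sq4)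
        also have "\<dots> \<le> sqrt KL * (h0 n)\<^sup>2"
          using ct_nz(2)[OF that] KL unfolding v_def by (intro mult_left_mono power_mono) auto
        finally have 2: "(\<integral>z. (\<Psi> (v t) z - \<Psi> u z)\<^sup>2 \<partial>Q) \<le> sqrt KL * (h0 n)\<^sup>2" .
        have i1: "integrable Q (\<lambda>z. 2 * (\<Psi> (v t) z - \<phi> t z)\<^sup>2 + 2 * (\<Psi> (v t) z - \<Psi> u z)\<^sup>2)"
          using L4\<phi>(2)[OF that] L4(2) by simp
        have pt: "(\<phi> t z - \<Psi> u z)\<^sup>2 \<le> 2 * (\<Psi> (v t) z - \<phi> t z)\<^sup>2 + 2 * (\<Psi> (v t) z - \<Psi> u z)\<^sup>2" for z
          using sum_squares_bound[of "\<phi> t z - \<Psi> (v t) z" "\<Psi> (v t) z - \<Psi> u z"]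
            power2_sum[of "\<phi> t z - \<Psi> (v t) z" "\<Psi> (v t) z - \<Psi> u z"] by (simp add: power2_commute)
        have mm: "(\<lambda>z. (\<phi> t z - \<Psi> u z)\<^sup>2) \<in> borel_measurable Q" using \<Psi>_meas[OF u01] by measurable
        have "integrable Q (\<lambda>z. (\<phi> t z - \<Psi> u z)\<^sup>2)"
          by (rule Bochner_Integration.integrable_bound[OF i1 mm]) (auto intro!: AE_I2 order.trans[OF pt])
        then have "(\<integral>z. (\<phi> t z - \<Psi> u z)\<^sup>2 \<partial>Q) \<le> (\<integral>z. 2 * (\<Psi> (v t) z - \<phi> t z)\<^sup>2 + 2 * (\<Psi> (v t) z - \<Psi> u z)\<^sup>2 \<partial>Q)"
          by (rule integral_mono[OF _ i1 pt])
        also have "\<dots> = 2 * (\<integral>z. (\<Psi> (v t) z - \<phi> t z)\<^sup>2 \<partial>Q) + 2 * (\<integral>z. (\<Psi> (v t) z - \<Psi> u z)\<^sup>2 \<partial>Q)"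
          using L4\<phi>(2)[OF that] L4(2) by simp
        also have "\<dots> \<le> e2 n" using L4\<phi>(3)[OF that] 2 unfolding e2_def e_def by simp
        finally show ?thesis .
      qed
      have e2_nn: "0 \<le> e2 n" unfolding e2_def using cE KL by simp
      define t0 where "t0 = win_start n h u"
      define J where "J = win_blocks n h l"
      define dd where "dd = L' * real l / p\<^sup>2"
      define s2 where "s2 = \<sigma> * (\<Gamma> + \<epsilon>) / p"
      have s2: "0 < s2" unfolding s2_def using \<sigma> \<Gamma> eps p1 by simp
      have s2_lo: "\<sigma> * \<epsilon> / p \<le> s2" unfolding s2_def using \<sigma> \<Gamma> p1 by (intro divide_right_mono mult_left_mono) auto
      define B where "B = (\<lambda>j \<omega>. \<Sum>t\<in>{t0 + int (j * l)..<t0 + int (Suc j * l)}. ct t * (\<phi> t (past \<zeta> t \<omega>) - (\<integral>z. \<phi> t z \<partial>Q)))"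
      (* The kernel is Lipschitz, so its weight varies by at most dd within a block. *)
      have varB: "(\<integral>\<omega>. (B j \<omega>)\<^sup>2 \<partial>P) \<le> 2 * (ct (t0 + int (j * l)))\<^sup>2 * real l * (\<Gamma> + \<epsilon> / 2)
          + 4 * (real l)\<^sup>2 * ((L' / p)\<^sup>2 * e2 n + dd\<^sup>2 * \<gamma>)" for j
      proof -
        let ?s = "t0 + int (j * l)"
        have set: "{?s..<t0 + int (Suc j * l)} = {?s..<?s + int l}" by (simp add: algebra_simps)
        have dist: "\<bar>ct t - ct ?s\<bar> \<le> dd" if "t \<in> {?s..<?s + int l}" for t
        proof -
          have "\<bar>K ((real_of_int t / real n - u) / h) - K ((real_of_int ?s / real n - u) / h)\<bar>
              \<le> L' * \<bar>(real_of_int t / real n - u) / h - (real_of_int ?s / real n - u) / h\<bar>"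
            using L'K unfolding lipschitz_on_def dist_real_def by blast
          also have "(real_of_int t / real n - u) / h - (real_of_int ?s / real n - u) / h = real_of_int (t - ?s) / p"
            using n hpos unfolding p_def by (simp add: field_simps)
          finally have 1: "\<bar>K ((real_of_int t / real n - u) / h) - K ((real_of_int ?s / real n - u) / h)\<bar>
              \<le> L' * \<bar>real_of_int (t - ?s) / p\<bar>" .
          have "\<bar>t - ?s\<bar> \<le> int l" using that by auto
          then have "\<bar>real_of_int (t - ?s)\<bar> \<le> real l" by linarith
          then have "\<bar>real_of_int (t - ?s)\<bar> / p \<le> real l / p" using p1 by (intro divide_right_mono) auto
          then have "\<bar>real_of_int (t - ?s) / p\<bar> \<le> real l / p" unfolding abs_divide using p1 by simp
          then have "L' * \<bar>real_of_int (t - ?s) / p\<bar> \<le> L' * (real l / p)" using L'1 by (intro mult_left_mono) auto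
          with 1 have "\<bar>K ((real_of_int t / real n - u) / h) - K ((real_of_int ?s / real n - u) / h)\<bar> \<le> L' * (real l / p)"
            by linarith
          then have "\<bar>K ((real_of_int t / real n - u) / h) - K ((real_of_int ?s / real n - u) / h)\<bar> / p \<le> L' * (real l / p) / p"
            using p1 by (intro divide_right_mono) auto
          moreover have "ct t - ct ?s = (K ((real_of_int t / real n - u) / h) - K ((real_of_int ?s / real n - u) / h)) / p"
            unfolding ct_def kernel_weight_def p_def by (simp add: diff_divide_distrib)
          ultimately show ?thesis using p1 by (simp add: dd_def abs_divide power2_eq_square)
        qed
        show ?thesis unfolding B_def set \<gamma>_def
          by (rule block_variance_le[OF u01 \<phi>m \<phi>b close e2_nn ct_bd dist l0[OF ll0]])
      qed
      have V: "(\<Sum>j<J. (\<integral>\<omega>. (B j \<omega>)\<^sup>2 \<partial>P)) \<le> 2 * s2"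
      proof -
        have "(\<Sum>j<J. (\<integral>\<omega>. (B j \<omega>)\<^sup>2 \<partial>P)) \<le> (\<Sum>j<J. 2 * (ct (t0 + int (j * l)))\<^sup>2 * real l * (\<Gamma> + \<epsilon> / 2)
          + 4 * (real l)\<^sup>2 * ((L' / p)\<^sup>2 * e2 n + dd\<^sup>2 * \<gamma>))" by (intro sum_mono varB)
        also have "\<dots> = 2 * (\<Gamma> + \<epsilon> / 2) * (real l * (\<Sum>j<J. (ct (t0 + int (j * l)))\<^sup>2))
          + 4 * (real J * real l) * real l * ((L' / p)\<^sup>2 * e2 n + dd\<^sup>2 * \<gamma>)"
        proof -
          have gen: "(\<Sum>j<J. 2 * (x j)\<^sup>2 * a * G + k) = 2 * G * (a * (\<Sum>j<J. (x j)\<^sup>2)) + real J * k"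
            for x :: "nat \<Rightarrow> real" and a G k :: real
            by (simp add: sum.distrib sum_distrib_left mult.assoc mult.left_commute mult.commute)
          show ?thesis unfolding gen by (simp add: power2_eq_square)
        qed
        also have "\<dots> \<le> 2 * (\<Gamma> + \<epsilon> / 2) * ((\<sigma> + 3 * L' * (cl * L) / L ^ 5) / p)
          + 4 * (3 * p) * real l * ((L' / p)\<^sup>2 * e2 n + dd\<^sup>2 * \<gamma>)"
        proof (intro add_mono mult_left_mono mult_right_mono)
          have "real l * (\<Sum>j<J. (ct (t0 + int (j * l)))\<^sup>2) =
              (real l / p * (\<Sum>j<J. (K ((real_of_int (t0 + int (j * l)) / real n - u) / h))\<^sup>2)) / p"
            unfolding ct_def kernel_weight_def p_def[symmetric] by (simp add: power_divide sum_divide_distrib[symmetric] power2_eq_square)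
          also have "\<dots> \<le> (\<sigma> + 3 * L' * (real l / p)) / p"
          proof (rule divide_right_mono)
            have "\<bar>real l / p * (\<Sum>j<J. (K ((real_of_int (t0 + int (j * l)) / real n - u) / h))\<^sup>2) - (\<integral>x. (K x)\<^sup>2 \<partial>lborel)\<bar> \<le> 3 * L' * (real l / p)"
              unfolding p_def J_def t0_def
              by (rule window_Riemann[OF n(1) hpos l1 lp[unfolded p_def] L'K2]) (use supp in auto)
            then show "real l / p * (\<Sum>j<J. (K ((real_of_int (t0 + int (j * l)) / real n - u) / h))\<^sup>2) \<le> \<sigma> + 3 * L' * (real l / p)"
              unfolding \<sigma>_def sigma2_K_def by linarith
          qed (use p1 in simp)
          also have "\<dots> \<le> (\<sigma> + 3 * L' * (cl * L) / L ^ 5) / p"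
          proof -
            have "real l / p \<le> (cl * L) / L ^ 5" using l_up p5 L1 cl by (intro frac_le) auto
            then have "3 * L' * (real l / p) \<le> 3 * L' * ((cl * L) / L ^ 5)" using L'1 by (intro mult_left_mono) auto
            then show ?thesis using p1 by (intro divide_right_mono) auto
          qed
          finally show "real l * (\<Sum>j<J. (ct (t0 + int (j * l)))\<^sup>2) \<le> (\<sigma> + 3 * L' * (cl * L) / L ^ 5) / p" .
          show "real J * real l \<le> 3 * p" using window_covers(3)[OF n(1) hpos l1 lp[unfolded p_def]] by (simp add: J_def p_def)
        qed (use \<Gamma> eps e2_nn \<gamma> in auto)
        also have "\<dots> = (2 * (\<Gamma> + \<epsilon> / 2) * \<sigma> + 2 * ((\<Gamma> + \<epsilon> / 2) * (3 * L' * (cl * L) / L ^ 5)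
           + 6 * (L'\<^sup>2 * real l * e2 n + L'\<^sup>2 * \<gamma> * real l ^ 3 / p\<^sup>2))) / p"
        proof -
          have gen: "2 * G * ((s + q) / p) + 4 * (3 * p) * k * ((a / p)\<^sup>2 * x + (a * k / p\<^sup>2)\<^sup>2 * g)
              = (2 * G * s + 2 * (G * q + 6 * (a\<^sup>2 * k * x + a\<^sup>2 * g * k ^ 3 / p\<^sup>2))) / p" for G s q k a x g :: real
            using p1 by (simp add: field_simps power2_eq_square power3_eq_cube)
          show ?thesis unfolding dd_def by (rule gen)
        qed
        also have "\<dots> \<le> (2 * (\<Gamma> + \<epsilon> / 2) * \<sigma> + 2 * f1 n) / p"
        proof -
          have a: "L'\<^sup>2 * real l * e2 n \<le> L'\<^sup>2 * (cl * L) * e2 n" using l_up e2_nn by (intro mult_left_mono mult_right_mono) auto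
          have d: "L'\<^sup>2 * \<gamma> * real l ^ 3 / p\<^sup>2 \<le> L'\<^sup>2 * \<gamma> * (cl * L) ^ 3 / (L ^ 5)\<^sup>2"
            using l_up p5 L1 \<gamma> cl by (intro frac_le mult_left_mono power_mono) auto
          have q: "(\<Gamma> + \<epsilon> / 2) * (3 * L' * (cl * L) / L ^ 5) = (\<Gamma> + \<epsilon> / 2) * 3 * L' * (cl * L) / L ^ 5" by simp
          have "(\<Gamma> + \<epsilon> / 2) * (3 * L' * (cl * L) / L ^ 5)
           + 6 * (L'\<^sup>2 * real l * e2 n + L'\<^sup>2 * \<gamma> * real l ^ 3 / p\<^sup>2) \<le> f1 n"
          proof -
            have gen: "s + 6 * (x + y) \<le> s + 6 * (x' + y')" if "x \<le> x'" "y \<le> y'" for s x y x' y' :: real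
              using add_mono[OF that] by (intro add_left_mono mult_left_mono) auto
            show ?thesis unfolding f1_def L_def[symmetric] q by (rule gen[OF a d])
          qed
          then show ?thesis using p1 by (intro divide_right_mono) auto
        qed
        also have "\<dots> \<le> (2 * (\<Gamma> + \<epsilon> / 2) * \<sigma> + 2 * (\<sigma> * \<epsilon> / 2)) / p"
          using elim(2) p1 by (intro divide_right_mono) auto
        also have "\<dots> = 2 * s2" unfolding s2_def by (simp add: algebra_simps)
        finally show ?thesis .
      qed
      define y where "y = 4 * sqrt (s2 * L)"
      have y0: "0 \<le> y" unfolding y_def using s2 L1 by simp
      have cond: "real l * (L' / p) * (2 * b) * y \<le> 2 * (2 * s2)"
      proof -
        define a where "a = 2 * real l * L' * b / p"
        have a0: "0 \<le> a" unfolding a_def using L'1 b0 p1 by simp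
        have b2: "b\<^sup>2 = cB\<^sup>2 * L powr (2 * (\<alpha> * real M))"
        proof -
          have "2 * (\<alpha> * real M) = \<alpha> * real M + \<alpha> * real M" by simp
          then show ?thesis unfolding b_def power_mult_distrib by (simp only: powr_add power2_eq_square)
        qed
        have "4 * (real l)\<^sup>2 * L'\<^sup>2 * b\<^sup>2 * L \<le> 4 * (cl * L)\<^sup>2 * L'\<^sup>2 * b\<^sup>2 * L"
          using l_up L1 by (intro mult_right_mono mult_left_mono power_mono) auto
        also have "\<dots> = f2 n * (L ^ 5 * L powr (2 * (\<alpha> * real M)))"
        proof -
          have "L ^ 5 \<noteq> 0" using L1 by simp
          then have "N / L ^ 5 * (L ^ 5 * x) = N * x" for N x :: real by (simp only: times_divide_eq_left times_divide_eq_right mult_ac nonzero_mult_div_cancel_left) (simp add: field_simps)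
          then show ?thesis unfolding f2_def L_def[symmetric] b2 by (simp add: mult.assoc mult.left_commute mult.commute)
        qed
        also have "\<dots> \<le> (\<sigma> * \<epsilon>) * p"
          using elim(3) p_ge \<sigma> eps L1 by (intro mult_mono) auto
        finally have "4 * (real l)\<^sup>2 * L'\<^sup>2 * b\<^sup>2 * L / p\<^sup>2 \<le> (\<sigma> * \<epsilon>) * p / p\<^sup>2"
          using p1 by (intro divide_right_mono) auto
        also have "\<dots> = \<sigma> * \<epsilon> / p" using p1 by (simp add: power2_eq_square)
        also have "4 * (real l)\<^sup>2 * L'\<^sup>2 * b\<^sup>2 * L / p\<^sup>2 = a\<^sup>2 * L" unfolding a_def by (simp add: power_divide power_mult_distrib)
        finally have "a\<^sup>2 * L \<le> s2" using s2_lo by linarith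
        then have "a\<^sup>2 * L * s2 \<le> s2 * s2" using s2 by (intro mult_right_mono) auto
        then have "sqrt (a\<^sup>2 * (s2 * L)) \<le> sqrt (s2 * s2)" by (intro real_sqrt_le_mono) (simp add: mult.commute mult.left_commute)
        then have "a * sqrt (s2 * L) \<le> s2" using a0 s2 by (simp add: real_sqrt_mult)
        moreover have "real l * (L' / p) * (2 * b) * y = 4 * (a * sqrt (s2 * L))" unfolding y_def a_def by simp
        ultimately show ?thesis by linarith
      qed
      define S where "S = (\<lambda>\<omega>. \<Sum>t\<in>{t0 ..< t0 + int (J * l)}. ct t * (\<phi> t (past \<zeta> t \<omega>) - (\<integral>z. \<phi> t z \<partial>Q)))"
      have tail: "prob {\<omega> \<in> space P. 2 * y \<le> \<bar>S \<omega>\<bar>} \<le> 4 / (real n)\<^sup>2"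
      proof -
        have "prob {\<omega> \<in> space P. 2 * y \<le> \<bar>S \<omega>\<bar>} \<le> 4 * exp (- y\<^sup>2 / (4 * (2 * s2)))"
          unfolding S_def
          by (rule block_sum_tail[OF \<phi>m \<phi>d \<phi>b ct_bd _ V[unfolded B_def] y0 cond]) (use s2 in auto)
        also have "exp (- y\<^sup>2 / (4 * (2 * s2))) = 1 / (real n)\<^sup>2"
        proof -
          have "y\<^sup>2 = 16 * (s2 * L)" unfolding y_def power_mult_distrib using s2 L1 by simp
          then have "- y\<^sup>2 / (4 * (2 * s2)) = - (2 * L)" using s2 by (simp add: field_simps)
          moreover have "exp (2 * L) = (real n)\<^sup>2" using n by (simp add: exp_double L_def)
          ultimately show ?thesis by (simp add: exp_minus inverse_eq_divide)
        qed
        finally show ?thesis by simp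
      qed
      define T where "T = (\<lambda>\<omega>. \<Sum>t\<in>{t0 ..< t0 + int (J * l)}. ct t * (\<Psi> (v t) (past \<zeta> t \<omega>) - mean_\<Psi> (v t)))"
      have T_eq: "(\<Sum>t=1..n. kernel_weight K n h u (int t) * (\<Psi> (real t / real n) (past \<zeta> (int t) \<omega>) - mean_\<Psi> (real t / real n))) = T \<omega>" for \<omega>
        using sum_window[where a = "\<lambda>t. \<Psi> (v t) (past \<zeta> t \<omega>) - mean_\<Psi> (v t)", OF n(1) hpos supp h1 l1 lp[unfolded p_def]]
        unfolding T_def ct_def t0_def J_def v_def by simp
      have sum_ct: "(\<Sum>t\<in>{t0 ..< t0 + int (J * l)}. ct t) \<le> 2"
      proof -
        have "(\<Sum>t\<in>{t0 ..< t0 + int (J * l)}. ct t) = (\<Sum>t=1..n. kernel_weight K n h u (int t))"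
          using sum_window[where a = "\<lambda>_. 1", OF n(1) hpos supp h1 l1 lp[unfolded p_def]] unfolding ct_def t0_def J_def by simp
        also have "\<dots> \<le> 1 + 3 * L' / p"
          using kernel_Riemann[OF n(1) hpos p1(1)[unfolded p_def] h1 L'K supp] Kint unfolding p_def by linarith
        also have "3 * L' / p \<le> 1" using L1 L5 p5 p1 by (simp add: divide_le_eq)
        finally show ?thesis by simp
      qed
      define r where "r = (\<lambda>t z. (\<Psi> (v t) z - \<phi> t z) - (\<integral>z. \<Psi> (v t) z - \<phi> t z \<partial>Q))"
      define R where "R = (\<lambda>\<omega>. \<Sum>t\<in>{t0 ..< t0 + int (J * l)}. ct t * \<bar>r t (past \<zeta> t \<omega>)\<bar>)"
      have ir: "integrable Q (r t)" "(\<integral>z. \<bar>r t z\<bar> \<partial>Q) \<le> 2 * (c * e)" if "ct t \<noteq> 0" for t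
      proof -
        show i: "integrable Q (r t)" unfolding r_def using L4\<phi>(1)[OF that] by simp
        have "(\<integral>z. \<bar>r t z\<bar> \<partial>Q) \<le> (\<integral>z. \<bar>\<Psi> (v t) z - \<phi> t z\<bar> + \<bar>\<integral>z. \<Psi> (v t) z - \<phi> t z \<partial>Q\<bar> \<partial>Q)"
          using i L4\<phi>(1)[OF that] by (intro integral_mono) (auto simp: r_def)
        also have "\<dots> = (\<integral>z. \<bar>\<Psi> (v t) z - \<phi> t z\<bar> \<partial>Q) + \<bar>\<integral>z. \<Psi> (v t) z - \<phi> t z \<partial>Q\<bar>"
          using L4\<phi>(1)[OF that] by (simp add: Q.prob_space)
        also have "\<bar>\<integral>z. \<Psi> (v t) z - \<phi> t z \<partial>Q\<bar> \<le> (\<integral>z. \<bar>\<Psi> (v t) z - \<phi> t z\<bar> \<partial>Q)" by (rule integral_abs_bound)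
        finally show "(\<integral>z. \<bar>r t z\<bar> \<partial>Q) \<le> 2 * (c * e)" using L4\<phi>(4)[OF that] by linarith
      qed
      have irP: "integrable P (\<lambda>\<omega>. ct t * \<bar>r t (past \<zeta> t \<omega>)\<bar>)" for t
        using integrable_past[OF ir(1)] by (cases "ct t = 0") auto
      have ER: "(\<integral>\<omega>. R \<omega> \<partial>P) \<le> 4 * (c * e)"
      proof -
        have "(\<integral>\<omega>. R \<omega> \<partial>P) = (\<Sum>t\<in>{t0 ..< t0 + int (J * l)}. (\<integral>\<omega>. ct t * \<bar>r t (past \<zeta> t \<omega>)\<bar> \<partial>P))"
          unfolding R_def by (rule Bochner_Integration.integral_sum[OF irP])
        also have "\<dots> \<le> (\<Sum>t\<in>{t0 ..< t0 + int (J * l)}. ct t * (2 * (c * e)))"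
        proof (rule sum_mono)
          fix t
          show "(\<integral>\<omega>. ct t * \<bar>r t (past \<zeta> t \<omega>)\<bar> \<partial>P) \<le> ct t * (2 * (c * e))"
          proof (cases "ct t = 0")
            case False
            have "(\<integral>\<omega>. \<bar>r t (past \<zeta> t \<omega>)\<bar> \<partial>P) = (\<integral>z. \<bar>r t z\<bar> \<partial>Q)"
              using ir(1)[OF False] by (intro integral_past) auto
            then show ?thesis using ir(2)[OF False] ct_nn[of t] by (simp add: mult_left_mono)
          qed simp
        qed
        also have "\<dots> = (\<Sum>t\<in>{t0 ..< t0 + int (J * l)}. ct t) * (2 * (c * e))" by (simp add: sum_distrib_right)
        also have "\<dots> \<le> 2 * (2 * (c * e))" using sum_ct c e by (intro mult_right_mono) auto
        finally show ?thesis by simp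
      qed
      define z where "z = 1 / 2 * sqrt (s2 * L)"
      have z: "0 < z" unfolding z_def using s2 L1 by simp
      have iR: "integrable P R" unfolding R_def by (intro Bochner_Integration.integrable_sum irP)
      have R0: "0 \<le> R \<omega>" for \<omega> unfolding R_def using ct_nn by (intro sum_nonneg mult_nonneg_nonneg) auto
      have Rtail: "prob {\<omega> \<in> space P. z \<le> R \<omega>} \<le> 1 / (real n)\<^sup>2"
      proof -
        have "prob {\<omega> \<in> space P. z \<le> R \<omega>} \<le> (\<integral>\<omega>. R \<omega> \<partial>P) / z"
          by (rule integral_Markov_inequality_measure[where A = "{}"]) (use iR R0 z in auto)
        also have "\<dots> \<le> 4 * (c * e) / z" using ER z by (intro divide_right_mono) auto
        also have "\<dots> \<le> 4 * (c * e) / (sqrt (\<sigma> * \<epsilon>) / (2 * real n))"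
        proof (rule divide_left_mono)
          have "\<sigma> * \<epsilon> / (real n)\<^sup>2 \<le> \<sigma> * \<epsilon> / p"
          proof (rule divide_left_mono)
            have "p \<le> real n * 1" using pn by simp
            also have "\<dots> \<le> (real n)\<^sup>2" using n1 unfolding power2_eq_square by (intro mult_left_mono) auto
            finally show "p \<le> (real n)\<^sup>2" .
          qed (use \<sigma> eps p1 n in auto)
          also have "\<dots> \<le> s2" by (rule s2_lo)
          also have "\<dots> \<le> s2 * L" using s2 L1 by simp
          finally have "sqrt (\<sigma> * \<epsilon> / (real n)\<^sup>2) \<le> sqrt (s2 * L)" by (rule real_sqrt_le_mono)
          then show "sqrt (\<sigma> * \<epsilon>) / (2 * real n) \<le> z" unfolding z_def using n by (simp add: real_sqrt_divide field_simps)
          show "0 \<le> 4 * (c * e)" using c e by simp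
          show "0 < z * (sqrt (\<sigma> * \<epsilon>) / (2 * real n))" using z \<sigma> eps n by simp
        qed
        also have "\<dots> = (8 * c / sqrt (\<sigma> * \<epsilon>)) * (1 / real n ^ 3)"
          unfolding e_def using n by (simp add: field_simps power3_eq_cube power4_eq_xxxx)
        also have "\<dots> \<le> real n * (1 / real n ^ 3)"
          using elim(4) n by (intro mult_right_mono) auto
        also have "\<dots> = 1 / (real n)\<^sup>2" using n by (simp add: field_simps power3_eq_cube power2_eq_square)
        finally show ?thesis .
      qed
      have TS: "\<bar>T \<omega>\<bar> \<le> \<bar>S \<omega>\<bar> + R \<omega>" for \<omega>
      proof -
        have "T \<omega> - S \<omega> = (\<Sum>t\<in>{t0 ..< t0 + int (J * l)}. ct t * r t (past \<zeta> t \<omega>))"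
          unfolding T_def S_def sum_subtractf[symmetric]
        proof (rule sum.cong[OF refl])
          fix t
          show "ct t * (\<Psi> (v t) (past \<zeta> t \<omega>) - mean_\<Psi> (v t)) - ct t * (\<phi> t (past \<zeta> t \<omega>) - (\<integral>z. \<phi> t z \<partial>Q)) = ct t * r t (past \<zeta> t \<omega>)"
          proof (cases "ct t = 0")
            case False
            have vt: "v t \<in> {0..1}" unfolding v_def using ct_nz[OF False] by simp
            have "integrable Q (\<phi> t)" using \<phi>b by (intro Q.integrable_const_bound[where B=b]) auto
            then have eq: "(\<integral>z. \<Psi> (v t) z - \<phi> t z \<partial>Q) = mean_\<Psi> (v t) - (\<integral>z. \<phi> t z \<partial>Q)"
              unfolding mean_\<Psi>_def using \<Psi>_integrable(1)[OF vt] by simp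
            show ?thesis unfolding r_def eq by (simp add: algebra_simps)
          qed simp
        qed
        also have "\<bar>\<dots>\<bar> \<le> R \<omega>" unfolding R_def by (rule order.trans[OF sum_abs]) (use ct_nn in \<open>simp add: abs_mult\<close>)
        finally show ?thesis by linarith
      qed
      have thr: "17 / 2 * sqrt (sigma2_K K * (lr_var u + \<epsilon>) / (real n * h) * ln (real n)) = 2 * y + z"
        unfolding y_def z_def s2_def \<sigma>_def \<Gamma>_def p_def L_def by simp
      have mS[measurable]: "S \<in> borel_measurable P" unfolding S_def by measurable
      have mR[measurable]: "R \<in> borel_measurable P" using iR by simp
      have "prob {\<omega> \<in> space P. 2 * y + z \<le> \<bar>T \<omega>\<bar>} \<le> prob ({\<omega> \<in> space P. 2 * y \<le> \<bar>S \<omega>\<bar>} \<union> {\<omega> \<in> space P. z \<le> R \<omega>})"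
      proof (rule finite_measure_mono)
        show "{\<omega> \<in> space P. 2 * y + z \<le> \<bar>T \<omega>\<bar>} \<subseteq> {\<omega> \<in> space P. 2 * y \<le> \<bar>S \<omega>\<bar>} \<union> {\<omega> \<in> space P. z \<le> R \<omega>}"
        proof
          fix \<omega> assume a: "\<omega> \<in> {\<omega> \<in> space P. 2 * y + z \<le> \<bar>T \<omega>\<bar>}"
          show "\<omega> \<in> {\<omega> \<in> space P. 2 * y \<le> \<bar>S \<omega>\<bar>} \<union> {\<omega> \<in> space P. z \<le> R \<omega>}"
          proof (cases "z \<le> R \<omega>")
            case False
            then have "2 * y \<le> \<bar>S \<omega>\<bar>" using TS[of \<omega>] a by simp
            then show ?thesis using a by simp
          qed (use a in simp)
        qed
      qed measurable
      also have "\<dots> \<le> prob {\<omega> \<in> space P. 2 * y \<le> \<bar>S \<omega>\<bar>} + prob {\<omega> \<in> space P. z \<le> R \<omega>}"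
        by (rule measure_Un_le) measurable
      also have "\<dots> \<le> 4 / (real n)\<^sup>2 + 1 / (real n)\<^sup>2" using tail Rtail by linarith
      finally show "prob {\<omega> \<in> space P. 17 / 2 * sqrt (sigma2_K K * (lr_var u + \<epsilon>) / (real n * h) * ln (real n)) \<le>
         \<bar>\<Sum>t=1..n. kernel_weight K n h u (int t) * (\<Psi> (real t / real n) (past \<zeta> (int t) \<omega>) - mean_\<Psi> (real t / real n))\<bar>} \<le> 5 / (real n)\<^sup>2"
        unfolding thr T_eq by simp
    qed
  qed
qed

end

section \<open>Deviation of the kernel estimator\<close>

lemma power_mean_sum:
  fixes w d :: "'a \<Rightarrow> real"
  assumes w: "\<And>t. t \<in> A \<Longrightarrow> 0 \<le> w t" and d: "\<And>t. t \<in> A \<Longrightarrow> 0 \<le> d t" and fin: "finite A"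
  shows "(\<Sum>t\<in>A. w t * d t) ^ Suc r \<le> (\<Sum>t\<in>A. w t) ^ r * (\<Sum>t\<in>A. w t * d t ^ Suc r)"
proof (cases "(\<Sum>t\<in>A. w t) = 0")
  case True
  then have "\<forall>t\<in>A. w t = 0" using w fin by (subst (asm) sum_nonneg_eq_0_iff) auto
  then show ?thesis by simp
next
  case False
  define W where "W = (\<Sum>t\<in>A. w t)"
  have W: "0 < W" using False w unfolding W_def by (simp add: sum_nonneg order_less_le)
  define z where "z = (\<Sum>t\<in>A. w t * d t) / W"
  have z: "0 \<le> z" unfolding z_def using W w d by (intro divide_nonneg_nonneg sum_nonneg) auto
  have zW: "z * W = (\<Sum>t\<in>A. w t * d t)" using W by (simp add: z_def)
  have "(\<Sum>t\<in>A. w t * (z ^ Suc r + real (Suc r) * z ^ r * (d t - z))) \<le> (\<Sum>t\<in>A. w t * d t ^ Suc r)"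
    by (intro sum_mono mult_left_mono power_ge_tangent w d z)
  also have "(\<Sum>t\<in>A. w t * (z ^ Suc r + real (Suc r) * z ^ r * (d t - z))) =
     (z ^ Suc r - real (Suc r) * z ^ r * z) * (\<Sum>t\<in>A. w t) + real (Suc r) * z ^ r * (\<Sum>t\<in>A. w t * d t)"
    by (simp only: sum_distrib_left sum.distrib[symmetric]) (intro sum.cong refl, simp add: algebra_simps)
  also have "\<dots> = z ^ Suc r * W" unfolding zW[symmetric] W_def[symmetric] by (simp add: algebra_simps)
  finally have *: "z ^ Suc r * W \<le> (\<Sum>t\<in>A. w t * d t ^ Suc r)" .
  have "(\<Sum>t\<in>A. w t * d t) ^ Suc r = W ^ r * (z ^ Suc r * W)"
    unfolding zW[symmetric] by (simp add: power_mult_distrib)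
  also have "\<dots> \<le> W ^ r * (\<Sum>t\<in>A. w t * d t ^ Suc r)" using * W by (intro mult_left_mono) auto
  finally show ?thesis unfolding W_def .
qed

context ls_model
begin

text \<open>
  One coordinate of \<open>G_hat\<close>, the factors \<open>1/n\<close> and \<open>1/h\<close> being part of the weights.
\<close>
definition "kernel_estimator K n h u \<omega> = inverse (\<Sum>t=1..n. kernel_weight K n h u (int t)) * (\<Sum>t=1..n. kernel_weight K n h u (int t) * g (Y_obs X t n \<omega>))"

lemma nn_integral_weighted_sum4:
  fixes w :: "nat \<Rightarrow> real" and d :: "nat \<Rightarrow> 'w \<Rightarrow> real"
  assumes w: "\<And>t. 0 \<le> w t" and d: "\<And>t. t \<in> {1..n} \<Longrightarrow> w t \<noteq> 0 \<Longrightarrow> d t \<in> borel_measurable P"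
    and m: "\<And>t. t \<in> {1..n} \<Longrightarrow> w t \<noteq> 0 \<Longrightarrow> (\<integral>\<^sup>+ \<omega>. ennreal (\<bar>d t \<omega>\<bar> ^ 4) \<partial>P) \<le> ennreal K" and K: "0 \<le> K"
  shows "(\<integral>\<^sup>+ \<omega>. ennreal ((\<Sum>t=1..n. w t * \<bar>d t \<omega>\<bar>) ^ 4) \<partial>P) \<le> ennreal ((\<Sum>t=1..n. w t) ^ 4 * K)"
proof -
  define W where "W = (\<Sum>t=1..n. w t)"
  have W: "0 \<le> W" unfolding W_def by (intro sum_nonneg w)
  have "(\<integral>\<^sup>+ \<omega>. ennreal ((\<Sum>t=1..n. w t * \<bar>d t \<omega>\<bar>) ^ 4) \<partial>P) \<le> (\<integral>\<^sup>+ \<omega>. (\<Sum>t=1..n. ennreal (W ^ 3 * w t) * ennreal (\<bar>d t \<omega>\<bar> ^ 4)) \<partial>P)"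
  proof (intro nn_integral_mono)
    fix \<omega>
    have "(\<Sum>t=1..n. w t * \<bar>d t \<omega>\<bar>) ^ Suc 3 \<le> (\<Sum>t=1..n. w t) ^ 3 * (\<Sum>t=1..n. w t * \<bar>d t \<omega>\<bar> ^ Suc 3)"
      using w by (intro power_mean_sum) auto
    then have "(\<Sum>t=1..n. w t * \<bar>d t \<omega>\<bar>) ^ 4 \<le> (\<Sum>t=1..n. (W ^ 3 * w t) * \<bar>d t \<omega>\<bar> ^ 4)"
      by (simp add: W_def sum_distrib_left mult.assoc eval_nat_numeral)
    then have "ennreal ((\<Sum>t=1..n. w t * \<bar>d t \<omega>\<bar>) ^ 4) \<le> ennreal (\<Sum>t=1..n. (W ^ 3 * w t) * \<bar>d t \<omega>\<bar> ^ 4)" by (rule ennreal_leI)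
    also have "\<dots> = (\<Sum>t=1..n. ennreal ((W ^ 3 * w t) * \<bar>d t \<omega>\<bar> ^ 4))"
      using W w by (intro sum_ennreal[symmetric]) auto
    also have "\<dots> = (\<Sum>t=1..n. ennreal (W ^ 3 * w t) * ennreal (\<bar>d t \<omega>\<bar> ^ 4))"
      using W w by (intro sum.cong refl ennreal_mult) auto
    finally show "ennreal ((\<Sum>t=1..n. w t * \<bar>d t \<omega>\<bar>) ^ 4) \<le> (\<Sum>t=1..n. ennreal (W ^ 3 * w t) * ennreal (\<bar>d t \<omega>\<bar> ^ 4))" .
  qed
  also have "\<dots> = (\<Sum>t=1..n. (\<integral>\<^sup>+ \<omega>. ennreal (W ^ 3 * w t) * ennreal (\<bar>d t \<omega>\<bar> ^ 4) \<partial>P))"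
  proof (rule nn_integral_sum)
    fix t assume t: "t \<in> {1..n}"
    show "(\<lambda>\<omega>. ennreal (W ^ 3 * w t) * ennreal (\<bar>d t \<omega>\<bar> ^ 4)) \<in> borel_measurable P"
      using d[OF t] by (cases "w t = 0") (simp, measurable)
  qed
  also have "\<dots> \<le> (\<Sum>t=1..n. ennreal (W ^ 3 * w t) * ennreal K)"
  proof (rule sum_mono)
    fix t assume t: "t \<in> {1..n}"
    show "(\<integral>\<^sup>+ \<omega>. ennreal (W ^ 3 * w t) * ennreal (\<bar>d t \<omega>\<bar> ^ 4) \<partial>P) \<le> ennreal (W ^ 3 * w t) * ennreal K"
    proof (cases "w t = 0")
      case False
      note [measurable] = d[OF t False]
      have "(\<integral>\<^sup>+ \<omega>. ennreal (W ^ 3 * w t) * ennreal (\<bar>d t \<omega>\<bar> ^ 4) \<partial>P) = ennreal (W ^ 3 * w t) * (\<integral>\<^sup>+ \<omega>. ennreal (\<bar>d t \<omega>\<bar> ^ 4) \<partial>P)"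
        by (rule nn_integral_cmult) measurable
      also have "\<dots> \<le> ennreal (W ^ 3 * w t) * ennreal K" by (intro mult_left_mono m t False) auto
      finally show ?thesis .
    qed simp
  qed
  also have "\<dots> = (\<Sum>t=1..n. ennreal (W ^ 3 * w t * K))" using W w K by (intro sum.cong refl ennreal_mult[symmetric]) auto
  also have "\<dots> = ennreal (\<Sum>t=1..n. W ^ 3 * w t * K)" using W w K by (intro sum_ennreal) auto
  also have "(\<Sum>t=1..n. W ^ 3 * w t * K) = W ^ 4 * K"
    unfolding sum_distrib_left[symmetric] sum_distrib_right[symmetric] W_def by (simp add: eval_nat_numeral mult_ac)
  finally show ?thesis unfolding W_def .
qed

lemma kernel_estimator_measurable: "1 \<le> n \<Longrightarrow> kernel_estimator K n h u \<in> borel_measurable P"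
  unfolding kernel_estimator_def
  by (intro borel_measurable_times borel_measurable_sum borel_measurable_const g_Y_obs_measurable) auto

text \<open>
  The estimator is a convex combination of the \<open>g (Y_obs X t n)\<close>, or 0 when all weights vanish.
\<close>
lemma kernel_estimator_moment4:
  "\<exists>C0\<ge>0. \<forall>K\<in>kernel_class. \<forall>n\<ge>1. \<forall>h>0. \<forall>u. (\<integral>\<^sup>+ \<omega>. ennreal (\<bar>kernel_estimator K n h u \<omega>\<bar> ^ 4) \<partial>P) \<le> ennreal C0"
proof -
  obtain C0 where C0: "0 \<le> C0" and m: "\<And>n t. 1 \<le> n \<Longrightarrow> t \<le> n \<Longrightarrow> (\<integral>\<^sup>+ \<omega>. ennreal (\<bar>g (Y_obs X t n \<omega>)\<bar> ^ 4) \<partial>P) \<le> ennreal C0"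
    using g_Y_obs_moment4 by blast
  have "(\<integral>\<^sup>+ \<omega>. ennreal (\<bar>kernel_estimator K n h u \<omega>\<bar> ^ 4) \<partial>P) \<le> ennreal C0" if K: "K \<in> kernel_class" and n: "1 \<le> n" and h: "0 < h" for K n h u
  proof -
    define w where "w = (\<lambda>t. kernel_weight K n h u (int t))"
    have w0: "0 \<le> w t" for t using K n h by (auto simp: w_def kernel_weight_def kernel_class_def)
    define W where "W = (\<Sum>t=1..n. w t)"
    have W0: "0 \<le> W" unfolding W_def by (intro sum_nonneg w0)
    define q where "q = (\<lambda>t. inverse W * w t)"
    have q0: "0 \<le> q t" for t unfolding q_def using w0 W0 by simp
    have "\<bar>kernel_estimator K n h u \<omega>\<bar> \<le> (\<Sum>t=1..n. q t * \<bar>g (Y_obs X t n \<omega>)\<bar>)" for \<omega>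
    proof -
      have "kernel_estimator K n h u \<omega> = (\<Sum>t=1..n. q t * g (Y_obs X t n \<omega>))"
        unfolding kernel_estimator_def q_def W_def w_def by (simp add: sum_distrib_left mult.assoc)
      also have "\<bar>\<dots>\<bar> \<le> (\<Sum>t=1..n. \<bar>q t * g (Y_obs X t n \<omega>)\<bar>)" by (rule sum_abs)
      finally show ?thesis using q0 by (simp add: abs_mult)
    qed
    then have "(\<integral>\<^sup>+ \<omega>. ennreal (\<bar>kernel_estimator K n h u \<omega>\<bar> ^ 4) \<partial>P) \<le> (\<integral>\<^sup>+ \<omega>. ennreal ((\<Sum>t=1..n. q t * \<bar>g (Y_obs X t n \<omega>)\<bar>) ^ 4) \<partial>P)"
      by (intro nn_integral_mono ennreal_leI power_mono) auto
    also have "\<dots> \<le> ennreal ((\<Sum>t=1..n. q t) ^ 4 * C0)"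
      by (rule nn_integral_weighted_sum4) (use q0 C0 m n g_Y_obs_measurable in auto)
    also have "\<dots> \<le> ennreal (1 * C0)"
    proof (intro ennreal_leI mult_right_mono C0 power_le_one)
      have "(\<Sum>t=1..n. q t) = inverse W * W" unfolding q_def W_def by (simp add: sum_distrib_left)
      then show "(\<Sum>t=1..n. q t) \<le> 1" by (cases "W = 0") auto
    qed (intro sum_nonneg q0)
    finally show ?thesis by simp
  qed
  then show ?thesis using C0 by blast
qed

text \<open>
  The sum over observations differs from the stationary one by an average of errors of size \<open>1/n\<close> in
  \<open>L\<^sup>4\<close>. The fluctuation is at least of order \<open>n\<^bsup>-1/2\<^esup>\<close>, so that half of it absorbs the difference outside
  an event of probability \<open>O(n\<^sup>-\<^sup>2)\<close>, by Markov's inequality of order 4.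
\<close>
lemma kernel_obs_deviation:
  assumes u: "0 < u" "u < 1" and K: "K \<in> kernel_class" and eps: "0 < \<epsilon>"
    and h0: "(\<lambda>n. ln (real n) * (h0 n)\<^sup>2) \<longlonglongrightarrow> 0" "h0 \<longlonglongrightarrow> 0"
  shows "\<exists>C\<ge>0. \<forall>\<^sub>F n in sequentially. \<forall>h. ln (real n) powr (5 + 2 * \<alpha> * real M) / real n \<le> h \<longrightarrow> h \<le> h0 n \<longrightarrow>
    prob {\<omega> \<in> space P. 9 * sqrt (sigma2_K K * (lr_var u + \<epsilon>) / (real n * h) * ln (real n)) \<le>
      \<bar>\<Sum>t=1..n. kernel_weight K n h u (int t) * (g (Y_obs X t n \<omega>) - mean_\<Psi> (real t / real n))\<bar>} \<le> C / (real n)\<^sup>2"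
proof -
  obtain L' where lipK: "L'-lipschitz_on UNIV K" and L'1: "1 \<le> L'" using kernel_products_lipschitz[OF K] by metis
  obtain supp: "\<And>x. K x \<noteq> 0 \<Longrightarrow> \<bar>x\<bar> \<le> 1 / 2" and Kpos: "\<And>x. 0 \<le> K x" and Kint: "(\<integral>x. K x \<partial>lborel) = 1"
    using kernel_class_facts[OF K] by metis
  define \<sigma> where "\<sigma> = sigma2_K K"
  have \<sigma>: "0 < \<sigma>" unfolding \<sigma>_def by (rule sigma2_K_pos[OF K])
  have \<Gamma>: "0 \<le> lr_var u" using u by (intro lr_var_nonneg) auto
  obtain Kc where Kc: "0 \<le> Kc" and close: "\<And>n t. 1 \<le> n \<Longrightarrow> t \<in> {1..n} \<Longrightarrow> real n * u / 2 \<le> real t \<Longrightarrow>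
    (\<integral>\<^sup>+ \<omega>. ennreal (\<bar>g (Y_obs X t n \<omega>) - \<Psi> (real t / real n) (past \<zeta> (int t) \<omega>)\<bar> ^ 4) \<partial>P) \<le> ennreal (Kc * (1 / real n) ^ 4)"
    using g_Y_obs_close[OF u(1)] by blast
  define C where "C = 5 + 256 * Kc / (\<sigma> * \<epsilon>)\<^sup>2"
  have C: "0 \<le> C" unfolding C_def using Kc by simp
  have lninf: "filterlim (\<lambda>n. ln (real n)) at_top sequentially"
    by (rule filterlim_compose[OF ln_at_top filterlim_real_sequentially])
  have ev1: "\<forall>\<^sub>F n in sequentially. 1 + 3 * L' \<le> ln (real n)" using lninf by (simp add: filterlim_at_top)
  have ev2: "\<forall>\<^sub>F n in sequentially. h0 n < min u (1 - u)" using h0(2) u by (intro order_tendstoD(2)) auto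
  have "\<forall>\<^sub>F n in sequentially. \<forall>h. ln (real n) powr (5 + 2 * \<alpha> * real M) / real n \<le> h \<longrightarrow> h \<le> h0 n \<longrightarrow>
    prob {\<omega> \<in> space P. 9 * sqrt (\<sigma> * (lr_var u + \<epsilon>) / (real n * h) * ln (real n)) \<le>
      \<bar>\<Sum>t=1..n. kernel_weight K n h u (int t) * (g (Y_obs X t n \<omega>) - mean_\<Psi> (real t / real n))\<bar>} \<le> C / (real n)\<^sup>2"
    using kernel_sum_deviation[OF u K eps h0, folded \<sigma>_def] ev1 ev2 eventually_gt_at_top[of 0]
  proof eventually_elim
    case (elim n)
    show ?case
    proof (intro allI impI)
      fix h assume hl: "ln (real n) powr (5 + 2 * \<alpha> * real M) / real n \<le> h" and hh: "h \<le> h0 n"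
      define L where "L = ln (real n)"
      define p where "p = real n * h"
      have n: "1 \<le> n" "0 < real n" using elim by auto
      have L: "1 \<le> L" "3 * L' \<le> L" using elim(2) L'1 by (simp_all add: L_def)
      have "L powr 1 \<le> L powr (5 + 2 * \<alpha> * real M)" using L alpha by (intro powr_mono) auto
      also have "\<dots> \<le> h * real n" using hl n(2) by (simp only: L_def pos_divide_le_eq)
      finally have pL: "L \<le> p" using L by (simp add: p_def mult.commute)
      have p1: "1 \<le> p" "0 < p" using pL L by auto
      have hpos: "0 < h" using p1 n unfolding p_def by (simp add: zero_less_mult_iff)
      have hs: "h < u" "h < 1 - u" using hh elim(3) by auto
      have h1: "h / 2 < u" "u + h / 2 \<le> 1" using hs hpos by auto
      have pn: "p \<le> real n" using hs u n unfolding p_def by (simp add: mult_left_le)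
      define w where "w = (\<lambda>t. kernel_weight K n h u (int t))"
      have w0: "0 \<le> w t" for t unfolding w_def kernel_weight_def using Kpos n hpos by simp
      have range: "real n * u / 2 \<le> real t" "real t / real n \<in> {0..1}" if "w t \<noteq> 0" for t
      proof -
        have "\<bar>real_of_int (int t) / real n - u\<bar> \<le> h / 2"
          using that unfolding w_def by (intro kernel_weight_nonzero_range[OF n(1) hpos supp])
        then have "u / 2 \<le> real t / real n" "real t / real n \<le> 1" "0 \<le> real t / real n" using hs h1 by (simp_all, linarith+)
        then show "real n * u / 2 \<le> real t" "real t / real n \<in> {0..1}" using n by (auto simp: pos_le_divide_eq mult.commute)
      qed
      have W2: "(\<Sum>t=1..n. w t) \<le> 2"
      proof -
        have "\<bar>(\<Sum>t=1..n. w t) - (\<integral>x. K x \<partial>lborel)\<bar> \<le> 3 * L' / p"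
          unfolding w_def p_def by (rule kernel_Riemann[OF n(1) hpos p1(1)[unfolded p_def] h1 lipK supp])
        moreover have "3 * L' / p \<le> 1" using L pL p1 by (simp add: pos_divide_le_eq)
        ultimately show ?thesis using Kint by linarith
      qed
      have Wn: "0 \<le> (\<Sum>t=1..n. w t)" by (intro sum_nonneg w0)
      define s2 where "s2 = \<sigma> * (lr_var u + \<epsilon>) / p"
      have s2: "0 < s2" unfolding s2_def using \<sigma> \<Gamma> eps p1 by simp
      define z where "z = 1 / 2 * sqrt (s2 * L)"
      have z: "0 < z" unfolding z_def using s2 L by simp
      define d where "d = (\<lambda>t \<omega>. g (Y_obs X t n \<omega>) - \<Psi> (real t / real n) (past \<zeta> (int t) \<omega>))"
      have dm: "d t \<in> borel_measurable P" if "t \<in> {1..n}" for t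
      proof -
        have "real t / real n \<in> {0..1}" using that n by auto
        then have "(\<lambda>\<omega>. \<Psi> (real t / real n) (past \<zeta> (int t) \<omega>)) \<in> borel_measurable P"
          by (intro measurable_compose[OF past_measurable \<Psi>_meas])
        then show ?thesis unfolding d_def using g_Y_obs_measurable[OF n(1), of t] that by simp
      qed
      define R where "R = (\<lambda>\<omega>. \<Sum>t=1..n. w t * \<bar>d t \<omega>\<bar>)"
      have R0: "0 \<le> R \<omega>" for \<omega> unfolding R_def using w0 by (intro sum_nonneg) auto
      have Rm[measurable]: "R \<in> borel_measurable P"
        unfolding R_def by (intro borel_measurable_sum borel_measurable_times borel_measurable_const borel_measurable_abs dm)
      have R4: "(\<integral>\<^sup>+ \<omega>. ennreal (R \<omega> ^ 4) \<partial>P) \<le> ennreal (16 * Kc * (1 / real n) ^ 4)"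
      proof -
        have "(\<integral>\<^sup>+ \<omega>. ennreal (R \<omega> ^ 4) \<partial>P) \<le> ennreal ((\<Sum>t=1..n. w t) ^ 4 * (Kc * (1 / real n) ^ 4))"
          unfolding R_def
        proof (rule nn_integral_weighted_sum4[OF w0 dm])
          fix t assume "t \<in> {1..n}" "w t \<noteq> 0"
          then show "(\<integral>\<^sup>+ \<omega>. ennreal (\<bar>d t \<omega>\<bar> ^ 4) \<partial>P) \<le> ennreal (Kc * (1 / real n) ^ 4)"
            unfolding d_def by (intro close n range)
        qed (use Kc in auto)
        also have "\<dots> \<le> ennreal (2 ^ 4 * (Kc * (1 / real n) ^ 4))"
          using W2 Wn Kc by (intro ennreal_leI mult_right_mono power_mono) auto
        finally show ?thesis by (simp add: mult.assoc)
      qed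
      have iR: "integrable P (\<lambda>\<omega>. R \<omega> ^ 4)"
      proof (rule integrableI_bounded)
        have "(\<integral>\<^sup>+ \<omega>. ennreal (norm (R \<omega> ^ 4)) \<partial>P) = (\<integral>\<^sup>+ \<omega>. ennreal (R \<omega> ^ 4) \<partial>P)" using R0 by simp
        then show "(\<integral>\<^sup>+ \<omega>. ennreal (norm (R \<omega> ^ 4)) \<partial>P) < \<infinity>" using R4 by (auto intro: order.strict_trans1)
      qed measurable
      have ER: "(\<integral>\<omega>. R \<omega> ^ 4 \<partial>P) \<le> 16 * Kc * (1 / real n) ^ 4"
      proof -
        have "ennreal (\<integral>\<omega>. R \<omega> ^ 4 \<partial>P) = (\<integral>\<^sup>+ \<omega>. ennreal (R \<omega> ^ 4) \<partial>P)"
          using R0 by (intro nn_integral_eq_integral[symmetric] iR) auto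
        then have "ennreal (\<integral>\<omega>. R \<omega> ^ 4 \<partial>P) \<le> ennreal (16 * Kc * (1 / real n) ^ 4)" using R4 by simp
        then show ?thesis using Kc by (subst (asm) ennreal_le_iff) auto
      qed
      have Rtail: "prob {\<omega> \<in> space P. z \<le> R \<omega>} \<le> 256 * Kc / (\<sigma> * \<epsilon>)\<^sup>2 / (real n)\<^sup>2"
      proof -
        have "prob {\<omega> \<in> space P. z \<le> R \<omega>} \<le> prob {\<omega> \<in> space P. z ^ 4 \<le> R \<omega> ^ 4}"
          using z by (intro finite_measure_mono) (auto intro: power_mono)
        also have "\<dots> \<le> (\<integral>\<omega>. R \<omega> ^ 4 \<partial>P) / z ^ 4"
          by (rule integral_Markov_inequality_measure[where A = "{}"]) (use iR R0 z in auto)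
        also have "\<dots> \<le> (16 * Kc * (1 / real n) ^ 4) / z ^ 4" using ER z by (intro divide_right_mono) auto
        also have "\<dots> \<le> (16 * Kc * (1 / real n) ^ 4) / ((\<sigma> * \<epsilon>)\<^sup>2 / (16 * (real n)\<^sup>2))"
        proof (rule divide_left_mono)
          have "\<sigma> * \<epsilon> / real n \<le> \<sigma> * \<epsilon> / p" using pn p1 \<sigma> eps n by (intro divide_left_mono) auto
          also have "\<dots> \<le> s2" unfolding s2_def using \<sigma> \<Gamma> p1 by (intro divide_right_mono mult_left_mono) auto
          also have "\<dots> \<le> s2 * L" using s2 L by simp
          finally have "(\<sigma> * \<epsilon> / real n)\<^sup>2 \<le> (s2 * L)\<^sup>2" using \<sigma> eps by (intro power_mono) auto
          also have "(s2 * L)\<^sup>2 = 16 * z ^ 4"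
          proof -
            have "z ^ 4 = (z\<^sup>2)\<^sup>2" by simp
            also have "z\<^sup>2 = s2 * L / 4"
            proof -
              have "(sqrt (s2 * L))\<^sup>2 = s2 * L" using s2 L by simp
              then show ?thesis unfolding z_def power_mult_distrib by (simp add: power2_eq_square)
            qed
            finally show ?thesis by (simp add: power_divide)
          qed
          finally show "(\<sigma> * \<epsilon>)\<^sup>2 / (16 * (real n)\<^sup>2) \<le> z ^ 4" by (simp add: power_divide)
          show "0 < z ^ 4 * ((\<sigma> * \<epsilon>)\<^sup>2 / (16 * (real n)\<^sup>2))" using z \<sigma> eps n by simp
        qed (use Kc in simp)
        also have "\<dots> = 256 * Kc / (\<sigma> * \<epsilon>)\<^sup>2 / (real n)\<^sup>2"
          using n \<sigma> eps by (simp add: field_simps power2_eq_square power4_eq_xxxx)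
        finally show ?thesis .
      qed
      define T where "T = (\<lambda>\<omega>. \<Sum>t=1..n. w t * (\<Psi> (real t / real n) (past \<zeta> (int t) \<omega>) - mean_\<Psi> (real t / real n)))"
      define S where "S = (\<lambda>\<omega>. \<Sum>t=1..n. w t * (g (Y_obs X t n \<omega>) - mean_\<Psi> (real t / real n)))"
      have Tm[measurable]: "T \<in> borel_measurable P"
        unfolding T_def using n by (intro borel_measurable_sum borel_measurable_times borel_measurable_const borel_measurable_diff
          measurable_compose[OF past_measurable \<Psi>_meas]) auto
      have ST: "\<bar>S \<omega>\<bar> \<le> \<bar>T \<omega>\<bar> + R \<omega>" for \<omega>
      proof -
        have "S \<omega> - T \<omega> = (\<Sum>t=1..n. w t * d t \<omega>)"
          unfolding S_def T_def d_def by (simp add: sum_subtractf[symmetric] algebra_simps)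
        also have "\<bar>\<dots>\<bar> \<le> R \<omega>" unfolding R_def by (rule order.trans[OF sum_abs]) (use w0 in \<open>simp add: abs_mult\<close>)
        finally show ?thesis by linarith
      qed
      have s_eq: "sqrt (\<sigma> * (lr_var u + \<epsilon>) / (real n * h) * ln (real n)) = sqrt (s2 * L)" by (simp add: s2_def p_def L_def)
      have Ttail: "prob {\<omega> \<in> space P. 17 / 2 * sqrt (s2 * L) \<le> \<bar>T \<omega>\<bar>} \<le> 5 / (real n)\<^sup>2"
        using elim(1) hl hh unfolding s_eq[symmetric] T_def w_def by blast
      have "prob {\<omega> \<in> space P. 9 * sqrt (s2 * L) \<le> \<bar>S \<omega>\<bar>}
        \<le> prob ({\<omega> \<in> space P. 17 / 2 * sqrt (s2 * L) \<le> \<bar>T \<omega>\<bar>} \<union> {\<omega> \<in> space P. z \<le> R \<omega>})"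
      proof (rule finite_measure_mono)
        show "{\<omega> \<in> space P. 9 * sqrt (s2 * L) \<le> \<bar>S \<omega>\<bar>}
          \<subseteq> {\<omega> \<in> space P. 17 / 2 * sqrt (s2 * L) \<le> \<bar>T \<omega>\<bar>} \<union> {\<omega> \<in> space P. z \<le> R \<omega>}"
        proof
          fix \<omega> assume a: "\<omega> \<in> {\<omega> \<in> space P. 9 * sqrt (s2 * L) \<le> \<bar>S \<omega>\<bar>}"
          show "\<omega> \<in> {\<omega> \<in> space P. 17 / 2 * sqrt (s2 * L) \<le> \<bar>T \<omega>\<bar>} \<union> {\<omega> \<in> space P. z \<le> R \<omega>}"
          proof (cases "z \<le> R \<omega>")
            case False
            then have "17 / 2 * sqrt (s2 * L) \<le> \<bar>T \<omega>\<bar>" using ST[of \<omega>] a unfolding z_def by simp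
            then show ?thesis using a by simp
          qed (use a in simp)
        qed
      qed measurable
      also have "\<dots> \<le> prob {\<omega> \<in> space P. 17 / 2 * sqrt (s2 * L) \<le> \<bar>T \<omega>\<bar>} + prob {\<omega> \<in> space P. z \<le> R \<omega>}"
        by (rule measure_Un_le) measurable
      also have "\<dots> \<le> 5 / (real n)\<^sup>2 + 256 * Kc / (\<sigma> * \<epsilon>)\<^sup>2 / (real n)\<^sup>2" using Ttail Rtail by linarith
      also have "\<dots> = C / (real n)\<^sup>2" by (simp add: C_def add_divide_distrib)
      finally show "prob {\<omega> \<in> space P. 9 * sqrt (\<sigma> * (lr_var u + \<epsilon>) / (real n * h) * ln (real n)) \<le>
        \<bar>\<Sum>t=1..n. kernel_weight K n h u (int t) * (g (Y_obs X t n \<omega>) - mean_\<Psi> (real t / real n))\<bar>} \<le> C / (real n)\<^sup>2"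
        unfolding s_eq S_def w_def .
    qed
  qed
  then show ?thesis using C unfolding \<sigma>_def by blast
qed

text \<open>
  Deviation plus bias, divided by the total weight, which is at least \<open>9/10\<close>; the constants 9 and 2 become
  10 and 3 to make room for this.
\<close>
lemma coordinate_risk:
  assumes u: "0 < u" "u < 1" and K: "K \<in> kernel_class" and eps: "0 < \<epsilon>"
    and f: "twice_cont_diff_near f u" and fm: "\<And>v. v \<in> {0..1} \<Longrightarrow> f v = mean_\<Psi> v"
    and h0: "(\<lambda>n. ln (real n) * (h0 n)\<^sup>2) \<longlonglongrightarrow> 0" "h0 \<longlonglongrightarrow> 0"
    and h0n: "filterlim (\<lambda>n. real n * (h0 n)\<^sup>2) at_top sequentially"
  shows "\<exists>C\<ge>0. \<forall>\<^sub>F n in sequentially. \<forall>h. ln (real n) powr (5 + 2 * \<alpha> * real M) / real n \<le> h \<longrightarrow> h \<le> h0 n \<longrightarrow>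
    prob {\<omega> \<in> space P. 10 * sqrt (sigma2_K K * (lr_var u + \<epsilon>) / (real n * h) * ln (real n))
      + 3 * mu_K K * (\<bar>deriv (deriv f) u\<bar> + \<epsilon>) * (h0 n)\<^sup>2 < \<bar>kernel_estimator K n h u \<omega> - f u\<bar>} \<le> C / (real n)\<^sup>2"
proof -
  obtain L' where lipK: "L'-lipschitz_on UNIV K" and L'1: "1 \<le> L'" using kernel_products_lipschitz[OF K] by metis
  obtain supp: "\<And>x. K x \<noteq> 0 \<Longrightarrow> \<bar>x\<bar> \<le> 1 / 2" and Kpos: "\<And>x. 0 \<le> K x" and Kint: "(\<integral>x. K x \<partial>lborel) = 1"
    using kernel_class_facts[OF K] by metis
  obtain C where C: "0 \<le> C" and dev: "\<forall>\<^sub>F n in sequentially. \<forall>h. ln (real n) powr (5 + 2 * \<alpha> * real M) / real n \<le> h \<longrightarrow> h \<le> h0 n \<longrightarrow>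
    prob {\<omega> \<in> space P. 9 * sqrt (sigma2_K K * (lr_var u + \<epsilon>) / (real n * h) * ln (real n)) \<le>
      \<bar>\<Sum>t=1..n. kernel_weight K n h u (int t) * (g (Y_obs X t n \<omega>) - mean_\<Psi> (real t / real n))\<bar>} \<le> C / (real n)\<^sup>2"
    using kernel_obs_deviation[OF u K eps h0] by blast
  have lninf: "filterlim (\<lambda>n. ln (real n)) at_top sequentially"
    by (rule filterlim_compose[OF ln_at_top filterlim_real_sequentially])
  have ev1: "\<forall>\<^sub>F n in sequentially. 1 + 30 * L' \<le> ln (real n)" using lninf by (simp add: filterlim_at_top)
  have ev2: "\<forall>\<^sub>F n in sequentially. h0 n < min u (1 - u)" using h0(2) u by (intro order_tendstoD(2)) auto
  have "\<forall>\<^sub>F n in sequentially. \<forall>h. ln (real n) powr (5 + 2 * \<alpha> * real M) / real n \<le> h \<longrightarrow> h \<le> h0 n \<longrightarrow>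
    prob {\<omega> \<in> space P. 10 * sqrt (sigma2_K K * (lr_var u + \<epsilon>) / (real n * h) * ln (real n))
      + 3 * mu_K K * (\<bar>deriv (deriv f) u\<bar> + \<epsilon>) * (h0 n)\<^sup>2 < \<bar>kernel_estimator K n h u \<omega> - f u\<bar>} \<le> C / (real n)\<^sup>2"
    using dev kernel_bias[OF u K f eps h0(2) h0n] ev1 ev2 eventually_gt_at_top[of 0]
  proof eventually_elim
    case (elim n)
    show ?case
    proof (intro allI impI)
      fix h assume hl: "ln (real n) powr (5 + 2 * \<alpha> * real M) / real n \<le> h" and hh: "h \<le> h0 n"
      define L where "L = ln (real n)"
      define p where "p = real n * h"
      have n: "1 \<le> n" "0 < real n" using elim by auto
      have L: "1 \<le> L" "30 * L' \<le> L" using elim(3) L'1 by (simp_all add: L_def)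
      have L5: "L powr 5 = L ^ 5" using L by (intro powr_numeral) simp
      have "L powr 5 \<le> L powr (5 + 2 * \<alpha> * real M)" using L alpha by (intro powr_mono) auto
      also have "\<dots> \<le> h * real n" using hl n(2) by (simp only: L_def pos_divide_le_eq)
      finally have p5: "L ^ 5 \<le> p" unfolding L5 by (simp add: p_def mult.commute)
      have "L ^ 1 \<le> L ^ 5" using L by (intro power_increasing) auto
      then have pL: "L \<le> p" using p5 by simp
      have p1: "1 \<le> p" "0 < p" using pL L by auto
      have hpos: "0 < h" using p1 n unfolding p_def by (simp add: zero_less_mult_iff)
      have hs: "h < u" "h < 1 - u" using hh elim(4) by auto
      have h1: "h / 2 < u" "u + h / 2 \<le> 1" using hs hpos by auto
      define w where "w = (\<lambda>t. kernel_weight K n h u (int t))"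
      define W where "W = (\<Sum>t=1..n. w t)"
      have W: "9 / 10 \<le> W"
      proof -
        have "\<bar>W - (\<integral>x. K x \<partial>lborel)\<bar> \<le> 3 * L' / p"
          unfolding W_def w_def p_def by (rule kernel_Riemann[OF n(1) hpos p1(1)[unfolded p_def] h1 lipK supp])
        moreover have "3 * L' / p \<le> 1 / 10" using L pL p1 by (simp add: pos_divide_le_eq)
        ultimately show ?thesis using Kint by linarith
      qed
      define S where "S = (\<lambda>\<omega>. \<Sum>t=1..n. w t * (g (Y_obs X t n \<omega>) - mean_\<Psi> (real t / real n)))"
      define b where "b = (\<Sum>t=1..n. w t * (f (real t / real n) - f u))"
      have b: "\<bar>b\<bar> \<le> 2 * mu_K K * (\<bar>deriv (deriv f) u\<bar> + \<epsilon>) * (h0 n)\<^sup>2"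
        using elim(2) p5 hh unfolding b_def w_def L_def p_def by blast
      define B where "B = mu_K K * (\<bar>deriv (deriv f) u\<bar> + \<epsilon>) * (h0 n)\<^sup>2"
      have B0: "0 \<le> B" unfolding B_def using mu_K_pos[OF K] eps by simp
      define s where "s = sqrt (sigma2_K K * (lr_var u + \<epsilon>) / (real n * h) * ln (real n))"
      have s0: "0 \<le> s"
      proof -
        have "0 \<le> lr_var u" using u by (intro lr_var_nonneg) auto
        then show ?thesis unfolding s_def L_def[symmetric] using sigma2_K_pos[OF K] eps n hpos L
          by (intro real_sqrt_ge_zero mult_nonneg_nonneg divide_nonneg_nonneg) auto
      qed
      have eq: "W * (kernel_estimator K n h u \<omega> - f u) = S \<omega> + b" for \<omega>
      proof -
        have "W * kernel_estimator K n h u \<omega> = (\<Sum>t=1..n. w t * g (Y_obs X t n \<omega>))"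
          using W unfolding kernel_estimator_def W_def w_def by simp
        moreover have "S \<omega> + b = (\<Sum>t=1..n. w t * g (Y_obs X t n \<omega>)) - W * f u"
        proof -
          have "w t * (g (Y_obs X t n \<omega>) - mean_\<Psi> (real t / real n)) + w t * (f (real t / real n) - f u) = w t * g (Y_obs X t n \<omega>) - w t * f u"
            if "t \<in> {1..n}" for t
          proof -
            have "real t / real n \<in> {0..1}" using that n by auto
            from fm[OF this] show ?thesis by (simp add: algebra_simps)
          qed
          then show ?thesis unfolding S_def b_def W_def sum.distrib[symmetric] sum_distrib_right sum_subtractf[symmetric]
            by (intro sum.cong) auto
        qed
        ultimately show ?thesis by (simp add: algebra_simps)
      qed
      have "prob {\<omega> \<in> space P. 10 * s + 3 * B < \<bar>kernel_estimator K n h u \<omega> - f u\<bar>} \<le> prob {\<omega> \<in> space P. 9 * s \<le> \<bar>S \<omega>\<bar>}"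
      proof (rule finite_measure_mono)
        show "{\<omega> \<in> space P. 10 * s + 3 * B < \<bar>kernel_estimator K n h u \<omega> - f u\<bar>} \<subseteq> {\<omega> \<in> space P. 9 * s \<le> \<bar>S \<omega>\<bar>}"
        proof safe
          fix \<omega> assume w: "10 * s + 3 * B < \<bar>kernel_estimator K n h u \<omega> - f u\<bar>"
          have "9 / 10 * (10 * s + 3 * B) \<le> W * \<bar>kernel_estimator K n h u \<omega> - f u\<bar>"
            using W w s0 B0 by (intro mult_mono) auto
          also have "\<dots> = \<bar>S \<omega> + b\<bar>" using W eq[of \<omega>] by (metis abs_mult abs_of_nonneg divide_nonneg_nonneg order_trans zero_le_numeral)
          also have "\<dots> \<le> \<bar>S \<omega>\<bar> + 2 * B" using b unfolding B_def by linarith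
          finally show "9 * s \<le> \<bar>S \<omega>\<bar>" using B0 by simp
        qed
        have "S \<in> borel_measurable P" unfolding S_def
          using n by (intro borel_measurable_sum borel_measurable_times borel_measurable_const borel_measurable_diff g_Y_obs_measurable) auto
        then show "{\<omega> \<in> space P. 9 * s \<le> \<bar>S \<omega>\<bar>} \<in> events" by measurable
      qed
      also have "\<dots> \<le> C / (real n)\<^sup>2" using elim(1) hl hh unfolding s_def S_def w_def by blast
      finally show "prob {\<omega> \<in> space P. 10 * sqrt (sigma2_K K * (lr_var u + \<epsilon>) / (real n * h) * ln (real n))
        + 3 * mu_K K * (\<bar>deriv (deriv f) u\<bar> + \<epsilon>) * (h0 n)\<^sup>2 < \<bar>kernel_estimator K n h u \<omega> - f u\<bar>} \<le> C / (real n)\<^sup>2"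
        unfolding s_def B_def by (simp add: mult.assoc)
    qed
  qed
  then show ?thesis using C by blast
qed

end

section \<open>Bandwidth grid and the comparison rule\<close>

text \<open>
  All that is used of the order \<open>(log n / n)\<^bsup>1/5\<^esup>\<close>. The constant \<open>11/2\<close> is any number above 5: since
  \<open>log (1/h0)\<close> is about \<open>(log n) / 5\<close>, the factor \<open>\<lambda>(h)\<close> in the threshold is worth almost \<open>\<surd>(log n / 5)\<close>.
\<close>
lemma bandwidth_scale:
  fixes A0 a b :: real
  assumes A0: "0 < A0" and a: "0 < a"
  defines "h0 \<equiv> \<lambda>n::nat. (A0 * (ln (real n) / real n)) powr (1 / 5)"
  shows "(\<lambda>n. ln (real n) * (h0 n)\<^sup>2) \<longlonglongrightarrow> 0" "h0 \<longlonglongrightarrow> 0"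
    "filterlim (\<lambda>n. real n * (h0 n)\<^sup>2) at_top sequentially"
    "\<forall>\<^sub>F n in sequentially. ln (real n) \<le> 11 / 2 * ln (1 / h0 n)"
    "\<forall>\<^sub>F n in sequentially. ln (real n) powr b / real n \<le> a * h0 n"
    "\<forall>\<^sub>F n in sequentially. 0 < h0 n \<and> h0 n < 1"
  subgoal unfolding h0_def using A0 by real_asymp
  subgoal unfolding h0_def using A0 by real_asymp
  subgoal unfolding h0_def using A0 by real_asymp
  subgoal unfolding h0_def using A0 by real_asymp
  subgoal unfolding h0_def using A0 a by real_asymp
  subgoal unfolding h0_def eventually_conj_iff using A0 by (intro conjI) real_asymp+
  done

lemma remainder_below_rate:
  fixes C R :: real
  assumes "0 < R"
  shows "\<forall>\<^sub>F n in sequentially. C * ln (real n) ^ 4 / real n \<le> R * (ln (real n) / real n) powr (4 / 5)"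
  using assms by real_asymp

text \<open>
  Here \<open>x/h\<close> is the variance times \<open>log n\<close> and \<open>m h\<^sup>4\<close> the squared bias. The factor 32 keeps the bias
  small in the constants of the comparison.
\<close>
lemma balanced_bandwidth:
  fixes x m :: real
  assumes x: "0 < x" and m: "0 < m"
  defines "h \<equiv> (x / (32 * m)) powr (1 / 5)"
  shows "x / h = 2 * (x powr (4 / 5) * m powr (1 / 5))" "m * h ^ 4 = x / h / 32" "0 < h"
proof -
  define y where "y = (x / (32 * m)) powr (1 / 5)"
  have y: "0 < y" using x m by (simp add: y_def)
  have y5: "y ^ 5 = x / (32 * m)"
    using x m by (simp add: y_def powr_realpow[symmetric] powr_powr)
  have hy: "h = y" by (simp add: h_def y_def)
  show "0 < h" using y hy by simp
  have xe: "x = 32 * m * y ^ 5" unfolding y5 using m by simp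
  have y4: "(y ^ 5) powr (4 / 5) = y ^ 4"
  proof -
    have "y ^ 5 = y powr 5" "y ^ 4 = y powr 4" using y by simp_all
    then show ?thesis by (simp only: powr_powr) simp
  qed
  have 1: "x powr (4 / 5) = 32 powr (4/5) * m powr (4/5) * y ^ 4"
    unfolding xe powr_mult y4 ..
  have 2: "(32::real) powr (4 / 5) = 16"
  proof -
    have "(32::real) = 2 powr 5" by simp
    then have "(32::real) powr (4 / 5) = 2 powr 4" by (simp only: powr_powr) simp
    then show ?thesis by simp
  qed
  have 3: "m powr (4/5) * m powr (1/5) = m" using m by (simp add: powr_add[symmetric])
  have "x powr (4 / 5) * m powr (1 / 5) = 16 * (m powr (4/5) * m powr (1/5)) * y ^ 4" unfolding 1 2 by simp
  also have "\<dots> = 16 * m * y ^ 4" unfolding 3 by simp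
  finally have 4: "x powr (4 / 5) * m powr (1 / 5) = 16 * m * y ^ 4" .
  have 5: "x / y = 32 * m * y ^ 4" unfolding xe using y by (simp add: eval_nat_numeral)
  show "x / h = 2 * (x powr (4 / 5) * m powr (1 / 5))" unfolding hy 4 5 by simp
  show "m * h ^ 4 = x / h / 32" unfolding hy 5 by simp
qed

text \<open>
  By the triangle inequality through \<open>G\<close>, two estimators at bandwidths up to \<open>hs\<close> differ by at most
  twice the larger error, so \<open>hs\<close> passes its comparisons. Hence the selected bandwidth is at least \<open>hs\<close>
  and, if larger, has passed the comparison with \<open>hs\<close>. Nothing is assumed on the errors at bandwidths
  larger than \<open>hs\<close>.
\<close>
lemma Lepski_oracle_inequality:
  fixes est :: "real \<Rightarrow> nat \<Rightarrow> real" and G :: "nat \<Rightarrow> real"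
  assumes fin: "finite A" and hs: "hs \<in> A"
    and err: "\<And>h. h \<in> A \<Longrightarrow> h \<le> hs \<Longrightarrow> L2_set (\<lambda>i. est h i - G i) {..<d} \<le> E h"
    and E: "\<And>h. h \<in> A \<Longrightarrow> h < hs \<Longrightarrow> E hs \<le> E h"
    and thr: "\<And>h. h \<in> A \<Longrightarrow> h < hs \<Longrightarrow> 2 * E h \<le> thr h" "0 \<le> thr hs"
  defines "hh \<equiv> Sup {h \<in> A. \<forall>h'\<in>A. h' < h \<longrightarrow> L2_set (\<lambda>i. est h i - est h' i) {..<d} \<le> thr h'}"
  shows "L2_set (\<lambda>i. est hh i - G i) {..<d} \<le> thr hs + E hs"
proof -
  define B where "B = {h \<in> A. \<forall>h'\<in>A. h' < h \<longrightarrow> L2_set (\<lambda>i. est h i - est h' i) {..<d} \<le> thr h'}"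
  have tri: "L2_set (\<lambda>i. x i - z i) {..<d} \<le> L2_set (\<lambda>i. x i - y i) {..<d} + L2_set (\<lambda>i. y i - z i) {..<d}" for x y z :: "nat \<Rightarrow> real"
    using L2_set_triangle_ineq[of "\<lambda>i. x i - y i" "\<lambda>i. y i - z i" "{..<d}"] by simp
  have hsB: "hs \<in> B"
    unfolding B_def
  proof (intro CollectI conjI hs ballI impI)
    fix h' assume h': "h' \<in> A" "h' < hs"
    have "L2_set (\<lambda>i. G i - est h' i) {..<d} = L2_set (\<lambda>i. est h' i - G i) {..<d}"
      by (simp add: L2_set_def power2_commute)
    then have "L2_set (\<lambda>i. est hs i - est h' i) {..<d} \<le> E hs + E h'"
      using tri[of "est hs" "est h'" G] err[OF hs] err[OF h'(1)] h' by fastforce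
    then show "L2_set (\<lambda>i. est hs i - est h' i) {..<d} \<le> thr h'" using E[OF h'] thr(1)[OF h'] by linarith
  qed
  have finB: "finite B" using fin by (simp add: B_def)
  have hh: "hh = Max B" unfolding hh_def B_def[symmetric] using finB hsB by (intro cSup_eq_Max) auto
  have "hs \<le> hh" unfolding hh using finB hsB by simp
  have "hh \<in> B" unfolding hh using finB hsB by (intro Max_in) auto
  show ?thesis
  proof (cases "hh = hs")
    case True
    then show ?thesis using err[OF hs] thr(2) by simp
  next
    case False
    then have "L2_set (\<lambda>i. est hh i - est hs i) {..<d} \<le> thr hs"
      using \<open>hs \<le> hh\<close> \<open>hh \<in> B\<close> hs by (auto simp: B_def)
    then show ?thesis using tri[of "est hh" G "est hs"] err[OF hs] by simp
  qed
qed

text \<open>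
  Off the good event, \<open>x \<le> x\<^sup>2 / s + s\<close> trades a second moment against the probability of the event; the
  choice \<open>s = n\<close> will balance bounded second moments against a probability \<open>O(n\<^sup>-\<^sup>2)\<close>, up to logarithms. The
  function \<open>F\<close> itself, a loss at a selected bandwidth, is only required to be dominated by measurable
  functions.
\<close>
lemma (in prob_space) expectation_split_on_good_event:
  fixes F :: "'a \<Rightarrow> real" and N :: "'b \<Rightarrow> 'a \<Rightarrow> real"
  assumes good: "\<And>\<omega>. \<omega> \<in> A \<Longrightarrow> F \<omega> \<le> B" and bad: "\<And>\<omega>. \<omega> \<in> space M \<Longrightarrow> F \<omega> \<le> (\<Sum>h\<in>I. N h \<omega>)"
    and A: "A \<in> events" and N: "\<And>h. h \<in> I \<Longrightarrow> N h \<in> borel_measurable M" "\<And>h \<omega>. h \<in> I \<Longrightarrow> 0 \<le> N h \<omega>"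
    and V: "\<And>h. h \<in> I \<Longrightarrow> (\<integral>\<^sup>+ \<omega>. ennreal ((N h \<omega>)\<^sup>2) \<partial>M) \<le> ennreal V" "0 \<le> V" and B: "0 \<le> B" and s: "0 < s"
    and p: "prob (space M - A) \<le> p"
  shows "(\<integral>\<^sup>+ \<omega>. ennreal (F \<omega>) \<partial>M) \<le> ennreal (B + real (card I) * (V / s + s * p))"
proof -
  have p0: "0 \<le> p" using p measure_nonneg[of M "space M - A"] by linarith
  have Ac[measurable]: "space M - A \<in> events" using A by auto
  note [measurable] = N(1)
  let ?G = "\<lambda>\<omega>. \<Sum>h\<in>I. ennreal (1 / s) * ennreal ((N h \<omega>)\<^sup>2) + ennreal s * indicator (space M - A) \<omega>"
  have pt: "ennreal (F \<omega>) \<le> ennreal B + ?G \<omega>" if w: "\<omega> \<in> space M" for \<omega>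
  proof (cases "\<omega> \<in> A")
    case True
    then have "ennreal (F \<omega>) \<le> ennreal B" using good by (intro ennreal_leI)
    then show ?thesis by (simp add: add_increasing2)
  next
    case False
    have le: "x \<le> 1 / s * x\<^sup>2 + s" if "0 \<le> x" for x :: real
    proof (cases "x \<le> s")
      case True
      moreover have "0 \<le> 1 / s * x\<^sup>2" using s by simp
      ultimately show ?thesis by linarith
    next
      case False
      then have "s * x \<le> x * x" using that by (intro mult_right_mono) auto
      then have "x \<le> 1 / s * x\<^sup>2" using s by (simp add: field_simps power2_eq_square)
      then show ?thesis using s by linarith
    qed
    have "ennreal (F \<omega>) \<le> ennreal (\<Sum>h\<in>I. N h \<omega>)" using bad[OF w] by (rule ennreal_leI)
    also have "\<dots> = (\<Sum>h\<in>I. ennreal (N h \<omega>))" using N(2) by (intro sum_ennreal[symmetric]) auto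
    also have "\<dots> \<le> ?G \<omega>"
    proof (rule sum_mono)
      fix h assume h: "h \<in> I"
      have "ennreal (N h \<omega>) \<le> ennreal (1 / s * (N h \<omega>)\<^sup>2 + s)" using le[OF N(2)[OF h]] by (rule ennreal_leI)
      also have "\<dots> = ennreal (1 / s * (N h \<omega>)\<^sup>2) + ennreal s" using s by (intro ennreal_plus) auto
      also have "ennreal (1 / s * (N h \<omega>)\<^sup>2) = ennreal (1 / s) * ennreal ((N h \<omega>)\<^sup>2)" using s by (intro ennreal_mult) auto
      finally show "ennreal (N h \<omega>) \<le> ennreal (1 / s) * ennreal ((N h \<omega>)\<^sup>2) + ennreal s * indicator (space M - A) \<omega>"
        using False w by simp
    qed
    finally show ?thesis by (simp add: add_increasing)
  qed
  have "(\<integral>\<^sup>+ \<omega>. ennreal (F \<omega>) \<partial>M) \<le> (\<integral>\<^sup>+ \<omega>. ennreal B + ?G \<omega> \<partial>M)" by (intro nn_integral_mono pt)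
  also have "\<dots> = (\<integral>\<^sup>+ \<omega>. ennreal B \<partial>M) + (\<integral>\<^sup>+ \<omega>. ?G \<omega> \<partial>M)" by (intro nn_integral_add borel_measurable_sum) measurable
  also have "(\<integral>\<^sup>+ \<omega>. ennreal B \<partial>M) = ennreal B" by (simp add: emeasure_space_1)
  also have "(\<integral>\<^sup>+ \<omega>. ?G \<omega> \<partial>M) = (\<Sum>h\<in>I. (\<integral>\<^sup>+ \<omega>. ennreal (1 / s) * ennreal ((N h \<omega>)\<^sup>2) + ennreal s * indicator (space M - A) \<omega> \<partial>M))"
    by (intro nn_integral_sum) measurable
  finally have 1: "(\<integral>\<^sup>+ \<omega>. ennreal (F \<omega>) \<partial>M)
    \<le> ennreal B + (\<Sum>h\<in>I. (\<integral>\<^sup>+ \<omega>. ennreal (1 / s) * ennreal ((N h \<omega>)\<^sup>2) + ennreal s * indicator (space M - A) \<omega> \<partial>M))" .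
  have 2: "(\<integral>\<^sup>+ \<omega>. ennreal (1 / s) * ennreal ((N h \<omega>)\<^sup>2) + ennreal s * indicator (space M - A) \<omega> \<partial>M) \<le> ennreal (V / s + s * p)" if h: "h \<in> I" for h
  proof -
    note [measurable] = N(1)[OF h]
    have "(\<integral>\<^sup>+ \<omega>. ennreal (1 / s) * ennreal ((N h \<omega>)\<^sup>2) + ennreal s * indicator (space M - A) \<omega> \<partial>M)
      = ennreal (1 / s) * (\<integral>\<^sup>+ \<omega>. ennreal ((N h \<omega>)\<^sup>2) \<partial>M) + ennreal s * emeasure M (space M - A)"
      by (subst nn_integral_add) (simp_all add: nn_integral_cmult)
    also have "\<dots> \<le> ennreal (1 / s) * ennreal V + ennreal s * ennreal p"
      using V(1)[OF h] p by (intro add_mono mult_left_mono) (auto simp: emeasure_eq_measure intro: ennreal_leI)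
    also have "\<dots> = ennreal (V / s + s * p)" using s V(2) p0 by (simp add: ennreal_mult[symmetric] ennreal_plus[symmetric] del: ennreal_plus)
    finally show ?thesis .
  qed
  have "(\<integral>\<^sup>+ \<omega>. ennreal (F \<omega>) \<partial>M) \<le> ennreal B + (\<Sum>h\<in>I. ennreal (V / s + s * p))"
    by (rule order.trans[OF 1]) (intro add_left_mono sum_mono 2)
  also have "(\<Sum>h\<in>I. ennreal (V / s + s * p)) = ennreal (\<Sum>h\<in>I. V / s + s * p)"
    using s V(2) p0 by (intro sum_ennreal) auto
  also have "(\<Sum>h\<in>I. V / s + s * p) = real (card I) * (V / s + s * p)" by simp
  also have "ennreal B + ennreal (real (card I) * (V / s + s * p)) = ennreal (B + real (card I) * (V / s + s * p))"
    using s V(2) p0 B by (intro ennreal_plus[symmetric]) auto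
  finally show ?thesis .
qed

lemma bw_grid_card:
  assumes a: "0 < a" "a < 1" and L: "1 \<le> ln (real n)" and hl: "1 / real n \<le> hl"
  shows "finite (bw_grid a hl)" "real (card (bw_grid a hl)) \<le> (1 / ln (1 / a) + 1) * ln (real n)"
proof -
  have n: "0 < real n" using L by (metis ln_0 not_one_le_zero of_nat_0_less_iff of_nat_eq_0_iff zero_less_iff_neq_zero)
  have la: "0 < ln (1 / a)" using a by simp
  define N where "N = nat \<lfloor>ln (real n) / ln (1 / a)\<rfloor>"
  have sub: "bw_grid a hl \<subseteq> (\<lambda>k. a ^ k) ` {..N}"
  proof
    fix h assume "h \<in> bw_grid a hl"
    then obtain k where k: "h = a ^ k" "hl \<le> a ^ k" by (auto simp: bw_grid_def)
    have "ln (1 / real n) \<le> ln (a ^ k)" using k hl n a by (subst ln_le_cancel_iff) auto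
    then have "real k * ln (1 / a) \<le> ln (real n)" using n a by (simp add: ln_div ln_realpow)
    then have "real k \<le> ln (real n) / ln (1 / a)" using la by (simp add: pos_le_divide_eq)
    then have "k \<le> N" unfolding N_def by linarith
    then show "h \<in> (\<lambda>k. a ^ k) ` {..N}" using k by auto
  qed
  then show "finite (bw_grid a hl)" by (rule finite_subset) simp
  have "card (bw_grid a hl) \<le> card ((\<lambda>k. a ^ k) ` {..N})" using sub by (intro card_mono) auto
  also have "\<dots> \<le> Suc N" using card_image_le[of "{..N}"] by simp
  finally have "real (card (bw_grid a hl)) \<le> real N + 1" by simp
  also have "real N \<le> ln (real n) / ln (1 / a)" unfolding N_def using la L by simp
  also have "ln (real n) / ln (1 / a) + 1 \<le> (1 / ln (1 / a) + 1) * ln (real n)" using L by (simp add: algebra_simps)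
  finally show "real (card (bw_grid a hl)) \<le> (1 / ln (1 / a) + 1) * ln (real n)" by simp
qed

text \<open>
  The first power of \<open>a\<close> that is at most \<open>h\<close> exceeds \<open>a h\<close>.
\<close>
lemma bw_grid_near:
  assumes a: "0 < a" "a < 1" and h: "0 < h" "h < 1" and hl: "hl \<le> a * h"
  obtains hs where "hs \<in> bw_grid a hl" "a * h < hs" "hs \<le> h"
proof -
  have "\<exists>k. a ^ k \<le> h" using real_arch_pow_inv[of h a] a h by (auto intro: less_imp_le)
  define k where "k = (LEAST k. a ^ k \<le> h)"
  have k: "a ^ k \<le> h" unfolding k_def using \<open>\<exists>k. a ^ k \<le> h\<close> by (rule LeastI_ex)
  then have "k \<noteq> 0" using h by (intro notI) simp
  then obtain j where j: "k = Suc j" by (cases k) auto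
  have "\<not> a ^ j \<le> h" using not_less_Least[of j "\<lambda>k. a ^ k \<le> h"] j unfolding k_def[symmetric] by simp
  then have lo: "a * h < a ^ k" using a unfolding j by simp
  have "a ^ k \<le> 1" using a by (intro power_le_one) auto
  then have "a ^ k \<in> bw_grid a hl" using lo hl by (auto simp: bw_grid_def)
  then show ?thesis using that lo k by blast
qed

section \<open>The vector-valued estimator\<close>

text \<open>
  The estimator of \<open>\<real>\<^sup>d\<close>-valued means, each coordinate of \<open>g\<close> satisfying the scalar model.
\<close>
locale vector_model = prob_space P for P :: "'w measure" +
  fixes \<alpha> D \<rho> :: real and Dq :: "real \<Rightarrow> real" and S :: "'s measure"
    and \<zeta> \<zeta>' :: "int \<Rightarrow> 'w \<Rightarrow> 's" and H :: "(nat \<Rightarrow> 's) \<Rightarrow> real \<Rightarrow> real"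
    and X :: "nat \<Rightarrow> nat \<Rightarrow> 'w \<Rightarrow> real" and M :: nat and chi :: "nat \<Rightarrow> real" and C :: real
    and d :: nat and u :: real and K :: "real \<Rightarrow> real" and g :: "(nat \<Rightarrow> real) \<Rightarrow> nat \<Rightarrow> real"
  assumes coordinate: "\<And>i. i < d \<Longrightarrow> ls_model P \<alpha> D \<rho> Dq S \<zeta> \<zeta>' H X M chi C (\<lambda>x. g x i)"
    and u: "0 < u" "u < 1" and K: "K \<in> kernel_class" and d: "1 \<le> d"
    and G_smooth: "\<And>i. i < d \<Longrightarrow> twice_cont_diff_near (\<lambda>v. G_target P g (shift_process H \<zeta>) v i) u"
begin

abbreviation "G v \<equiv> G_target P g (shift_process H \<zeta>) v"
abbreviation "Sig \<equiv> Sigma_lr P g (shift_process H \<zeta>) u"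
abbreviation "curv i \<equiv> deriv (deriv (\<lambda>v. G v i)) u"
abbreviation "gi i \<equiv> (\<lambda>x. g x i)"

lemma G_hat_eq_kernel_estimator: "1 \<le> n \<Longrightarrow> 0 < h \<Longrightarrow> i < d \<Longrightarrow> G_hat K g X n h u \<omega> i = ls_model.kernel_estimator X (gi i) K n h u \<omega>"
  unfolding ls_model.kernel_estimator_def[OF coordinate] G_hat_def K_scaled_def kernel_weight_def
  by (simp add: sum_distrib_left)

lemma G_eq_mean: "i < d \<Longrightarrow> v \<in> {0..1} \<Longrightarrow> G v i = ls_model.mean_\<Psi> P S \<zeta> H (gi i) v"
proof -
  assume i: "i < d" and v: "v \<in> {0..1}"
  interpret ls_model P \<alpha> D \<rho> Dq S \<zeta> \<zeta>' H X M chi C "gi i" by (rule coordinate[OF i])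
  show ?thesis unfolding G_target_def Y_stat_eq mean_\<Psi>_def by (rule integral_past[OF \<Psi>_meas[OF v]])
qed

lemma Sig_eq_lr_var: "i < d \<Longrightarrow> Sig i i = ls_model.lr_var P S \<zeta> H (gi i) u"
proof -
  assume i: "i < d"
  interpret ls_model P \<alpha> D \<rho> Dq S \<zeta> \<zeta>' H X M chi C "gi i" by (rule coordinate[OF i])
  have u01: "u \<in> {0..1}" using u by simp
  show ?thesis
    unfolding Sigma_lr_def Y_stat_eq lr_var_def Cov_def integral_past[OF \<Psi>_meas[OF u01]] autocov_def mean_\<Psi>_def ..
qed

lemma Sig_nonneg: "i < d \<Longrightarrow> 0 \<le> Sig i i"
  using ls_model.lr_var_nonneg[OF coordinate] u by (simp add: Sig_eq_lr_var)

lemma G_hat_measurable: "1 \<le> n \<Longrightarrow> 0 < h \<Longrightarrow> i < d \<Longrightarrow> (\<lambda>\<omega>. G_hat K g X n h u \<omega> i) \<in> borel_measurable P"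
  by (simp add: G_hat_eq_kernel_estimator ls_model.kernel_estimator_measurable[OF coordinate])

text \<open>
  Any bandwidth, however badly chosen, has a bounded fourth moment of the loss.
\<close>
lemma squared_loss_moment:
  "\<exists>V\<ge>0. \<forall>n\<ge>1. \<forall>h>0. (\<integral>\<^sup>+ \<omega>. ennreal (((L2_set (\<lambda>i. G_hat K g X n h u \<omega> i - G u i) {..<d})\<^sup>2)\<^sup>2) \<partial>P) \<le> ennreal V"
proof -
  have "\<exists>C0\<ge>0. \<forall>n\<ge>1. \<forall>h>0. (\<integral>\<^sup>+ \<omega>. ennreal (\<bar>G_hat K g X n h u \<omega> i\<bar> ^ 4) \<partial>P) \<le> ennreal C0" if i: "i < d" for i
  proof -
    obtain C0 where "0 \<le> C0" "\<And>n h. 1 \<le> n \<Longrightarrow> 0 < h \<Longrightarrow> (\<integral>\<^sup>+ \<omega>. ennreal (\<bar>ls_model.kernel_estimator X (gi i) K n h u \<omega>\<bar> ^ 4) \<partial>P) \<le> ennreal C0"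
      using ls_model.kernel_estimator_moment4[OF coordinate[OF i]] K by metis
    then show ?thesis by (intro exI[of _ C0]) (simp add: G_hat_eq_kernel_estimator[OF _ _ i])
  qed
  then obtain C0 where C0: "\<And>i. i < d \<Longrightarrow> 0 \<le> C0 i"
    "\<And>i n h. i < d \<Longrightarrow> 1 \<le> n \<Longrightarrow> 0 < h \<Longrightarrow> (\<integral>\<^sup>+ \<omega>. ennreal (\<bar>G_hat K g X n h u \<omega> i\<bar> ^ 4) \<partial>P) \<le> ennreal (C0 i)"
    by metis
  define V where "V = (\<Sum>i<d. real d * (8 * (C0 i + (G u i) ^ 4)))"
  have V: "0 \<le> V" unfolding V_def using C0(1) by (intro sum_nonneg mult_nonneg_nonneg add_nonneg_nonneg) auto
  have "(\<integral>\<^sup>+ \<omega>. ennreal (((L2_set (\<lambda>i. G_hat K g X n h u \<omega> i - G u i) {..<d})\<^sup>2)\<^sup>2) \<partial>P) \<le> ennreal V"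
    if n: "1 \<le> n" and h: "0 < h" for n h
  proof -
    note [measurable] = G_hat_measurable[OF n h]
    let ?x = "\<lambda>\<omega> i. G_hat K g X n h u \<omega> i"
    have four: "(x - y) ^ 4 \<le> 8 * (\<bar>x\<bar> ^ 4 + y ^ 4)" for x y :: real
    proof -
      have sq: "(a + b)\<^sup>2 \<le> 2 * (a\<^sup>2 + b\<^sup>2)" for a b :: real
        using zero_le_power2[of "a - b"] by (simp add: power2_eq_square algebra_simps)
      have 1: "(x - y)\<^sup>2 \<le> 2 * (x\<^sup>2 + y\<^sup>2)" using sq[of x "- y"] by simp
      have 2: "(x\<^sup>2 + y\<^sup>2)\<^sup>2 \<le> 2 * ((x\<^sup>2)\<^sup>2 + (y\<^sup>2)\<^sup>2)" by (rule sq)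
      have "((x - y)\<^sup>2)\<^sup>2 \<le> (2 * (x\<^sup>2 + y\<^sup>2))\<^sup>2" using 1 by (intro power_mono) auto
      also have "\<dots> \<le> 8 * ((x\<^sup>2)\<^sup>2 + (y\<^sup>2)\<^sup>2)" using 2 unfolding power_mult_distrib by simp
      finally show ?thesis by simp
    qed
    have pt: "((L2_set (\<lambda>i. ?x \<omega> i - G u i) {..<d})\<^sup>2)\<^sup>2 \<le> (\<Sum>i<d. real d * (8 * (\<bar>?x \<omega> i\<bar> ^ 4 + (G u i) ^ 4)))" for \<omega>
    proof -
      have "((L2_set (\<lambda>i. ?x \<omega> i - G u i) {..<d})\<^sup>2)\<^sup>2 = (\<Sum>i<d. (?x \<omega> i - G u i)\<^sup>2)\<^sup>2"
        by (simp add: L2_set_def sum_nonneg)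
      also have "\<dots> \<le> real d * (\<Sum>i<d. ((?x \<omega> i - G u i)\<^sup>2)\<^sup>2)"
        using sum_squared_le_sum_of_squares[of "\<lambda>i. (?x \<omega> i - G u i)\<^sup>2" "{..<d}"] by (simp add: mult.commute)
      also have "\<dots> = (\<Sum>i<d. real d * (?x \<omega> i - G u i) ^ 4)" by (simp add: sum_distrib_left)
      also have "\<dots> \<le> (\<Sum>i<d. real d * (8 * (\<bar>?x \<omega> i\<bar> ^ 4 + (G u i) ^ 4)))"
        by (intro sum_mono mult_left_mono four) auto
      finally show ?thesis .
    qed
    have "(\<integral>\<^sup>+ \<omega>. ennreal (((L2_set (\<lambda>i. ?x \<omega> i - G u i) {..<d})\<^sup>2)\<^sup>2) \<partial>P)
      \<le> (\<integral>\<^sup>+ \<omega>. (\<Sum>i<d. ennreal (real d * 8) * (ennreal (\<bar>?x \<omega> i\<bar> ^ 4) + ennreal ((G u i) ^ 4))) \<partial>P)"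
    proof (intro nn_integral_mono)
      fix \<omega>
      have "ennreal (((L2_set (\<lambda>i. ?x \<omega> i - G u i) {..<d})\<^sup>2)\<^sup>2) \<le> ennreal (\<Sum>i<d. real d * (8 * (\<bar>?x \<omega> i\<bar> ^ 4 + (G u i) ^ 4)))"
        by (rule ennreal_leI[OF pt])
      also have "\<dots> = (\<Sum>i<d. ennreal (real d * (8 * (\<bar>?x \<omega> i\<bar> ^ 4 + (G u i) ^ 4))))" by (intro sum_ennreal[symmetric]) auto
      also have "\<dots> = (\<Sum>i<d. ennreal (real d * 8) * (ennreal (\<bar>?x \<omega> i\<bar> ^ 4) + ennreal ((G u i) ^ 4)))"
        by (intro sum.cong refl) (simp add: ennreal_mult[symmetric] ennreal_plus[symmetric] mult.assoc del: ennreal_plus)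
      finally show "ennreal (((L2_set (\<lambda>i. ?x \<omega> i - G u i) {..<d})\<^sup>2)\<^sup>2)
        \<le> (\<Sum>i<d. ennreal (real d * 8) * (ennreal (\<bar>?x \<omega> i\<bar> ^ 4) + ennreal ((G u i) ^ 4)))" .
    qed
    also have "\<dots> = (\<Sum>i<d. (\<integral>\<^sup>+ \<omega>. ennreal (real d * 8) * (ennreal (\<bar>?x \<omega> i\<bar> ^ 4) + ennreal ((G u i) ^ 4)) \<partial>P))"
      by (intro nn_integral_sum) simp
    also have "\<dots> \<le> (\<Sum>i<d. ennreal (real d * (8 * (C0 i + (G u i) ^ 4))))"
    proof (rule sum_mono)
      fix i assume i: "i \<in> {..<d}"
      have m: "(\<lambda>\<omega>. ennreal (\<bar>?x \<omega> i\<bar> ^ 4)) \<in> borel_measurable P" using i by simp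
      have "(\<integral>\<^sup>+ \<omega>. ennreal (real d * 8) * (ennreal (\<bar>?x \<omega> i\<bar> ^ 4) + ennreal ((G u i) ^ 4)) \<partial>P)
        = ennreal (real d * 8) * ((\<integral>\<^sup>+ \<omega>. ennreal (\<bar>?x \<omega> i\<bar> ^ 4) \<partial>P) + ennreal ((G u i) ^ 4))"
        using m by (simp add: nn_integral_cmult nn_integral_add emeasure_space_1)
      also have "\<dots> \<le> ennreal (real d * 8) * (ennreal (C0 i) + ennreal ((G u i) ^ 4))"
        using i C0(2)[OF _ n h] by (intro mult_left_mono add_right_mono) auto
      also have "\<dots> = ennreal (real d * (8 * (C0 i + (G u i) ^ 4)))"
        using i C0(1)[of i] by (simp add: ennreal_mult[symmetric] ennreal_plus[symmetric] mult.assoc del: ennreal_plus)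
      finally show "(\<integral>\<^sup>+ \<omega>. ennreal (real d * 8) * (ennreal (\<bar>?x \<omega> i\<bar> ^ 4) + ennreal ((G u i) ^ 4)) \<partial>P)
        \<le> ennreal (real d * (8 * (C0 i + (G u i) ^ 4)))" .
    qed
    also have "\<dots> = ennreal V" unfolding V_def using C0(1) by (intro sum_ennreal) auto
    finally show ?thesis .
  qed
  then show ?thesis using V by blast
qed

text \<open>
  The event on which the deviation-plus-bias bound of \<open>coordinate_risk\<close> holds for every coordinate.
\<close>
definition good_at :: "real \<Rightarrow> (nat \<Rightarrow> real) \<Rightarrow> nat \<Rightarrow> real \<Rightarrow> 'w \<Rightarrow> bool" where
  "good_at \<epsilon> h0 n h \<omega> \<longleftrightarrow> (\<forall>i<d. \<bar>G_hat K g X n h u \<omega> i - G u i\<bar> \<le>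
     10 * sqrt (sigma2_K K * (Sig i i + \<epsilon>) / (real n * h) * ln (real n)) + 3 * mu_K K * (\<bar>curv i\<bar> + \<epsilon>) * (h0 n)\<^sup>2)"

lemma good_at_measurable:
  assumes "1 \<le> n" "0 < h"
  shows "{\<omega> \<in> space P. good_at \<epsilon> h0 n h \<omega>} \<in> events"
  unfolding good_at_def
proof -
  have [measurable]: "(\<lambda>\<omega>. G_hat K g X n h u \<omega> i) \<in> borel_measurable P" if "i < d" for i
    by (rule G_hat_measurable[OF assms that])
  have "{\<omega> \<in> space P. i < d \<longrightarrow> \<bar>G_hat K g X n h u \<omega> i - G u i\<bar> \<le> c i} \<in> events" for c i
    by (cases "i < d") auto
  from sets.sets_Collect_countable_All[OF this]
  show "{\<omega> \<in> space P. \<forall>i<d. \<bar>G_hat K g X n h u \<omega> i - G u i\<bar> \<le>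
     10 * sqrt (sigma2_K K * (Sig i i + \<epsilon>) / (real n * h) * ln (real n)) + 3 * mu_K K * (\<bar>curv i\<bar> + \<epsilon>) * (h0 n)\<^sup>2} \<in> events" .
qed

lemma good_at_probability:
  assumes eps: "0 < \<epsilon>"
    and h0: "(\<lambda>n. ln (real n) * (h0 n)\<^sup>2) \<longlonglongrightarrow> 0" "h0 \<longlonglongrightarrow> 0"
    and h0n: "filterlim (\<lambda>n. real n * (h0 n)\<^sup>2) at_top sequentially"
  shows "\<exists>C\<ge>0. \<forall>\<^sub>F n in sequentially. \<forall>h. 0 < h \<longrightarrow> ln (real n) powr (5 + 2 * \<alpha> * real M) / real n \<le> h \<longrightarrow> h \<le> h0 n \<longrightarrow>
    prob {\<omega> \<in> space P. \<not> good_at \<epsilon> h0 n h \<omega>} \<le> C / (real n)\<^sup>2"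
proof -
  let ?b = "\<lambda>i n h. 10 * sqrt (sigma2_K K * (Sig i i + \<epsilon>) / (real n * h) * ln (real n)) + 3 * mu_K K * (\<bar>curv i\<bar> + \<epsilon>) * (h0 n)\<^sup>2"
  let ?E = "\<lambda>i n h. {\<omega> \<in> space P. ?b i n h < \<bar>G_hat K g X n h u \<omega> i - G u i\<bar>}"
  define bounded_by where "bounded_by = (\<lambda>i C. \<forall>\<^sub>F n in sequentially. \<forall>h. 0 < h \<longrightarrow>
    ln (real n) powr (5 + 2 * \<alpha> * real M) / real n \<le> h \<longrightarrow> h \<le> h0 n \<longrightarrow> prob (?E i n h) \<le> C / (real n)\<^sup>2)"
  have ex: "\<exists>C\<ge>0. bounded_by i C" if i: "i < d" for i
  proof -
    obtain C where C: "0 \<le> C" and ev: "\<forall>\<^sub>F n in sequentially. \<forall>h. ln (real n) powr (5 + 2 * \<alpha> * real M) / real n \<le> h \<longrightarrow> h \<le> h0 n \<longrightarrow>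
      prob {\<omega> \<in> space P. ?b i n h < \<bar>ls_model.kernel_estimator X (gi i) K n h u \<omega> - G u i\<bar>} \<le> C / (real n)\<^sup>2"
      using ls_model.coordinate_risk[OF coordinate[OF i] u K eps G_smooth[OF i] G_eq_mean[OF i] h0 h0n]
      unfolding Sig_eq_lr_var[OF i] by blast
    have "bounded_by i C"
      unfolding bounded_by_def
      using ev eventually_ge_at_top[of 1]
    proof eventually_elim
      case (elim n)
      show ?case
      proof (intro allI impI)
        fix h assume h: "0 < h" "ln (real n) powr (5 + 2 * \<alpha> * real M) / real n \<le> h" "h \<le> h0 n"
        show "prob (?E i n h) \<le> C / (real n)\<^sup>2"
          unfolding G_hat_eq_kernel_estimator[OF elim(2) h(1) i] using elim(1) h by blast
      qed
    qed
    then show ?thesis using C by blast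
  qed
  obtain C where C: "\<And>i. i < d \<Longrightarrow> 0 \<le> C i" and ev: "\<And>i. i < d \<Longrightarrow> bounded_by i (C i)"
    using ex by metis
  have "\<forall>\<^sub>F n in sequentially. \<forall>i\<in>{..<d}. \<forall>h. 0 < h \<longrightarrow>
      ln (real n) powr (5 + 2 * \<alpha> * real M) / real n \<le> h \<longrightarrow> h \<le> h0 n \<longrightarrow> prob (?E i n h) \<le> C i / (real n)\<^sup>2"
    using ev unfolding bounded_by_def by (intro eventually_ball_finite) auto
  then have "\<forall>\<^sub>F n in sequentially. \<forall>h. 0 < h \<longrightarrow> ln (real n) powr (5 + 2 * \<alpha> * real M) / real n \<le> h \<longrightarrow> h \<le> h0 n \<longrightarrow>
    prob {\<omega> \<in> space P. \<not> good_at \<epsilon> h0 n h \<omega>} \<le> (\<Sum>i<d. C i) / (real n)\<^sup>2"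
    using eventually_ge_at_top[of 1]
  proof eventually_elim
    case (elim n)
    show ?case
    proof (intro allI impI)
      fix h assume h: "0 < h" "ln (real n) powr (5 + 2 * \<alpha> * real M) / real n \<le> h" "h \<le> h0 n"
      have m: "?E i n h \<in> events" if "i < d" for i
      proof -
        note [measurable] = G_hat_measurable[OF elim(2) h(1) that]
        show ?thesis by measurable
      qed
      have eq: "{\<omega> \<in> space P. \<not> good_at \<epsilon> h0 n h \<omega>} = (\<Union>i\<in>{..<d}. ?E i n h)"
        unfolding good_at_def not_all not_imp not_le lessThan_def by blast
      have "prob {\<omega> \<in> space P. \<not> good_at \<epsilon> h0 n h \<omega>} \<le> (\<Sum>i<d. prob (?E i n h))"
        unfolding eq
      proof (rule finite_measure_subadditive_finite[OF finite_lessThan], rule image_subsetI)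
        fix i assume "i \<in> {..<d}"
        then show "?E i n h \<in> events" by (intro m) (simp only: lessThan_iff)
      qed
      also have "\<dots> \<le> (\<Sum>i<d. C i / (real n)\<^sup>2)"
      proof (rule sum_mono)
        fix i assume "i \<in> {..<d}"
        from elim(1)[THEN bspec, OF this, THEN spec, THEN mp, OF h(1), THEN mp, OF h(2), THEN mp, OF h(3)] show "prob (?E i n h) \<le> C i / (real n)\<^sup>2" .
      qed
      finally show "prob {\<omega> \<in> space P. \<not> good_at \<epsilon> h0 n h \<omega>} \<le> (\<Sum>i<d. C i) / (real n)\<^sup>2" by (simp add: sum_divide_distrib)
    qed
  qed
  then show ?thesis using C by (intro exI[of _ "\<Sum>i<d. C i"]) (auto intro: sum_nonneg)
qed

text \<open>
  The coordinate bounds add up in the Euclidean norm: the variances to the trace, the biases to the norm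
  of the second derivative. The two smallness conditions on \<open>\<epsilon>\<close> cost the factors \<open>11/10\<close> and 2.
\<close>
lemma good_at_loss:
  assumes good: "good_at \<epsilon> h0 n h \<omega>" and eps: "0 \<le> \<epsilon>" and n: "1 \<le> n" and h: "0 < h"
    and e1: "real d * \<epsilon> \<le> tr d Sig / 10" and e2: "real d * \<epsilon> \<le> L2_set curv {..<d}"
  shows "L2_set (\<lambda>i. G_hat K g X n h u \<omega> i - G u i) {..<d}
    \<le> 10 * sqrt (11 / 10 * (sigma2_K K * tr d Sig * ln (real n) / (real n * h))) + 6 * mu_K K * L2_set curv {..<d} * (h0 n)\<^sup>2"
proof -
  let ?b = "\<lambda>i. 10 * sqrt (sigma2_K K * (Sig i i + \<epsilon>) / (real n * h) * ln (real n))"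
  let ?c = "\<lambda>i. 3 * mu_K K * (h0 n)\<^sup>2 * (\<bar>curv i\<bar> + \<epsilon>)"
  have \<sigma>: "0 < sigma2_K K" and \<mu>: "0 < mu_K K" using K by (auto intro: sigma2_K_pos mu_K_pos)
  have ln: "0 \<le> ln (real n)" using n by simp
  have b0: "0 \<le> sigma2_K K * (Sig i i + \<epsilon>) / (real n * h) * ln (real n)" if "i < d" for i
    using Sig_nonneg[OF that] \<sigma> ln h eps by simp
  have "L2_set (\<lambda>i. G_hat K g X n h u \<omega> i - G u i) {..<d} = L2_set (\<lambda>i. \<bar>G_hat K g X n h u \<omega> i - G u i\<bar>) {..<d}"
    by (simp add: L2_set_def)
  also have "\<dots> \<le> L2_set (\<lambda>i. ?b i + ?c i) {..<d}"
  proof (rule L2_set_mono)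
    fix i assume "i \<in> {..<d}"
    then have "\<bar>G_hat K g X n h u \<omega> i - G u i\<bar> \<le> ?b i + 3 * mu_K K * (\<bar>curv i\<bar> + \<epsilon>) * (h0 n)\<^sup>2"
      using good unfolding good_at_def by blast
    also have "3 * mu_K K * (\<bar>curv i\<bar> + \<epsilon>) * (h0 n)\<^sup>2 = ?c i" by simp
    finally show "\<bar>G_hat K g X n h u \<omega> i - G u i\<bar> \<le> ?b i + ?c i" .
  qed simp
  also have "\<dots> \<le> L2_set ?b {..<d} + L2_set ?c {..<d}" by (rule L2_set_triangle_ineq)
  finally have 1: "L2_set (\<lambda>i. G_hat K g X n h u \<omega> i - G u i) {..<d} \<le> L2_set ?b {..<d} + L2_set ?c {..<d}" .
  have "L2_set ?b {..<d} = sqrt (100 * (\<Sum>i<d. sigma2_K K * (Sig i i + \<epsilon>) / (real n * h) * ln (real n)))"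
    unfolding L2_set_def sum_distrib_left using b0 by (intro arg_cong[where f=sqrt] sum.cong) (auto simp: power_mult_distrib)
  also have "(\<Sum>i<d. sigma2_K K * (Sig i i + \<epsilon>) / (real n * h) * ln (real n))
    = sigma2_K K * (tr d Sig + real d * \<epsilon>) / (real n * h) * ln (real n)"
    unfolding tr_def by (simp add: sum_distrib_left[symmetric] sum_distrib_right[symmetric] sum_divide_distrib[symmetric] sum.distrib)
  also have "sqrt (100 * (sigma2_K K * (tr d Sig + real d * \<epsilon>) / (real n * h) * ln (real n)))
    \<le> sqrt (100 * (sigma2_K K * (11 / 10 * tr d Sig) / (real n * h) * ln (real n)))"
    using e1 \<sigma> ln h n by (intro real_sqrt_le_mono mult_left_mono mult_right_mono divide_right_mono) auto
  also have "\<dots> = 10 * sqrt (11 / 10 * (sigma2_K K * tr d Sig * ln (real n) / (real n * h)))"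
  proof -
    have "100 * (sigma2_K K * (11 / 10 * tr d Sig) / (real n * h) * ln (real n))
      = 10\<^sup>2 * (11 / 10 * (sigma2_K K * tr d Sig * ln (real n) / (real n * h)))" by simp
    then show ?thesis by (simp only: real_sqrt_mult real_sqrt_abs abs_numeral)
  qed
  finally have 2: "L2_set ?b {..<d} \<le> 10 * sqrt (11 / 10 * (sigma2_K K * tr d Sig * ln (real n) / (real n * h)))" .
  have "L2_set ?c {..<d} = 3 * mu_K K * (h0 n)\<^sup>2 * L2_set (\<lambda>i. \<bar>curv i\<bar> + \<epsilon>) {..<d}"
    using \<mu> by (intro L2_set_right_distrib[symmetric]) simp
  also have "L2_set (\<lambda>i. \<bar>curv i\<bar> + \<epsilon>) {..<d} \<le> L2_set (\<lambda>i. \<bar>curv i\<bar>) {..<d} + L2_set (\<lambda>i. \<epsilon>) {..<d}"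
    by (rule L2_set_triangle_ineq)
  also have "L2_set (\<lambda>i. \<bar>curv i\<bar>) {..<d} = L2_set curv {..<d}" by (simp add: L2_set_def)
  also have "L2_set (\<lambda>i. \<epsilon>) {..<d} \<le> real d * \<epsilon>"
  proof -
    have "L2_set (\<lambda>i. \<epsilon>) {..<d} \<le> (\<Sum>i<d. \<epsilon>)" using eps by (intro L2_set_le_sum)
    then show ?thesis by simp
  qed
  finally have "L2_set ?c {..<d} \<le> 3 * mu_K K * (h0 n)\<^sup>2 * (L2_set curv {..<d} + real d * \<epsilon>)"
    using \<mu> by (simp add: mult_left_mono)
  also have "\<dots> \<le> 3 * mu_K K * (h0 n)\<^sup>2 * (L2_set curv {..<d} + L2_set curv {..<d})"
    using e2 \<mu> by (intro mult_left_mono) auto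
  also have "\<dots> = 6 * mu_K K * L2_set curv {..<d} * (h0 n)\<^sup>2" by simp
  finally show ?thesis using 1 2 by linarith
qed

end

lemma max_norm_gt_iff: "1 \<le> d \<Longrightarrow> \<epsilon> < max_norm d A \<longleftrightarrow> (\<exists>i<d. \<exists>j<d. \<epsilon> < \<bar>A i j\<bar>)"
proof -
  assume d: "1 \<le> d"
  have eq: "{\<bar>A i j\<bar> | i j. i < d \<and> j < d} = (\<lambda>(i, j). \<bar>A i j\<bar>) ` ({..<d} \<times> {..<d})" by auto
  have "{..<d} \<noteq> {}" using d by (auto simp: lessThan_empty_iff)
  then show ?thesis unfolding max_norm_def eq by (subst Max_gr_iff) auto
qed

text \<open>
  The trace is off by at most \<open>d\<close> times the maximal entry. The event for the maximal entry is a finite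
  union over the entries and therefore measurable.
\<close>
lemma (in prob_space) trace_estimate_consistent:
  fixes d Sigh
  assumes V: "assumption_V d M Sg Sigh" and d: "1 \<le> d" and u: "u \<in> {0..1}" and eps: "0 < \<epsilon>"
  shows "\<exists>C\<ge>0. \<forall>\<^sub>F n in sequentially. {\<omega> \<in> space M. \<bar>tr d (Sigh n u \<omega>) - tr d (Sg u)\<bar> \<le> \<epsilon>} \<in> events \<and>
     prob {\<omega> \<in> space M. \<not> \<bar>tr d (Sigh n u \<omega>) - tr d (Sg u)\<bar> \<le> \<epsilon>} \<le> C / (real n)\<^sup>2"
proof -
  define e where "e = \<epsilon> / real d"
  have e: "0 < e" using eps d by (simp add: e_def)
  let ?B = "\<lambda>n. {\<omega> \<in> space M. e < max_norm d (\<lambda>i j. Sigh n u \<omega> i j - Sg u i j)}"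
  have m: "\<And>n i j. 1 \<le> n \<Longrightarrow> i < d \<Longrightarrow> j < d \<Longrightarrow> (\<lambda>\<omega>. Sigh n u \<omega> i j) \<in> borel_measurable M"
    and O: "(\<lambda>n. prob (?B n)) \<in> O(\<lambda>n. 1 / real n ^ 2)"
    using V u e unfolding assumption_V_def by blast+
  obtain c where "0 < c" and c: "\<forall>\<^sub>F n in sequentially. norm (prob (?B n)) \<le> c * norm (1 / real n ^ 2)"
    using O by (elim landau_o.bigE)
  have "\<forall>\<^sub>F n in sequentially. {\<omega> \<in> space M. \<bar>tr d (Sigh n u \<omega>) - tr d (Sg u)\<bar> \<le> \<epsilon>} \<in> events \<and>
     prob {\<omega> \<in> space M. \<not> \<bar>tr d (Sigh n u \<omega>) - tr d (Sg u)\<bar> \<le> \<epsilon>} \<le> c / (real n)\<^sup>2"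
    using c eventually_ge_at_top[of 1]
  proof eventually_elim
    case (elim n)
    have mt: "(\<lambda>\<omega>. tr d (Sigh n u \<omega>)) \<in> borel_measurable M" unfolding tr_def using m[OF elim(2)] by simp
    have BE: "?B n = (\<Union>i<d. \<Union>j<d. {\<omega> \<in> space M. e < \<bar>Sigh n u \<omega> i j - Sg u i j\<bar>})"
      by (auto simp: max_norm_gt_iff[OF d])
    have "{\<omega> \<in> space M. e < \<bar>Sigh n u \<omega> i j - Sg u i j\<bar>} \<in> events" if "i < d" "j < d" for i j
    proof -
      note [measurable] = m[OF elim(2) that]
      show ?thesis by measurable
    qed
    then have BM: "?B n \<in> events" unfolding BE by (intro sets.finite_UN) auto
    have sub: "{\<omega> \<in> space M. \<not> \<bar>tr d (Sigh n u \<omega>) - tr d (Sg u)\<bar> \<le> \<epsilon>} \<subseteq> ?B n"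
    proof (rule subsetI, rule ccontr)
      fix \<omega> assume w: "\<omega> \<in> {\<omega> \<in> space M. \<not> \<bar>tr d (Sigh n u \<omega>) - tr d (Sg u)\<bar> \<le> \<epsilon>}" and nB: "\<omega> \<notin> ?B n"
      have le: "\<bar>Sigh n u \<omega> i i - Sg u i i\<bar> \<le> e" if "i < d" for i
        using w nB that unfolding BE by force
      have "\<bar>tr d (Sigh n u \<omega>) - tr d (Sg u)\<bar> \<le> (\<Sum>i<d. \<bar>Sigh n u \<omega> i i - Sg u i i\<bar>)"
        unfolding tr_def sum_subtractf[symmetric] by (rule sum_abs)
      also have "\<dots> \<le> (\<Sum>i<d. e)" using le by (intro sum_mono) auto
      also have "\<dots> = \<epsilon>" using d by (simp add: e_def)
      finally show False using w by simp
    qed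
    have "prob {\<omega> \<in> space M. \<not> \<bar>tr d (Sigh n u \<omega>) - tr d (Sg u)\<bar> \<le> \<epsilon>} \<le> prob (?B n)"
      by (rule finite_measure_mono[OF sub BM])
    also have "\<dots> \<le> c / (real n)\<^sup>2" using elim(1) by simp
    finally show ?case using mt by simp
  qed
  then show ?thesis using \<open>0 < c\<close> by (intro exI[of _ c]) simp
qed

section \<open>Risk at the selected bandwidth\<close>

text \<open>
  The numerical form of the error: \<open>y\<close> is the variance times \<open>log n\<close> at the bandwidth considered, \<open>y0\<close> the
  same at \<open>h0\<close>, and \<open>q\<close> the bias.
\<close>
lemma loss_constant:
  fixes y y0 q :: real
  assumes "0 \<le> y0" "y0 \<le> y" "0 \<le> q" "q\<^sup>2 = 9 / 8 * y0"
  shows "10 * sqrt (11 / 10 * y) + q \<le> 58 / 5 * sqrt y"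
proof -
  have y: "0 \<le> y" using assms by linarith
  have "sqrt (11 / 10 * y) \<le> sqrt ((21 / 20)\<^sup>2 * y)" using y by (intro real_sqrt_le_mono mult_right_mono) (auto simp: power2_eq_square)
  also have "\<dots> = 21 / 20 * sqrt y" by (simp only: real_sqrt_mult real_sqrt_abs abs_divide abs_numeral)
  finally have 1: "sqrt (11 / 10 * y) \<le> 21 / 20 * sqrt y" .
  have "q = sqrt (9 / 8 * y0)" using assms by (metis real_sqrt_unique)
  also have "\<dots> \<le> sqrt ((107 / 100)\<^sup>2 * y)" using assms y by (intro real_sqrt_le_mono mult_mono) (auto simp: power2_eq_square)
  also have "\<dots> = 107 / 100 * sqrt y" by (simp only: real_sqrt_mult real_sqrt_abs abs_divide abs_numeral)
  finally have 2: "q \<le> 107 / 100 * sqrt y" .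
  have "0 \<le> sqrt y" using y by simp
  then show ?thesis using 1 2 by linarith
qed

text \<open>
  Why 64 suffices: the threshold must exceed twice the error, that is \<open>23.2 \<surd>y\<close>. The estimated trace costs
  a factor \<open>\<surd>0.81\<close> and \<open>\<lambda>(h)\<close> is at least \<open>\<surd>(2/11 log n)\<close>, together at least \<open>0.38\<close>, and
  \<open>64 \<cdot> 0.38 = 24.32\<close>.
\<close>
lemma threshold_lower:
  fixes z T tr L l Cs :: real
  assumes z: "0 \<le> z" and T: "0 \<le> T" "81 / 100 * T \<le> tr" and Cs: "64 \<le> Cs" and L: "0 \<le> L" "2 / 11 * L \<le> l"
  shows "2 * (58 / 5 * sqrt (z * T * L)) \<le> Cs * sqrt (z * tr) * max 1 (sqrt l)"
proof -
  let ?y = "z * T * L"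
  have y: "0 \<le> ?y" using z T L by simp
  have "38 / 100 * sqrt ?y = sqrt ((38 / 100)\<^sup>2 * ?y)" by (simp only: real_sqrt_mult real_sqrt_abs abs_divide abs_numeral)
  also have "\<dots> \<le> sqrt ((81 / 100 * (2 / 11)) * ?y)" using y by (intro real_sqrt_le_mono mult_right_mono) (auto simp: power2_eq_square)
  also have "(81 / 100 * (2 / 11)) * ?y = (z * (81 / 100 * T)) * (2 / 11 * L)" by simp
  also have "sqrt \<dots> = sqrt (z * (81 / 100 * T)) * sqrt (2 / 11 * L)" by (rule real_sqrt_mult)
  also have "\<dots> \<le> sqrt (z * tr) * max 1 (sqrt l)"
  proof (rule mult_mono)
    show "sqrt (z * (81 / 100 * T)) \<le> sqrt (z * tr)" using z T by (intro real_sqrt_le_mono mult_left_mono) auto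
    have "sqrt (2 / 11 * L) \<le> sqrt l" using L by (intro real_sqrt_le_mono) auto
    then show "sqrt (2 / 11 * L) \<le> max 1 (sqrt l)" by (rule max.coboundedI2)
    have "0 \<le> tr" using T by linarith
    then show "0 \<le> sqrt (z * tr)" using z by simp
    show "0 \<le> sqrt (2 / 11 * L)" using L by simp
  qed
  finally have 1: "38 / 100 * sqrt ?y \<le> sqrt (z * tr) * max 1 (sqrt l)" .
  have "0 \<le> sqrt ?y" using y by simp
  then have "2 * (58 / 5 * sqrt ?y) \<le> 64 * (38 / 100 * sqrt ?y)" by simp
  also have "\<dots> \<le> Cs * (sqrt (z * tr) * max 1 (sqrt l))" by (rule mult_mono[OF Cs 1]) (use Cs \<open>0 \<le> sqrt ?y\<close> in auto)
  finally show ?thesis by (simp add: mult.assoc)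
qed

text \<open>
  At the oracle bandwidth the threshold is of the order of the error, since \<open>\<lambda>(h)\<^sup>2 \<le> log n\<close> on the grid.
\<close>
lemma threshold_upper:
  fixes z T tr L l Cs :: real
  assumes z: "0 \<le> z" and T: "0 \<le> T" "tr \<le> 119 / 100 * T" and Cs: "0 \<le> Cs" and L: "1 \<le> L" "l \<le> L"
  shows "Cs * sqrt (z * tr) * max 1 (sqrt l) \<le> 11 / 10 * Cs * sqrt (z * T * L)"
proof -
  have m: "max 1 (sqrt l) \<le> sqrt L" using L by simp
  have "sqrt (z * tr) \<le> sqrt ((11 / 10)\<^sup>2 * (z * T))"
  proof (rule real_sqrt_le_mono)
    have "z * tr \<le> z * (119 / 100 * T)" using z T by (intro mult_left_mono)
    also have "\<dots> \<le> z * ((11 / 10)\<^sup>2 * T)" using z T by (intro mult_left_mono mult_right_mono) (auto simp: power2_eq_square)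
    finally show "z * tr \<le> (11 / 10)\<^sup>2 * (z * T)" by (simp add: mult_ac)
  qed
  also have "\<dots> = 11 / 10 * sqrt (z * T)" by (simp only: real_sqrt_mult real_sqrt_abs abs_divide abs_numeral)
  finally have "sqrt (z * tr) * max 1 (sqrt l) \<le> (11 / 10 * sqrt (z * T)) * sqrt L"
    using m z T by (intro mult_mono) auto
  then have "Cs * (sqrt (z * tr) * max 1 (sqrt l)) \<le> Cs * ((11 / 10 * sqrt (z * T)) * sqrt L)"
    using Cs by (rule mult_left_mono)
  then show ?thesis by (simp add: real_sqrt_mult mult_ac)
qed

context vector_model
begin

text \<open>
  The deterministic core. With \<open>y(h) = \<sigma>\<^sub>K\<^sup>2 tr \<Sigma>(u) log n / (n h)\<close>, errors are at most \<open>58/5 \<surd>y(h)\<close> for \<open>h \<le> hs\<close>,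
  thresholds at least twice that for \<open>h < hs\<close>, and the threshold at \<open>hs\<close> is at most \<open>11/10 C\<^sup># \<surd>y(hs)\<close>, so the loss at the selected bandwidth is at
  most \<open>2 C\<^sup># \<surd>y(hs)\<close>. Since \<open>hs > a h0\<close>, \<open>y(hs)\<close> is at most \<open>2/a\<close> times the rate.
\<close>
lemma selected_loss_on_good_event:
  fixes hl :: real
  assumes a: "0 < a" "a < 1" and Cs: "64 \<le> Cs" and n: "1 \<le> n" and L: "1 \<le> ln (real n)"
    and T: "0 < tr d Sig" and c2: "0 < L2_set curv {..<d}"
    and h0: "h0 n = (sigma2_K K * tr d Sig * ln (real n) / real n / (32 * ((mu_K K)\<^sup>2 * (L2_set curv {..<d})\<^sup>2))) powr (1 / 5)"
    and h0L: "ln (real n) \<le> 11 / 2 * ln (1 / h0 n)" and hl: "1 / real n \<le> hl"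
    and hs: "hs \<in> bw_grid a hl" "a * h0 n < hs" "hs \<le> h0 n"
    and eps: "0 \<le> \<epsilon>" "real d * \<epsilon> \<le> tr d Sig / 10" "real d * \<epsilon> \<le> L2_set curv {..<d}"
    and good: "\<And>h. h \<in> bw_grid a hl \<Longrightarrow> h \<le> hs \<Longrightarrow> good_at \<epsilon> h0 n h \<omega>"
    and trace: "\<bar>tr d (Sigh n u \<omega>) - tr d Sig\<bar> \<le> 19 / 100 * tr d Sig"
  shows "(L2_set (\<lambda>i. G_hat K g X n (h_hat d a hl Cs K g X Sigh n u \<omega>) u \<omega> i - G u i) {..<d})\<^sup>2
    \<le> 8 * Cs\<^sup>2 / a * ((sigma2_K K * tr d Sig) powr (4 / 5) * ((mu_K K)\<^sup>2 * (L2_set curv {..<d})\<^sup>2) powr (1 / 5) * (ln (real n) / real n) powr (4 / 5))"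
proof -
  define \<sigma> T \<mu> c2 L where "\<sigma> = sigma2_K K" and "T = tr d Sig" and "\<mu> = mu_K K" and "c2 = L2_set curv {..<d}" and "L = ln (real n)"
  note defs = \<sigma>_def T_def \<mu>_def c2_def L_def
  have pos: "0 < \<sigma>" "0 < T" "0 < \<mu>" "0 < c2" "1 \<le> L" "0 < real n"
    using K assms(6,5,7) n by (auto simp: defs intro: sigma2_K_pos mu_K_pos)
  define m where "m = \<mu>\<^sup>2 * c2\<^sup>2"
  define x where "x = \<sigma> * T * L / real n"
  have m: "0 < m" and x: "0 < x" using pos by (auto simp: m_def x_def)
  have h0x: "h0 n = (x / (32 * m)) powr (1 / 5)" unfolding h0 x_def m_def defs ..
  note bal = balanced_bandwidth[OF x m, folded h0x]
  define rate where "rate = (\<sigma> * T) powr (4 / 5) * m powr (1 / 5) * (L / real n) powr (4 / 5)"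
  have xr: "x / h0 n = 2 * rate"
  proof -
    have "x powr (4 / 5) = (\<sigma> * T * (L / real n)) powr (4 / 5)" by (simp add: x_def)
    then have "x powr (4 / 5) = (\<sigma> * T) powr (4 / 5) * (L / real n) powr (4 / 5)" by (simp only: powr_mult)
    then show ?thesis unfolding bal(1) rate_def by simp
  qed
  let ?grid = "bw_grid a hl"
  have hpos: "0 < h" if "h \<in> ?grid" for h
  proof -
    have "0 < 1 / real n" using pos by simp
    moreover have "hl \<le> h" using that by (simp add: bw_grid_def)
    ultimately show ?thesis using hl by linarith
  qed
  define loss where "loss = (\<lambda>h. L2_set (\<lambda>i. G_hat K g X n h u \<omega> i - G u i) {..<d})"
  define y where "y = (\<lambda>h. \<sigma> / (real n * h) * T * L)"
  have yx: "y h = x / h" for h by (simp add: y_def x_def)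
  have y_mono: "y h' \<le> y h" if "0 < h" "h \<le> h'" for h h'
    unfolding yx using that x by (intro divide_left_mono) auto
  have err: "loss h \<le> 58 / 5 * sqrt (y h)" if h: "h \<in> ?grid" "h \<le> hs" for h
  proof -
    have "loss h \<le> 10 * sqrt (11 / 10 * (\<sigma> * T * L / (real n * h))) + 6 * \<mu> * c2 * (h0 n)\<^sup>2"
      unfolding loss_def defs by (rule good_at_loss[OF good[OF h] eps(1) n hpos[OF h(1)] eps(2,3)])
    also have "\<sigma> * T * L / (real n * h) = y h" by (simp add: y_def)
    also have "10 * sqrt (11 / 10 * y h) + 6 * \<mu> * c2 * (h0 n)\<^sup>2 \<le> 58 / 5 * sqrt (y h)"
    proof (rule loss_constant)
      show "0 \<le> y (h0 n)" unfolding yx using x bal(3) by simp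
      show "y (h0 n) \<le> y h" using hpos[OF h(1)] h(2) hs(3) by (intro y_mono) auto
      show "0 \<le> 6 * \<mu> * c2 * (h0 n)\<^sup>2" using pos by simp
      have "(6 * \<mu> * c2 * (h0 n)\<^sup>2)\<^sup>2 = 36 * (m * (h0 n) ^ 4)" unfolding m_def by (simp add: power_mult_distrib)
      also have "\<dots> = 9 / 8 * y (h0 n)" unfolding bal(2) yx by simp
      finally show "(6 * \<mu> * c2 * (h0 n)\<^sup>2)\<^sup>2 = 9 / 8 * y (h0 n)" .
    qed
    finally show ?thesis .
  qed
  define thr where "thr = (\<lambda>h. Cs * v_hat d K Sigh n h u \<omega> * lambda_bw h)"
  have thr_fold: "Cs * v_hat d K Sigh n h u \<omega> * lambda_bw h = thr h" for h by (simp add: thr_def)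
  have thr_eq: "thr h = Cs * sqrt (\<sigma> / (real n * h) * tr d (Sigh n u \<omega>)) * max 1 (sqrt (ln (1 / h)))" for h
    by (simp add: thr_def v_hat_def lambda_bw_def \<sigma>_def)
  have tr: "81 / 100 * T \<le> tr d (Sigh n u \<omega>)" "tr d (Sigh n u \<omega>) \<le> 119 / 100 * T"
    using trace unfolding T_def[symmetric] by linarith+
  have low: "2 * (58 / 5 * sqrt (y h)) \<le> thr h" if h: "h \<in> ?grid" "h < hs" for h
    unfolding thr_eq y_def
  proof (rule threshold_lower[OF _ _ tr(1) Cs])
    have "ln (1 / h0 n) \<le> ln (1 / h)" using hpos[OF h(1)] h(2) hs(3) bal(3) by (subst ln_le_cancel_iff) (auto intro!: divide_left_mono)
    then show "2 / 11 * L \<le> ln (1 / h)" using h0L unfolding L_def[symmetric] by linarith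
    show "0 \<le> \<sigma> / (real n * h)" "0 \<le> T" "0 \<le> L" using pos hpos[OF h(1)] by auto
  qed
  have up: "thr hs \<le> 11 / 10 * Cs * sqrt (y hs)"
    unfolding thr_eq y_def
  proof (rule threshold_upper[OF _ _ tr(2) _ pos(5)])
    have "1 / real n \<le> hs" using hs(1) hl by (auto simp: bw_grid_def)
    then have "1 / hs \<le> real n" using hpos[OF hs(1)] pos by (simp add: field_simps)
    then show "ln (1 / hs) \<le> L" unfolding L_def using hpos[OF hs(1)] pos by (subst ln_le_cancel_iff) auto
    show "0 \<le> \<sigma> / (real n * hs)" "0 \<le> T" "0 \<le> Cs" using pos hpos[OF hs(1)] Cs by auto
  qed
  have y0: "0 \<le> y hs" unfolding yx using x hpos[OF hs(1)] by simp
  define hh where "hh = h_hat d a hl Cs K g X Sigh n u \<omega>"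
  have "loss hh \<le> thr hs + 58 / 5 * sqrt (y hs)"
    unfolding loss_def hh_def h_hat_def thr_fold
  proof (rule Lepski_oracle_inequality[where est = "\<lambda>h. G_hat K g X n h u \<omega>" and G = "G u" and E = "\<lambda>h. 58 / 5 * sqrt (y h)" and hs = hs])
    show "finite ?grid" by (rule bw_grid_card(1)[OF a L hl])
    show "58 / 5 * sqrt (y hs) \<le> 58 / 5 * sqrt (y h)" if "h \<in> ?grid" "h < hs" for h
      using y_mono[of h hs] hpos[OF that(1)] that(2) by simp
    show "0 \<le> thr hs"
    proof -
      have "0 \<le> tr d (Sigh n u \<omega>)" using tr(1) pos(2) by linarith
      then show ?thesis unfolding thr_eq using Cs pos hpos[OF hs(1)] by (intro mult_nonneg_nonneg) auto
    qed
    show "L2_set (\<lambda>i. G_hat K g X n h u \<omega> i - G u i) {..<d} \<le> 58 / 5 * sqrt (y h)" if "h \<in> ?grid" "h \<le> hs" for h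
      using err[OF that] unfolding loss_def .
  qed (use hs(1) low in auto)
  also have "\<dots> \<le> 2 * Cs * sqrt (y hs)"
  proof -
    have "58 / 5 * sqrt (y hs) \<le> 9 / 10 * Cs * sqrt (y hs)" using Cs y0 by (intro mult_right_mono) auto
    then show ?thesis using up by (simp add: algebra_simps)
  qed
  finally have "(loss hh)\<^sup>2 \<le> (2 * Cs * sqrt (y hs))\<^sup>2" by (intro power_mono) (auto simp: loss_def)
  also have "\<dots> = 4 * Cs\<^sup>2 * y hs" using y0 by (simp add: power_mult_distrib)
  also have "\<dots> \<le> 4 * Cs\<^sup>2 * (x / (a * h0 n))"
    unfolding yx using x hs(2) a bal(3) hpos[OF hs(1)] by (intro mult_left_mono divide_left_mono) auto
  also have "x / (a * h0 n) = 2 * rate / a" unfolding xr[symmetric] by simp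
  also have "4 * Cs\<^sup>2 * (2 * rate / a) = 8 * Cs\<^sup>2 / a * rate" by simp
  finally show ?thesis unfolding loss_def hh_def rate_def m_def defs .
qed

text \<open>
  The smallest grid point passes vacuously, so the supremum is over a nonempty finite set and attained. This
  holds for every outcome, also where the estimated trace is negative.
\<close>
lemma h_hat_in_grid:
  assumes fin: "finite (bw_grid a hl)" and ne: "bw_grid a hl \<noteq> {}"
  shows "h_hat d a hl Cs K g X Sigh n u \<omega> \<in> bw_grid a hl"
proof -
  define B where "B = {h \<in> bw_grid a hl. \<forall>h'\<in>bw_grid a hl. h' < h \<longrightarrow>
           L2_set (\<lambda>i. G_hat K g X n h u \<omega> i - G_hat K g X n h' u \<omega> i) {..<d}
             \<le> Cs * v_hat d K Sigh n h' u \<omega> * lambda_bw h'}"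
  have "\<not> h' < Min (bw_grid a hl)" if "h' \<in> bw_grid a hl" for h' using Min_le[OF fin that] by linarith
  then have "Min (bw_grid a hl) \<in> B" using Min_in[OF fin ne] unfolding B_def by blast
  moreover have "finite B" using fin by (simp add: B_def)
  ultimately have "Sup B = Max B" "Max B \<in> B" by (auto intro: cSup_eq_Max Max_in)
  then show ?thesis unfolding h_hat_def B_def[symmetric] by (auto simp: B_def)
qed

text \<open>
  The good event consists of \<open>good_at\<close> for the \<open>O(log n)\<close> grid points below \<open>hs\<close> and of an estimated trace
  within 19 percent of the true one.
\<close>
lemma selected_bandwidth_risk:
  assumes V: "assumption_V d P (Sigma_lr P g (shift_process H \<zeta>)) Sigh" and a: "0 < a" "a < 1" and Cs: "64 \<le> Cs"
    and curv: "L2_set curv {..<d} \<noteq> 0" and tr: "tr d Sig \<noteq> 0" and alpha: "0 \<le> \<alpha>"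
  defines "hl \<equiv> \<lambda>n. ln (real n) powr (5 + 2 * \<alpha> * real M) / real n"
  shows "\<forall>\<^sub>F n in sequentially.
    (\<integral>\<^sup>+ \<omega>. ennreal ((L2_set (\<lambda>i. G_hat K g X n (h_hat d a (hl n) Cs K g X Sigh n u \<omega>) u \<omega> i - G u i) {..<d})\<^sup>2) \<partial>P)
    \<le> ennreal ((8 * Cs\<^sup>2 / a + 1) * ((sigma2_K K * tr d Sig) powr (4 / 5) * ((mu_K K)\<^sup>2 * (L2_set curv {..<d})\<^sup>2) powr (1 / 5) * (ln (real n) / real n) powr (4 / 5)))"
proof -
  define \<sigma> T \<mu> c2 where "\<sigma> = sigma2_K K" and "T = tr d Sig" and "\<mu> = mu_K K" and "c2 = L2_set curv {..<d}"
  note defs = \<sigma>_def T_def \<mu>_def c2_def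
  have "0 \<le> T" unfolding T_def tr_def using Sig_nonneg by (intro sum_nonneg) auto
  moreover have "0 \<le> c2" by (simp add: c2_def)
  ultimately have pos: "0 < \<sigma>" "0 < T" "0 < \<mu>" "0 < c2"
    using tr curv sigma2_K_pos[OF K] mu_K_pos[OF K] unfolding defs by linarith+
  define m where "m = \<mu>\<^sup>2 * c2\<^sup>2"
  have m: "0 < m" using pos by (simp add: m_def)
  define A0 where "A0 = \<sigma> * T / (32 * m)"
  have A0: "0 < A0" using pos m by (simp add: A0_def)
  define h0 where "h0 = (\<lambda>n. (A0 * (ln (real n) / real n)) powr (1 / 5))"
  have scale: "(\<lambda>n. ln (real n) * (h0 n)\<^sup>2) \<longlonglongrightarrow> 0" "h0 \<longlonglongrightarrow> 0"
    "filterlim (\<lambda>n. real n * (h0 n)\<^sup>2) at_top sequentially"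
    "\<forall>\<^sub>F n in sequentially. ln (real n) \<le> 11 / 2 * ln (1 / h0 n)"
    "\<forall>\<^sub>F n in sequentially. ln (real n) powr (5 + 2 * \<alpha> * real M) / real n \<le> a * h0 n"
    "\<forall>\<^sub>F n in sequentially. 0 < h0 n \<and> h0 n < 1"
    unfolding h0_def by (rule bandwidth_scale[OF A0 a(1)])+
  define \<epsilon> where "\<epsilon> = min (T / 10) c2 / real d"
  have eps: "0 < \<epsilon>" "real d * \<epsilon> \<le> T / 10" "real d * \<epsilon> \<le> c2" using pos d by (auto simp: \<epsilon>_def)
  obtain Cg where Cg: "0 \<le> Cg" and evg: "\<forall>\<^sub>F n in sequentially. \<forall>h. 0 < h \<longrightarrow> hl n \<le> h \<longrightarrow> h \<le> h0 n \<longrightarrow>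
    prob {\<omega> \<in> space P. \<not> good_at \<epsilon> h0 n h \<omega>} \<le> Cg / (real n)\<^sup>2"
    using good_at_probability[OF eps(1) scale(1,2,3)] unfolding hl_def by blast
  have u01: "u \<in> {0..1}" using u by simp
  have T19: "0 < 19 / 100 * T" using pos by simp
  obtain Ct where Ct: "0 \<le> Ct" and evt: "\<forall>\<^sub>F n in sequentially. {\<omega> \<in> space P. \<bar>tr d (Sigh n u \<omega>) - T\<bar> \<le> 19 / 100 * T} \<in> events \<and>
     prob {\<omega> \<in> space P. \<not> \<bar>tr d (Sigh n u \<omega>) - T\<bar> \<le> 19 / 100 * T} \<le> Ct / (real n)\<^sup>2"
    using trace_estimate_consistent[OF V d u01 T19] unfolding T_def by blast
  obtain Vm where Vm: "0 \<le> Vm" and mom: "\<And>n h. 1 \<le> n \<Longrightarrow> 0 < h \<Longrightarrow>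
    (\<integral>\<^sup>+ \<omega>. ennreal (((L2_set (\<lambda>i. G_hat K g X n h u \<omega> i - G u i) {..<d})\<^sup>2)\<^sup>2) \<partial>P) \<le> ennreal Vm"
    using squared_loss_moment by blast
  define ca where "ca = 1 / ln (1 / a) + 1"
  have ca: "0 \<le> ca" using a by (simp add: ca_def)
  define C3 where "C3 = ca * (Vm + Ct + ca * Cg)"
  define R where "R = (\<sigma> * T) powr (4 / 5) * m powr (1 / 5)"
  have R: "0 < R" using pos m by (simp add: R_def)
  have lninf: "filterlim (\<lambda>n. ln (real n)) at_top sequentially"
    by (rule filterlim_compose[OF ln_at_top filterlim_real_sequentially])
  have ev1: "\<forall>\<^sub>F n in sequentially. 1 \<le> ln (real n)" using lninf by (simp add: filterlim_at_top)
  show ?thesis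
    using evg evt scale(4) scale(5) scale(6) ev1 eventually_ge_at_top[of 1] remainder_below_rate[OF R, of C3]
  proof eventually_elim
    case (elim n)
    define L where "L = ln (real n)"
    have n: "1 \<le> n" "0 < real n" using elim(7) by auto
    have L: "1 \<le> L" using elim(6) by (simp add: L_def)
    have hl1: "1 / real n \<le> hl n"
      unfolding hl_def using elim(6) n alpha by (intro divide_right_mono ge_one_powr_ge_zero) auto
    have hla: "hl n \<le> a * h0 n" using elim(4) by (simp add: hl_def)
    define grid where "grid = bw_grid a (hl n)"
    have fin: "finite grid" and card: "real (card grid) \<le> ca * L"
      using bw_grid_card[OF a elim(6) hl1] by (auto simp: grid_def ca_def L_def)
    obtain hs where hs: "hs \<in> grid" "a * h0 n < hs" "hs \<le> h0 n"
      using bw_grid_near[OF a _ _ hla] elim(5) unfolding grid_def by blast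
    have hpos: "0 < h" "hl n \<le> h" if "h \<in> grid" for h
    proof -
      show "hl n \<le> h" using that by (simp add: grid_def bw_grid_def)
      moreover have "0 < 1 / real n" using n by simp
      ultimately show "0 < h" using hl1 by linarith
    qed
    define low where "low = {h \<in> grid. h \<le> hs}"
    have low: "finite low" "low \<noteq> {}" "low \<subseteq> grid" using fin hs(1) by (auto simp: low_def)
    define Tr where "Tr = {\<omega> \<in> space P. \<bar>tr d (Sigh n u \<omega>) - T\<bar> \<le> 19 / 100 * T}"
    define Gd where "Gd = (\<lambda>h. {\<omega> \<in> space P. good_at \<epsilon> h0 n h \<omega>})"
    define good where "good = Tr \<inter> (\<Inter>h\<in>low. Gd h)"
    have Tr: "Tr \<in> events" using elim(2) by (simp add: Tr_def)
    have Gd: "Gd h \<in> events" if "h \<in> low" for h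
      unfolding Gd_def using that low(3) hpos n by (intro good_at_measurable) auto
    have good: "good \<in> events" unfolding good_def using Tr Gd low by (intro sets.Int sets.finite_INT) auto
    (* One failure probability O(1 / n ^ 2) per grid point, and one for the trace. *)
    define p where "p = Ct / (real n)\<^sup>2 + ca * L * (Cg / (real n)\<^sup>2)"
    have p: "prob (space P - good) \<le> p"
    proof -
      have eq: "space P - good = (space P - Tr) \<union> (\<Union>h\<in>low. space P - Gd h)" by (auto simp: good_def)
      have "prob (space P - good) \<le> prob (space P - Tr) + prob (\<Union>h\<in>low. space P - Gd h)"
      proof -
        have "(\<Union>h\<in>low. space P - Gd h) \<in> events" using Gd low(1) by (intro sets.finite_UN) auto
        then show ?thesis unfolding eq using Tr by (intro measure_Un_le) auto
      qed
      also have "prob (\<Union>h\<in>low. space P - Gd h) \<le> (\<Sum>h\<in>low. prob (space P - Gd h))"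
        using Gd low(1) by (intro finite_measure_subadditive_finite) auto
      also have "\<dots> \<le> (\<Sum>h\<in>low. Cg / (real n)\<^sup>2)"
      proof (rule sum_mono)
        fix h assume h: "h \<in> low"
        have h': "0 < h" "hl n \<le> h" "h \<le> h0 n" using h low(3) hpos hs(3) by (auto simp: low_def)
        have "space P - Gd h = {\<omega> \<in> space P. \<not> good_at \<epsilon> h0 n h \<omega>}" by (auto simp: Gd_def)
        then show "prob (space P - Gd h) \<le> Cg / (real n)\<^sup>2" using elim(1) h' by simp
      qed
      also have "\<dots> = real (card low) * (Cg / (real n)\<^sup>2)" by simp
      also have "\<dots> \<le> ca * L * (Cg / (real n)\<^sup>2)"
      proof (rule mult_right_mono)
        have "real (card low) \<le> real (card grid)" using fin low(3) by (simp add: card_mono)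
        then show "real (card low) \<le> ca * L" using card by linarith
      qed (use Cg in simp)
      also have "prob (space P - Tr) \<le> Ct / (real n)\<^sup>2"
      proof -
        have "space P - Tr = {\<omega> \<in> space P. \<not> \<bar>tr d (Sigh n u \<omega>) - T\<bar> \<le> 19 / 100 * T}" by (auto simp: Tr_def)
        then show ?thesis using elim(2) by simp
      qed
      finally show ?thesis by (simp add: p_def)
    qed
    define N where "N = (\<lambda>h \<omega>. (L2_set (\<lambda>i. G_hat K g X n h u \<omega> i - G u i) {..<d})\<^sup>2)"
    define hh where "hh = h_hat d a (hl n) Cs K g X Sigh n u"
    define rate where "rate = R * (L / real n) powr (4 / 5)"
    have rate0: "0 \<le> rate" using R by (simp add: rate_def)
    have "(\<integral>\<^sup>+ \<omega>. ennreal (N (hh \<omega>) \<omega>) \<partial>P) \<le> ennreal (8 * Cs\<^sup>2 / a * rate + real (card grid) * (Vm / real n + real n * p))"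
    proof (rule expectation_split_on_good_event[OF _ _ good _ _ _ Vm _ n(2) p])
      fix \<omega> assume w: "\<omega> \<in> good"
      have g: "good_at \<epsilon> h0 n h \<omega>" if "h \<in> bw_grid a (hl n)" "h \<le> hs" for h
        using w that by (auto simp: good_def low_def grid_def Gd_def)
      have t: "\<bar>tr d (Sigh n u \<omega>) - T\<bar> \<le> 19 / 100 * T" using w by (auto simp: good_def Tr_def)
      have h0n: "h0 n = (\<sigma> * T * ln (real n) / real n / (32 * (\<mu>\<^sup>2 * c2\<^sup>2))) powr (1 / 5)"
        by (simp add: h0_def A0_def m_def mult.commute)
      show "N (hh \<omega>) \<omega> \<le> 8 * Cs\<^sup>2 / a * rate"
        unfolding N_def hh_def rate_def R_def m_def L_def defs
        by (rule selected_loss_on_good_event[where ?h0.0 = h0 and \<epsilon> = \<epsilon> and hs = hs and n = n and hl = "hl n" and Sigh = Sigh and \<omega> = \<omega>, OF a Cs n(1) elim(6) pos(2,4)[unfolded defs] h0n[unfolded defs] elim(3) hl1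
            hs[unfolded grid_def] less_imp_le[OF eps(1)] eps(2,3)[unfolded defs] g t[unfolded defs]])
    next
      fix \<omega>
      have "hh \<omega> \<in> grid" unfolding hh_def grid_def
        by (rule h_hat_in_grid) (use fin hs(1) in \<open>auto simp: grid_def\<close>)
      then show "N (hh \<omega>) \<omega> \<le> (\<Sum>h\<in>grid. N h \<omega>)"
        using fin member_le_sum[of "hh \<omega>" grid "\<lambda>h. N h \<omega>"] by (simp add: N_def)
    next
      fix h assume h: "h \<in> grid"
      have mm: "(\<lambda>\<omega>. G_hat K g X n h u \<omega> i) \<in> borel_measurable P" if "i < d" for i
        by (rule G_hat_measurable[OF n(1) hpos(1)[OF h] that])
      have "N h = (\<lambda>\<omega>. \<Sum>i<d. (G_hat K g X n h u \<omega> i - G u i)\<^sup>2)"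
        by (simp add: N_def L2_set_def sum_nonneg)
      then show "N h \<in> borel_measurable P" using mm by simp
      show "(\<integral>\<^sup>+ \<omega>. ennreal ((N h \<omega>)\<^sup>2) \<partial>P) \<le> ennreal Vm" unfolding N_def by (rule mom[OF n(1) hpos(1)[OF h]])
    qed (use rate0 a in \<open>auto simp: N_def\<close>)
    also have "\<dots> \<le> ennreal ((8 * Cs\<^sup>2 / a + 1) * rate)"
    proof (rule ennreal_leI)
      have p0: "0 \<le> p" using p measure_nonneg[of P "space P - good"] by linarith
      have "real (card grid) * (Vm / real n + real n * p) \<le> (ca * L) * (Vm / real n + real n * p)"
        using card Vm p0 n by (intro mult_right_mono) auto
      also have "\<dots> = ca * L * (Vm + Ct + ca * L * Cg) / real n"
        unfolding p_def using n by (simp add: field_simps power2_eq_square)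
      also have "\<dots> \<le> C3 * L ^ 4 / real n"
      proof (rule divide_right_mono)
        have "Vm + Ct + ca * L * Cg \<le> (Vm + Ct + ca * Cg) * L"
        proof -
          have "Vm * 1 \<le> Vm * L" "Ct * 1 \<le> Ct * L" using L Vm Ct by (intro mult_left_mono; simp)+
          then show ?thesis by (simp add: algebra_simps)
        qed
        then have "ca * L * (Vm + Ct + ca * L * Cg) \<le> ca * L * ((Vm + Ct + ca * Cg) * L)"
          using ca L by (intro mult_left_mono) auto
        also have "\<dots> = C3 * L ^ 2" by (simp add: C3_def power2_eq_square)
        also have "\<dots> \<le> C3 * L ^ 4"
          using L ca Vm Ct Cg by (intro mult_left_mono power_increasing) (auto simp: C3_def)
        finally show "ca * L * (Vm + Ct + ca * L * Cg) \<le> C3 * L ^ 4" .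
      qed (use n in simp)
      also have "\<dots> \<le> rate" using elim(8) by (simp add: L_def rate_def)
      finally show "8 * Cs\<^sup>2 / a * rate + real (card grid) * (Vm / real n + real n * p) \<le> (8 * Cs\<^sup>2 / a + 1) * rate"
        by (simp add: algebra_simps)
    qed
    finally show ?case unfolding N_def hh_def rate_def R_def m_def L_def defs .
  qed
qed

end

theorem theorem4p6:
  shows "\<exists>c :: real \<Rightarrow> real \<Rightarrow> real. (\<forall>a\<in>{0<..<1}. \<forall>Cs\<ge>64. c a Cs > 0) \<and>
    (\<forall>(M::nat) (chi::nat \<Rightarrow> real) (C::real) (\<alpha>::real) (D::real) (Dq::real \<Rightarrow> real) (\<rho>::real) (\<kappa>::real).
      \<alpha> \<ge> 0 \<longrightarrow> D > 0 \<longrightarrow> 0 < \<rho> \<longrightarrow> \<rho> < 1 \<longrightarrow>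
      (\<exists>cH>0. \<forall>(a::real) (Cs::real) (d::nat) (u::real) (P::'w measure) (S::'s measure)
          (\<zeta>::int \<Rightarrow> 'w \<Rightarrow> 's) (\<zeta>'::int \<Rightarrow> 'w \<Rightarrow> 's) (H::(nat \<Rightarrow> 's) \<Rightarrow> real \<Rightarrow> real)
          (X::nat \<Rightarrow> nat \<Rightarrow> 'w \<Rightarrow> real) (K::real \<Rightarrow> real)
          (g::(nat \<Rightarrow> real) \<Rightarrow> nat \<Rightarrow> real) (Sigh::nat \<Rightarrow> real \<Rightarrow> 'w \<Rightarrow> nat \<Rightarrow> nat \<Rightarrow> real).
        let Xt = shift_process H \<zeta>;
            G = G_target P g Xt;
            Sig = Sigma_lr P g Xt;
            G'' = (\<lambda>i. deriv (deriv (\<lambda>v. G v i)) u);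
            hl = (\<lambda>n. cH * ln (real n) powr (5 + 2 * \<alpha> * real M) / real n)
        in
        0 < a \<longrightarrow> a < 1 \<longrightarrow> Cs \<ge> 64 \<longrightarrow> d \<ge> 1 \<longrightarrow> 0 < u \<longrightarrow> u < 1 \<longrightarrow>
        prob_space P \<longrightarrow>
        assumption_A \<alpha> D Dq \<rho> P S \<zeta> \<zeta>' H X \<longrightarrow>
        assumption_V d P Sig Sigh \<longrightarrow>
        K \<in> kernel_class \<longrightarrow> (SUP x. \<bar>K x\<bar>) = \<kappa> \<longrightarrow>
        (\<forall>i<d. (\<lambda>x. g x i) \<in> borel_measurable (\<Pi>\<^sub>M j\<in>UNIV. borel)) \<longrightarrow>
        (\<forall>i<d. H_class M chi C (\<lambda>x. g x i)) \<longrightarrow>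
        (\<forall>j. \<bar>chi j\<bar> \<le> C * \<rho> ^ j) \<longrightarrow>
        (\<forall>i<d. twice_cont_diff_near (\<lambda>v. G v i) u) \<longrightarrow>
        L2_set G'' {..<d} \<noteq> 0 \<longrightarrow>
        tr d (Sig u) \<noteq> 0 \<longrightarrow>
        (\<forall>\<^sub>F n in sequentially.
          (\<integral>\<^sup>+ \<omega>. ennreal ((L2_set (\<lambda>i.
               G_hat K g X n (h_hat d a (hl n) Cs K g X Sigh n u \<omega>) u \<omega> i - G u i) {..<d}) ^ 2) \<partial>P)
          \<le> ennreal (c a Cs
               * (sigma2_K K * tr d (Sig u)) powr (4 / 5)
               * ((mu_K K)\<^sup>2 * (L2_set G'' {..<d})\<^sup>2) powr (1 / 5)
               * (ln (real n) / real n) powr (4 / 5)))))"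
proof (unfold Let_def, intro exI[of _ "\<lambda>a Cs. 8 * Cs\<^sup>2 / a + 1"] exI[of _ "1 :: real"] conjI ballI allI impI zero_less_one)
  (* The first summand of c comes from the good event, the second from its complement. *)
  fix a Cs :: real assume "a \<in> {0<..<1}" "64 \<le> Cs"
  then show "0 < 8 * Cs\<^sup>2 / a + 1" by (intro add_nonneg_pos divide_nonneg_nonneg) auto
next
  fix M :: nat and chi :: "nat \<Rightarrow> real" and C \<alpha> D :: real and Dq :: "real \<Rightarrow> real" and \<rho> :: real
    and a Cs :: real and d :: nat and u :: real and P :: "'w measure" and S :: "'s measure"
    and \<zeta> \<zeta>' :: "int \<Rightarrow> 'w \<Rightarrow> 's" and H :: "(nat \<Rightarrow> 's) \<Rightarrow> real \<Rightarrow> real"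
    and X :: "nat \<Rightarrow> nat \<Rightarrow> 'w \<Rightarrow> real" and K :: "real \<Rightarrow> real"
    and g :: "(nat \<Rightarrow> real) \<Rightarrow> nat \<Rightarrow> real" and Sigh :: "nat \<Rightarrow> real \<Rightarrow> 'w \<Rightarrow> nat \<Rightarrow> nat \<Rightarrow> real"
  assume par: "0 \<le> \<alpha>" "0 < D" "0 < \<rho>" "\<rho> < 1"
    and a: "0 < a" "a < 1" and Cs: "64 \<le> Cs" and d: "1 \<le> d" and u: "0 < u" "u < 1" and P: "prob_space P"
    and A: "assumption_A \<alpha> D Dq \<rho> P S \<zeta> \<zeta>' H X"
    and V: "assumption_V d P (Sigma_lr P g (shift_process H \<zeta>)) Sigh" and K: "K \<in> kernel_class"
    and gm: "\<forall>i<d. (\<lambda>x. g x i) \<in> borel_measurable (\<Pi>\<^sub>M j\<in>UNIV. borel)"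
    and gc: "\<forall>i<d. H_class M chi C (\<lambda>x. g x i)" and chi: "\<forall>j. \<bar>chi j\<bar> \<le> C * \<rho> ^ j"
    and sm: "\<forall>i<d. twice_cont_diff_near (\<lambda>v. G_target P g (shift_process H \<zeta>) v i) u"
    and curv: "L2_set (\<lambda>i. deriv (deriv (\<lambda>v. G_target P g (shift_process H \<zeta>) v i)) u) {..<d} \<noteq> 0"
    and tr: "tr d (Sigma_lr P g (shift_process H \<zeta>) u) \<noteq> 0"
  have "ls_model P \<alpha> D \<rho> Dq S \<zeta> \<zeta>' H X M chi C (\<lambda>x. g x i)" if "i < d" for i
    using P par A gm gc chi that by (intro ls_model.intro ls_model_axioms.intro) auto
  then interpret vector_model P \<alpha> D \<rho> Dq S \<zeta> \<zeta>' H X M chi C d u K g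
    using P u K d sm by (intro vector_model.intro vector_model_axioms.intro) auto
  show "\<forall>\<^sub>F n in sequentially.
      (\<integral>\<^sup>+ \<omega>. ennreal ((L2_set (\<lambda>i. G_hat K g X n
            (h_hat d a (1 * ln (real n) powr (5 + 2 * \<alpha> * real M) / real n) Cs K g X Sigh n u \<omega>) u \<omega> i
          - G_target P g (shift_process H \<zeta>) u i) {..<d})\<^sup>2) \<partial>P)
      \<le> ennreal ((8 * Cs\<^sup>2 / a + 1)
          * (sigma2_K K * tr d (Sigma_lr P g (shift_process H \<zeta>) u)) powr (4 / 5)
          * ((mu_K K)\<^sup>2 * (L2_set (\<lambda>i. deriv (deriv (\<lambda>v. G_target P g (shift_process H \<zeta>) v i)) u) {..<d})\<^sup>2) powr (1 / 5)
          * (ln (real n) / real n) powr (4 / 5))"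
    using selected_bandwidth_risk[OF V a Cs curv tr par(1)] by (simp only: mult_1 mult.assoc)
qed

end
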